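(* Suppose $\mathcal{X}=\mathrm{iid}(\pi/\sqrt n)$, where $\pi$ is a mean-zero unit-variance distribution on $\mathbb{R}$ for which the product $\pi\pi'$ of two independent copies of $\pi$ has a moment-generating function $M(\theta)=\mathbb{E}\exp(\theta\pi\pi')$ which is finite on an open interval containing zero. Then there exists $\bar\beta$ such that for any $\beta\ge\bar\beta$ and any $\gamma>\beta^2$, $\mathrm{Wish}(\gamma,\beta,\mathcal{X})$ is contiguous to $\mathrm{Wish}(\gamma)$.
   Context: $\mathrm{iid}(\pi/\sqrt n)$ denotes the family of distributions $\mathcal{X}_n$ on $\mathbb{R}^n$ under which the coordinates of $x$ are independent, each distributed as $\pi/\sqrt n$. Spiked Wishart model $\mathrm{Wish}(\gamma,\beta,\mathcal{X})$, for $\gamma>0$, $\beta\in[-1,\infty)$: draw $x\sim\mathcal{X}_n$ and reveal $Y=\frac1NXX^\top$, where $X$ is an $n\times N$ matrix whose columns are sampled independently from $\mathcal{N}(0,I_n+\beta xx^\top)$, and $N=N(n)$ satisfies $n/N\to\gamma$ as $n\to\infty$. If $\beta<0$ and $|\beta|\cdot\|x\|^2>1$, output instead a failure symbol $\perp$. The unspiked model $\mathrm{Wish}(\gamma)$ is the case $\beta=0$ (with the same $N$). A sequence of distributions $Q_n$ is contiguous to $P_n$ if for every sequence of events $A_n$, $P_n(A_n)\to0$ implies $Q_n(A_n)\to0$. *)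

theory Defs
  imports "HOL-Probability.Probability"
begin

text \<open>
  The dimension varies along the sequences considered here, so a vector in \<open>\<real>\<^sup>n\<close> is a function on
  \<open>{..<n}\<close>, extended by \<open>undefined\<close> as usual for \<^const>\<open>PiM\<close>, and an $n \times n$ matrix is such a
  function on \<open>{..<n} \<times> {..<n}\<close> when it is a random outcome. Parameter matrices are plain functions
  \<open>nat \<Rightarrow> nat \<Rightarrow> real\<close> of which only the entries with indices below \<open>n\<close> matter.
\<close>

abbreviation vec_borel :: "nat \<Rightarrow> (nat \<Rightarrow> real) measure" where
  "vec_borel n \<equiv> \<Pi>\<^sub>M i\<in>{..<n}. borel"

abbreviation mat_borel :: "nat \<Rightarrow> (nat \<times> nat \<Rightarrow> real) measure" where
  "mat_borel n \<equiv> \<Pi>\<^sub>M ij\<in>{..<n} \<times> {..<n}. borel"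


subsection \<open>Centred multivariate normal distributions\<close>

definition psd :: "nat \<Rightarrow> (nat \<Rightarrow> nat \<Rightarrow> real) \<Rightarrow> bool" where
  "psd n A \<longleftrightarrow> (\<forall>i<n. \<forall>j<n. A i j = A j i) \<and>
     (\<forall>v :: nat \<Rightarrow> real. (\<Sum>i<n. \<Sum>j<n. v i * A i j * v j) \<ge> 0)"

text \<open>
  The positive semidefinite square root of a positive semidefinite matrix exists, and its entries
  with indices below \<open>n\<close> are uniquely determined.
\<close>

definition psd_sqrt :: "nat \<Rightarrow> (nat \<Rightarrow> nat \<Rightarrow> real) \<Rightarrow> nat \<Rightarrow> nat \<Rightarrow> real" where
  "psd_sqrt n S = (SOME A. psd n A \<and> (\<forall>i<n. \<forall>j<n. (\<Sum>k<n. A i k * A k j) = S i j))"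

text \<open>
  \<open>\<N>(0, S)\<close> is the law of \<open>S\<^sup>1\<^sup>/\<^sup>2 g\<close> with \<open>g\<close> standard normal. In contrast to the definition by a
  density, this covers singular \<open>S\<close>, which arises from \<open>I + \<beta> x x\<^sup>T\<close> if \<open>\<beta> \<parallel>x\<parallel>\<^sup>2 = -1\<close>.
\<close>

definition multi_normal :: "nat \<Rightarrow> (nat \<Rightarrow> nat \<Rightarrow> real) \<Rightarrow> (nat \<Rightarrow> real) measure" where
  "multi_normal n S =
     distr (\<Pi>\<^sub>M i\<in>{..<n}. std_normal_distribution) (vec_borel n)
       (\<lambda>g. \<lambda>i\<in>{..<n}. \<Sum>j<n. psd_sqrt n S i j * g j)"


subsection \<open>The spiked Wishart model\<close>

text \<open>\<^const>\<open>None\<close> is the failure symbol.\<close>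

definition option_algebra :: "'a measure \<Rightarrow> 'a option measure" where
  "option_algebra M =
     sigma (insert None (Some ` space M)) (insert {None} ((`) Some ` sets M))"

definition spiked_cov :: "real \<Rightarrow> (nat \<Rightarrow> real) \<Rightarrow> nat \<Rightarrow> nat \<Rightarrow> real" where
  "spiked_cov \<beta> x i j = (if i = j then 1 else 0) + \<beta> * x i * x j"

text \<open>The matrix $\frac1N X X^T$; here \<open>X k\<close> is the \<open>k\<close>-th column of \<open>X\<close>.\<close>

definition sample_cov :: "nat \<Rightarrow> nat \<Rightarrow> (nat \<Rightarrow> nat \<Rightarrow> real) \<Rightarrow> nat \<times> nat \<Rightarrow> real" where
  "sample_cov n N X = (\<lambda>(i, j)\<in>{..<n} \<times> {..<n}. (1 / real N) * (\<Sum>k<N. X k i * X k j))"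

definition wishart_given ::
    "real \<Rightarrow> nat \<Rightarrow> nat \<Rightarrow> (nat \<Rightarrow> real) \<Rightarrow> (nat \<times> nat \<Rightarrow> real) option measure" where
  "wishart_given \<beta> n N x =
     (if \<beta> < 0 \<and> \<bar>\<beta>\<bar> * (\<Sum>i<n. (x i)\<^sup>2) > 1
      then return (option_algebra (mat_borel n)) None
      else distr (\<Pi>\<^sub>M k\<in>{..<N}. multi_normal n (spiked_cov \<beta> x)) (option_algebra (mat_borel n))
             (\<lambda>X. Some (sample_cov n N X)))"

text \<open>
  The aspect ratio \<open>\<gamma>\<close> is not a parameter of the law: it enters through the sequence \<open>N\<close> only.
  The unspiked model is the case \<open>\<beta> = 0\<close>, where the law does not depend on the prior \<open>\<X>\<close>.
\<close>

definition spiked_wishart ::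
    "real \<Rightarrow> (nat \<Rightarrow> (nat \<Rightarrow> real) measure) \<Rightarrow> (nat \<Rightarrow> nat) \<Rightarrow> nat
      \<Rightarrow> (nat \<times> nat \<Rightarrow> real) option measure" where
  "spiked_wishart \<beta> \<X> N n = \<X> n \<bind> wishart_given \<beta> n (N n)"

definition unspiked_wishart ::
    "(nat \<Rightarrow> (nat \<Rightarrow> real) measure) \<Rightarrow> (nat \<Rightarrow> nat) \<Rightarrow> nat
      \<Rightarrow> (nat \<times> nat \<Rightarrow> real) option measure" where
  "unspiked_wishart = spiked_wishart 0"

definition iid_prior :: "real measure \<Rightarrow> nat \<Rightarrow> (nat \<Rightarrow> real) measure" where
  "iid_prior \<pi> n = (\<Pi>\<^sub>M i\<in>{..<n}. distr \<pi> borel (\<lambda>t. t / sqrt (real n)))"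

definition product_mgf :: "real measure \<Rightarrow> real \<Rightarrow> ennreal" where
  "product_mgf \<pi> \<theta> = (\<integral>\<^sup>+ (s, t). ennreal (exp (\<theta> * (s * t))) \<partial>(\<pi> \<Otimes>\<^sub>M \<pi>))"


subsection \<open>Contiguity\<close>

text \<open>\<open>contiguous Q P\<close>: \<open>Q\<close> is contiguous to \<open>P\<close>, where \<open>Q n\<close> and \<open>P n\<close> live on the same measurable space.\<close>

definition contiguous :: "(nat \<Rightarrow> 'a measure) \<Rightarrow> (nat \<Rightarrow> 'a measure) \<Rightarrow> bool" where
  "contiguous Q P \<longleftrightarrow>
     (\<forall>A. (\<forall>n. A n \<in> sets (P n)) \<longrightarrow> (\<lambda>n. measure (P n) (A n)) \<longlonglongrightarrow> 0
        \<longrightarrow> (\<lambda>n. measure (Q n) (A n)) \<longlonglongrightarrow> 0)"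

end

theory Submission
  imports Defs "HOL-Real_Asymp.Real_Asymp"
begin

text \<open>
  Truncated second moment method. Let \<open>L x\<close> be the likelihood ratio given the spike \<open>x\<close>; it suffices to
  bound the second moment of the prior average of \<open>L x\<close> restricted to an event \<open>E x\<close> that is typical
  under the spiked law given \<open>x\<close>. Let \<open>\<alpha>\<close> be the overlap of two independent spikes. Its tail is
  \<open>exp (- n (a^2 / 2 - C a^3))\<close>, with \<open>C > 0\<close> unavoidable if \<open>\<pi>\<close> has a nonzero third moment, while
  the correlation \<open>(1 - \<beta>^2 \<alpha>^2)^(- N / 2)\<close> of \<open>L x\<close> and \<open>L x'\<close> is about
  \<open>exp (n (\<beta>^2 / \<gamma>) \<alpha>^2 / 2)\<close>. When \<open>\<beta>^2 / \<gamma>\<close> is close to 1 the cubic term is not affordable, not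
  even after conditioning on the length of \<open>X\<^sup>T x\<close>. Therefore \<open>E x\<close> also requires that the average of
  \<open>exp (s / 2 |y + G w|^2)\<close> over Gaussian \<open>w\<close> is of its typical size, where \<open>G\<close> is the part of the data
  orthogonal to \<open>x\<close> and \<open>y = X\<^sup>T x / |x|\<close> up to scaling. Rotating the component of \<open>x'\<close> orthogonal to
  \<open>x\<close> turns this into a bound on the correlation whose exponent gains a term of order \<open>\<beta> |\<alpha>|^3\<close>, which
  beats \<open>C |\<alpha>|^3\<close> for large \<open>\<beta>\<close>. The extra requirement is typical because the Gaussian average can be
  computed recursively along a Householder bidiagonalisation of \<open>G\<close>, where only chi-square variables
  enter.
\<close>

subsection \<open>Gaussian integrals\<close>

text \<open>Overlaps are treated in three ranges. Below a small \<open>\<epsilon>1\<close> the plain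
  second moment suffices, since the gap between \<open>\<beta>^2 / \<gamma>\<close> and 1 absorbs
  the cubic term. Above a fixed \<open>\<alpha>0\<close> one ratio is bounded pointwise through the
  length of \<open>X^T x\<close>; the exponent is then of order \<open>n / \<beta>\<close>, so this
  range also asks for a large \<open>\<beta>\<close>. Only the compact range in between needs the
  refined event, where a finite grid of parameters and continuity of the exponent are enough. The
  refined event has a free parameter \<open>t\<close>, the growth rate in \<open>y\<close> being
  \<open>1 + t\<close>. At \<open>t = \<beta>\<close> the exponent agrees with the plain one to
  second order in the overlap \<open>a\<close>. With \<open>1 + t = (1 + \<beta>) (1 - z)\<close>
  and \<open>\<mu> = \<beta>^2 / \<gamma>\<close>, a positive \<open>z\<close> saves
  \<open>\<mu> a^2 z\<close> and costs about \<open>z^2 (1 - \<mu>) / (2 \<beta>^2)\<close>, which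
  is quadratic in \<open>z\<close> and damped by \<open>\<beta>^2\<close>. Hence
  \<open>z = \<beta> a / 8\<close> yields a cubic gain whose factor grows with
  \<open>\<beta>\<close>. All multiples of \<open>y\<close> are controlled at once because the
  recursion replaces \<open>y\<close> by a row of \<open>G\<close> times a Gaussian scalar.\<close>

abbreviation gauss :: "nat \<Rightarrow> (nat \<Rightarrow> real) measure" where
  "gauss n \<equiv> \<Pi>\<^sub>M i\<in>{..<n}. std_normal_distribution"

abbreviation gmat :: "nat \<Rightarrow> nat \<Rightarrow> (nat \<Rightarrow> nat \<Rightarrow> real) measure" where
  "gmat N n \<equiv> \<Pi>\<^sub>M k\<in>{..<N}. gauss n"

definition ip :: "nat \<Rightarrow> (nat \<Rightarrow> real) \<Rightarrow> (nat \<Rightarrow> real) \<Rightarrow> real" where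
  "ip n v w = (\<Sum>i<n. v i * w i)"

lemma prob_std_normal: "prob_space std_normal_distribution"
  by (rule prob_space_normal_density) simp

lemma prob_gauss: "prob_space (gauss n)"
  by (intro prob_space_PiM prob_std_normal)

lemma prob_gmat: "prob_space (gmat N n)"
  by (intro prob_space_PiM prob_gauss)

lemma product_sigma_finite_normal: "product_sigma_finite (\<lambda>i. std_normal_distribution)"
  using prob_std_normal by (simp add: product_sigma_finite_def prob_space_imp_sigma_finite)

lemma product_sigma_finite_gauss: "product_sigma_finite (\<lambda>i. gauss n)"
  using prob_gauss by (simp add: product_sigma_finite_def prob_space_imp_sigma_finite)

lemma sets_gauss: "sets (gauss n) = sets (vec_borel n)"
  by (intro sets_PiM_cong) simp_all

lemma measurable_gauss_comp:
  assumes "f \<in> M \<rightarrow>\<^sub>M gauss n" "i < n"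
  shows "(\<lambda>x. f x i) \<in> borel_measurable M"
  using measurable_compose[OF assms(1), of "\<lambda>v. v i" borel]
    measurable_component_singleton[of i "{..<n}" "\<lambda>i. std_normal_distribution"] assms(2)
  by simp

lemma measurable_gmat_comp:
  assumes "f \<in> M \<rightarrow>\<^sub>M gmat N n" "k < N"
  shows "(\<lambda>x. f x k) \<in> M \<rightarrow>\<^sub>M gauss n"
  using measurable_compose[OF assms(1) measurable_component_singleton[of k "{..<N}" "\<lambda>i. gauss n"]] assms(2)
  by simp

lemma measurable_ip [measurable (raw)]:
  assumes "f \<in> M \<rightarrow>\<^sub>M gauss n" "g \<in> M \<rightarrow>\<^sub>M gauss n"
  shows "(\<lambda>x. ip n (f x) (g x)) \<in> borel_measurable M"
  unfolding ip_def using assms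
  by (intro borel_measurable_sum borel_measurable_times borel_measurable_const measurable_gauss_comp) auto

lemma measurable_ip_const [measurable (raw)]:
  assumes "g \<in> M \<rightarrow>\<^sub>M gauss n"
  shows "(\<lambda>x. ip n v (g x)) \<in> borel_measurable M"
  unfolding ip_def using assms
  by (intro borel_measurable_sum borel_measurable_times borel_measurable_const measurable_gauss_comp) auto

lemma measurable_into_gauss:
  assumes "\<And>i. i < n \<Longrightarrow> (\<lambda>x. f x i) \<in> borel_measurable M"
  shows "(\<lambda>x. \<lambda>i\<in>{..<n}. f x i) \<in> M \<rightarrow>\<^sub>M gauss n"
  using assms by (intro measurable_restrict) auto

lemma ip_commute: "ip n v w = ip n w v"
  by (simp add: ip_def mult.commute)

lemma ip_cong: "(\<And>i. i < n \<Longrightarrow> v i = v' i) \<Longrightarrow> (\<And>i. i < n \<Longrightarrow> w i = w' i) \<Longrightarrow> ip n v w = ip n v' w'"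
  by (auto simp: ip_def intro!: sum.cong)

lemma ip_add_left: "ip n (\<lambda>i. v i + w i) u = ip n v u + ip n w u"
  by (simp add: ip_def ring_distribs sum.distrib)

lemma ip_scale_left: "ip n (\<lambda>i. c * v i) u = c * ip n v u"
  by (simp add: ip_def sum_distrib_left mult.assoc)

lemma ip_scale_right: "ip n u (\<lambda>i. c * v i) = c * ip n u v"
  by (simp add: ip_def sum_distrib_left mult.assoc mult.left_commute)

lemma ip_self_nonneg [simp]: "0 \<le> ip n v v"
  by (simp add: ip_def sum_nonneg)

lemma ip_self_zero: "ip n v v = 0 \<Longrightarrow> i < n \<Longrightarrow> v i = 0"
  unfolding ip_def by (subst (asm) sum_nonneg_eq_0_iff) auto

lemma ip_Suc: "ip (Suc n) v w = ip n v w + v n * w n"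
  by (simp add: ip_def)

text \<open>Completing the square: the integrand is a multiple of the normal density with mean
  \<open>b / (1 - a)\<close> and variance \<open>1 / (1 - a)\<close>. Every step of the later
  recursion, and the linearisation of a squared inner product, is an instance.\<close>

lemma nn_integral_normal_exp:
  assumes "a < 1"
  shows "(\<integral>\<^sup>+w. ennreal (exp (a / 2 * w\<^sup>2 + b * w)) \<partial>std_normal_distribution)
    = ennreal (exp (b\<^sup>2 / (2 * (1 - a))) / sqrt (1 - a))"
proof -
  define s where "s = 1 / sqrt (1 - a)"
  define m where "m = b / (1 - a)"
  have s: "s > 0" and s2: "s\<^sup>2 = 1 / (1 - a)" using assms by (simp_all add: s_def power_divide)
  interpret P: prob_space "density lborel (normal_density m s)"
    by (rule prob_space_normal_density[OF s])
  have "(\<integral>\<^sup>+w. ennreal (exp (a / 2 * w\<^sup>2 + b * w)) \<partial>std_normal_distribution)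
    = (\<integral>\<^sup>+w. ennreal (exp (b\<^sup>2 / (2 * (1 - a))) * s) * ennreal (normal_density m s w) \<partial>lborel)"
  proof (subst nn_integral_density, simp, simp, intro nn_integral_cong)
    fix w :: real
    have e: "- w\<^sup>2 / 2 + (a / 2 * w\<^sup>2 + b * w) = b\<^sup>2 / (2 * (1 - a)) + (- ((w - m)\<^sup>2 / (2 * s\<^sup>2)))"
    proof -
      have "(w - m)\<^sup>2 / (2 * s\<^sup>2) = (1 - a) * (w - m)\<^sup>2 / 2" by (simp add: s2)
      also have "\<dots> = (1 - a) * w\<^sup>2 / 2 - ((1 - a) * m) * w + ((1 - a) * m) * m / 2"
        by (simp add: power2_eq_square field_simps)
      also have "(1 - a) * m = b" using assms by (simp add: m_def)
      also have "b * m / 2 = b\<^sup>2 / (2 * (1 - a))" by (simp add: m_def power2_eq_square)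
      finally show ?thesis by (simp add: field_simps)
    qed
    have "std_normal_density w * exp (a / 2 * w\<^sup>2 + b * w)
      = 1 / sqrt (2 * pi) * exp (- w\<^sup>2 / 2 + (a / 2 * w\<^sup>2 + b * w))"
      unfolding std_normal_density_def exp_add by simp
    also have "\<dots> = exp (b\<^sup>2 / (2 * (1 - a))) * s * normal_density m s w"
      unfolding e exp_add normal_density_def using s by (simp add: real_sqrt_mult)
    finally show "ennreal (std_normal_density w) * ennreal (exp (a / 2 * w\<^sup>2 + b * w))
      = ennreal (exp (b\<^sup>2 / (2 * (1 - a))) * s) * ennreal (normal_density m s w)"
      using s by (simp add: ennreal_mult''[symmetric] ennreal_mult'[symmetric])
  qed
  also have "\<dots> = ennreal (exp (b\<^sup>2 / (2 * (1 - a))) * s) * emeasure (density lborel (normal_density m s)) UNIV"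
    by (subst nn_integral_cmult) (simp_all add: emeasure_density)
  also have "emeasure (density lborel (normal_density m s)) UNIV = 1"
    using P.emeasure_space_1 by simp
  finally show ?thesis by (simp add: s_def)
qed

text \<open>A linear substitution read as a change of measure: the weight is the density of the
  normal law with variance \<open>1 / v^2\<close> relative to the standard normal law.\<close>

lemma nn_integral_normal_scale:
  assumes [measurable]: "f \<in> borel_measurable borel" and v: "v > 0"
  shows "(\<integral>\<^sup>+w. f w \<partial>std_normal_distribution)
    = (\<integral>\<^sup>+w. f (v * w) * ennreal (v * exp (- (v\<^sup>2 - 1) / 2 * w\<^sup>2)) \<partial>std_normal_distribution)"
proof -
  have "(\<integral>\<^sup>+w. f w \<partial>std_normal_distribution) = (\<integral>\<^sup>+w. ennreal (std_normal_density w) * f w \<partial>lborel)"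
    by (subst nn_integral_density) auto
  also have "\<dots> = ennreal v * (\<integral>\<^sup>+w. ennreal (std_normal_density (v * w)) * f (v * w) \<partial>lborel)"
    using v by (subst nn_integral_real_affine[of _ v 0]) auto
  also have "\<dots> = (\<integral>\<^sup>+w. ennreal v * (ennreal (std_normal_density (v * w)) * f (v * w)) \<partial>lborel)"
    by (subst nn_integral_cmult) auto
  also have "\<dots> = (\<integral>\<^sup>+w. ennreal (std_normal_density w) * (f (v * w) * ennreal (v * exp (- (v\<^sup>2 - 1) / 2 * w\<^sup>2))) \<partial>lborel)"
  proof (intro nn_integral_cong)
    fix w
    have "- (v * w)\<^sup>2 / 2 = - w\<^sup>2 / 2 + (- (v\<^sup>2 - 1) / 2 * w\<^sup>2)"
      by (simp add: power_mult_distrib field_simps)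
    then have "v * std_normal_density (v * w) = std_normal_density w * (v * exp (- (v\<^sup>2 - 1) / 2 * w\<^sup>2))"
      unfolding std_normal_density_def by (simp only: exp_add mult.assoc mult.left_commute)
    then have "ennreal v * ennreal (std_normal_density (v * w)) = ennreal (std_normal_density w) * ennreal (v * exp (- (v\<^sup>2 - 1) / 2 * w\<^sup>2))"
      using v by (simp add: ennreal_mult''[symmetric] ennreal_mult'[symmetric])
    from this[THEN arg_cong, of "\<lambda>u. u * f (v * w)"]
    show "ennreal v * (ennreal (std_normal_density (v * w)) * f (v * w))
      = ennreal (std_normal_density w) * (f (v * w) * ennreal (v * exp (- (v\<^sup>2 - 1) / 2 * w\<^sup>2)))"
      by (simp only: mult.assoc mult.commute mult.left_commute)
  qed
  also have "\<dots> = (\<integral>\<^sup>+w. f (v * w) * ennreal (v * exp (- (v\<^sup>2 - 1) / 2 * w\<^sup>2)) \<partial>std_normal_distribution)"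
    by (subst nn_integral_density) auto
  finally show ?thesis .
qed

lemma nn_integral_gauss_Suc:
  assumes "f \<in> borel_measurable (gauss (Suc n))"
  shows "(\<integral>\<^sup>+w. f w \<partial>gauss (Suc n)) = (\<integral>\<^sup>+w. \<integral>\<^sup>+a. f (w(n := a)) \<partial>std_normal_distribution \<partial>gauss n)"
    "(\<integral>\<^sup>+w. f w \<partial>gauss (Suc n)) = (\<integral>\<^sup>+a. \<integral>\<^sup>+w. f (w(n := a)) \<partial>gauss n \<partial>std_normal_distribution)"
proof -
  interpret product_sigma_finite "\<lambda>i::nat. std_normal_distribution" by (rule product_sigma_finite_normal)
  show "(\<integral>\<^sup>+w. f w \<partial>gauss (Suc n)) = (\<integral>\<^sup>+w. \<integral>\<^sup>+a. f (w(n := a)) \<partial>std_normal_distribution \<partial>gauss n)"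
    using product_nn_integral_insert[of "{..<n}" n f] assms by (simp add: lessThan_Suc)
  show "(\<integral>\<^sup>+w. f w \<partial>gauss (Suc n)) = (\<integral>\<^sup>+a. \<integral>\<^sup>+w. f (w(n := a)) \<partial>gauss n \<partial>std_normal_distribution)"
    using product_nn_integral_insert_rev[of "{..<n}" n f] assms by (simp add: lessThan_Suc)
qed

lemma nn_integral_gmat_Suc:
  assumes "f \<in> borel_measurable (gmat (Suc N) n)"
  shows "(\<integral>\<^sup>+G. f G \<partial>gmat (Suc N) n) = (\<integral>\<^sup>+g. \<integral>\<^sup>+G. f (G(N := g)) \<partial>gmat N n \<partial>gauss n)"
proof -
  interpret product_sigma_finite "\<lambda>i::nat. gauss n" by (rule product_sigma_finite_gauss)
  show ?thesis
    using product_nn_integral_insert_rev[of "{..<N}" N f] assms by (simp add: lessThan_Suc)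
qed

lemma measurable_upd_gauss:
  assumes "f \<in> M \<rightarrow>\<^sub>M gauss n" "g \<in> borel_measurable M"
  shows "(\<lambda>x. (f x)(n := g x)) \<in> M \<rightarrow>\<^sub>M gauss (Suc n)"
  by (rule measurable_fun_upd[where J="{..<n}"]) (use assms in auto)

lemma measurable_upd_gmat:
  assumes "f \<in> M \<rightarrow>\<^sub>M gmat N n" "g \<in> M \<rightarrow>\<^sub>M gauss n"
  shows "(\<lambda>x. (f x)(N := g x)) \<in> M \<rightarrow>\<^sub>M gmat (Suc N) n"
  by (rule measurable_fun_upd[where J="{..<N}"]) (use assms in auto)

lemma nn_integral_gauss_scale:
  assumes f: "f \<in> borel_measurable (gauss n)" and v: "v > 0"
  shows "(\<integral>\<^sup>+w. f w \<partial>gauss n)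
    = (\<integral>\<^sup>+w. f (\<lambda>i\<in>{..<n}. v * w i) * ennreal (v ^ n * exp (- (v\<^sup>2 - 1) / 2 * ip n w w)) \<partial>gauss n)"
  using f
proof (induction n arbitrary: f)
  case 0
  show ?case
    by (simp add: PiM_empty nn_integral_count_space_finite ip_def restrict_def)
next
  case (Suc n)
  note Suc.prems[measurable]
  note [measurable (raw)] = measurable_upd_gauss
  have m1: "(\<lambda>b. f (b(n := c))) \<in> borel_measurable (gauss n)" for c
    by (rule measurable_compose[OF measurable_upd_gauss Suc.prems]) auto
  have "(\<integral>\<^sup>+w. f w \<partial>gauss (Suc n)) = (\<integral>\<^sup>+a. \<integral>\<^sup>+w. f (w(n := a)) \<partial>gauss n \<partial>std_normal_distribution)"
    by (rule nn_integral_gauss_Suc) fact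
  also have "\<dots> = (\<integral>\<^sup>+a. (\<integral>\<^sup>+w. f (w(n := v * a)) \<partial>gauss n) * ennreal (v * exp (- (v\<^sup>2 - 1) / 2 * a\<^sup>2)) \<partial>std_normal_distribution)"
  proof (rule nn_integral_normal_scale[OF _ v])
    interpret prob_space "gauss n" by (rule prob_gauss)
    show "(\<lambda>a. \<integral>\<^sup>+ w. f (w(n := a)) \<partial>gauss n) \<in> borel_measurable borel"
      by measurable
  qed
  also have "\<dots> = (\<integral>\<^sup>+a. (\<integral>\<^sup>+w. f ((\<lambda>i\<in>{..<n}. v * w i)(n := v * a)) * ennreal (v ^ n * exp (- (v\<^sup>2 - 1) / 2 * ip n w w)) \<partial>gauss n)
      * ennreal (v * exp (- (v\<^sup>2 - 1) / 2 * a\<^sup>2)) \<partial>std_normal_distribution)"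
    by (subst Suc.IH[OF m1]) (rule refl)
  also have "\<dots> = (\<integral>\<^sup>+a. \<integral>\<^sup>+w. f ((\<lambda>i\<in>{..<n}. v * w i)(n := v * a)) * ennreal (v ^ n * exp (- (v\<^sup>2 - 1) / 2 * ip n w w))
      * ennreal (v * exp (- (v\<^sup>2 - 1) / 2 * a\<^sup>2)) \<partial>gauss n \<partial>std_normal_distribution)"
    by (intro nn_integral_cong nn_integral_multc[symmetric]) measurable
  also have "\<dots> = (\<integral>\<^sup>+a. \<integral>\<^sup>+w. (\<lambda>w. f (\<lambda>i\<in>{..<Suc n}. v * w i) * ennreal (v ^ Suc n * exp (- (v\<^sup>2 - 1) / 2 * ip (Suc n) w w))) (w(n := a)) \<partial>gauss n \<partial>std_normal_distribution)"
  proof (intro nn_integral_cong)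
    fix a w
    have 1: "(\<lambda>i\<in>{..<Suc n}. v * (w(n := a)) i) = (\<lambda>i\<in>{..<n}. v * w i)(n := v * a)"
      by (auto simp: fun_eq_iff)
    have 2: "ip (Suc n) (w(n := a)) (w(n := a)) = ip n w w + a\<^sup>2"
      by (simp add: ip_Suc power2_eq_square) (auto intro!: ip_cong)
    have 3: "ennreal (v ^ n * exp (- (v\<^sup>2 - 1) / 2 * ip n w w)) * ennreal (v * exp (- (v\<^sup>2 - 1) / 2 * a\<^sup>2))
      = ennreal (v ^ Suc n * exp (- (v\<^sup>2 - 1) / 2 * ip (Suc n) (w(n := a)) (w(n := a))))"
      unfolding 2 ring_distribs exp_add using v by (simp add: ennreal_mult''[symmetric] ennreal_mult'[symmetric] ac_simps)
    show "f ((\<lambda>i\<in>{..<n}. v * w i)(n := v * a)) * ennreal (v ^ n * exp (- (v\<^sup>2 - 1) / 2 * ip n w w))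
      * ennreal (v * exp (- (v\<^sup>2 - 1) / 2 * a\<^sup>2)) = (\<lambda>w. f (\<lambda>i\<in>{..<Suc n}. v * w i) * ennreal (v ^ Suc n * exp (- (v\<^sup>2 - 1) / 2 * ip (Suc n) w w))) (w(n := a))"
      by (simp only: 1 3[symmetric] mult.assoc)
  qed
  also have "\<dots> = (\<integral>\<^sup>+w. f (\<lambda>i\<in>{..<Suc n}. v * w i) * ennreal (v ^ Suc n * exp (- (v\<^sup>2 - 1) / 2 * ip (Suc n) w w)) \<partial>gauss (Suc n))"
    by (rule nn_integral_gauss_Suc(2)[symmetric]) measurable
  finally show ?case .
qed

lemma nn_integral_gauss_exp_ip:
  assumes t: "t < 1 / 2"
  shows "(\<integral>\<^sup>+w. ennreal (exp (t * ip n w w)) \<partial>gauss n) = ennreal ((1 - 2 * t) powr (- real n / 2))"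
proof -
  interpret product_sigma_finite "\<lambda>i::nat. std_normal_distribution" by (rule product_sigma_finite_normal)
  have "(\<integral>\<^sup>+w. ennreal (exp (t * ip n w w)) \<partial>gauss n) = (\<integral>\<^sup>+w. (\<Prod>i<n. ennreal (exp (t * (w i)\<^sup>2))) \<partial>gauss n)"
    by (intro nn_integral_cong)
      (simp add: ip_def exp_sum prod_ennreal sum_distrib_left power2_eq_square)
  also have "\<dots> = (\<Prod>i<n. \<integral>\<^sup>+a. ennreal (exp (t * a\<^sup>2)) \<partial>std_normal_distribution)"
    by (intro product_nn_integral_prod) auto
  also have "(\<integral>\<^sup>+a. ennreal (exp (t * a\<^sup>2)) \<partial>std_normal_distribution) = ennreal ((1 - 2 * t) powr (- 1 / 2))"
    using nn_integral_normal_exp[of "2 * t" 0] t by (simp add: powr_minus powr_half_sqrt field_simps)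
  also have "(\<Prod>i<n. ennreal ((1 - 2 * t) powr (- 1 / 2))) = ennreal ((1 - 2 * t) powr (- real n / 2))"
    using t by (simp add: ennreal_power powr_power)
  finally show ?thesis .
qed

subsection \<open>Rotations of Gaussian vectors\<close>

lemma measurable_gauss_coord: "i < n \<Longrightarrow> (\<lambda>v. v i) \<in> borel_measurable (gauss n)"
  using measurable_gauss_comp[OF measurable_ident[unfolded id_def]] by blast

text \<open>Two one-dimensional affine substitutions and Fubini replace a planar change of
  variables: first \<open>p = c * a - s * b\<close> with \<open>b\<close> fixed, then
  \<open>b = c * q - s * p\<close> with \<open>p\<close> fixed. Their Jacobians cancel; the first
  one is why \<open>c\<close> must not vanish.\<close>

lemma nn_integral_rotate2:
  assumes F[measurable]: "case_prod F \<in> borel_measurable (borel \<Otimes>\<^sub>M borel)" and c: "c \<noteq> 0" and cs: "c\<^sup>2 + s\<^sup>2 = (1::real)"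
  shows "(\<integral>\<^sup>+b. \<integral>\<^sup>+a. F (c * a - s * b) (s * a + c * b) \<partial>std_normal_distribution \<partial>std_normal_distribution)
    = (\<integral>\<^sup>+b. \<integral>\<^sup>+a. F a b \<partial>std_normal_distribution \<partial>std_normal_distribution)"
proof -
  define G where "G a b = ennreal (std_normal_density a * std_normal_density b)" for a b
  have [measurable]: "case_prod G \<in> borel_measurable (borel \<Otimes>\<^sub>M borel)"
    unfolding G_def by measurable
  have cc: "c * c + s * s = 1" using cs by (simp add: power2_eq_square)
  have unfold: "(\<integral>\<^sup>+b. \<integral>\<^sup>+a. H a b \<partial>std_normal_distribution \<partial>std_normal_distribution)
    = (\<integral>\<^sup>+b. \<integral>\<^sup>+a. G a b * H a b \<partial>lborel \<partial>lborel)"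
    if [measurable]: "case_prod H \<in> borel_measurable (borel \<Otimes>\<^sub>M borel)" for H
  proof -
    have "(\<integral>\<^sup>+b. \<integral>\<^sup>+a. H a b \<partial>std_normal_distribution \<partial>std_normal_distribution)
      = (\<integral>\<^sup>+b. \<integral>\<^sup>+a. ennreal (std_normal_density a) * H a b \<partial>lborel \<partial>std_normal_distribution)"
      by (intro nn_integral_cong nn_integral_density) auto
    also have "\<dots> = (\<integral>\<^sup>+b. ennreal (std_normal_density b) * (\<integral>\<^sup>+a. ennreal (std_normal_density a) * H a b \<partial>lborel) \<partial>lborel)"
      by (intro nn_integral_density) auto
    also have "\<dots> = (\<integral>\<^sup>+b. \<integral>\<^sup>+a. ennreal (std_normal_density b) * (ennreal (std_normal_density a) * H a b) \<partial>lborel \<partial>lborel)"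
      by (intro nn_integral_cong nn_integral_cmult[symmetric]) auto
    also have "\<dots> = (\<integral>\<^sup>+b. \<integral>\<^sup>+a. G a b * H a b \<partial>lborel \<partial>lborel)"
      by (intro nn_integral_cong) (simp add: G_def ennreal_mult mult_ac)
    finally show ?thesis .
  qed
  have Geq: "G (s * q + c * p) (c * q - s * p) = G p q" for p q
  proof -
    have "(s * q + c * p)\<^sup>2 + (c * q - s * p)\<^sup>2 = p\<^sup>2 * (c * c + s * s) + q\<^sup>2 * (c * c + s * s)"
      by (simp add: power2_eq_square algebra_simps)
    then have *: "- (s * q + c * p)\<^sup>2 / 2 + - (c * q - s * p)\<^sup>2 / 2 = - p\<^sup>2 / 2 + - q\<^sup>2 / 2" 
      unfolding cc by (simp add: field_simps)
    have "G x y = ennreal (1 / sqrt (2 * pi) * (1 / sqrt (2 * pi)) * exp (- x\<^sup>2 / 2 + - y\<^sup>2 / 2))" for x y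
      unfolding G_def std_normal_density_def exp_add by (simp add: mult_ac)
    then show ?thesis by (simp only: *)
  qed
  have "(\<integral>\<^sup>+b. \<integral>\<^sup>+a. F (c * a - s * b) (s * a + c * b) \<partial>std_normal_distribution \<partial>std_normal_distribution)
    = (\<integral>\<^sup>+b. \<integral>\<^sup>+a. G a b * F (c * a - s * b) (s * a + c * b) \<partial>lborel \<partial>lborel)"
    by (rule unfold) measurable
  also have "\<dots> = (\<integral>\<^sup>+b. ennreal \<bar>1 / c\<bar> * (\<integral>\<^sup>+p. G (s * b / c + 1 / c * p) b * F (c * (s * b / c + 1 / c * p) - s * b) (s * (s * b / c + 1 / c * p) + c * b) \<partial>lborel) \<partial>lborel)"
    using c by (intro nn_integral_cong nn_integral_real_affine) auto
  also have "\<dots> = (\<integral>\<^sup>+b. ennreal \<bar>1 / c\<bar> * (\<integral>\<^sup>+p. G ((s * b + p) / c) b * F p ((s * p + b) / c) \<partial>lborel) \<partial>lborel)"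
  proof -
    have 1: "s * b / c + 1 / c * p = (s * b + p) / c" for b p using c by (simp add: field_simps)
    have 2: "c * ((s * b + p) / c) - s * b = p" for b p using c by (simp add: field_simps)
    have 3: "s * ((s * b + p) / c) + c * b = (s * p + b) / c" for b p
    proof -
      have "s * ((s * b + p) / c) + c * b = (s * p + (c * c + s * s) * b) / c" using c by (simp add: field_simps)
      then show ?thesis by (simp add: cc)
    qed
    show ?thesis by (simp only: 1 2 3)
  qed
  also have "\<dots> = (\<integral>\<^sup>+b. \<integral>\<^sup>+p. ennreal \<bar>1 / c\<bar> * (G ((s * b + p) / c) b * F p ((s * p + b) / c)) \<partial>lborel \<partial>lborel)"
    by (intro nn_integral_cong nn_integral_cmult[symmetric]) auto
  also have "\<dots> = (\<integral>\<^sup>+p. \<integral>\<^sup>+b. ennreal \<bar>1 / c\<bar> * (G ((s * b + p) / c) b * F p ((s * p + b) / c)) \<partial>lborel \<partial>lborel)"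
    by (intro lborel_pair.Fubini') measurable
  also have "\<dots> = (\<integral>\<^sup>+p. ennreal \<bar>1 / c\<bar> * (\<integral>\<^sup>+b. G ((s * b + p) / c) b * F p ((s * p + b) / c) \<partial>lborel) \<partial>lborel)"
    by (intro nn_integral_cong nn_integral_cmult) auto
  also have "\<dots> = (\<integral>\<^sup>+p. ennreal \<bar>1 / c\<bar> * (ennreal \<bar>c\<bar> * (\<integral>\<^sup>+q. G ((s * (- s * p + c * q) + p) / c) (- s * p + c * q) * F p ((s * p + (- s * p + c * q)) / c) \<partial>lborel)) \<partial>lborel)"
    using c by (intro nn_integral_cong arg_cong[where f="\<lambda>x. _ * x"] nn_integral_real_affine) auto
  also have "\<dots> = (\<integral>\<^sup>+p. \<integral>\<^sup>+q. G p q * F p q \<partial>lborel \<partial>lborel)"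
  proof -
    have 1: "(s * (c * q - s * p) + p) / c = s * q + c * p" for p q
    proof -
      have "s * (c * q - s * p) + p = c * (s * q) + p * (1 - s * s)" by (simp add: algebra_simps)
      also have "1 - s * s = c * c" using cc by simp
      finally show ?thesis using c by (simp add: field_simps)
    qed
    have 2: "(s * p + (c * q - s * p)) / c = q" for p q using c by simp
    have 3: "- s * p + c * q = c * q - s * p" for p q by simp
    have 4: "ennreal \<bar>1 / c\<bar> * (ennreal \<bar>c\<bar> * x) = x" for x
      using c by (simp add: mult.assoc[symmetric] ennreal_mult[symmetric])
    show ?thesis by (simp only: 3 1 2 4 Geq)
  qed
  also have "\<dots> = (\<integral>\<^sup>+q. \<integral>\<^sup>+p. G p q * F p q \<partial>lborel \<partial>lborel)"
    by (intro lborel_pair.Fubini') measurable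
  also have "\<dots> = (\<integral>\<^sup>+b. \<integral>\<^sup>+a. F a b \<partial>std_normal_distribution \<partial>std_normal_distribution)"
    by (rule unfold[symmetric]) measurable
  finally show ?thesis .
qed

text \<open>An orthogonal map given together with its adjoint. Linearity is not a clause, since it
  follows from the adjoint identity tested against unit vectors. The inverse laws are restricted to
  indices below \<open>n\<close> because the arguments need not be extensional.\<close>

definition isom :: "nat \<Rightarrow> ((nat \<Rightarrow> real) \<Rightarrow> nat \<Rightarrow> real) \<Rightarrow> ((nat \<Rightarrow> real) \<Rightarrow> nat \<Rightarrow> real) \<Rightarrow> bool" where
  "isom n T T' \<longleftrightarrow>
     T \<in> gauss n \<rightarrow>\<^sub>M gauss n \<and> T' \<in> gauss n \<rightarrow>\<^sub>M gauss n \<and>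
     distr (gauss n) (gauss n) T = gauss n \<and> distr (gauss n) (gauss n) T' = gauss n \<and>
     (\<forall>v w. ip n (T v) w = ip n v (T' w)) \<and>
     (\<forall>v. \<forall>i<n. T' (T v) i = v i) \<and> (\<forall>v. \<forall>i<n. T (T' v) i = v i)"

lemma isom_sym: "isom n T T' \<Longrightarrow> isom n T' T"
  unfolding isom_def by (simp add: ip_commute[of n "T' _"]) (simp add: ip_commute)

lemma isom_measurable:
  assumes "isom n T T'"
  shows "T \<in> gauss n \<rightarrow>\<^sub>M gauss n" "T' \<in> gauss n \<rightarrow>\<^sub>M gauss n"
  using assms by (auto simp: isom_def)

lemma isom_adjoint: "isom n T T' \<Longrightarrow> ip n (T v) w = ip n v (T' w)"
  by (simp add: isom_def)

lemma isom_inverse: "isom n T T' \<Longrightarrow> i < n \<Longrightarrow> T' (T v) i = v i"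
  by (simp add: isom_def)

lemma isom_ip: "isom n T T' \<Longrightarrow> ip n (T v) (T w) = ip n v w"
  using isom_adjoint[of n T T' v "T w"] by (auto simp: isom_def intro!: ip_cong)

lemma ip_unit: "i < n \<Longrightarrow> ip n v (\<lambda>k. if k = i then 1 else 0) = v i"
  by (simp add: ip_def if_distrib[of "\<lambda>x. _ * x"] cong: if_cong)

lemma isom_coord: "isom n T T' \<Longrightarrow> i < n \<Longrightarrow> T v i = ip n v (T' (\<lambda>k. if k = i then 1 else 0))"
  using isom_adjoint ip_unit by metis

lemma isom_cong: "isom n T T' \<Longrightarrow> (\<And>k. k < n \<Longrightarrow> v k = w k) \<Longrightarrow> i < n \<Longrightarrow> T v i = T w i"
  by (simp add: isom_coord cong: ip_cong)

lemma isom_add: "isom n T T' \<Longrightarrow> i < n \<Longrightarrow> T (\<lambda>k. v k + w k) i = T v i + T w i"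
  by (simp add: isom_coord ip_add_left)

lemma isom_scale: "isom n T T' \<Longrightarrow> i < n \<Longrightarrow> T (\<lambda>k. c * v k) i = c * T v i"
  by (simp add: isom_coord ip_scale_left)

lemma nn_integral_isom:
  assumes "isom n T T'" "f \<in> borel_measurable (gauss n)"
  shows "(\<integral>\<^sup>+w. f (T w) \<partial>gauss n) = (\<integral>\<^sup>+w. f w \<partial>gauss n)"
proof -
  have "(\<integral>\<^sup>+w. f w \<partial>gauss n) = (\<integral>\<^sup>+w. f w \<partial>distr (gauss n) (gauss n) T)"
    using assms(1) by (simp add: isom_def)
  also have "\<dots> = (\<integral>\<^sup>+w. f (T w) \<partial>gauss n)"
    using assms by (intro nn_integral_distr) (auto simp: isom_def)
  finally show ?thesis ..
qed

lemma isom_id: "isom n (\<lambda>v. \<lambda>i\<in>{..<n}. v i) (\<lambda>v. \<lambda>i\<in>{..<n}. v i)"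
proof -
  have m: "(\<lambda>v. \<lambda>i\<in>{..<n}. v i) \<in> gauss n \<rightarrow>\<^sub>M gauss n"
    by (intro measurable_into_gauss measurable_gauss_coord)
  have "distr (gauss n) (gauss n) (\<lambda>v. \<lambda>i\<in>{..<n}. v i) = distr (gauss n) (gauss n) (\<lambda>v. v)"
    by (intro distr_cong) (auto simp: space_PiM PiE_def extensional_def fun_eq_iff)
  then show ?thesis using m by (auto simp: isom_def intro!: ip_cong)
qed

lemma isom_comp:
  assumes S: "isom n S S'" and T: "isom n T T'"
  shows "isom n (\<lambda>v. S (T v)) (\<lambda>v. T' (S' v))"
proof -
  note m = isom_measurable[OF S] isom_measurable[OF T]
  have "distr (gauss n) (gauss n) (\<lambda>v. S (T v)) = distr (distr (gauss n) (gauss n) T) (gauss n) S"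
    using m by (subst distr_distr) (auto simp: comp_def)
  also have "\<dots> = gauss n" using S T by (simp add: isom_def)
  finally have 1: "distr (gauss n) (gauss n) (\<lambda>v. S (T v)) = gauss n" .
  have "distr (gauss n) (gauss n) (\<lambda>v. T' (S' v)) = distr (distr (gauss n) (gauss n) S') (gauss n) T'"
    using m by (subst distr_distr) (auto simp: comp_def)
  also have "\<dots> = gauss n" using S T by (simp add: isom_def)
  finally have 2: "distr (gauss n) (gauss n) (\<lambda>v. T' (S' v)) = gauss n" .
  have 3: "T' (S' (S (T v))) i = v i" if "i < n" for v i
    using isom_cong[OF isom_sym[OF T], of "S' (S (T v))" "T v"] isom_inverse[OF S] isom_inverse[OF T] that by simp
  have 4: "S (T (T' (S' v))) i = v i" if "i < n" for v i
    using isom_cong[OF S, of "T (T' (S' v))" "S' v"] isom_inverse[OF isom_sym[OF S]] isom_inverse[OF isom_sym[OF T]] that by simp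
  show ?thesis
    unfolding isom_def using m 1 2 3 4 isom_adjoint[OF S] isom_adjoint[OF T]
    by (auto intro: measurable_compose)
qed

definition givens :: "nat \<Rightarrow> nat \<Rightarrow> nat \<Rightarrow> real \<Rightarrow> real \<Rightarrow> (nat \<Rightarrow> real) \<Rightarrow> nat \<Rightarrow> real" where
  "givens n i j c s v = (\<lambda>k\<in>{..<n}. if k = i then c * v i - s * v j else if k = j then s * v i + c * v j else v k)"

lemma measurable_givens:
  assumes "i < n" "j < n" shows "givens n i j c s \<in> gauss n \<rightarrow>\<^sub>M gauss n"
  unfolding givens_def
proof (intro measurable_into_gauss)
  fix k assume "k < n"
  note [measurable] = measurable_gauss_coord[OF assms(1)] measurable_gauss_coord[OF assms(2)] measurable_gauss_coord[OF this]
  show "(\<lambda>v. if k = i then c * v i - s * v j else if k = j then s * v i + c * v j else v k) \<in> borel_measurable (gauss n)"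
    by auto
qed

lemma nn_integral_givens:
  assumes ij: "i < n" "j < n" "i \<noteq> j" and c: "c \<noteq> 0" and cs: "c\<^sup>2 + s\<^sup>2 = (1::real)"
    and f: "f \<in> borel_measurable (gauss n)"
  shows "(\<integral>\<^sup>+v. f (givens n i j c s v) \<partial>gauss n) = (\<integral>\<^sup>+v. f v \<partial>gauss n)"
proof -
  interpret product_sigma_finite "\<lambda>i::nat. std_normal_distribution" by (rule product_sigma_finite_normal)
  define J where "J = {..<n} - {i, j}"
  have n: "{..<n} = insert i (insert j J)" using ij by (auto simp: J_def)
  have J: "finite J" "j \<notin> J" "i \<notin> insert j J" using ij by (auto simp: J_def)
  have upd1: "(\<lambda>p. x(j := snd p, i := fst p)) \<in> borel \<Otimes>\<^sub>M borel \<rightarrow>\<^sub>M gauss n" if "x \<in> space (PiM J (\<lambda>i. std_normal_distribution))" for x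
    unfolding n
    by (rule measurable_fun_upd[where J="insert j J"], simp)
      (rule measurable_fun_upd[where J="J"], use that in auto)
  have dec: "(\<integral>\<^sup>+v. g v \<partial>gauss n) = (\<integral>\<^sup>+x. \<integral>\<^sup>+b. \<integral>\<^sup>+a. g (x(j := b, i := a)) \<partial>std_normal_distribution \<partial>std_normal_distribution \<partial>PiM J (\<lambda>i. std_normal_distribution))"
    if g: "g \<in> borel_measurable (gauss n)" for g
  proof -
    have g': "g \<in> borel_measurable (PiM (insert i (insert j J)) (\<lambda>i. std_normal_distribution))"
      using g by (simp add: n)
    have "(\<integral>\<^sup>+v. g v \<partial>gauss n) = (\<integral>\<^sup>+x. \<integral>\<^sup>+a. g (x(i := a)) \<partial>std_normal_distribution \<partial>PiM (insert j J) (\<lambda>i. std_normal_distribution))"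
      unfolding n using J by (intro product_nn_integral_insert g') auto
    also have "\<dots> = (\<integral>\<^sup>+x. \<integral>\<^sup>+b. \<integral>\<^sup>+a. g (x(j := b, i := a)) \<partial>std_normal_distribution \<partial>std_normal_distribution \<partial>PiM J (\<lambda>i. std_normal_distribution))"
    proof (intro product_nn_integral_insert)
      have "(\<lambda>p. g ((fst p)(i := snd p))) \<in> borel_measurable (PiM (insert j J) (\<lambda>i. std_normal_distribution) \<Otimes>\<^sub>M std_normal_distribution)"
        by (rule measurable_compose[OF _ g'], rule measurable_fun_upd[where J="insert j J"]) auto
      then show "(\<lambda>x. \<integral>\<^sup>+ a. g (x(i := a)) \<partial>std_normal_distribution) \<in> borel_measurable (Pi\<^sub>M (insert j J) (\<lambda>i. std_normal_distribution))"
        by (intro sigma_finite_measure.borel_measurable_nn_integral[OF prob_space_imp_sigma_finite[OF prob_std_normal]]) (simp add: case_prod_beta')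
    qed (use J in auto)
    finally show ?thesis .
  qed
  have "(\<integral>\<^sup>+v. f (givens n i j c s v) \<partial>gauss n) =
    (\<integral>\<^sup>+x. \<integral>\<^sup>+b. \<integral>\<^sup>+a. f (givens n i j c s (x(j := b, i := a))) \<partial>std_normal_distribution \<partial>std_normal_distribution \<partial>PiM J (\<lambda>i. std_normal_distribution))"
    by (rule dec) (rule measurable_compose[OF measurable_givens[OF ij(1,2)] f])
  also have "\<dots> = (\<integral>\<^sup>+x. \<integral>\<^sup>+b. \<integral>\<^sup>+a. (\<lambda>a b. f (x(j := b, i := a))) (c * a - s * b) (s * a + c * b) \<partial>std_normal_distribution \<partial>std_normal_distribution \<partial>PiM J (\<lambda>i. std_normal_distribution))"
  proof (intro nn_integral_cong)
    fix x :: "nat \<Rightarrow> real" and a b assume x: "x \<in> space (PiM J (\<lambda>i. std_normal_distribution))"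
    have "givens n i j c s (x(j := b, i := a)) = x(j := s * a + c * b, i := c * a - s * b)"
      using x ij by (auto simp: fun_eq_iff givens_def space_PiM PiE_def extensional_def J_def)
    then show "f (givens n i j c s (x(j := b, i := a))) = (\<lambda>a b. f (x(j := b, i := a))) (c * a - s * b) (s * a + c * b)" by simp
  qed
  also have "\<dots> = (\<integral>\<^sup>+x. \<integral>\<^sup>+b. \<integral>\<^sup>+a. f (x(j := b, i := a)) \<partial>std_normal_distribution \<partial>std_normal_distribution \<partial>PiM J (\<lambda>i. std_normal_distribution))"
  proof (rule nn_integral_cong)
    fix x :: "nat \<Rightarrow> real" assume x: "x \<in> space (PiM J (\<lambda>i. std_normal_distribution))"
    show "(\<integral>\<^sup>+b. \<integral>\<^sup>+a. (\<lambda>a b. f (x(j := b, i := a))) (c * a - s * b) (s * a + c * b) \<partial>std_normal_distribution \<partial>std_normal_distribution)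
      = (\<integral>\<^sup>+b. \<integral>\<^sup>+a. f (x(j := b, i := a)) \<partial>std_normal_distribution \<partial>std_normal_distribution)"
      by (rule nn_integral_rotate2[OF _ c cs])
        (use measurable_compose[OF upd1[OF x] f] in \<open>simp only: case_prod_beta'\<close>)
  qed
  also have "\<dots> = (\<integral>\<^sup>+v. f v \<partial>gauss n)" by (rule dec[OF f, symmetric])
  finally show ?thesis .
qed

lemma sum_split2:
  fixes f :: "nat \<Rightarrow> real"
  assumes "i < n" "j < n" "i \<noteq> j"
  shows "(\<Sum>k<n. f k) = f i + f j + (\<Sum>k\<in>{..<n} - {i, j}. f k)"
  using assms sum.subset_diff[of "{i, j}" "{..<n}" f] by simp

lemma isom_givens:
  assumes ij: "i < n" "j < n" "i \<noteq> j" and c: "c \<noteq> 0" and cs: "c\<^sup>2 + s\<^sup>2 = (1::real)"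
  shows "isom n (givens n i j c s) (givens n i j c (- s))"
proof -
  have d: "distr (gauss n) (gauss n) (givens n i j c u) = gauss n" if "c\<^sup>2 + u\<^sup>2 = 1" for u
  proof (rule measure_eqI)
    fix A assume "A \<in> sets (distr (gauss n) (gauss n) (givens n i j c u))"
    then have A[measurable]: "A \<in> sets (gauss n)" by simp
    have "emeasure (distr (gauss n) (gauss n) (givens n i j c u)) A
      = (\<integral>\<^sup>+v. indicator A v \<partial>distr (gauss n) (gauss n) (givens n i j c u))" by simp
    also have "\<dots> = (\<integral>\<^sup>+v. indicator A (givens n i j c u v) \<partial>gauss n)"
      by (intro nn_integral_distr measurable_givens ij) simp
    also have "\<dots> = (\<integral>\<^sup>+v. indicator A v \<partial>gauss n)" by (rule nn_integral_givens[OF ij c that]) simp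
    finally show "emeasure (distr (gauss n) (gauss n) (givens n i j c u)) A = emeasure (gauss n) A" by simp
  qed simp
  have inv: "givens n i j c (- u) (givens n i j c u v) k = v k" if "c\<^sup>2 + u\<^sup>2 = 1" "k < n" for u v k
  proof -
    have "c * (c * v i - u * v j) + u * (u * v i + c * v j) = (c\<^sup>2 + u\<^sup>2) * v i"
      "- (u * (c * v i - u * v j)) + c * (u * v i + c * v j) = (c\<^sup>2 + u\<^sup>2) * v j"
      by (simp_all add: power2_eq_square algebra_simps)
    then show ?thesis using that ij by (auto simp: givens_def)
  qed
  have adj: "ip n (givens n i j c s v) w = ip n v (givens n i j c (- s) w)" for v w
  proof -
    have "(\<Sum>k\<in>{..<n} - {i, j}. givens n i j c s v k * w k) = (\<Sum>k\<in>{..<n} - {i, j}. v k * givens n i j c (- s) w k)"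
      by (intro sum.cong) (auto simp: givens_def)
    then show ?thesis
      unfolding ip_def sum_split2[OF ij] using ij by (simp add: givens_def algebra_simps)
  qed
  show ?thesis
    unfolding isom_def
    using d[of s] d[of "- s"] inv[of s] inv[of "- s"] adj cs measurable_givens[OF ij(1,2)] by auto
qed

text \<open>A Givens rotation in the plane of the coordinates \<open>k\<close> and \<open>m\<close>
  moves entry \<open>k\<close> into entry \<open>m\<close>. Its cosine is proportional to
  \<open>b m\<close>, and \<open>isom_givens\<close> needs it nonzero; if \<open>b m = 0\<close> but
  \<open>b k\<close> is not, a turn by 45 degrees comes first.\<close>

lemma isom_zero_coord:
  assumes k: "k < m"
  shows "\<exists>T T'. isom (Suc m) T T' \<and> T b k = 0 \<and> (\<forall>i<m. i \<noteq> k \<longrightarrow> T b i = b i)"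
proof -
  have *: "\<exists>T T'. isom (Suc m) T T' \<and> T b k = 0 \<and> (\<forall>i<m. i \<noteq> k \<longrightarrow> T b i = b i)" if bm: "b m \<noteq> 0" for b
  proof -
    define r where "r = sqrt ((b k)\<^sup>2 + (b m)\<^sup>2)"
    have pos: "(b k)\<^sup>2 + (b m)\<^sup>2 > 0" using bm by (simp add: add_nonneg_pos)
    then have r: "r > 0" and r2: "r\<^sup>2 = (b k)\<^sup>2 + (b m)\<^sup>2" by (simp_all add: r_def)
    have cs: "(b m / r)\<^sup>2 + (b k / r)\<^sup>2 = 1"
      using pos bm unfolding power_divide r2 add_divide_distrib[symmetric] by (simp add: add.commute)
    show ?thesis
      using isom_givens[of k "Suc m" m "b m / r" "b k / r"] k bm r cs
      by (intro exI[of _ "givens (Suc m) k m (b m / r) (b k / r)"] exI[of _ "givens (Suc m) k m (b m / r) (- (b k / r))"])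
        (auto simp: givens_def)
  qed
  show ?thesis
  proof (cases "b m \<noteq> 0")
    case True then show ?thesis by (rule *)
  next
    case bm: False
    show ?thesis
    proof (cases "b k = 0")
      case True
      have "(\<lambda>i\<in>{..<Suc m}. b i) k = 0 \<and> (\<forall>i<m. i \<noteq> k \<longrightarrow> (\<lambda>i\<in>{..<Suc m}. b i) i = b i)"
        using True k by simp
      then show ?thesis using isom_id[of "Suc m"] by blast
    next
      case bk: False
      let ?h = "1 / sqrt 2" 
      have i1: "isom (Suc m) (givens (Suc m) k m ?h ?h) (givens (Suc m) k m ?h (- ?h))"
        using k by (intro isom_givens) (auto simp: power_divide)
      have "givens (Suc m) k m ?h ?h b m \<noteq> 0" using bm bk k by (simp add: givens_def)
      from *[of "givens (Suc m) k m ?h ?h b", OF this] obtain T T' where T: "isom (Suc m) T T'" "T (givens (Suc m) k m ?h ?h b) k = 0"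
        "\<forall>i<m. i \<noteq> k \<longrightarrow> T (givens (Suc m) k m ?h ?h b) i = givens (Suc m) k m ?h ?h b i" by blast
      have "T (givens (Suc m) k m ?h ?h b) k = 0 \<and> (\<forall>i<m. i \<noteq> k \<longrightarrow> T (givens (Suc m) k m ?h ?h b) i = b i)"
        using T(2,3) k by (auto simp: givens_def)
      then show ?thesis using isom_comp[OF T(1) i1] by blast
    qed
  qed
qed

text \<open>Successive plane rotations against the last coordinate play the part of a Householder
  reflection. Only the square of the last entry is specified, as its sign depends on the
  rotations.\<close>

lemma isom_to_last:
  obtains T T' where "isom (Suc m) T T'" "\<And>i. i < m \<Longrightarrow> T a i = 0" "(T a m)\<^sup>2 = ip (Suc m) a a"
proof -
  have "\<exists>T T'. isom (Suc m) T T' \<and> (\<forall>i<l. T a i = 0)" if "l \<le> m" for l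
    using that
  proof (induction l)
    case 0 then show ?case using isom_id by blast
  next
    case (Suc l)
    then obtain T T' where T: "isom (Suc m) T T'" "\<forall>i<l. T a i = 0" by auto
    obtain S S' where S: "isom (Suc m) S S'" "S (T a) l = 0" "\<forall>i<m. i \<noteq> l \<longrightarrow> S (T a) i = T a i"
      using isom_zero_coord[of l m "T a"] Suc.prems by auto
    have "S (T a) i = 0" if "i < Suc l" for i
      using that S(2,3) T(2) Suc.prems by (cases "i = l") auto
    then show ?case using isom_comp[OF S(1) T(1)] by blast
  qed
  from this[of m] obtain T T' where T: "isom (Suc m) T T'" "\<forall>i<m. T a i = 0" by auto
  have "ip (Suc m) a a = ip (Suc m) (T a) (T a)" using isom_ip[OF T(1)] by simp
  also have "\<dots> = (T a m)\<^sup>2" using T(2) by (simp add: ip_Suc power2_eq_square) (simp add: ip_def)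
  finally show ?thesis using that T by metis
qed

subsection \<open>Bidiagonalisation of Gaussian matrices\<close>

lemma measurable_gmat_col: "k < N \<Longrightarrow> (\<lambda>G. G k) \<in> gmat N n \<rightarrow>\<^sub>M gauss n"
  by (rule measurable_gmat_comp[OF measurable_ident_sets[OF refl]])

lemma nn_integral_gmat_map:
  assumes T: "isom n T T'" and f: "f \<in> borel_measurable (gmat N n)"
  shows "(\<integral>\<^sup>+G. f (\<lambda>k\<in>{..<N}. T (G k)) \<partial>gmat N n) = (\<integral>\<^sup>+G. f G \<partial>gmat N n)"
proof -
  have "distr (gmat N n) (gmat N n) (compose {..<N} T) = (\<Pi>\<^sub>M k\<in>{..<N}. distr (gauss n) (gauss n) T)"
    using isom_measurable[OF T] by (intro distr_PiM_finite_prob_space' prob_gauss) auto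
  also have "\<dots> = gmat N n" using T by (simp add: isom_def)
  finally have d: "distr (gmat N n) (gmat N n) (compose {..<N} T) = gmat N n" .
  have m: "compose {..<N} T \<in> gmat N n \<rightarrow>\<^sub>M gmat N n"
    unfolding compose_def
    by (intro measurable_restrict measurable_compose[OF measurable_gmat_col isom_measurable(1)[OF T]]) auto
  have "(\<integral>\<^sup>+G. f G \<partial>gmat N n) = (\<integral>\<^sup>+G. f G \<partial>distr (gmat N n) (gmat N n) (compose {..<N} T))"
    by (simp only: d)
  also have "\<dots> = (\<integral>\<^sup>+G. f (compose {..<N} T G) \<partial>gmat N n)"
    by (rule nn_integral_distr[OF m]) (simp add: f)
  finally show ?thesis by (simp add: compose_def)
qed

lemma measurable_attach_row:
  "(\<lambda>p. \<lambda>k\<in>{..<N}. (snd p k)(m := fst p k)) \<in> gauss N \<Otimes>\<^sub>M gmat N m \<rightarrow>\<^sub>M gmat N (Suc m)"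
proof (intro measurable_restrict)
  fix k assume k: "k \<in> {..<N}"
  show "(\<lambda>p. (snd p k)(m := fst p k)) \<in> gauss N \<Otimes>\<^sub>M gmat N m \<rightarrow>\<^sub>M gauss (Suc m)"
    by (rule measurable_upd_gauss[OF measurable_gmat_comp[OF measurable_snd] measurable_gauss_comp[OF measurable_fst]])
      (use k in auto)
qed

text \<open>\<open>gmat\<close> is a product over columns, so detaching the last row regroups the
  product. The two laws are compared on boxes of column events, where both sides factorise.\<close>

lemma nn_integral_gmat_split:
  assumes f: "f \<in> borel_measurable (gmat N (Suc m))"
  shows "(\<integral>\<^sup>+G. f G \<partial>gmat N (Suc m)) = (\<integral>\<^sup>+r. \<integral>\<^sup>+G. f (\<lambda>k\<in>{..<N}. (G k)(m := r k)) \<partial>gmat N m \<partial>gauss N)"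
proof -
  let ?h = "\<lambda>p. \<lambda>k\<in>{..<N}. (snd p k)(m := fst p k)"
  interpret B: prob_space "gmat N m" by (rule prob_gmat)
  interpret S: product_sigma_finite "\<lambda>i::nat. gauss (Suc m)" by (rule product_sigma_finite_gauss)
  interpret S': product_sigma_finite "\<lambda>i::nat. gauss m" by (rule product_sigma_finite_gauss)
  interpret R: product_sigma_finite "\<lambda>i::nat. std_normal_distribution" by (rule product_sigma_finite_normal)
  have "distr (gauss N \<Otimes>\<^sub>M gmat N m) (gmat N (Suc m)) ?h = gmat N (Suc m)"
  proof (rule S.PiM_eqI)
    fix A assume A: "\<And>i. i \<in> {..<N} \<Longrightarrow> A i \<in> sets (gauss (Suc m))"
    have PA: "Pi\<^sub>E {..<N} A \<in> sets (gmat N (Suc m))" using A by (intro sets_PiM_I_finite) auto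
    have ind: "(\<lambda>p. indicator (A k) ((fst p)(m := snd p)) :: ennreal) \<in> borel_measurable (gauss m \<Otimes>\<^sub>M std_normal_distribution)" if "k < N" for k
      by (rule measurable_compose[OF measurable_upd_gauss[OF measurable_fst]]) (use A that in auto)
    have ind1: "(\<lambda>g. indicator (A k) (g(m := c)) :: ennreal) \<in> borel_measurable (gauss m)" if "k < N" for k c
      by (rule measurable_compose[OF measurable_upd_gauss]) (use A that in auto)
    have ind2: "(\<lambda>a. \<integral>\<^sup>+g. indicator (A k) (g(m := a)) \<partial>gauss m :: ennreal) \<in> borel_measurable std_normal_distribution" if "k < N" for k
    proof (intro sigma_finite_measure.borel_measurable_nn_integral[OF prob_space_imp_sigma_finite[OF prob_gauss]], unfold case_prod_beta')
      show "(\<lambda>p. indicator (A k) ((snd p)(m := fst p)) :: ennreal) \<in> borel_measurable (std_normal_distribution \<Otimes>\<^sub>M gauss m)"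
        by (rule measurable_compose[OF measurable_upd_gauss[OF measurable_snd]]) (use A that in auto)
    qed
    have "emeasure (distr (gauss N \<Otimes>\<^sub>M gmat N m) (gmat N (Suc m)) ?h) (Pi\<^sub>E {..<N} A)
      = (\<integral>\<^sup>+p. indicator (Pi\<^sub>E {..<N} A) p \<partial>distr (gauss N \<Otimes>\<^sub>M gmat N m) (gmat N (Suc m)) ?h)"
      using PA by simp
    also have "\<dots> = (\<integral>\<^sup>+p. indicator (Pi\<^sub>E {..<N} A) (?h p) \<partial>(gauss N \<Otimes>\<^sub>M gmat N m))"
      by (rule nn_integral_distr[OF measurable_attach_row]) (use PA in simp)
    also have "\<dots> = (\<integral>\<^sup>+r. \<integral>\<^sup>+G. indicator (Pi\<^sub>E {..<N} A) (?h (r, G)) \<partial>gmat N m \<partial>gauss N)"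
      by (rule B.nn_integral_fst[symmetric]) (rule measurable_compose[OF measurable_attach_row], use PA in simp)
    also have "\<dots> = (\<integral>\<^sup>+r. \<integral>\<^sup>+G. (\<Prod>k<N. indicator (A k) ((G k)(m := r k))) \<partial>gmat N m \<partial>gauss N)"
      by (intro nn_integral_cong) (auto simp: indicator_def PiE_iff)
    also have "\<dots> = (\<integral>\<^sup>+r. (\<Prod>k<N. \<integral>\<^sup>+g. indicator (A k) (g(m := r k)) \<partial>gauss m) \<partial>gauss N)"
      by (intro nn_integral_cong S'.product_nn_integral_prod) (auto intro: ind1)
    also have "\<dots> = (\<Prod>k<N. \<integral>\<^sup>+a. \<integral>\<^sup>+g. indicator (A k) (g(m := a)) \<partial>gauss m \<partial>std_normal_distribution)"
      by (rule R.product_nn_integral_prod[where f="\<lambda>k a. \<integral>\<^sup>+g. indicator (A k) (g(m := a)) \<partial>gauss m"], simp, rule ind2, simp)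
    also have "\<dots> = (\<Prod>k<N. emeasure (gauss (Suc m)) (A k))"
    proof (intro prod.cong refl)
      fix k assume k: "k \<in> {..<N}"
      then have "(\<integral>\<^sup>+a. \<integral>\<^sup>+g. indicator (A k) (g(m := a)) \<partial>gauss m \<partial>std_normal_distribution)
        = (\<integral>\<^sup>+g. indicator (A k) g \<partial>gauss (Suc m))"
        using A by (intro nn_integral_gauss_Suc(2)[symmetric]) auto
      then show "(\<integral>\<^sup>+a. \<integral>\<^sup>+g. indicator (A k) (g(m := a)) \<partial>gauss m \<partial>std_normal_distribution)
        = emeasure (gauss (Suc m)) (A k)" using A[OF k] by simp
    qed
    finally show "emeasure (distr (gauss N \<Otimes>\<^sub>M gmat N m) (gmat N (Suc m)) ?h) (Pi\<^sub>E {..<N} A)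
      = (\<Prod>i\<in>{..<N}. emeasure (gauss (Suc m)) (A i))" .
  qed auto
  then have "(\<integral>\<^sup>+G. f G \<partial>gmat N (Suc m)) = (\<integral>\<^sup>+G. f G \<partial>distr (gauss N \<Otimes>\<^sub>M gmat N m) (gmat N (Suc m)) ?h)"
    by simp
  also have "\<dots> = (\<integral>\<^sup>+p. f (?h p) \<partial>(gauss N \<Otimes>\<^sub>M gmat N m))"
    by (rule nn_integral_distr[OF measurable_attach_row]) (simp add: f)
  also have "\<dots> = (\<integral>\<^sup>+r. \<integral>\<^sup>+G. f (?h (r, G)) \<partial>gmat N m \<partial>gauss N)"
    by (rule B.nn_integral_fst[symmetric]) (rule measurable_compose[OF measurable_attach_row f])
  finally show ?thesis by simp
qed

text \<open>With \<open>G k\<close> as the columns, this is multiplication from the right: each row,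
  a vector with \<open>N\<close> entries, is rotated by \<open>T\<close>.\<close>

definition rowmap :: "((nat \<Rightarrow> real) \<Rightarrow> nat \<Rightarrow> real) \<Rightarrow> nat \<Rightarrow> nat \<Rightarrow> (nat \<Rightarrow> nat \<Rightarrow> real) \<Rightarrow> nat \<Rightarrow> nat \<Rightarrow> real" where
  "rowmap T N n G = (\<lambda>k\<in>{..<N}. \<lambda>i\<in>{..<n}. T (\<lambda>k\<in>{..<N}. G k i) k)"

lemma measurable_rowmap:
  assumes T: "isom N T T'"
  shows "rowmap T N n \<in> gmat N n \<rightarrow>\<^sub>M gmat N n"
  unfolding rowmap_def
proof (rule measurable_restrict, rule measurable_into_gauss)
  fix k i assume k: "k \<in> {..<N}" and i: "i < n"
  have "(\<lambda>G. \<lambda>k\<in>{..<N}. G k i) \<in> gmat N n \<rightarrow>\<^sub>M gauss N"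
    by (intro measurable_into_gauss measurable_gauss_comp[OF measurable_gmat_col]) (use i in auto)
  from measurable_gauss_comp[OF measurable_compose[OF this isom_measurable(1)[OF T]], of k] k
  show "(\<lambda>G. T (\<lambda>k\<in>{..<N}. G k i) k) \<in> borel_measurable (gmat N n)" by blast
qed

text \<open>Induction on the number of rows, detaching the last one: the rows are independent
  standard Gaussian vectors, and \<open>T\<close> preserves the law of each.\<close>

lemma nn_integral_rowmap:
  assumes T: "isom N T T'" and f: "f \<in> borel_measurable (gmat N n)"
  shows "(\<integral>\<^sup>+G. f (rowmap T N n G) \<partial>gmat N n) = (\<integral>\<^sup>+G. f G \<partial>gmat N n)"
  using f
proof (induction n arbitrary: f)
  case 0
  show ?case
    by (intro nn_integral_cong arg_cong[where f=f])
      (auto simp: rowmap_def space_PiM PiE_def extensional_def fun_eq_iff Pi_iff)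
next
  case (Suc n)
  let ?h = "\<lambda>r G. \<lambda>k\<in>{..<N}. (G k)(n := r k)"
  have m: "(\<lambda>p. f (?h (fst p) (snd p))) \<in> borel_measurable (gauss N \<Otimes>\<^sub>M gmat N n)"
    by (rule measurable_compose[OF measurable_attach_row Suc.prems])
  have m1: "(\<lambda>G. f (?h r G)) \<in> borel_measurable (gmat N n)" if "r \<in> space (gauss N)" for r
    using measurable_compose[OF measurable_Pair1'[OF that] m] by simp
  have m2: "(\<lambda>r. \<integral>\<^sup>+G. f (?h r G) \<partial>gmat N n) \<in> borel_measurable (gauss N)"
    using m by (intro sigma_finite_measure.borel_measurable_nn_integral[OF prob_space_imp_sigma_finite[OF prob_gmat]])
      (simp only: case_prod_beta')
  have "(\<integral>\<^sup>+G. f (rowmap T N (Suc n) G) \<partial>gmat N (Suc n))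
    = (\<integral>\<^sup>+r. \<integral>\<^sup>+G. f (rowmap T N (Suc n) (?h r G)) \<partial>gmat N n \<partial>gauss N)"
    by (rule nn_integral_gmat_split) (rule measurable_compose[OF measurable_rowmap[OF T] Suc.prems])
  also have "\<dots> = (\<integral>\<^sup>+r. \<integral>\<^sup>+G. f (?h (T r) (rowmap T N n G)) \<partial>gmat N n \<partial>gauss N)"
  proof (intro nn_integral_cong arg_cong[where f=f])
    fix r G assume "r \<in> space (gauss N)"
    then have r: "(\<lambda>k\<in>{..<N}. r k) = r" by (auto simp: space_PiM PiE_def extensional_def fun_eq_iff)
    have "T (\<lambda>k\<in>{..<N}. (?h r G) k n) k = T r k" if "k < N" for k
      using isom_cong[OF T, of "\<lambda>k\<in>{..<N}. (?h r G) k n" r k] that by simp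
    moreover have "T (\<lambda>k\<in>{..<N}. (?h r G) k i) k = T (\<lambda>k\<in>{..<N}. G k i) k" if "k < N" "i < n" for k i
      using isom_cong[OF T, of "\<lambda>k\<in>{..<N}. (?h r G) k i" "\<lambda>k\<in>{..<N}. G k i" k] that by simp
    ultimately show "rowmap T N (Suc n) (?h r G) = ?h (T r) (rowmap T N n G)"
      by (auto simp: rowmap_def fun_eq_iff less_Suc_eq)
  qed
  also have "\<dots> = (\<integral>\<^sup>+r. \<integral>\<^sup>+G. f (?h (T r) G) \<partial>gmat N n \<partial>gauss N)"
  proof (rule nn_integral_cong)
    fix r assume "r \<in> space (gauss N)"
    then have "T r \<in> space (gauss N)" using isom_measurable(1)[OF T] by (rule measurable_space[rotated])
    from Suc.IH[OF m1[OF this]]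
    show "(\<integral>\<^sup>+G. f (?h (T r) (rowmap T N n G)) \<partial>gmat N n) = (\<integral>\<^sup>+G. f (?h (T r) G) \<partial>gmat N n)" .
  qed
  also have "\<dots> = (\<integral>\<^sup>+r. \<integral>\<^sup>+G. f (?h r G) \<partial>gmat N n \<partial>gauss N)"
    by (rule nn_integral_isom[OF T m2])
  also have "\<dots> = (\<integral>\<^sup>+G. f G \<partial>gmat N (Suc n))"
    by (rule nn_integral_gmat_split[symmetric]) fact
  finally show ?case .
qed

text \<open>For \<open>s > 0\<close> and \<open>y = 0\<close> this is the determinant of
  \<open>I - s * G^T G\<close> to the power \<open>- 1 / 2\<close> as long as \<open>s\<close> times
  the largest eigenvalue of \<open>G^T G\<close> is below 1, and infinite otherwise; hence the
  values in \<open>ennreal\<close>.\<close>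

definition Lam :: "real \<Rightarrow> nat \<Rightarrow> nat \<Rightarrow> (nat \<Rightarrow> real) \<Rightarrow> (nat \<Rightarrow> nat \<Rightarrow> real) \<Rightarrow> ennreal" where
  "Lam s n N y G = (\<integral>\<^sup>+w. ennreal (exp (s / 2 * (\<Sum>k<N. (y k + ip n (G k) w)\<^sup>2))) \<partial>gauss n)"

lemma Lam_cong:
  assumes "\<And>k. k < N \<Longrightarrow> y k = y' k" "\<And>k i. k < N \<Longrightarrow> i < n \<Longrightarrow> G k i = G' k i"
  shows "Lam s n N y G = Lam s n N y' G'"
  unfolding Lam_def using assms
  by (intro nn_integral_cong arg_cong[where f=ennreal] arg_cong[where f=exp] arg_cong[where f="\<lambda>x. _ * x"] sum.cong refl)
    (auto cong: ip_cong)

text \<open>The vector with entries \<open>y k + ip n (G k) w\<close> is itself rotated by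
  \<open>T\<close>, which keeps its length for every \<open>w\<close>.\<close>

lemma Lam_rowmap:
  assumes T: "isom N T T'"
  shows "Lam s n N (T y) (rowmap T N n G) = Lam s n N y G"
proof -
  have "(\<Sum>k<N. (T y k + ip n (rowmap T N n G k) w)\<^sup>2) = (\<Sum>k<N. (y k + ip n (G k) w)\<^sup>2)" for w
  proof -
    let ?z = "\<lambda>k. y k + ip n (G k) w"
    have "T y k + ip n (rowmap T N n G k) w = T ?z k" if k: "k < N" for k
    proof -
      define u where "u = T' (\<lambda>l. if l = k then 1 else 0)"
      have c: "T v k = ip N v u" for v unfolding u_def by (rule isom_coord[OF T k])
      have "ip n (rowmap T N n G k) w = (\<Sum>i<n. (\<Sum>l<N. G l i * u l) * w i)"
        unfolding ip_def rowmap_def c using k by (intro sum.cong refl) (simp add: c ip_def)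
      also have "\<dots> = (\<Sum>l<N. (\<Sum>i<n. G l i * w i) * u l)"
        unfolding sum_distrib_right by (subst sum.swap) (simp add: mult_ac)
      also have "\<dots> = ip N (\<lambda>l. ip n (G l) w) u" by (simp add: ip_def)
      finally show ?thesis by (simp add: c ip_add_left)
    qed
    then have "(\<Sum>k<N. (T y k + ip n (rowmap T N n G k) w)\<^sup>2) = ip N (T ?z) (T ?z)"
      by (simp add: ip_def power2_eq_square)
    also have "\<dots> = ip N ?z ?z" by (rule isom_ip[OF T])
    finally show ?thesis by (simp add: ip_def power2_eq_square)
  qed
  then show ?thesis by (simp add: Lam_def)
qed

lemma measurable_quad_sum:
  assumes "\<And>k. k < N \<Longrightarrow> f k \<in> borel_measurable M"
  shows "(\<lambda>x. ennreal (exp (s / 2 * (\<Sum>k<N. (f k x)\<^sup>2)))) \<in> borel_measurable M"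
proof -
  have "(\<lambda>x. \<Sum>k<N. (f k x)\<^sup>2) \<in> borel_measurable M"
    using assms by (intro borel_measurable_sum borel_measurable_power) auto
  then show ?thesis by measurable
qed

text \<open>The adjoint moves \<open>T\<close> over to \<open>w\<close>, and the Gaussian average
  over \<open>w\<close> does not notice it.\<close>

lemma Lam_map:
  assumes T: "isom n T T'"
  shows "Lam s n N y (\<lambda>k\<in>{..<N}. T (G k)) = Lam s n N y G"
proof -
  have "Lam s n N y (\<lambda>k\<in>{..<N}. T (G k)) = (\<integral>\<^sup>+w. ennreal (exp (s / 2 * (\<Sum>k<N. (y k + ip n (G k) (T' w))\<^sup>2))) \<partial>gauss n)"
    unfolding Lam_def by (intro nn_integral_cong) (simp add: isom_adjoint[OF T])
  also have "\<dots> = Lam s n N y G"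
    unfolding Lam_def
    by (rule nn_integral_isom[OF isom_sym[OF T], of "\<lambda>w. ennreal (exp (s / 2 * (\<Sum>k<N. (y k + ip n (G k) w)\<^sup>2)))"])
      (intro measurable_quad_sum borel_measurable_add borel_measurable_const measurable_ip_const measurable_ident_sets refl)
  finally show ?thesis .
qed

lemma measurable_Lam:
  assumes y: "\<And>k. k < N \<Longrightarrow> (\<lambda>x. y x k) \<in> borel_measurable M" and G: "\<And>k. k < N \<Longrightarrow> (\<lambda>x. G x k) \<in> M \<rightarrow>\<^sub>M gauss n"
  shows "(\<lambda>x. Lam s n N (y x) (G x)) \<in> borel_measurable M"
  unfolding Lam_def
proof (intro sigma_finite_measure.borel_measurable_nn_integral[OF prob_space_imp_sigma_finite[OF prob_gauss]], unfold case_prod_beta')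
  show "(\<lambda>p. ennreal (exp (s / 2 * (\<Sum>k<N. (y (fst p) k + ip n (G (fst p) k) (snd p))\<^sup>2)))) \<in> borel_measurable (M \<Otimes>\<^sub>M gauss n)"
    by (intro measurable_quad_sum borel_measurable_add measurable_ip measurable_snd measurable_compose[OF measurable_fst y] measurable_compose[OF measurable_fst G])
qed

text \<open>
  Only rational multiples of \<open>y\<close> occur, so that the condition is measurable in \<open>y\<close> and \<open>G\<close>.
\<close>
definition good :: "real \<Rightarrow> nat \<Rightarrow> nat \<Rightarrow> real \<Rightarrow> real \<Rightarrow> (nat \<Rightarrow> real) \<Rightarrow> (nat \<Rightarrow> nat \<Rightarrow> real) \<Rightarrow> bool" where
  "good s n N \<theta> C y G \<longleftrightarrow> (\<forall>q :: rat. Lam s n N (\<lambda>k. of_rat q * y k) G \<le> ennreal (C * exp (s / 2 * (of_rat q)\<^sup>2 * \<theta> * ip N y y)))"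

lemma pred_good:
  assumes y: "\<And>k. k < N \<Longrightarrow> (\<lambda>x. y x k) \<in> borel_measurable M" and G: "\<And>k. k < N \<Longrightarrow> (\<lambda>x. G x k) \<in> M \<rightarrow>\<^sub>M gauss n"
  shows "Measurable.pred M (\<lambda>x. good s n N \<theta> C (y x) (G x))"
proof -
  have ipy: "(\<lambda>x. ip N (y x) (y x)) \<in> borel_measurable M"
    unfolding ip_def using y by (intro borel_measurable_sum borel_measurable_times) auto
  have "Measurable.pred M (\<lambda>x. Lam s n N (\<lambda>k. \<kappa> * y x k) (G x) \<le> ennreal (C * exp (s / 2 * \<kappa>\<^sup>2 * \<theta> * ip N (y x) (y x))))" for \<kappa>
  proof -
    have [measurable]: "(\<lambda>x. Lam s n N (\<lambda>k. \<kappa> * y x k) (G x)) \<in> borel_measurable M"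
      using y by (intro measurable_Lam G) auto
    note [measurable] = ipy
    show ?thesis by measurable
  qed
  then show ?thesis
    unfolding good_def by (intro pred_intros_countable)
qed

text \<open>Fatou's lemma along rationals tending to \<open>\<kappa>\<close>: \<open>Lam\<close> is
  lower semicontinuous in the multiplier, and the right-hand side is continuous.\<close>

lemma good_real:
  assumes "good s n N \<theta> C y G"
  shows "Lam s n N (\<lambda>k. \<kappa> * y k) G \<le> ennreal (C * exp (s / 2 * \<kappa>\<^sup>2 * \<theta> * ip N y y))"
proof -
  have "\<kappa> \<in> closure \<rat>" by (simp add: Rats_closure_real)
  then obtain q where q: "\<And>j. q j \<in> \<rat>" "q \<longlonglongrightarrow> \<kappa>"
    unfolding closure_sequential by blast
  have "Lam s n N (\<lambda>k. \<kappa> * y k) G = (\<integral>\<^sup>+w. liminf (\<lambda>j. ennreal (exp (s / 2 * (\<Sum>k<N. (q j * y k + ip n (G k) w)\<^sup>2)))) \<partial>gauss n)"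
    unfolding Lam_def
    by (intro nn_integral_cong lim_imp_Liminf[symmetric] tendsto_ennrealI tendsto_intros q(2)) simp
  also have "\<dots> \<le> liminf (\<lambda>j. Lam s n N (\<lambda>k. q j * y k) G)"
    unfolding Lam_def
    by (intro nn_integral_liminf measurable_quad_sum borel_measurable_add borel_measurable_const measurable_ip_const measurable_ident_sets refl)
  also have "\<dots> \<le> liminf (\<lambda>j. ennreal (C * exp (s / 2 * (q j)\<^sup>2 * \<theta> * ip N y y)))"
    using assms q(1) by (intro Liminf_mono always_eventually) (metis good_def Rats_cases)
  also have "\<dots> = ennreal (C * exp (s / 2 * \<kappa>\<^sup>2 * \<theta> * ip N y y))"
    by (intro lim_imp_Liminf tendsto_ennrealI tendsto_intros q(2)) simp
  finally show ?thesis .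
qed


text \<open>In this shape the Gaussian coordinate \<open>a\<close> in direction \<open>m\<close>
  enters the last column through \<open>z + d * a\<close> only, and turns the rest into
  \<open>Lam\<close> at \<open>a * r\<close>, a random multiple of \<open>r\<close>; this is why
  \<open>good\<close> speaks of all multiples. Inserting the bound for \<open>H\<close> leaves a
  single Gaussian integral in \<open>a\<close>, from which \<open>\<theta>1\<close> and
  \<open>C1\<close> are read off.\<close>

lemma good_step:
  assumes G: "good s m M \<theta> C r H" and C: "0 \<le> C" and s: "s > 0" and th: "0 \<le> \<theta>"
    and d: "d\<^sup>2 \<le> D" and r: "ip M r r \<le> E"
    and p: "p = 1 - s * D - s * \<theta> * E" "p > 0"
    and th1: "1 + s * D / p \<le> \<theta>1" and C1: "C1 = C / sqrt p"
    and g: "g m = d" "\<And>i. i < m \<Longrightarrow> g i = 0"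
    and y: "\<And>k. k < M \<Longrightarrow> y k = 0"
  shows "good s (Suc m) (Suc M) \<theta>1 C1 y ((\<lambda>k\<in>{..<M}. (H k)(m := r k))(M := g))"
  unfolding good_def
proof
  fix q :: rat
  let ?G = "(\<lambda>k\<in>{..<M}. (H k)(m := r k))(M := g)"
  define \<kappa> :: real where "\<kappa> = of_rat q"
  define z where "z = \<kappa> * y M"
  \<comment> \<open>The coefficient of \<open>a^2 / 2\<close> in the exponent: \<open>d^2\<close>
    comes from the last column and \<open>\<theta> * ip M r r\<close> from the bound for
    \<open>H\<close>. \<open>p\<close> is a lower bound for \<open>1 - A\<close>.\<close>
  define A where "A = s * d\<^sup>2 + s * \<theta> * ip M r r"
  have A1: "1 - A \<ge> p"
    unfolding A_def p using s th d r by (smt (verit) mult_left_mono mult_nonneg_nonneg)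
  have A: "A < 1" using A1 p(2) by simp
  have yy: "ip (Suc M) y y = (y M)\<^sup>2"
    using y by (simp add: ip_Suc power2_eq_square) (simp add: ip_def)
  have "Lam s (Suc m) (Suc M) (\<lambda>k. \<kappa> * y k) ?G
    = (\<integral>\<^sup>+a. \<integral>\<^sup>+w. ennreal (exp (s / 2 * (\<Sum>k<Suc M. (\<kappa> * y k + ip (Suc m) (?G k) (w(m := a)))\<^sup>2))) \<partial>gauss m \<partial>std_normal_distribution)"
    unfolding Lam_def
    by (rule nn_integral_gauss_Suc(2))
      (intro measurable_quad_sum borel_measurable_add borel_measurable_const measurable_ip_const measurable_ident_sets refl)
  also have "\<dots> = (\<integral>\<^sup>+a. ennreal (exp (s / 2 * (z + d * a)\<^sup>2)) * Lam s m M (\<lambda>k. a * r k) H \<partial>std_normal_distribution)"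
  proof (rule nn_integral_cong)
    fix a
    have "(\<Sum>k<Suc M. (\<kappa> * y k + ip (Suc m) (?G k) (w(m := a)))\<^sup>2)
      = (z + d * a)\<^sup>2 + (\<Sum>k<M. (a * r k + ip m (H k) w)\<^sup>2)" for w
    proof -
      have "ip m g (w(m := a)) = 0" using g by (simp add: ip_def)
      then have 1: "\<kappa> * y M + ip (Suc m) (?G M) (w(m := a)) = z + d * a" using g by (simp add: ip_Suc z_def)
      have 2: "\<kappa> * y k + ip (Suc m) (?G k) (w(m := a)) = a * r k + ip m (H k) w" if "k < M" for k
        using that y by (simp add: ip_Suc mult.commute) (auto simp: ip_def intro!: sum.cong)
      have "(\<Sum>k<M. (\<kappa> * y k + ip (Suc m) (?G k) (w(m := a)))\<^sup>2) = (\<Sum>k<M. (a * r k + ip m (H k) w)\<^sup>2)"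
        by (intro sum.cong refl) (simp only: 2 lessThan_iff)
      then show ?thesis by (simp only: sum.lessThan_Suc 1)
    qed
    then have "(\<integral>\<^sup>+w. ennreal (exp (s / 2 * (\<Sum>k<Suc M. (\<kappa> * y k + ip (Suc m) (?G k) (w(m := a)))\<^sup>2))) \<partial>gauss m)
      = (\<integral>\<^sup>+w. ennreal (exp (s / 2 * (z + d * a)\<^sup>2)) * ennreal (exp (s / 2 * (\<Sum>k<M. (a * r k + ip m (H k) w)\<^sup>2))) \<partial>gauss m)"
      by (simp only:) (simp add: exp_add ennreal_mult'' ring_distribs)
    also have "\<dots> = ennreal (exp (s / 2 * (z + d * a)\<^sup>2)) * Lam s m M (\<lambda>k. a * r k) H"
      unfolding Lam_def
      by (intro nn_integral_cmult measurable_quad_sum borel_measurable_add borel_measurable_const measurable_ip_const measurable_ident_sets refl)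
    finally show "(\<integral>\<^sup>+w. ennreal (exp (s / 2 * (\<Sum>k<Suc M. (\<kappa> * y k + ip (Suc m) (?G k) (w(m := a)))\<^sup>2))) \<partial>gauss m)
      = ennreal (exp (s / 2 * (z + d * a)\<^sup>2)) * Lam s m M (\<lambda>k. a * r k) H" .
  qed
  also have "\<dots> \<le> (\<integral>\<^sup>+a. ennreal (C * exp (s / 2 * z\<^sup>2)) * ennreal (exp (A / 2 * a\<^sup>2 + (s * z * d) * a)) \<partial>std_normal_distribution)"
  proof (rule nn_integral_mono)
    fix a
    have e: "s / 2 * (z + d * a)\<^sup>2 + s / 2 * a\<^sup>2 * \<theta> * ip M r r = s / 2 * z\<^sup>2 + (A / 2 * a\<^sup>2 + (s * z * d) * a)"
      unfolding A_def by (simp add: power2_eq_square field_simps)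
    have "ennreal (exp (s / 2 * (z + d * a)\<^sup>2)) * Lam s m M (\<lambda>k. a * r k) H
      \<le> ennreal (exp (s / 2 * (z + d * a)\<^sup>2)) * ennreal (C * exp (s / 2 * a\<^sup>2 * \<theta> * ip M r r))"
      by (intro mult_left_mono good_real[OF G]) simp
    also have "\<dots> = ennreal (C * exp (s / 2 * (z + d * a)\<^sup>2 + s / 2 * a\<^sup>2 * \<theta> * ip M r r))"
      by (simp only: exp_add) (simp add: ennreal_mult'[symmetric] mult_ac)
    also have "\<dots> = ennreal (C * exp (s / 2 * z\<^sup>2)) * ennreal (exp (A / 2 * a\<^sup>2 + (s * z * d) * a))"
      unfolding e exp_add using C by (simp add: ennreal_mult''[symmetric] mult_ac)
    finally show "ennreal (exp (s / 2 * (z + d * a)\<^sup>2)) * Lam s m M (\<lambda>k. a * r k) H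
      \<le> ennreal (C * exp (s / 2 * z\<^sup>2)) * ennreal (exp (A / 2 * a\<^sup>2 + (s * z * d) * a))" .
  qed
  also have "\<dots> = ennreal (C * exp (s / 2 * z\<^sup>2)) * ennreal (exp ((s * z * d)\<^sup>2 / (2 * (1 - A))) / sqrt (1 - A))"
    by (subst nn_integral_cmult, simp) (simp only: nn_integral_normal_exp[OF A])
  also have "\<dots> = ennreal (C * exp (s / 2 * z\<^sup>2) * (exp ((s * z * d)\<^sup>2 / (2 * (1 - A))) / sqrt (1 - A)))"
    using C A by (subst ennreal_mult) auto
  also have "\<dots> \<le> ennreal (C1 * exp (s / 2 * \<kappa>\<^sup>2 * \<theta>1 * ip (Suc M) y y))"
  proof (rule ennreal_leI)
    have "(s * z * d)\<^sup>2 / (2 * (1 - A)) \<le> (s * z * d)\<^sup>2 / (2 * p)"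
      using A1 p(2) by (intro divide_left_mono) auto
    also have "\<dots> = s / 2 * z\<^sup>2 * (s * d\<^sup>2 / p)" by (simp add: power2_eq_square)
    also have "\<dots> \<le> s / 2 * z\<^sup>2 * (s * D / p)"
      using s p(2) d by (intro mult_left_mono divide_right_mono) auto
    finally have "s / 2 * z\<^sup>2 + (s * z * d)\<^sup>2 / (2 * (1 - A)) \<le> s / 2 * z\<^sup>2 * (1 + s * D / p)"
      by (simp add: ring_distribs)
    also have "\<dots> \<le> s / 2 * z\<^sup>2 * \<theta>1" using s th1 by (intro mult_left_mono) auto
    also have "\<dots> = s / 2 * \<kappa>\<^sup>2 * \<theta>1 * ip (Suc M) y y" by (simp add: z_def yy power_mult_distrib mult_ac)
    finally have 1: "exp (s / 2 * z\<^sup>2) * exp ((s * z * d)\<^sup>2 / (2 * (1 - A))) \<le> exp (s / 2 * \<kappa>\<^sup>2 * \<theta>1 * ip (Suc M) y y)"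
      by (simp add: exp_add[symmetric])
    have 2: "1 / sqrt (1 - A) \<le> 1 / sqrt p" using A1 p(2) by (intro divide_left_mono) auto
    have "C * exp (s / 2 * z\<^sup>2) * (exp ((s * z * d)\<^sup>2 / (2 * (1 - A))) / sqrt (1 - A))
      = C * ((1 / sqrt (1 - A)) * (exp (s / 2 * z\<^sup>2) * exp ((s * z * d)\<^sup>2 / (2 * (1 - A)))))"
      by (simp add: field_simps)
    also have "\<dots> \<le> C * ((1 / sqrt p) * exp (s / 2 * \<kappa>\<^sup>2 * \<theta>1 * ip (Suc M) y y))"
      using C p(2) A by (intro mult_left_mono mult_mono 1 2) auto
    finally show "C * exp (s / 2 * z\<^sup>2) * (exp ((s * z * d)\<^sup>2 / (2 * (1 - A))) / sqrt (1 - A))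
      \<le> C1 * exp (s / 2 * \<kappa>\<^sup>2 * \<theta>1 * ip (Suc M) y y)" by (simp add: C1)
  qed
  finally show "Lam s (Suc m) (Suc M) (\<lambda>k. of_rat q * y k) ?G \<le> ennreal (C1 * exp (s / 2 * (of_rat q)\<^sup>2 * \<theta>1 * ip (Suc M) y y))"
    by (simp only: \<kappa>_def)
qed


lemma good_cong:
  assumes "\<And>k. k < N \<Longrightarrow> y k = y' k" "\<And>k i. k < N \<Longrightarrow> i < n \<Longrightarrow> G k i = G' k i"
  shows "good s n N \<theta> C y G = good s n N \<theta> C y' G'"
proof -
  have "ip N y y = ip N y' y'" using assms(1) by (intro ip_cong) auto
  moreover have "Lam s n N (\<lambda>k. of_rat q * y k) G = Lam s n N (\<lambda>k. of_rat q * y' k) G'" for q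
    using assms by (intro Lam_cong) auto
  ultimately show ?thesis by (simp add: good_def)
qed

lemma good_rowmap:
  assumes T: "isom N T T'"
  shows "good s n N \<theta> C (T y) (rowmap T N n G) = good s n N \<theta> C y G"
proof -
  have "Lam s n N (\<lambda>k. of_rat q * T y k) (rowmap T N n G) = Lam s n N (\<lambda>k. of_rat q * y k) G" for q
  proof -
    have "Lam s n N (\<lambda>k. of_rat q * T y k) (rowmap T N n G) = Lam s n N (T (\<lambda>k. of_rat q * y k)) (rowmap T N n G)"
      by (intro Lam_cong) (simp_all add: isom_scale[OF T])
    then show ?thesis by (simp add: Lam_rowmap[OF T])
  qed
  then show ?thesis by (simp add: good_def isom_ip[OF T])
qed

lemma good_map:
  assumes T: "isom n T T'"
  shows "good s n N \<theta> C y (\<lambda>k\<in>{..<N}. T (G k)) = good s n N \<theta> C y G"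
  by (simp add: good_def Lam_map[OF T])

text \<open>
  One step rotates the last column of \<open>G\<close> onto a coordinate axis and then rotates the row of \<open>G\<close>
  that belongs to this axis; what remains is a Gaussian matrix with one row and one column less, and
  only the two squared lengths enter the bound.
\<close>
lemma good_probability:
  fixes \<theta> C D E p :: "nat \<Rightarrow> real"
  assumes s: "s > 0" and th0: "\<And>M. 0 \<le> \<theta> M" and C0: "1 \<le> C 0"
    and p: "\<And>M. M < N \<Longrightarrow> p M = 1 - s * D M - s * \<theta> M * E M" "\<And>M. M < N \<Longrightarrow> 0 < p M"
    and th: "\<And>M. M < N \<Longrightarrow> 1 + s * D M / p M \<le> \<theta> (Suc M)"
    and C: "\<And>M. M < N \<Longrightarrow> C (Suc M) = C M / sqrt (p M)"
  shows "(\<integral>\<^sup>+G. indicator {G. \<not> good s (N + L) N (\<theta> N) (C N) y G} G \<partial>gmat N (N + L))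
    \<le> (\<Sum>M<N. (\<integral>\<^sup>+g. indicator {g. D M < ip (Suc M + L) g g} g \<partial>gauss (Suc M + L))
             + (\<integral>\<^sup>+r. indicator {r. E M < ip M r r} r \<partial>gauss M))"
proof -
  have Cpos: "C M \<ge> 0" if "M \<le> N" for M
    using that
  proof (induction M)
    case (Suc M) then show ?case using C[of M] p(2)[of M] by simp
  qed (use C0 in simp)
  have "(\<integral>\<^sup>+G. indicator {G. \<not> good s (M + L) M (\<theta> M) (C M) y G} G \<partial>gmat M (M + L))
    \<le> (\<Sum>M<M. (\<integral>\<^sup>+g. indicator {g. D M < ip (Suc M + L) g g} g \<partial>gauss (Suc M + L))
             + (\<integral>\<^sup>+r. indicator {r. E M < ip M r r} r \<partial>gauss M))" if "M \<le> N" for M y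
    using that
  proof (induction M arbitrary: y)
    case 0
    interpret prob_space "gauss L" by (rule prob_gauss)
    have "good s (0 + L) 0 (\<theta> 0) (C 0) y G" for G
      unfolding good_def Lam_def ip_def using C0 emeasure_space_1 by (simp add: one_ennreal_def[symmetric])
    then show ?case by simp
  next
    case (Suc M)
    define m where "m = M + L"
    define bad where "bad y G = (indicator {G. \<not> good s (Suc m) (Suc M) (\<theta> (Suc M)) (C (Suc M)) y G} G :: ennreal)" for y G
    define bad' where "bad' r G = (indicator {G. \<not> good s m M (\<theta> M) (C M) r G} G :: ennreal)" for r G
    define tail1 where "tail1 = (\<integral>\<^sup>+g. indicator {g. D M < ip (Suc m) g g} g \<partial>gauss (Suc m))"
    define tail2 where "tail2 = (\<integral>\<^sup>+r. indicator {r. E M < ip M r r} r \<partial>gauss M)"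
    define R where "R = (\<Sum>M<M. (\<integral>\<^sup>+g. indicator {g. D M < ip (Suc M + L) g g} g \<partial>gauss (Suc M + L))
             + (\<integral>\<^sup>+r. indicator {r. E M < ip M r r} r \<partial>gauss M))"
    have M: "M < N" using Suc.prems by simp
    \<comment> \<open>In the smaller problem the vector is the random row \<open>r\<close>,
      independent of the remaining matrix; this is why the induction runs over arbitrary
      \<open>y\<close>.\<close>
    have IH: "(\<integral>\<^sup>+G. bad' r G \<partial>gmat M m) \<le> R" for r
      using Suc.IH[of r] M by (simp add: bad'_def R_def m_def)
    have m_bad: "(\<lambda>x. bad y (G x)) \<in> borel_measurable X" if "G \<in> X \<rightarrow>\<^sub>M gmat (Suc M) (Suc m)" for G X y
    proof -
      have "Measurable.pred X (\<lambda>x. good s (Suc m) (Suc M) (\<theta> (Suc M)) (C (Suc M)) y (G x))"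
        by (intro pred_good borel_measurable_const measurable_gmat_comp[OF that])
      then show ?thesis unfolding bad_def indicator_def by measurable
    qed
    have m_bad': "(\<lambda>x. bad' (r x) (G x)) \<in> borel_measurable X" if "r \<in> X \<rightarrow>\<^sub>M gauss M" "G \<in> X \<rightarrow>\<^sub>M gmat M m" for r G X
    proof -
      have "Measurable.pred X (\<lambda>x. good s m M (\<theta> M) (C M) (r x) (G x))"
        by (intro pred_good measurable_gauss_comp[OF that(1)] measurable_gmat_comp[OF that(2)])
      then show ?thesis unfolding bad'_def indicator_def by measurable
    qed
    \<comment> \<open>\<open>good_step\<close> wants \<open>y\<close> concentrated in the last
      entry; rotating every row puts it there without changing the law of \<open>G\<close>.\<close>
    obtain T T' where T: "isom (Suc M) T T'" "\<And>i. i < M \<Longrightarrow> T y i = 0"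
      by (rule isom_to_last[of M y]) blast
    have col: "(\<integral>\<^sup>+G. bad (T y) (G(M := g)) \<partial>gmat M (Suc m)) \<le> indicator {g. D M < ip (Suc m) g g} g + (tail2 + R)"
      if g: "g \<in> space (gauss (Suc m))" for g
    proof -
      \<comment> \<open>This rotation depends on the last column \<open>g\<close>, which is fixed
        here; the other columns are independent of it and keep their law under
        \<open>S\<close>.\<close>
      obtain S S' where S: "isom (Suc m) S S'" "\<And>i. i < m \<Longrightarrow> S g i = 0" "(S g m)\<^sup>2 = ip (Suc m) g g"
        by (rule isom_to_last[of m g]) blast
      have Sg: "S g \<in> space (gauss (Suc m))" by (rule measurable_space[OF isom_measurable(1)[OF S(1)] g])
      have mu: "(\<lambda>G. bad (T y) (G(M := S g))) \<in> borel_measurable (gmat M (Suc m))"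
        by (intro m_bad measurable_upd_gmat measurable_ident_sets refl measurable_const Sg)
      have "(\<integral>\<^sup>+G. bad (T y) (G(M := g)) \<partial>gmat M (Suc m)) = (\<integral>\<^sup>+G. bad (T y) ((\<lambda>k\<in>{..<M}. S (G k))(M := S g)) \<partial>gmat M (Suc m))"
      proof (rule nn_integral_cong)
        fix G
        have "(\<lambda>k\<in>{..<Suc M}. S ((G(M := g)) k)) = (\<lambda>k\<in>{..<M}. S (G k))(M := S g)" by (auto simp: fun_eq_iff)
        then have "good s (Suc m) (Suc M) (\<theta> (Suc M)) (C (Suc M)) (T y) ((\<lambda>k\<in>{..<M}. S (G k))(M := S g))
          = good s (Suc m) (Suc M) (\<theta> (Suc M)) (C (Suc M)) (T y) (G(M := g))"
          using good_map[OF S(1), of s "Suc M" "\<theta> (Suc M)" "C (Suc M)" "T y" "G(M := g)"] by simp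
        then show "bad (T y) (G(M := g)) = bad (T y) ((\<lambda>k\<in>{..<M}. S (G k))(M := S g))"
          by (simp only: bad_def indicator_def mem_Collect_eq)
      qed
      also have "\<dots> = (\<integral>\<^sup>+G. bad (T y) (G(M := S g)) \<partial>gmat M (Suc m))"
        by (rule nn_integral_gmat_map[OF S(1) mu])
      also have "\<dots> = (\<integral>\<^sup>+r. \<integral>\<^sup>+H. bad (T y) ((\<lambda>k\<in>{..<M}. (H k)(m := r k))(M := S g)) \<partial>gmat M m \<partial>gauss M)"
        by (rule nn_integral_gmat_split[OF mu])
      also have "\<dots> \<le> (\<integral>\<^sup>+r. \<integral>\<^sup>+H. (indicator {g. D M < ip (Suc m) g g} g + indicator {r. E M < ip M r r} r) + bad' r H \<partial>gmat M m \<partial>gauss M)"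
      proof (intro nn_integral_mono)
        fix r H
        have "good s (Suc m) (Suc M) (\<theta> (Suc M)) (C (Suc M)) (T y) ((\<lambda>k\<in>{..<M}. (H k)(m := r k))(M := S g))"
          if "\<not> D M < ip (Suc m) g g" "\<not> E M < ip M r r" "good s m M (\<theta> M) (C M) r H"
          by (rule good_step[OF that(3) Cpos s th0 _ _ p(1)[OF M] p(2)[OF M] th[OF M] C[OF M] refl S(2) T(2)])
            (use that M S(3) in auto)
        then show "bad (T y) ((\<lambda>k\<in>{..<M}. (H k)(m := r k))(M := S g))
          \<le> (indicator {g. D M < ip (Suc m) g g} g + indicator {r. E M < ip M r r} r) + bad' r H"
          by (auto simp: bad_def bad'_def indicator_def)
      qed
      also have "\<dots> = (\<integral>\<^sup>+r. (indicator {g. D M < ip (Suc m) g g} g + indicator {r. E M < ip M r r} r) + (\<integral>\<^sup>+H. bad' r H \<partial>gmat M m) \<partial>gauss M)"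
      proof (rule nn_integral_cong)
        fix r assume r: "r \<in> space (gauss M)"
        interpret H: prob_space "gmat M m" by (rule prob_gmat)
        show "(\<integral>\<^sup>+H. (indicator {g. D M < ip (Suc m) g g} g + indicator {r. E M < ip M r r} r) + bad' r H \<partial>gmat M m)
          = (indicator {g. D M < ip (Suc m) g g} g + indicator {r. E M < ip M r r} r) + (\<integral>\<^sup>+H. bad' r H \<partial>gmat M m)"
          using r by (subst nn_integral_add) (auto intro!: m_bad' measurable_const measurable_ident_sets simp: H.emeasure_space_1)
      qed
      also have "\<dots> \<le> (\<integral>\<^sup>+r. (indicator {g. D M < ip (Suc m) g g} g + R) + indicator {r. E M < ip M r r} r \<partial>gauss M)"
        using IH by (intro nn_integral_mono) (simp add: add_ac add_left_mono)
      also have "\<dots> = (indicator {g. D M < ip (Suc m) g g} g + R) + tail2"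
      proof -
        interpret r: prob_space "gauss M" by (rule prob_gauss)
        have "(\<lambda>r. indicator {r. E M < ip M r r} r :: ennreal) \<in> borel_measurable (gauss M)"
          unfolding indicator_def by measurable
        then show ?thesis unfolding tail2_def by (subst nn_integral_add) (auto simp: r.emeasure_space_1)
      qed
      finally show ?thesis by (simp add: add_ac)
    qed
    have "(\<integral>\<^sup>+G. bad y G \<partial>gmat (Suc M) (Suc m)) = (\<integral>\<^sup>+G. bad (T y) (rowmap T (Suc M) (Suc m) G) \<partial>gmat (Suc M) (Suc m))"
      by (intro nn_integral_cong) (simp only: bad_def indicator_def mem_Collect_eq good_rowmap[OF T(1)])
    also have "\<dots> = (\<integral>\<^sup>+G. bad (T y) G \<partial>gmat (Suc M) (Suc m))"
      by (rule nn_integral_rowmap[OF T(1)]) (intro m_bad measurable_ident_sets refl)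
    also have "\<dots> = (\<integral>\<^sup>+g. \<integral>\<^sup>+G. bad (T y) (G(M := g)) \<partial>gmat M (Suc m) \<partial>gauss (Suc m))"
      by (rule nn_integral_gmat_Suc) (intro m_bad measurable_ident_sets refl)
    also have "\<dots> \<le> (\<integral>\<^sup>+g. indicator {g. D M < ip (Suc m) g g} g + (tail2 + R) \<partial>gauss (Suc m))"
      by (rule nn_integral_mono) (rule col)
    also have "\<dots> = tail1 + (tail2 + R)"
    proof -
      interpret r: prob_space "gauss (Suc m)" by (rule prob_gauss)
      have "(\<lambda>r. indicator {r. D M < ip (Suc m) r r} r :: ennreal) \<in> borel_measurable (gauss (Suc m))"
        unfolding indicator_def by measurable
      then show ?thesis unfolding tail1_def by (subst nn_integral_add) (auto simp: r.emeasure_space_1)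
    qed
    finally show ?case
      by (simp add: bad_def tail1_def tail2_def R_def m_def add_ac)
  qed
  then show ?thesis by simp
qed

subsection \<open>Chi-square tails and the constant of the recursion\<close>

lemma measurable_indicator_ip:
  assumes "Measurable.pred borel P"
  shows "(\<lambda>w. indicator {w. P (ip m w w)} w :: ennreal) \<in> borel_measurable (gauss m)"
  using assms unfolding indicator_def by measurable

text \<open>Chernoff's bound at \<open>t = e / (8 * n)\<close>. The exponent is normalised by
  \<open>n\<close> and not by the dimension \<open>m\<close>, so that all dimensions in the
  recursion share one rate; \<open>e \<le> n\<close> keeps \<open>t\<close> small enough for the
  quadratic bound on the logarithm.\<close>

lemma gauss_upper_tail:
  assumes e: "0 \<le> e" "e \<le> real n" and m: "m \<le> n" and n: "n > 0"
  shows "(\<integral>\<^sup>+w. indicator {w. real m + e < ip m w w} w \<partial>gauss m) \<le> ennreal (exp (- e\<^sup>2 / (16 * n)))"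
proof -
  define t where "t = e / (8 * n)"
  have t: "0 \<le> t" "t \<le> 1 / 8" using e n by (auto simp: t_def field_simps)
  have "(\<integral>\<^sup>+w. indicator {w. real m + e < ip m w w} w \<partial>gauss m)
    \<le> (\<integral>\<^sup>+w. ennreal (exp (- t * (m + e))) * ennreal (exp (t * ip m w w)) \<partial>gauss m)"
  proof (rule nn_integral_mono)
    fix w :: "nat \<Rightarrow> real"
    have "1 \<le> exp (- t * (m + e)) * exp (t * ip m w w)" if "m + e < ip m w w"
    proof -
      have "0 \<le> t * (ip m w w - (m + e))" using t that by simp
      then show ?thesis by (simp add: exp_add[symmetric] algebra_simps)
    qed
    then show "indicator {w. real m + e < ip m w w} w \<le> ennreal (exp (- t * (m + e))) * ennreal (exp (t * ip m w w))"
      by (auto simp: indicator_def ennreal_mult'[symmetric] simp del: mult_minus_left)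
  qed
  also have "\<dots> = ennreal (exp (- t * (m + e))) * ennreal ((1 - 2 * t) powr (- real m / 2))"
    using t by (subst nn_integral_cmult) (simp_all add: nn_integral_gauss_exp_ip)
  also have "\<dots> = ennreal (exp (- t * (m + e) - real m / 2 * ln (1 - 2 * t)))"
    using t by (simp add: ennreal_mult'[symmetric] powr_def exp_add[symmetric])
  also have "\<dots> \<le> ennreal (exp (- e\<^sup>2 / (16 * n)))"
  proof (intro ennreal_leI, subst exp_le_cancel_iff)
    have "- (2 * t) - 2 * (2 * t)\<^sup>2 \<le> ln (1 - 2 * t)"
      using t by (intro ln_one_minus_pos_lower_bound) auto
    then have "real m / 2 * (- (2 * t) - 2 * (2 * t)\<^sup>2) \<le> real m / 2 * ln (1 - 2 * t)"
      by (intro mult_left_mono) auto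
    then have "- t * (m + e) - real m / 2 * ln (1 - 2 * t) \<le> - t * e + 4 * t\<^sup>2 * m"
      by (simp add: algebra_simps power2_eq_square)
    also have "\<dots> \<le> - t * e + 4 * t\<^sup>2 * n" using m by (intro add_left_mono mult_left_mono) auto
    also have "\<dots> = - e\<^sup>2 / (16 * n)" using n by (simp add: t_def power2_eq_square field_simps)
    finally show "- t * (m + e) - real m / 2 * ln (1 - 2 * t) \<le> - e\<^sup>2 / (16 * n)" .
  qed
  finally show ?thesis .
qed

lemma gauss_lower_tail:
  assumes e: "0 \<le> e" "e \<le> real n" and m: "m \<le> n" and n: "n > 0"
  shows "(\<integral>\<^sup>+w. indicator {w. ip m w w < real m - e} w \<partial>gauss m) \<le> ennreal (exp (- e\<^sup>2 / (16 * n)))"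
proof -
  define t where "t = e / (8 * n)"
  have t: "0 \<le> t" "t \<le> 1 / 8" using e n by (auto simp: t_def field_simps)
  have "(\<integral>\<^sup>+w. indicator {w. ip m w w < real m - e} w \<partial>gauss m)
    \<le> (\<integral>\<^sup>+w. ennreal (exp (t * (m - e))) * ennreal (exp ((- t) * ip m w w)) \<partial>gauss m)"
  proof (rule nn_integral_mono)
    fix w :: "nat \<Rightarrow> real"
    have "1 \<le> exp (t * (m - e)) * exp ((- t) * ip m w w)" if "ip m w w < m - e"
    proof -
      have "0 \<le> t * ((m - e) - ip m w w)" using t that by simp
      then show ?thesis by (simp add: exp_add[symmetric] algebra_simps)
    qed
    then show "indicator {w. ip m w w < real m - e} w \<le> ennreal (exp (t * (m - e))) * ennreal (exp ((- t) * ip m w w))"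
      by (auto simp: indicator_def ennreal_mult'[symmetric] simp del: mult_minus_left)
  qed
  also have "\<dots> = ennreal (exp (t * (m - e))) * ennreal ((1 - 2 * (- t)) powr (- real m / 2))"
    using t nn_integral_gauss_exp_ip[of "- t" m] by (subst nn_integral_cmult, simp) simp
  also have "\<dots> = ennreal (exp (t * (m - e) - real m / 2 * ln (1 + 2 * t)))"
    using t by (simp add: ennreal_mult'[symmetric] powr_def exp_add[symmetric])
  also have "\<dots> \<le> ennreal (exp (- e\<^sup>2 / (16 * n)))"
  proof (intro ennreal_leI, subst exp_le_cancel_iff)
    have "2 * t - (2 * t)\<^sup>2 \<le> ln (1 + 2 * t)"
      using t by (intro ln_one_plus_pos_lower_bound) auto
    then have "real m / 2 * (2 * t - (2 * t)\<^sup>2) \<le> real m / 2 * ln (1 + 2 * t)"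
      by (intro mult_left_mono) auto
    then have "t * (m - e) - real m / 2 * ln (1 + 2 * t) \<le> - t * e + 2 * t\<^sup>2 * m"
      by (simp add: algebra_simps power2_eq_square)
    also have "\<dots> \<le> - t * e + 4 * t\<^sup>2 * n" using m by (intro add_left_mono mult_mono) auto
    also have "\<dots> = - e\<^sup>2 / (16 * n)" using n by (simp add: t_def power2_eq_square field_simps)
    finally show "t * (m - e) - real m / 2 * ln (1 + 2 * t) \<le> - e\<^sup>2 / (16 * n)" .
  qed
  finally show ?thesis .
qed

text \<open>
  The exponential rate of the constant \<open>C N\<close> of \<open>good_probability\<close> at the fixed point \<open>\<theta> = 1 / q\<close>.
\<close>
definition logdet :: "real \<Rightarrow> real \<Rightarrow> real" where
  "logdet a q = - q * (1 - a - q) * ln q - (1 - q) * (q + a) * ln (q + a) - (1 - a - q) * (1 - q)"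

text \<open>As a function of \<open>q * (1 - a - q)\<close>, \<open>logdet a\<close> has derivative
  \<open>- ln (q * (q + a))\<close>, which increases as \<open>q\<close> decreases to
  \<open>q2\<close>. The derivative at \<open>q1\<close> is therefore the smallest one on the way;
  this is how the sum over the steps of the recursion gets below an integral.\<close>

lemma logdet_increment:
  assumes a: "0 \<le> a" and q: "0 < q2" "q2 \<le> q1" "1 - a \<le> 2 * q2"
  shows "- ln (q1 * (q1 + a)) * (q2 * (1 - a - q2) - q1 * (1 - a - q1)) \<le> logdet a q2 - logdet a q1"
proof -
  define H where "H q = logdet a q + ln (q1 * (q1 + a)) * (q * (1 - a - q))" for q
  have "H q1 \<le> H q2"
  proof (rule DERIV_nonpos_imp_nonincreasing[OF q(2)])
    fix x assume x: "q2 \<le> x" "x \<le> q1"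
    have pos: "x > 0" "x + a > 0" using x q a by auto
    have "(H has_real_derivative (- (1 - a - 2 * x) * ln x - (1 - a - x) * (x / x) - (1 - a - 2 * x) * ln (x + a) - (1 - x) * ((x + a) / (x + a))
       + (1 - x) + (1 - a - x) + ln (q1 * (q1 + a)) * (1 - a - 2 * x))) (at x)"
      unfolding H_def logdet_def using pos
      by (auto intro!: derivative_eq_intros) (simp add: algebra_simps)
    also have "(- (1 - a - 2 * x) * ln x - (1 - a - x) * (x / x) - (1 - a - 2 * x) * ln (x + a) - (1 - x) * ((x + a) / (x + a))
       + (1 - x) + (1 - a - x) + ln (q1 * (q1 + a)) * (1 - a - 2 * x))
      = (1 - a - 2 * x) * (ln (q1 * (q1 + a)) - ln (x * (x + a)))"
    proof -
      have "ln (x * (x + a)) = ln x + ln (x + a)" using pos by (simp add: ln_mult)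
      then show ?thesis using pos by (simp only:) (simp add: algebra_simps)
    qed
    finally have "(H has_real_derivative (1 - a - 2 * x) * (ln (q1 * (q1 + a)) - ln (x * (x + a)))) (at x)" .
    moreover have "(1 - a - 2 * x) * (ln (q1 * (q1 + a)) - ln (x * (x + a))) \<le> 0"
    proof (rule mult_nonpos_nonneg)
      show "1 - a - 2 * x \<le> 0" using x q by simp
      have "x * (x + a) \<le> q1 * (q1 + a)" using x pos a by (intro mult_mono) auto
      then show "0 \<le> ln (q1 * (q1 + a)) - ln (x * (x + a))" using pos by (simp add: ln_mono)
    qed
    ultimately show "\<exists>y. (H has_real_derivative y) (at x) \<and> y \<le> 0" by blast
  qed
  then show ?thesis by (simp add: H_def algebra_simps)
qed

lemma good_mono:
  assumes "good s n N \<theta> C y G" "s \<ge> 0" "\<theta> \<le> \<theta>'" "0 \<le> C" "C \<le> C'"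
  shows "good s n N \<theta>' C' y G"
  unfolding good_def
proof
  fix q :: rat
  have "Lam s n N (\<lambda>k. of_rat q * y k) G \<le> ennreal (C * exp (s / 2 * (of_rat q)\<^sup>2 * \<theta> * ip N y y))"
    using assms(1) by (simp add: good_def)
  also have "\<dots> \<le> ennreal (C' * exp (s / 2 * (of_rat q)\<^sup>2 * \<theta>' * ip N y y))"
    using assms(2-) by (intro ennreal_leI mult_mono) (auto intro!: mult_right_mono mult_left_mono)
  finally show "Lam s n N (\<lambda>k. of_rat q * y k) G \<le> ennreal (C' * exp (s / 2 * (of_rat q)\<^sup>2 * \<theta>' * ip N y y))" .
qed

text \<open>The recursion is run along the larger root \<open>q\<close> of
  \<open>q * (b - q) = s * x\<close>. With \<open>\<theta> = 1 / q\<close> and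
  \<open>p = q * (q + a)\<close> it reproduces itself, apart from a shift of \<open>x\<close> by 1
  between consecutive steps, and the root decreases in \<open>x\<close>, so that this shift only
  helps.\<close>

lemma good_gauss:
  fixes s q0 e :: real and n N L :: nat
  assumes s: "s > 0" and q0: "q0 > 0" and a: "a = s * L" and fix_pt: "s * (real N + 1 + e) = q0 * (1 - a - q0)"
    and root: "1 - a \<le> 2 * q0" and n: "N + L \<le> n" "n > 0" and e: "0 < e" "e \<le> n"
  shows "(\<integral>\<^sup>+G. indicator {G. \<not> good s (N + L) N (1 / q0) (exp (logdet a q0 / (2 * s))) y G} G \<partial>gmat N (N + L))
    \<le> ennreal (2 * real N * exp (- e\<^sup>2 / (16 * real n)))"
proof -
  define b where "b = 1 - a"
  define X where "X = real N + 1 + e"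
  \<comment> \<open>The larger root of \<open>q * (b - q) = s * x\<close>. The hypothesis
    \<open>root\<close> says that \<open>q0\<close> is the larger and not the smaller root at
    \<open>x = X\<close>, whence \<open>Q X = q0\<close>.\<close>
  define Q where "Q x = (b + sqrt (b\<^sup>2 - 4 * s * x)) / 2" for x
  have a0: "0 \<le> a" using s by (simp add: a)
  have X0: "X > 0" using e by (simp add: X_def)
  have "0 < q0 * (b - q0)" using fix_pt mult_pos_pos[OF s X0] by (simp add: b_def X_def)
  then have q0b: "q0 < b" using q0 by (simp add: zero_less_mult_iff)
  have b: "0 < b" "b \<le> 1" using q0b q0 a0 by (auto simp: b_def)
  have disc: "b\<^sup>2 - 4 * s * X = (2 * q0 - b)\<^sup>2"
    using fix_pt by (simp add: X_def b_def power2_eq_square algebra_simps)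
  have QX: "Q X = q0"
    using root q0b unfolding Q_def disc by (simp add: b_def)
  have discx: "0 \<le> b\<^sup>2 - 4 * s * x" if "x \<le> X" for x
  proof -
    have "4 * s * x \<le> 4 * s * X" using that s by simp
    then show ?thesis using disc by (smt (verit) zero_le_power2)
  qed
  have Qeq: "Q x * (b - Q x) = s * x" if "x \<le> X" for x
  proof -
    have "(sqrt (b\<^sup>2 - 4 * s * x))\<^sup>2 = b\<^sup>2 - 4 * s * x" using discx[OF that] by simp
    then show ?thesis by (simp add: Q_def power2_eq_square field_simps)
  qed
  have Qmono: "Q x' \<le> Q x" if "x \<le> x'" for x x'
    using that s by (simp add: Q_def)
  have Qge: "q0 \<le> Q x" if "x \<le> X" for x using Qmono[OF that] QX by simp
  have Qb: "Q x \<le> b" if "0 \<le> x" for x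
  proof -
    have "sqrt (b\<^sup>2 - 4 * s * x) \<le> sqrt (b\<^sup>2)" using that s by (intro real_sqrt_le_mono) simp
    then show ?thesis using b by (simp add: Q_def)
  qed
  \<comment> \<open>Beyond \<open>N\<close> the discriminant in \<open>Q\<close> may be negative;
    the value 0 there keeps \<open>\<theta>\<close> nonnegative at all indices, as
    \<open>good_probability\<close> demands.\<close>
  define \<theta> where "\<theta> M = (if M \<le> N then 1 / Q (real M + e) else 0)" for M :: nat
  define D where "D M = real (Suc M + L) + e" for M :: nat
  define E where "E M = real M + e" for M :: nat
  define p where "p M = 1 - s * D M - s * \<theta> M * E M" for M
  define C where "C M = (\<Prod>j<M. 1 / sqrt (p j))" for M
  have Qpos: "0 < Q (real M + e)" if "M \<le> N" for M
    using Qge[of "real M + e"] that q0 by (simp add: X_def)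
  \<comment> \<open>Replacing \<open>\<theta> M\<close> and \<open>E M\<close> by their larger
    counterparts at \<open>x = M + 1 + e\<close> gives \<open>p M \<ge> q * (q + a)\<close> for
    \<open>q = Q x\<close>, and then \<open>1 + s * D M / p M\<close> is at most
    \<open>1 / q\<close>.\<close>
  have plow: "Q (real M + 1 + e) * (Q (real M + 1 + e) + a) \<le> p M" "0 < Q (real M + 1 + e)" "Q (real M + 1 + e) \<le> b"
    "1 + s * D M / p M \<le> 1 / Q (real M + 1 + e)" "p M > 0" if M: "M < N" for M
  proof -
    define x where "x = real M + 1 + e"
    have x: "x \<le> X" "0 \<le> x" using M e by (auto simp: x_def X_def)
    define q where "q = Q x"
    have q: "0 < q" "q \<le> b" using Qge[OF x(1)] Qb[OF x(2)] q0 by (auto simp: q_def)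
    have qq: "q * (b - q) = s * x" using Qeq[OF x(1)] by (simp add: q_def)
    have "q \<le> Q (real M + e)" unfolding q_def by (intro Qmono) (simp add: x_def)
    then have "\<theta> M \<le> 1 / q" using q M by (simp add: \<theta>_def frac_le)
    then have "s * \<theta> M * E M \<le> s * (1 / q) * x"
      using s q e Qpos[of M] M by (intro mult_mono) (auto simp: E_def x_def \<theta>_def)
    also have "\<dots> = b - q" using qq q by (simp add: field_simps)
    finally have "s * \<theta> M * E M \<le> b - q" .
    moreover have sD: "s * D M = s * x + a" by (simp add: D_def x_def a algebra_simps)
    ultimately have "1 - (s * x + a) - (b - q) \<le> p M" by (simp add: p_def)
    then have pl: "q * (q + a) \<le> p M" using qq by (simp add: b_def algebra_simps)
    have qa: "0 < q * (q + a)" using q(1) a0 by (intro mult_pos_pos add_pos_nonneg)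
    have "s * D M / p M \<le> (s * x + a) / (q * (q + a))"
      using pl qa s e a0 x unfolding sD by (intro divide_left_mono) auto
    then have "1 + s * D M / p M \<le> 1 + (q * (b - q) + a) / (q * (q + a))" by (simp add: qq)
    also have "\<dots> = (q + a) / (q * (q + a))"
      using qa q(1) add_pos_nonneg[OF q(1) a0] by (simp add: b_def divide_simps) (simp add: algebra_simps)
    also have "\<dots> = 1 / q" using q(1) a0 add_pos_nonneg[OF q(1) a0] by simp
    finally have 4: "1 + s * D M / p M \<le> 1 / q" .
    show "Q (real M + 1 + e) * (Q (real M + 1 + e) + a) \<le> p M" "0 < Q (real M + 1 + e)" "Q (real M + 1 + e) \<le> b"
      "1 + s * D M / p M \<le> 1 / Q (real M + 1 + e)" "p M > 0"
      using pl q 4 qa by (simp_all add: q_def x_def)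
  qed
  \<comment> \<open>The bound runs one step ahead: the factor with \<open>p M\<close> is estimated
    at \<open>Q (M + 1 + e)\<close> and charged to the interval from there to
    \<open>Q (M + 2 + e)\<close>. At \<open>M = N\<close> the last interval ends at
    \<open>Q X = q0\<close>, which explains the summand 1 in \<open>X\<close>.\<close>
  have CM: "C M \<le> exp (logdet a (Q (real M + 1 + e)) / (2 * s))" "0 < C M" if "M \<le> N" for M
    using that
  proof (induction M)
    case 0
    {
      case 1
      let ?q = "Q (1 + e)"
      have q: "q0 \<le> ?q" "?q \<le> b" using Qge[of "1 + e"] Qb[of "1 + e"] e by (auto simp: X_def)
      have "0 \<le> - ln (b * (b + a)) * (?q * (1 - a - ?q) - b * (1 - a - b))"
        using b q q0 by (intro mult_nonneg_nonneg) (auto simp: b_def)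
      also have "\<dots> \<le> logdet a ?q - logdet a b"
        using q q0 root by (intro logdet_increment a0) (auto simp: b_def)
      also have "logdet a b = 0" by (simp add: logdet_def b_def)
      finally show ?case using s by (simp add: C_def)
    next
      case 2 show ?case by (simp add: C_def)
    }
  next
    case (Suc M)
    {
      case 1
      then have M: "M < N" by simp
      note pl = plow[OF M]
      let ?q1 = "Q (real M + 1 + e)" and ?q2 = "Q (real (Suc M) + 1 + e)"
      have xX: "real (Suc M) + 1 + e \<le> X" "real M + 1 + e \<le> X" using M by (auto simp: X_def)
      have q2: "q0 \<le> ?q2" "?q2 \<le> ?q1" using Qge[OF xX(1)] by (auto intro!: Qmono)
      have a1: "0 < ?q1 * (?q1 + a)" using pl(2) a0 by (intro mult_pos_pos add_pos_nonneg)
      have "- ln (?q1 * (?q1 + a)) * (?q2 * (1 - a - ?q2) - ?q1 * (1 - a - ?q1)) \<le> logdet a ?q2 - logdet a ?q1"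
        using q2 q0 root by (intro logdet_increment a0) auto
      also have "?q2 * (1 - a - ?q2) - ?q1 * (1 - a - ?q1) = s"
        using Qeq[OF xX(1)] Qeq[OF xX(2)] by (simp add: b_def algebra_simps)
      finally have "- ln (?q1 * (?q1 + a)) / 2 \<le> (logdet a ?q2 - logdet a ?q1) / (2 * s)"
        using s by (simp add: field_simps)
      moreover have "- ln (p M) / 2 \<le> - ln (?q1 * (?q1 + a)) / 2" using pl(1,5) a1 by simp
      ultimately have "- ln (p M) / 2 \<le> logdet a ?q2 / (2 * s) - logdet a ?q1 / (2 * s)"
        by (simp add: diff_divide_distrib)
      moreover have "1 / sqrt (p M) = exp (- ln (p M) / 2)"
        using pl(5) by (simp add: exp_minus powr_half_sqrt[symmetric] powr_def field_simps)
      ultimately have "1 / sqrt (p M) \<le> exp (logdet a ?q2 / (2 * s) - logdet a ?q1 / (2 * s))" by simp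
      then have "C (Suc M) \<le> exp (logdet a ?q1 / (2 * s)) * exp (logdet a ?q2 / (2 * s) - logdet a ?q1 / (2 * s))"
        unfolding C_def prod.lessThan_Suc using Suc.IH M pl(5) by (intro mult_mono) (auto simp: C_def)
      then show ?case by (simp add: exp_add[symmetric])
    next
      case 2
      then show ?case using Suc.IH plow(5)[of M] by (simp add: C_def)
    }
  qed
  have prob: "(\<integral>\<^sup>+G. indicator {G. \<not> good s (N + L) N (\<theta> N) (C N) y G} G \<partial>gmat N (N + L))
    \<le> (\<Sum>M<N. (\<integral>\<^sup>+g. indicator {g. D M < ip (Suc M + L) g g} g \<partial>gauss (Suc M + L))
             + (\<integral>\<^sup>+r. indicator {r. E M < ip M r r} r \<partial>gauss M))"
  proof (rule good_probability[OF s, where p = p])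
    show "0 \<le> \<theta> M" for M using Qpos[of M] by (auto simp: \<theta>_def intro: less_imp_le)
    show "1 + s * D M / p M \<le> \<theta> (Suc M)" if "M < N" for M
      using plow(4)[OF that] that by (simp add: \<theta>_def add_ac)
  qed (use plow(5) in \<open>auto simp: C_def p_def\<close>)
  have sub: "indicator {G. \<not> good s (N + L) N (1 / q0) (exp (logdet a q0 / (2 * s))) y G} G
    \<le> (indicator {G. \<not> good s (N + L) N (\<theta> N) (C N) y G} G :: ennreal)" for G
  proof -
    have "\<theta> N \<le> 1 / q0" using Qge[of "N + e"] q0 by (auto simp: \<theta>_def X_def intro!: frac_le)
    moreover have "C N \<le> exp (logdet a q0 / (2 * s))" using CM(1)[of N] QX by (simp add: X_def)
    ultimately show ?thesis
      using good_mono[of s "N + L" N "\<theta> N" "C N" y G "1 / q0" "exp (logdet a q0 / (2 * s))"] s CM(2)[of N]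
      by (auto simp: indicator_def)
  qed
  have "(\<integral>\<^sup>+G. indicator {G. \<not> good s (N + L) N (1 / q0) (exp (logdet a q0 / (2 * s))) y G} G \<partial>gmat N (N + L))
    \<le> (\<integral>\<^sup>+G. indicator {G. \<not> good s (N + L) N (\<theta> N) (C N) y G} G \<partial>gmat N (N + L))"
    by (intro nn_integral_mono sub)
  also have "\<dots> \<le> (\<Sum>M<N. ennreal (exp (- e\<^sup>2 / (16 * n))) + ennreal (exp (- e\<^sup>2 / (16 * n))))"
    unfolding D_def E_def
    by (rule order_trans[OF prob[unfolded D_def E_def]], intro sum_mono add_mono gauss_upper_tail)
      (use e n in auto)
  also have "\<dots> = ennreal (2 * real N * exp (- e\<^sup>2 / (16 * real n)))"
    by (simp add: ennreal_plus[symmetric] ennreal_of_nat_eq_real_of_nat ennreal_mult'[symmetric] mult_ac del: ennreal_plus)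
  finally show ?thesis .
qed

section \<open>Comparison of a tilted average at one vector with its Gaussian mean\<close>

lemma isom_neg: "isom n (\<lambda>v. \<lambda>i\<in>{..<n}. - v i) (\<lambda>v. \<lambda>i\<in>{..<n}. - v i)"
proof -
  have m: "(\<lambda>v. \<lambda>i\<in>{..<n}. - v i) \<in> gauss n \<rightarrow>\<^sub>M gauss n"
    by (intro measurable_into_gauss borel_measurable_uminus measurable_gauss_coord)
  have "distr std_normal_distribution std_normal_distribution uminus = std_normal_distribution"
  proof (rule measure_eqI)
    fix A assume "A \<in> sets (distr std_normal_distribution std_normal_distribution uminus)"
    then have A[measurable]: "A \<in> sets borel" by simp
    have "emeasure (distr std_normal_distribution std_normal_distribution uminus) A
      = (\<integral>\<^sup>+x. indicator A x \<partial>distr std_normal_distribution std_normal_distribution uminus)" by simp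
    also have "\<dots> = (\<integral>\<^sup>+x. indicator A (- x) \<partial>std_normal_distribution)"
      by (rule nn_integral_distr) simp_all
    also have "\<dots> = (\<integral>\<^sup>+x. ennreal (std_normal_density x) * indicator A (- x) \<partial>lborel)"
      by (rule nn_integral_density) simp_all
    also have "\<dots> = (\<integral>\<^sup>+x. ennreal (std_normal_density x) * indicator A x \<partial>lborel)"
      by (subst nn_integral_real_affine[of "\<lambda>x. ennreal (std_normal_density x) * indicator A x" "-1" 0])
        (simp_all add: std_normal_density_def)
    also have "\<dots> = emeasure std_normal_distribution A" by (simp add: emeasure_density)
    finally show "emeasure (distr std_normal_distribution std_normal_distribution uminus) A = emeasure std_normal_distribution A" .
  qed simp
  then have "distr (gauss n) (gauss n) (compose {..<n} uminus) = gauss n"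
    by (subst distr_PiM_finite_prob_space') (auto intro: prob_std_normal)
  moreover have "compose {..<n} uminus = (\<lambda>v. \<lambda>i\<in>{..<n}. - v i :: real)" by (simp add: compose_def fun_eq_iff)
  ultimately have "distr (gauss n) (gauss n) (\<lambda>v. \<lambda>i\<in>{..<n}. - v i) = gauss n" by (simp only:)
  then show ?thesis using m by (auto simp: isom_def ip_def)
qed

text \<open>Cramer's lower bound by change of measure: for a standard Gaussian vector scaled by
  \<open>v\<close> the event is implied by a typical one of probability at least one half, thanks to
  the slack between \<open>y\<close> and \<open>v^2\<close>, and the density of the scaling is
  bounded below on that typical event.\<close>

lemma gauss_ge_lower_bound:
  fixes \<delta> v y :: real
  assumes d: "0 < \<delta>" "\<delta> < 1" and m: "n = Suc m" "2 \<le> \<delta> * n" "4 * exp (- \<delta>\<^sup>2 * n / 64) \<le> 1"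
    and v: "v > 0" "y \<le> v\<^sup>2 * (1 - \<delta>)"
  shows "ennreal (v ^ m * exp (- n / 2 * ((v\<^sup>2 - 1) + \<delta> * \<bar>v\<^sup>2 - 1\<bar>)) / 2)
    \<le> (\<integral>\<^sup>+w. indicator {w. n * y \<le> ip m w w} w \<partial>gauss m)"
proof -
  interpret prob_space "gauss m" by (rule prob_gauss)
  define e where "e = \<delta> * n / 2"
  define K where "K = v ^ m * exp (- n / 2 * ((v\<^sup>2 - 1) + \<delta> * \<bar>v\<^sup>2 - 1\<bar>))"
  have K: "K \<ge> 0" using v by (simp add: K_def)
  have n: "n > 0" using m by simp
  have e: "0 \<le> e" "e \<le> n" using d mult_right_mono[of \<delta> 2 "real n"] by (auto simp: e_def)
  have ee: "exp (- e\<^sup>2 / (16 * n)) \<le> 1 / 4"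
    using m(3) n by (simp add: e_def power2_eq_square field_simps)
  \<comment> \<open>The typical event for the unscaled vector. Each tail has probability at most
    1/4. The tail lemmas are centred at \<open>m = n - 1\<close>; the shift by 1 is covered because
    \<open>e\<close> is at least 1 and only half of the allowed deviation
    \<open>\<delta> * n\<close>.\<close>
  define B where "B = {w \<in> space (gauss m). \<bar>ip m w w - n\<bar> \<le> \<delta> * n}"
  have B[measurable]: "B \<in> sets (gauss m)" unfolding B_def by measurable
  have "emeasure (gauss m) (space (gauss m) - B)
    \<le> emeasure (gauss m) ({w \<in> space (gauss m). real m + e < ip m w w} \<union> {w \<in> space (gauss m). ip m w w < real m - e})"
  proof (rule emeasure_mono)
    have a: "real n = real m + 1" using m by simp
    have "1 \<le> e" "2 * e = \<delta> * n" using m(2) by (simp_all add: e_def)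
    then show "space (gauss m) - B \<subseteq> {w \<in> space (gauss m). real m + e < ip m w w} \<union> {w \<in> space (gauss m). ip m w w < real m - e}"
      unfolding B_def using a by (auto simp: abs_le_iff)
  qed measurable
  also have "\<dots> \<le> emeasure (gauss m) {w \<in> space (gauss m). real m + e < ip m w w} + emeasure (gauss m) {w \<in> space (gauss m). ip m w w < real m - e}"
    by (rule emeasure_subadditive) measurable
  also have "\<dots> \<le> ennreal (1 / 4) + ennreal (1 / 4)"
  proof (rule add_mono)
    have 1: "emeasure (gauss m) {w \<in> space (gauss m). P w} = (\<integral>\<^sup>+w. indicator {w. P w} w \<partial>gauss m)"
      if [measurable]: "Measurable.pred (gauss m) P" for P
    proof -
      have "(\<integral>\<^sup>+w. indicator {w. P w} w \<partial>gauss m) = (\<integral>\<^sup>+w. indicator {w \<in> space (gauss m). P w} w \<partial>gauss m)"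
        by (intro nn_integral_cong) (simp add: indicator_def)
      also have "\<dots> = emeasure (gauss m) {w \<in> space (gauss m). P w}" by (rule nn_integral_indicator) measurable
      finally show ?thesis ..
    qed
    show "emeasure (gauss m) {w \<in> space (gauss m). real m + e < ip m w w} \<le> ennreal (1 / 4)"
      using gauss_upper_tail[OF e, of m] m n ee by (subst 1) (auto intro: order_trans ennreal_leI)
    show "emeasure (gauss m) {w \<in> space (gauss m). ip m w w < real m - e} \<le> ennreal (1 / 4)"
      using gauss_lower_tail[OF e, of m] m n ee by (subst 1) (auto intro: order_trans ennreal_leI)
  qed
  also have "\<dots> = ennreal (1 / 2)" by (simp add: ennreal_plus[symmetric] del: ennreal_plus)
  finally have "ennreal (measure (gauss m) (space (gauss m) - B)) \<le> ennreal (1 / 2)"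
    by (simp only: emeasure_eq_measure)
  then have "measure (gauss m) (space (gauss m) - B) \<le> 1 / 2"
    by (subst (asm) ennreal_le_iff) auto
  then have "1 / 2 \<le> measure (gauss m) B" using prob_compl[OF B] by simp
  then have "ennreal (K / 2) \<le> ennreal K * emeasure (gauss m) B"
    using K mult_left_mono[of "1/2" "measure (gauss m) B" K] by (simp add: emeasure_eq_measure ennreal_mult[symmetric] ennreal_leI)
  also have "\<dots> = (\<integral>\<^sup>+w. ennreal K * indicator B w \<partial>gauss m)"
    by (subst nn_integral_cmult_indicator) auto
  also have "\<dots> \<le> (\<integral>\<^sup>+w. indicator {w. n * y \<le> ip m w w} (\<lambda>i\<in>{..<m}. v * w i) * ennreal (v ^ m * exp (- (v\<^sup>2 - 1) / 2 * ip m w w)) \<partial>gauss m)"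
  proof (rule nn_integral_mono)
    fix w assume "w \<in> space (gauss m)"
    have sc: "ip m (\<lambda>i\<in>{..<m}. v * w i) (\<lambda>i\<in>{..<m}. v * w i) = v\<^sup>2 * ip m w w"
      by (simp add: ip_def sum_distrib_left power2_eq_square mult_ac)
    show "ennreal K * indicator B w \<le> indicator {w. n * y \<le> ip m w w} (\<lambda>i\<in>{..<m}. v * w i) * ennreal (v ^ m * exp (- (v\<^sup>2 - 1) / 2 * ip m w w))"
    proof (cases "w \<in> B")
      case True
      then have w: "\<bar>ip m w w - n\<bar> \<le> \<delta> * n" by (simp add: B_def)
      have "n * y \<le> n * (v\<^sup>2 * (1 - \<delta>))" using v by (intro mult_left_mono) auto
      also have "\<dots> \<le> v\<^sup>2 * ip m w w" using w v
        by (subst mult.left_commute, intro mult_left_mono) (auto simp: algebra_simps abs_le_iff)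
      finally have 1: "n * y \<le> v\<^sup>2 * ip m w w" .
      have "\<bar>(v\<^sup>2 - 1) / 2 * (ip m w w - n)\<bar> \<le> \<bar>v\<^sup>2 - 1\<bar> / 2 * (\<delta> * n)"
        unfolding abs_mult by (intro mult_mono w) auto
      then have "(v\<^sup>2 - 1) / 2 * (ip m w w - n) \<le> \<bar>v\<^sup>2 - 1\<bar> / 2 * (\<delta> * n)" by linarith
      then have "- n / 2 * ((v\<^sup>2 - 1) + \<delta> * \<bar>v\<^sup>2 - 1\<bar>) \<le> - (v\<^sup>2 - 1) / 2 * ip m w w"
        by (simp add: algebra_simps)
      then have "K \<le> v ^ m * exp (- (v\<^sup>2 - 1) / 2 * ip m w w)"
        unfolding K_def using v by (intro mult_left_mono) auto
      then show ?thesis using 1 True by (simp add: sc ennreal_leI)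
    qed simp
  qed
  also have "\<dots> = (\<integral>\<^sup>+w. indicator {w. n * y \<le> ip m w w} w \<partial>gauss m)"
    by (rule nn_integral_gauss_scale[symmetric, OF measurable_indicator_ip v(1)]) measurable
  finally show ?thesis by (simp add: K_def)
qed

text \<open>With the row \<open>r\<close> along the first spike fixed, this is the likelihood ratio
  of a second spike restricted to \<open>good\<close>, up to a factor free of \<open>G\<close>:
  \<open>c\<close> is the component along the first spike and \<open>\<rho> * w\<close> the
  orthogonal rest. The scalar \<open>\<rho>\<close> separates the length of the rest from its
  direction.\<close>

definition tilt :: "real \<Rightarrow> real \<Rightarrow> real \<Rightarrow> real \<Rightarrow> real \<Rightarrow> real \<Rightarrow> nat \<Rightarrow> nat \<Rightarrow> (nat \<Rightarrow> real) \<Rightarrow> (nat \<Rightarrow> real) \<Rightarrow> (nat \<Rightarrow> nat \<Rightarrow> real) \<Rightarrow> ennreal" where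
  "tilt b s \<theta> C c \<rho> n N r w G = ennreal (exp (b / 2 * (\<Sum>k<N. (c * r k + \<rho> * ip n (G k) w)\<^sup>2))) * indicator {G. good s n N \<theta> C r G} G"

lemma measurable_tilt:
  assumes r: "\<And>k. k < N \<Longrightarrow> (\<lambda>x. r x k) \<in> borel_measurable M" and w: "w \<in> M \<rightarrow>\<^sub>M gauss n" and G: "G \<in> M \<rightarrow>\<^sub>M gmat N n"
  shows "(\<lambda>x. tilt b s \<theta> C c \<rho> n N (r x) (w x) (G x)) \<in> borel_measurable M"
proof -
  have "Measurable.pred M (\<lambda>x. good s n N \<theta> C (r x) (G x))"
    by (intro pred_good r measurable_gmat_comp[OF G])
  then have 1: "(\<lambda>x. indicator {G. good s n N \<theta> C (r x) G} (G x) :: ennreal) \<in> borel_measurable M"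
    unfolding indicator_def by measurable
  have "(\<lambda>x. ennreal (exp (b / 2 * (\<Sum>k<N. (c * r x k + \<rho> * ip n (G x k) (w x))\<^sup>2)))) \<in> borel_measurable M"
    by (intro measurable_quad_sum borel_measurable_add borel_measurable_times borel_measurable_const r measurable_ip measurable_gmat_comp[OF G] w)
  then show ?thesis unfolding tilt_def using 1 by (rule borel_measurable_times_ennreal)
qed

lemma restrict_gauss: "(\<lambda>i\<in>{..<n}. w i) \<in> space (gauss n)"
  by (simp add: space_PiM)

lemma measurable_tilt_const:
  "(\<lambda>G. tilt b s \<theta> C c \<rho> n N r w G) \<in> borel_measurable (gmat N n)"
proof -
  have "tilt b s \<theta> C c \<rho> n N r w G = tilt b s \<theta> C c \<rho> n N r (\<lambda>i\<in>{..<n}. w i) G" for G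
    unfolding tilt_def by (intro arg_cong2[where f=times] arg_cong[where f="\<lambda>x. ennreal (exp (b / 2 * x))"] sum.cong refl)
      (auto cong: ip_cong)
  then show ?thesis
    by (simp only:) (intro measurable_tilt borel_measurable_const measurable_const restrict_gauss measurable_ident_sets refl)
qed

text \<open>Both the law of \<open>G\<close> and the condition \<open>good\<close> are invariant
  under a rotation of all columns, so rotating \<open>w\<close> can be undone in
  \<open>G\<close>.\<close>

lemma nn_integral_tilt_rotate:
  assumes T: "isom n T T'"
  shows "(\<integral>\<^sup>+G. tilt b s \<theta> C c \<rho> n N r (T w) G \<partial>gmat N n) = (\<integral>\<^sup>+G. tilt b s \<theta> C c \<rho> n N r w G \<partial>gmat N n)"
proof -
  have "(\<integral>\<^sup>+G. tilt b s \<theta> C c \<rho> n N r (T w) G \<partial>gmat N n) = (\<integral>\<^sup>+G. tilt b s \<theta> C c \<rho> n N r (T w) (\<lambda>k\<in>{..<N}. T (G k)) \<partial>gmat N n)"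
    by (rule nn_integral_gmat_map[OF T measurable_tilt_const, symmetric])
  also have "\<dots> = (\<integral>\<^sup>+G. tilt b s \<theta> C c \<rho> n N r w G \<partial>gmat N n)"
    unfolding tilt_def indicator_def mem_Collect_eq good_map[OF T] by (simp add: isom_ip[OF T])
  finally show ?thesis .
qed

text \<open>Adding the two signs turns the linear term into a hyperbolic cosine; this and the
  quadratic factor both increase with the modulus of the coefficient.\<close>

lemma exp_quad_mono:
  fixes \<rho>0 \<rho>1 :: real
  assumes "\<bar>\<rho>0\<bar> \<le> \<bar>\<rho>1\<bar>" "0 \<le> b" "0 \<le> S"
  shows "exp (b / 2 * (A + 2 * \<rho>0 * B + \<rho>0\<^sup>2 * S)) + exp (b / 2 * (A - 2 * \<rho>0 * B + \<rho>0\<^sup>2 * S))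
    \<le> exp (b / 2 * (A + 2 * \<rho>1 * B + \<rho>1\<^sup>2 * S)) + exp (b / 2 * (A - 2 * \<rho>1 * B + \<rho>1\<^sup>2 * S))"
proof -
  have e: "exp (b / 2 * (A + 2 * \<rho> * B + \<rho>\<^sup>2 * S)) + exp (b / 2 * (A - 2 * \<rho> * B + \<rho>\<^sup>2 * S))
    = exp (b / 2 * A) * (exp (b / 2 * (\<rho>\<^sup>2 * S)) * (2 * cosh \<bar>b * \<rho> * B\<bar>))" for \<rho>
  proof -
    have "b / 2 * (A + 2 * \<rho> * B + \<rho>\<^sup>2 * S) = b / 2 * A + (b / 2 * (\<rho>\<^sup>2 * S) + b * \<rho> * B)"
      "b / 2 * (A - 2 * \<rho> * B + \<rho>\<^sup>2 * S) = b / 2 * A + (b / 2 * (\<rho>\<^sup>2 * S) + - (b * \<rho> * B))"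
      by (simp_all add: algebra_simps)
    then show ?thesis unfolding cosh_real_abs by (simp only: cosh_field_def exp_add) (simp add: ring_distribs)
  qed
  have "\<rho>0\<^sup>2 \<le> \<rho>1\<^sup>2" using assms(1) by (simp add: abs_le_square_iff)
  moreover have "cosh \<bar>b * \<rho>0 * B\<bar> \<le> cosh \<bar>b * \<rho>1 * B\<bar>"
    using assms by (subst cosh_real_nonneg_le_iff) (auto simp: abs_mult intro!: mult_left_mono mult_right_mono)
  ultimately show ?thesis unfolding e using assms(2,3)
    by (intro mult_left_mono mult_mono) (auto intro!: mult_left_mono mult_right_mono)
qed

text \<open>A single integrand need not increase with the scale because of the cross term with
  \<open>r\<close>. But \<open>w\<close> and its negative have the same integral, and the sum of
  their integrands does increase.\<close>

lemma nn_integral_tilt_scale_mono: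
  assumes "\<bar>\<rho>0\<bar> \<le> \<bar>\<rho>1\<bar>" "0 \<le> b"
  shows "(\<integral>\<^sup>+G. tilt b s \<theta> C c \<rho>0 n N r w G \<partial>gmat N n) \<le> (\<integral>\<^sup>+G. tilt b s \<theta> C c \<rho>1 n N r w G \<partial>gmat N n)"
proof -
  let ?neg = "\<lambda>v. \<lambda>i\<in>{..<n}. - v i :: real"
  have sym: "2 * (\<integral>\<^sup>+G. tilt b s \<theta> C c \<rho> n N r w G \<partial>gmat N n)
    = (\<integral>\<^sup>+G. tilt b s \<theta> C c \<rho> n N r w G + tilt b s \<theta> C c \<rho> n N r (?neg w) G \<partial>gmat N n)" for \<rho>
    using nn_integral_tilt_rotate[OF isom_neg, where b=b and s=s and \<theta>=\<theta> and C=C and c=c and \<rho>=\<rho> and N=N and r=r and w=w]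
    by (subst nn_integral_add) (simp_all add: measurable_tilt_const mult_2)
  have "(\<integral>\<^sup>+G. tilt b s \<theta> C c \<rho>0 n N r w G + tilt b s \<theta> C c \<rho>0 n N r (?neg w) G \<partial>gmat N n)
    \<le> (\<integral>\<^sup>+G. tilt b s \<theta> C c \<rho>1 n N r w G + tilt b s \<theta> C c \<rho>1 n N r (?neg w) G \<partial>gmat N n)"
  proof (rule nn_integral_mono)
    fix G
    define A where "A = (\<Sum>k<N. (c * r k)\<^sup>2)"
    define B where "B = (\<Sum>k<N. c * r k * ip n (G k) w)"
    define S where "S = (\<Sum>k<N. (ip n (G k) w)\<^sup>2)"
    have neg: "ip n (G k) (?neg w) = - ip n (G k) w" for k by (simp add: ip_def sum_negf)
    have 1: "(\<Sum>k<N. (c * r k + \<rho> * ip n (G k) w)\<^sup>2) = A + 2 * \<rho> * B + \<rho>\<^sup>2 * S" for \<rho>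
      by (simp add: A_def B_def S_def sum_distrib_left sum.distrib[symmetric] power2_eq_square algebra_simps)
    have 2: "(\<Sum>k<N. (c * r k + \<rho> * ip n (G k) (?neg w))\<^sup>2) = A - 2 * \<rho> * B + \<rho>\<^sup>2 * S" for \<rho>
      unfolding neg by (simp add: A_def B_def S_def sum_distrib_left sum.distrib[symmetric] sum_subtractf[symmetric] power2_eq_square algebra_simps)
    have "S \<ge> 0" by (simp add: S_def sum_nonneg)
    then have "ennreal (exp (b / 2 * (A + 2 * \<rho>0 * B + \<rho>0\<^sup>2 * S)) + exp (b / 2 * (A - 2 * \<rho>0 * B + \<rho>0\<^sup>2 * S)))
      \<le> ennreal (exp (b / 2 * (A + 2 * \<rho>1 * B + \<rho>1\<^sup>2 * S)) + exp (b / 2 * (A - 2 * \<rho>1 * B + \<rho>1\<^sup>2 * S)))"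
      using assms by (intro ennreal_leI exp_quad_mono)
    then show "tilt b s \<theta> C c \<rho>0 n N r w G + tilt b s \<theta> C c \<rho>0 n N r (?neg w) G
      \<le> tilt b s \<theta> C c \<rho>1 n N r w G + tilt b s \<theta> C c \<rho>1 n N r (?neg w) G"
      unfolding tilt_def 1 2 by (simp add: indicator_def)
  qed
  then have "2 * (\<integral>\<^sup>+G. tilt b s \<theta> C c \<rho>0 n N r w G \<partial>gmat N n) \<le> 2 * (\<integral>\<^sup>+G. tilt b s \<theta> C c \<rho>1 n N r w G \<partial>gmat N n)"
    by (simp only: sym)
  then show ?thesis by (subst (asm) ennreal_mult_le_mult_iff) auto
qed

text \<open>Rotating \<open>w0\<close> and \<open>w1\<close> onto the last axis makes both multiples
  of one unit vector, so that comparing lengths becomes comparing scales.\<close>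

lemma nn_integral_tilt_mono:
  assumes le: "ip n w0 w0 \<le> ip n w1 w1" and b: "0 \<le> b"
  shows "(\<integral>\<^sup>+G. tilt b s \<theta> C c 1 n N r w0 G \<partial>gmat N n) \<le> (\<integral>\<^sup>+G. tilt b s \<theta> C c 1 n N r w1 G \<partial>gmat N n)"
proof (cases n)
  case 0
  then show ?thesis by (simp add: tilt_def ip_def)
next
  case (Suc m)
  let ?e = "\<lambda>i. if i = m then 1 else 0 :: real"
  have last: "\<exists>\<rho>. \<rho>\<^sup>2 = ip n w w \<and> (\<integral>\<^sup>+G. tilt b s \<theta> C c 1 n N r w G \<partial>gmat N n) = (\<integral>\<^sup>+G. tilt b s \<theta> C c \<rho> n N r ?e G \<partial>gmat N n)" for w
  proof -
    obtain T T' where T: "isom n T T'" "\<And>i. i < m \<Longrightarrow> T w i = 0" "(T w m)\<^sup>2 = ip n w w"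
      using isom_to_last[of m w] unfolding Suc by metis
    have "ip n v (T w) = T w m * ip n v ?e" for v
      using T(2) by (simp add: Suc ip_Suc) (simp add: ip_def)
    then have "tilt b s \<theta> C c 1 n N r (T w) G = tilt b s \<theta> C c (T w m) n N r ?e G" for G
      by (simp add: tilt_def)
    then have "(\<integral>\<^sup>+G. tilt b s \<theta> C c 1 n N r w G \<partial>gmat N n) = (\<integral>\<^sup>+G. tilt b s \<theta> C c (T w m) n N r ?e G \<partial>gmat N n)"
      using nn_integral_tilt_rotate[OF T(1), where b=b and s=s and \<theta>=\<theta> and C=C and c=c and \<rho>=1 and N=N and r=r and w=w] by simp
    then show ?thesis using T(3) by blast
  qed
  obtain \<rho>0 where 0: "\<rho>0\<^sup>2 = ip n w0 w0" "(\<integral>\<^sup>+G. tilt b s \<theta> C c 1 n N r w0 G \<partial>gmat N n) = (\<integral>\<^sup>+G. tilt b s \<theta> C c \<rho>0 n N r ?e G \<partial>gmat N n)"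
    using last by blast
  obtain \<rho>1 where 1: "\<rho>1\<^sup>2 = ip n w1 w1" "(\<integral>\<^sup>+G. tilt b s \<theta> C c 1 n N r w1 G \<partial>gmat N n) = (\<integral>\<^sup>+G. tilt b s \<theta> C c \<rho>1 n N r ?e G \<partial>gmat N n)"
    using last by blast
  have "\<bar>\<rho>0\<bar> \<le> \<bar>\<rho>1\<bar>" using le 0(1) 1(1) by (simp add: abs_le_square_iff)
  then show ?thesis unfolding 0(2) 1(2) using b by (rule nn_integral_tilt_scale_mono)
qed

text \<open>
  The left integral depends on \<open>w0\<close> through its norm only and increases with it, so it is at most
  its average over Gaussian vectors longer than \<open>w0\<close>, which \<^const>\<open>good\<close> controls.
\<close>
lemma nn_integral_tilt_bound:
  assumes b: "0 < b" and sig: "\<sigma> > 0" "s = b * \<sigma>\<^sup>2" and C: "0 \<le> C"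
  shows "(\<integral>\<^sup>+G. tilt b s \<theta> C c 1 n N r w0 G \<partial>gmat N n)
      * (\<integral>\<^sup>+w. indicator {w. ip n w0 w0 / \<sigma>\<^sup>2 \<le> ip n w w} w \<partial>gauss n)
    \<le> ennreal (C * exp (b / 2 * c\<^sup>2 * \<theta> * ip N r r))"
proof -
  interpret G: prob_space "gmat N n" by (rule prob_gmat)
  interpret g: prob_space "gauss n" by (rule prob_gauss)
  interpret pair_sigma_finite "gauss n" "gmat N n" ..
  let ?\<psi> = "\<lambda>w. \<integral>\<^sup>+G. tilt b s \<theta> C c 1 n N r w G \<partial>gmat N n"
  have m: "(\<lambda>p. tilt b s \<theta> C c \<rho> n N r (fst p) (snd p)) \<in> borel_measurable (gauss n \<Otimes>\<^sub>M gmat N n)" for \<rho>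
    by (intro measurable_tilt borel_measurable_const measurable_fst measurable_snd)
  have "?\<psi> w0 * (\<integral>\<^sup>+w. indicator {w. ip n w0 w0 / \<sigma>\<^sup>2 \<le> ip n w w} w \<partial>gauss n)
    = (\<integral>\<^sup>+w. ?\<psi> w0 * indicator {w. ip n w0 w0 / \<sigma>\<^sup>2 \<le> ip n w w} w \<partial>gauss n)"
    by (rule nn_integral_cmult[symmetric, OF measurable_indicator_ip]) measurable
  also have "\<dots> \<le> (\<integral>\<^sup>+w. \<integral>\<^sup>+G. tilt b s \<theta> C c \<sigma> n N r w G \<partial>gmat N n \<partial>gauss n)"
  proof (rule nn_integral_mono)
    fix w
    have "?\<psi> w0 \<le> (\<integral>\<^sup>+G. tilt b s \<theta> C c \<sigma> n N r w G \<partial>gmat N n)" if "ip n w0 w0 / \<sigma>\<^sup>2 \<le> ip n w w"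
    proof -
      have "ip n w0 w0 \<le> ip n (\<lambda>i. \<sigma> * w i) (\<lambda>i. \<sigma> * w i)"
        using that sig(1) by (simp add: ip_scale_left ip_scale_right field_simps power2_eq_square)
      then have "?\<psi> w0 \<le> ?\<psi> (\<lambda>i. \<sigma> * w i)" by (rule nn_integral_tilt_mono) (use b in simp)
      also have "\<dots> = (\<integral>\<^sup>+G. tilt b s \<theta> C c \<sigma> n N r w G \<partial>gmat N n)"
        by (simp add: tilt_def ip_scale_right)
      finally show ?thesis .
    qed
    then show "?\<psi> w0 * indicator {w. ip n w0 w0 / \<sigma>\<^sup>2 \<le> ip n w w} w \<le> (\<integral>\<^sup>+G. tilt b s \<theta> C c \<sigma> n N r w G \<partial>gmat N n)"
      by (auto simp: indicator_def)
  qed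
  \<comment> \<open>For fixed \<open>G\<close> the inner average over \<open>w\<close> is
    \<open>Lam\<close> with parameter \<open>s = b * \<sigma>^2\<close> at the vector
    \<open>c / \<sigma> * r\<close>, which is what \<open>good\<close> bounds.\<close>
  also have "\<dots> = (\<integral>\<^sup>+G. \<integral>\<^sup>+w. tilt b s \<theta> C c \<sigma> n N r w G \<partial>gauss n \<partial>gmat N n)"
    by (rule Fubini'[symmetric]) (use m in \<open>simp only: case_prod_beta'\<close>)
  also have "\<dots> \<le> (\<integral>\<^sup>+G. ennreal (C * exp (b / 2 * c\<^sup>2 * \<theta> * ip N r r)) \<partial>gmat N n)"
  proof (rule nn_integral_mono)
    fix G
    have e: "s / 2 * (\<Sum>k<N. (c / \<sigma> * r k + ip n (G k) w)\<^sup>2) = b / 2 * (\<Sum>k<N. (c * r k + \<sigma> * ip n (G k) w)\<^sup>2)" for w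
    proof -
      have "\<sigma>\<^sup>2 * (c / \<sigma> * r k + ip n (G k) w)\<^sup>2 = (c * r k + \<sigma> * ip n (G k) w)\<^sup>2" for k
        unfolding power_mult_distrib[symmetric] using sig(1) by (simp add: ring_distribs)
      then show ?thesis by (simp add: sig(2) sum_distrib_left[symmetric] mult.assoc) (simp add: sum_distrib_left)
    qed
    have e2: "s / 2 * (c / \<sigma>)\<^sup>2 = b / 2 * c\<^sup>2" using sig by (simp add: power_divide)
    have "(\<integral>\<^sup>+w. tilt b s \<theta> C c \<sigma> n N r w G \<partial>gauss n) \<le> ennreal (C * exp (b / 2 * c\<^sup>2 * \<theta> * ip N r r))"
      if "good s n N \<theta> C r G"
    proof -
      have "(\<integral>\<^sup>+w. tilt b s \<theta> C c \<sigma> n N r w G \<partial>gauss n) = Lam s n N (\<lambda>k. c / \<sigma> * r k) G"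
        unfolding Lam_def tilt_def e using that by (simp add: indicator_def)
      also have "\<dots> \<le> ennreal (C * exp (b / 2 * c\<^sup>2 * \<theta> * ip N r r))"
        using good_real[OF that, of "c / \<sigma>"] unfolding e2 .
      finally show ?thesis .
    qed
    then show "(\<integral>\<^sup>+w. tilt b s \<theta> C c \<sigma> n N r w G \<partial>gauss n) \<le> ennreal (C * exp (b / 2 * c\<^sup>2 * \<theta> * ip N r r))"
      by (cases "good s n N \<theta> C r G") (simp_all add: tilt_def)
  qed
  also have "\<dots> = ennreal (C * exp (b / 2 * c\<^sup>2 * \<theta> * ip N r r))" by (simp add: G.emeasure_space_1)
  finally show ?thesis .
qed

subsection \<open>Likelihood ratios\<close>

text \<open>The density of \<open>N\<close> independent columns with covariance
  \<open>I + \<beta> x x^T\<close> relative to standard normal columns: the inverse covariance is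
  given by the Sherman-Morrison formula, and the determinant is
  \<open>1 + \<beta> * ip n x x\<close>.\<close>

definition lik :: "real \<Rightarrow> nat \<Rightarrow> nat \<Rightarrow> (nat \<Rightarrow> real) \<Rightarrow> (nat \<Rightarrow> nat \<Rightarrow> real) \<Rightarrow> ennreal" where
  "lik \<beta> n N x X = ennreal ((1 + \<beta> * ip n x x) powr (- real N / 2)
     * exp (\<beta> / (1 + \<beta> * ip n x x) / 2 * (\<Sum>k<N. (ip n x (X k))\<^sup>2)))"

definition cproj :: "nat \<Rightarrow> (nat \<Rightarrow> real) \<Rightarrow> (nat \<Rightarrow> real) \<Rightarrow> nat \<Rightarrow> real" where
  "cproj n x v = (\<lambda>i\<in>{..<n}. v i - ip n x v / ip n x x * x i)"

text \<open>The positive square root of \<open>I + \<beta> x x^T\<close> applied to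
  \<open>v\<close>. If \<open>x\<close> vanishes, the division by zero gives \<open>v\<close>, as it
  should.\<close>

definition spike :: "real \<Rightarrow> nat \<Rightarrow> (nat \<Rightarrow> real) \<Rightarrow> (nat \<Rightarrow> real) \<Rightarrow> nat \<Rightarrow> real" where
  "spike \<beta> n x v = (\<lambda>i\<in>{..<n}. v i + (sqrt (1 + \<beta> * ip n x x) - 1) / ip n x x * ip n x v * x i)"

text \<open>The projected columns keep all \<open>n\<close> coordinates, and
  \<open>ip n x (X k)\<close> is not divided by the length of \<open>x\<close>. Both are harmless: a
  vanishing coordinate drops out of \<open>Lam\<close>, and \<open>good\<close> is invariant under
  rescaling of its vector.\<close>

definition goodx :: "real \<Rightarrow> nat \<Rightarrow> nat \<Rightarrow> real \<Rightarrow> real \<Rightarrow> (nat \<Rightarrow> real) \<Rightarrow> (nat \<Rightarrow> nat \<Rightarrow> real) \<Rightarrow> bool" where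
  "goodx s n N \<theta> C x X \<longleftrightarrow> good s n N \<theta> C (\<lambda>k. ip n x (X k)) (\<lambda>k. cproj n x (X k))"

lemma measurable_ip_left:
  assumes "\<And>i. i < n \<Longrightarrow> (\<lambda>p. x p i) \<in> borel_measurable M" "g \<in> M \<rightarrow>\<^sub>M gauss n"
  shows "(\<lambda>p. ip n (x p) (g p)) \<in> borel_measurable M"
  unfolding ip_def using assms(1) measurable_gauss_comp[OF assms(2)] by (intro borel_measurable_sum borel_measurable_times) auto

lemma measurable_ip_both:
  assumes "\<And>i. i < n \<Longrightarrow> (\<lambda>p. x p i) \<in> borel_measurable M" "\<And>i. i < n \<Longrightarrow> (\<lambda>p. y p i) \<in> borel_measurable M"
  shows "(\<lambda>p. ip n (x p) (y p)) \<in> borel_measurable M"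
  unfolding ip_def using assms by (intro borel_measurable_sum borel_measurable_times) auto

lemma ip_restrict_scale: "ip n (\<lambda>i\<in>{..<n}. c * v i) (\<lambda>i\<in>{..<n}. c * v i) = c\<^sup>2 * ip n v v"
  by (simp add: ip_def sum_distrib_left power2_eq_square mult_ac)

lemma measurable_lik:
  assumes x: "\<And>i. i < n \<Longrightarrow> (\<lambda>p. x p i) \<in> borel_measurable M" and X: "X \<in> M \<rightarrow>\<^sub>M gmat N n"
  shows "(\<lambda>p. lik \<beta> n N (x p) (X p)) \<in> borel_measurable M"
proof -
  have [measurable]: "(\<lambda>p. ip n (x p) (x p)) \<in> borel_measurable M" by (intro measurable_ip_both x)
  have [measurable]: "(\<lambda>p. \<Sum>k<N. (ip n (x p) (X p k))\<^sup>2) \<in> borel_measurable M"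
    by (intro borel_measurable_sum borel_measurable_power measurable_ip_left x measurable_gmat_comp[OF X]) auto
  show ?thesis unfolding lik_def by measurable
qed

lemma measurable_cproj:
  assumes x: "\<And>i. i < n \<Longrightarrow> (\<lambda>p. x p i) \<in> borel_measurable M" and v: "v \<in> M \<rightarrow>\<^sub>M gauss n"
  shows "(\<lambda>p. cproj n (x p) (v p)) \<in> M \<rightarrow>\<^sub>M gauss n"
  unfolding cproj_def
  by (intro measurable_into_gauss borel_measurable_diff borel_measurable_times borel_measurable_divide
      measurable_ip_left measurable_ip_both x measurable_gauss_comp[OF v] v)

lemma measurable_spike:
  assumes x: "\<And>i. i < n \<Longrightarrow> (\<lambda>p. x p i) \<in> borel_measurable M" and v: "v \<in> M \<rightarrow>\<^sub>M gauss n"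
  shows "(\<lambda>p. spike \<beta> n (x p) (v p)) \<in> M \<rightarrow>\<^sub>M gauss n"
  unfolding spike_def
proof (rule measurable_into_gauss)
  fix i assume i: "i < n"
  have [measurable]: "(\<lambda>p. ip n (x p) (x p)) \<in> borel_measurable M" by (intro measurable_ip_both x)
  have [measurable]: "(\<lambda>p. ip n (x p) (v p)) \<in> borel_measurable M" by (intro measurable_ip_left x v)
  note [measurable] = x[OF i] measurable_gauss_comp[OF v i]
  show "(\<lambda>p. v p i + (sqrt (1 + \<beta> * ip n (x p) (x p)) - 1) / ip n (x p) (x p) * ip n (x p) (v p) * x p i) \<in> borel_measurable M"
    by measurable
qed

lemma pred_goodx:
  assumes x: "\<And>i. i < n \<Longrightarrow> (\<lambda>p. x p i) \<in> borel_measurable M" and X: "X \<in> M \<rightarrow>\<^sub>M gmat N n"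
  shows "Measurable.pred M (\<lambda>p. goodx s n N \<theta> C (x p) (X p))"
  unfolding goodx_def
  by (intro pred_good measurable_ip_left x measurable_cproj measurable_gmat_comp[OF X])

lemma Lam_drop_last:
  "Lam s (Suc m) N y (\<lambda>k. (G k)(m := 0)) = Lam s m N y G"
proof -
  interpret N: prob_space std_normal_distribution by (rule prob_std_normal)
  have "Lam s (Suc m) N y (\<lambda>k. (G k)(m := 0))
    = (\<integral>\<^sup>+w. \<integral>\<^sup>+a. ennreal (exp (s / 2 * (\<Sum>k<N. (y k + ip (Suc m) ((G k)(m := 0)) (w(m := a)))\<^sup>2))) \<partial>std_normal_distribution \<partial>gauss m)"
    unfolding Lam_def
    by (rule nn_integral_gauss_Suc(1))
      (intro measurable_quad_sum borel_measurable_add borel_measurable_const measurable_ip_const measurable_ident_sets refl)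
  also have "\<dots> = (\<integral>\<^sup>+w. \<integral>\<^sup>+a. ennreal (exp (s / 2 * (\<Sum>k<N. (y k + ip m (G k) w)\<^sup>2))) \<partial>std_normal_distribution \<partial>gauss m)"
  proof -
    have "ip (Suc m) ((G k)(m := 0)) (w(m := a)) = ip m (G k) w" for k w a
      by (simp add: ip_Suc) (auto simp: ip_def intro!: sum.cong)
    then show ?thesis by (simp only:)
  qed
  also have "\<dots> = Lam s m N y G" unfolding Lam_def using N.emeasure_space_1 by simp
  finally show ?thesis .
qed

text \<open>The factor \<open>\<xi>\<close> is absorbed by passing from the multiplier
  \<open>q\<close> to \<open>q / \<xi>\<close>. The latter is real and in general not rational,
  hence the detour through \<open>good_real\<close>.\<close>

lemma good_drop_last:
  assumes "\<xi> \<noteq> 0"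
  shows "good s (Suc m) N \<theta> C (\<lambda>k. \<xi> * r k) (\<lambda>k. (G k)(m := 0)) \<longleftrightarrow> good s m N \<theta> C r G"
proof
  have ip2: "ip N (\<lambda>k. \<xi> * r k) (\<lambda>k. \<xi> * r k) = \<xi>\<^sup>2 * ip N r r"
    by (simp add: ip_scale_left ip_scale_right power2_eq_square)
  {
    assume g: "good s (Suc m) N \<theta> C (\<lambda>k. \<xi> * r k) (\<lambda>k. (G k)(m := 0))"
    show "good s m N \<theta> C r G"
      unfolding good_def
    proof
      fix q :: rat
      have e: "s / 2 * (of_rat q / \<xi>)\<^sup>2 * \<theta> * (\<xi>\<^sup>2 * ip N r r) = s / 2 * (of_rat q)\<^sup>2 * \<theta> * ip N r r"
        using assms by (simp add: power_divide)
      have l: "(\<lambda>k. of_rat q / \<xi> * (\<xi> * r k)) = (\<lambda>k. of_rat q * r k)" using assms by simp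
      show "Lam s m N (\<lambda>k. of_rat q * r k) G \<le> ennreal (C * exp (s / 2 * (of_rat q)\<^sup>2 * \<theta> * ip N r r))"
        using good_real[OF g, of "of_rat q / \<xi>"] unfolding Lam_drop_last ip2 e l .
    qed
  next
    assume g: "good s m N \<theta> C r G"
    show "good s (Suc m) N \<theta> C (\<lambda>k. \<xi> * r k) (\<lambda>k. (G k)(m := 0))"
      unfolding good_def
    proof
      fix q :: rat
      have e: "s / 2 * (of_rat q * \<xi>)\<^sup>2 * \<theta> * ip N r r = s / 2 * (of_rat q)\<^sup>2 * \<theta> * (\<xi>\<^sup>2 * ip N r r)"
        by (simp add: power_mult_distrib)
      have l: "(\<lambda>k. of_rat q * \<xi> * r k) = (\<lambda>k. of_rat q * (\<xi> * r k))" by (simp add: mult.assoc)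
      show "Lam s (Suc m) N (\<lambda>k. of_rat q * (\<xi> * r k)) (\<lambda>k. (G k)(m := 0))
        \<le> ennreal (C * exp (s / 2 * (of_rat q)\<^sup>2 * \<theta> * ip N (\<lambda>k. \<xi> * r k) (\<lambda>k. \<xi> * r k)))"
        using good_real[OF g, of "of_rat q * \<xi>"] unfolding Lam_drop_last ip2 e l .
    qed
  }
qed

lemma nn_integral_scaled_gauss:
  assumes h: "h \<in> borel_measurable (gauss N)" and a: "a \<ge> 0"
  shows "(\<integral>\<^sup>+r. ennreal ((1 + a) powr (- real N / 2) * exp (a / (1 + a) / 2 * ip N r r)) * h r \<partial>gauss N)
    = (\<integral>\<^sup>+r. h (\<lambda>k\<in>{..<N}. sqrt (1 + a) * r k) \<partial>gauss N)"
proof -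
  define v where "v = sqrt (1 + a)"
  have v: "v > 0" "v\<^sup>2 = 1 + a" using a by (simp_all add: v_def)
  have mm: "(\<lambda>r. h (\<lambda>k\<in>{..<N}. v * r k)) \<in> borel_measurable (gauss N)"
    by (rule measurable_compose[OF _ h]) (intro measurable_into_gauss borel_measurable_times borel_measurable_const measurable_gauss_coord)
  have "(\<integral>\<^sup>+r. h (\<lambda>k\<in>{..<N}. v * r k) \<partial>gauss N)
    = (\<integral>\<^sup>+r. h (\<lambda>k\<in>{..<N}. v * (\<lambda>i\<in>{..<N}. 1 / v * r i) k) * ennreal ((1 / v) ^ N * exp (- ((1 / v)\<^sup>2 - 1) / 2 * ip N r r)) \<partial>gauss N)"
    by (rule nn_integral_gauss_scale[OF mm]) (use v in simp)
  also have "\<dots> = (\<integral>\<^sup>+r. ennreal ((1 + a) powr (- real N / 2) * exp (a / (1 + a) / 2 * ip N r r)) * h r \<partial>gauss N)"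
  proof (rule nn_integral_cong)
    fix r assume r: "r \<in> space (gauss N)"
    have 1: "(\<lambda>k\<in>{..<N}. v * (\<lambda>i\<in>{..<N}. 1 / v * r i) k) = r"
      using r v by (auto simp: space_PiM PiE_def extensional_def fun_eq_iff)
    have 2: "- ((1 / v)\<^sup>2 - 1) = a / (1 + a)" using a by (simp add: power_divide v field_simps)
    have "v ^ N = (1 + a) powr (real N / 2)"
      using a by (simp add: v_def powr_half_sqrt[symmetric] powr_realpow[symmetric] powr_powr)
    then have 3: "(1 / v) ^ N = (1 + a) powr (- real N / 2)"
      by (simp add: power_divide powr_minus_divide)
    show "h (\<lambda>k\<in>{..<N}. v * (\<lambda>i\<in>{..<N}. 1 / v * r i) k) * ennreal ((1 / v) ^ N * exp (- ((1 / v)\<^sup>2 - 1) / 2 * ip N r r))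
      = ennreal ((1 + a) powr (- real N / 2) * exp (a / (1 + a) / 2 * ip N r r)) * h r"
      unfolding 1 2 3 by (rule mult.commute)
  qed
  finally show ?thesis by (simp add: v_def)
qed

text \<open>Coordinates in which \<open>x\<close> lies on the last axis. The data then split into
  the row \<open>r\<close> along \<open>x\<close> and an independent matrix \<open>G\<close> of one
  dimension less, and the likelihood ratio of \<open>x\<close> is a function of \<open>r\<close>
  alone.\<close>

locale rotated =
  fixes \<beta> :: real and m N :: nat and x :: "nat \<Rightarrow> real" and T T' :: "(nat \<Rightarrow> real) \<Rightarrow> nat \<Rightarrow> real"
  assumes \<beta>: "\<beta> \<ge> 0" and isom: "isom (Suc m) T T'" and Tx: "\<And>i. i < m \<Longrightarrow> T x i = 0"
    and xx: "ip (Suc m) x x \<noteq> 0"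
begin

definition "\<xi> = T x m"

lemma \<xi>2: "\<xi>\<^sup>2 = ip (Suc m) x x"
proof -
  have "ip (Suc m) x x = ip (Suc m) (T x) (T x)" by (simp add: isom_ip[OF isom])
  also have "\<dots> = \<xi>\<^sup>2" using Tx by (simp add: ip_Suc \<xi>_def power2_eq_square) (simp add: ip_def)
  finally show ?thesis by simp
qed

lemma \<xi>: "\<xi> \<noteq> 0"
  using \<xi>2 xx by auto

definition "att r G = (\<lambda>k\<in>{..<N}. T' ((G k)(m := r k)))" for r :: "nat \<Rightarrow> real" and G :: "nat \<Rightarrow> nat \<Rightarrow> real"

definition "lr r = ennreal ((1 + \<beta> * ip (Suc m) x x) powr (- real N / 2)
   * exp (\<beta> * ip (Suc m) x x / (1 + \<beta> * ip (Suc m) x x) / 2 * ip N r r))" for r :: "nat \<Rightarrow> real"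

lemma ip_att:
  assumes "k < N"
  shows "ip (Suc m) y (att r G k) = T y m * r k + ip m (G k) (T y)"
proof -
  have "ip (Suc m) y (att r G k) = ip (Suc m) ((G k)(m := r k)) (T y)"
    using assms isom_adjoint[OF isom_sym[OF isom], of "(G k)(m := r k)" y] by (simp add: att_def ip_commute[of _ y])
  also have "\<dots> = T y m * r k + ip m (G k) (T y)"
    by (simp add: ip_Suc mult.commute) (auto simp: ip_def intro!: sum.cong)
  finally show ?thesis .
qed

lemma ip_x_att: "k < N \<Longrightarrow> ip (Suc m) x (att r G k) = \<xi> * r k"
  using Tx by (simp add: ip_att \<xi>_def) (simp add: ip_def)

lemma lik_att: "lik \<beta> (Suc m) N x (att r G) = lr r"
proof -
  have "(\<Sum>k<N. (ip (Suc m) x (att r G k))\<^sup>2) = (\<Sum>k<N. \<xi>\<^sup>2 * (r k * r k))"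
    by (intro sum.cong refl) (simp add: ip_x_att power_mult_distrib power2_eq_square)
  also have "\<dots> = ip (Suc m) x x * ip N r r" by (simp add: \<xi>2 ip_def[of N] sum_distrib_left)
  finally show ?thesis by (simp add: lik_def lr_def)
qed

lemma measurable_att: "(\<lambda>p. att (fst p) (snd p)) \<in> gauss N \<Otimes>\<^sub>M gmat N m \<rightarrow>\<^sub>M gmat N (Suc m)"
  unfolding att_def
proof (rule measurable_restrict)
  fix k assume k: "k \<in> {..<N}"
  show "(\<lambda>p. T' ((snd p k)(m := fst p k))) \<in> gauss N \<Otimes>\<^sub>M gmat N m \<rightarrow>\<^sub>M gauss (Suc m)"
    by (rule measurable_compose[OF measurable_upd_gauss[OF measurable_gmat_comp[OF measurable_snd] measurable_gauss_comp[OF measurable_fst]] isom_measurable(2)[OF isom]])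
      (use k in auto)
qed

lemma measurable_att1: "r \<in> space (gauss N) \<Longrightarrow> att r \<in> gmat N m \<rightarrow>\<^sub>M gmat N (Suc m)"
  using measurable_compose[OF measurable_Pair1' measurable_att] by simp

lemma measurable_lr [measurable]: "lr \<in> borel_measurable (gauss N)"
  unfolding lr_def by measurable

lemma nn_integral_att:
  assumes F: "F \<in> borel_measurable (gmat N (Suc m))"
  shows "(\<integral>\<^sup>+X. F X \<partial>gmat N (Suc m)) = (\<integral>\<^sup>+r. \<integral>\<^sup>+G. F (att r G) \<partial>gmat N m \<partial>gauss N)"
proof -
  have "(\<integral>\<^sup>+X. F X \<partial>gmat N (Suc m)) = (\<integral>\<^sup>+X. F (\<lambda>k\<in>{..<N}. T' (X k)) \<partial>gmat N (Suc m))"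
    by (rule nn_integral_gmat_map[OF isom_sym[OF isom] F, symmetric])
  also have "\<dots> = (\<integral>\<^sup>+r. \<integral>\<^sup>+G. F (\<lambda>k\<in>{..<N}. T' ((\<lambda>k\<in>{..<N}. (G k)(m := r k)) k)) \<partial>gmat N m \<partial>gauss N)"
    by (rule nn_integral_gmat_split)
      (intro measurable_compose[OF _ F] measurable_restrict measurable_compose[OF measurable_gmat_col isom_measurable(2)[OF isom]], auto)
  also have "\<dots> = (\<integral>\<^sup>+r. \<integral>\<^sup>+G. F (att r G) \<partial>gmat N m \<partial>gauss N)"
    by (intro nn_integral_cong arg_cong[where f=F]) (auto simp: att_def)
  finally show ?thesis .
qed

lemma nn_integral_lik:
  assumes F: "F \<in> borel_measurable (gmat N (Suc m))"
  shows "(\<integral>\<^sup>+X. lik \<beta> (Suc m) N x X * F X \<partial>gmat N (Suc m)) = (\<integral>\<^sup>+r. lr r * (\<integral>\<^sup>+G. F (att r G) \<partial>gmat N m) \<partial>gauss N)"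
proof -
  have "(\<integral>\<^sup>+X. lik \<beta> (Suc m) N x X * F X \<partial>gmat N (Suc m)) = (\<integral>\<^sup>+r. \<integral>\<^sup>+G. lr r * F (att r G) \<partial>gmat N m \<partial>gauss N)"
    by (subst nn_integral_att) (auto simp: lik_att intro!: borel_measurable_times_ennreal F measurable_lik measurable_ident_sets)
  also have "\<dots> = (\<integral>\<^sup>+r. lr r * (\<integral>\<^sup>+G. F (att r G) \<partial>gmat N m) \<partial>gauss N)"
    by (intro nn_integral_cong nn_integral_cmult measurable_compose[OF measurable_att1 F])
  finally show ?thesis .
qed

lemma nn_integral_lr:
  assumes "h \<in> borel_measurable (gauss N)"
  shows "(\<integral>\<^sup>+r. lr r * h r \<partial>gauss N) = (\<integral>\<^sup>+r. h (\<lambda>k\<in>{..<N}. sqrt (1 + \<beta> * ip (Suc m) x x) * r k) \<partial>gauss N)"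
  unfolding lr_def by (rule nn_integral_scaled_gauss[OF assms]) (use \<beta> in simp)

lemma nn_integral_lr_1: "(\<integral>\<^sup>+r. lr r \<partial>gauss N) = 1"
proof -
  interpret prob_space "gauss N" by (rule prob_gauss)
  show ?thesis using nn_integral_lr[of "\<lambda>_. 1"] by (simp add: emeasure_space_1)
qed

lemma spike_eq:
  assumes "v \<in> space (gauss (Suc m))"
  shows "spike \<beta> (Suc m) x v = T' ((T v)(m := sqrt (1 + \<beta> * ip (Suc m) x x) * T v m))"
proof -
  let ?e = "\<lambda>i. if i = m then 1 else 0 :: real"
  let ?v = "sqrt (1 + \<beta> * ip (Suc m) x x)"
  have x': "x i = \<xi> * T' ?e i" if "i < Suc m" for i
  proof -
    have "x i = T' (T x) i" using isom_inverse[OF isom that] by simp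
    also have "\<dots> = T' (\<lambda>i. \<xi> * ?e i) i"
      by (rule isom_cong[OF isom_sym[OF isom] _ that]) (use Tx in \<open>auto simp: \<xi>_def less_Suc_eq\<close>)
    finally show ?thesis using isom_scale[OF isom_sym[OF isom] that] by simp
  qed
  have ipx: "ip (Suc m) x v = \<xi> * T v m"
  proof -
    have "ip (Suc m) x v = ip (Suc m) (T x) (T v)" by (simp add: isom_ip[OF isom])
    also have "\<dots> = \<xi> * T v m" using Tx by (simp add: ip_Suc \<xi>_def) (simp add: ip_def)
    finally show ?thesis .
  qed
  have "T' ((T v)(m := ?v * T v m)) i = v i + (?v - 1) / ip (Suc m) x x * ip (Suc m) x v * x i" if i: "i < Suc m" for i
  proof -
    have "T' ((T v)(m := ?v * T v m)) i = T' (\<lambda>k. T v k + (?v - 1) * T v m * ?e k) i"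
      by (rule isom_cong[OF isom_sym[OF isom] _ i]) (auto simp: algebra_simps)
    also have "\<dots> = v i + (?v - 1) * T v m * T' ?e i"
      using isom_add[OF isom_sym[OF isom] i] isom_scale[OF isom_sym[OF isom] i] isom_inverse[OF isom i] by simp
    also have "(?v - 1) * T v m * T' ?e i = (?v - 1) / ip (Suc m) x x * ip (Suc m) x v * x i"
      unfolding ipx x'[OF i] \<xi>2[symmetric] using \<xi> by (simp add: power2_eq_square)
    finally show ?thesis .
  qed
  moreover have "T' ((T v)(m := ?v * T v m)) \<in> space (gauss (Suc m))"
  proof (rule measurable_space[OF isom_measurable(2)[OF isom]])
    have "T v \<in> space (gauss (Suc m))" by (rule measurable_space[OF isom_measurable(1)[OF isom] assms])
    then show "(T v)(m := ?v * T v m) \<in> space (gauss (Suc m))" by (auto simp: space_PiM PiE_def extensional_def)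
  qed
  ultimately show ?thesis by (auto simp: spike_def fun_eq_iff space_PiM PiE_def extensional_def)
qed

text \<open>In rotated coordinates \<open>spike\<close> stretches only the row \<open>r\<close>, and
  \<open>lr\<close> is the density of the stretched Gaussian row. This identifies \<open>lik\<close>
  as the likelihood ratio of the spiked data.\<close>

lemma nn_integral_spike:
  assumes F: "F \<in> borel_measurable (gmat N (Suc m))"
  shows "(\<integral>\<^sup>+X. F (\<lambda>k\<in>{..<N}. spike \<beta> (Suc m) x (X k)) \<partial>gmat N (Suc m)) = (\<integral>\<^sup>+X. lik \<beta> (Suc m) N x X * F X \<partial>gmat N (Suc m))"
proof -
  let ?v = "sqrt (1 + \<beta> * ip (Suc m) x x)"
  let ?D = "\<lambda>z. z(m := ?v * z m)"
  have mD: "(\<lambda>X. \<lambda>k\<in>{..<N}. T' (?D (X k))) \<in> gmat N (Suc m) \<rightarrow>\<^sub>M gmat N (Suc m)"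
  proof (rule measurable_restrict)
    fix k assume k: "k \<in> {..<N}"
    have "?D \<in> gauss (Suc m) \<rightarrow>\<^sub>M gauss (Suc m)"
      by (rule measurable_fun_upd[where J="{..<Suc m}"]) (auto intro!: borel_measurable_times measurable_gauss_coord measurable_ident_sets)
    from measurable_compose[OF measurable_compose[OF measurable_gmat_col this] isom_measurable(2)[OF isom]] k
    show "(\<lambda>X. T' (?D (X k))) \<in> gmat N (Suc m) \<rightarrow>\<^sub>M gauss (Suc m)" by blast
  qed
  have "(\<integral>\<^sup>+X. F (\<lambda>k\<in>{..<N}. spike \<beta> (Suc m) x (X k)) \<partial>gmat N (Suc m))
    = (\<integral>\<^sup>+X. F (\<lambda>k\<in>{..<N}. T' (?D ((\<lambda>k\<in>{..<N}. T (X k)) k))) \<partial>gmat N (Suc m))"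
  proof (intro nn_integral_cong arg_cong[where f=F] restrict_ext)
    fix X k assume X: "X \<in> space (gmat N (Suc m))" and k: "k \<in> {..<N}"
    then have "X k \<in> space (gauss (Suc m))" by (auto simp: space_PiM PiE_def Pi_def extensional_def)
    then show "spike \<beta> (Suc m) x (X k) = T' (?D ((\<lambda>k\<in>{..<N}. T (X k)) k))" using k by (simp add: spike_eq)
  qed
  also have "\<dots> = (\<integral>\<^sup>+X. F (\<lambda>k\<in>{..<N}. T' (?D (X k))) \<partial>gmat N (Suc m))"
    by (rule nn_integral_gmat_map[OF isom]) (rule measurable_compose[OF mD F])
  also have "\<dots> = (\<integral>\<^sup>+r. \<integral>\<^sup>+G. F (\<lambda>k\<in>{..<N}. T' (?D ((\<lambda>k\<in>{..<N}. (G k)(m := r k)) k))) \<partial>gmat N m \<partial>gauss N)"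
    by (rule nn_integral_gmat_split) (rule measurable_compose[OF mD F])
  also have "\<dots> = (\<integral>\<^sup>+r. \<integral>\<^sup>+G. F (att (\<lambda>k\<in>{..<N}. ?v * r k) G) \<partial>gmat N m \<partial>gauss N)"
    by (intro nn_integral_cong arg_cong[where f=F]) (auto simp: att_def)
  also have "\<dots> = (\<integral>\<^sup>+r. lr r * (\<integral>\<^sup>+G. F (att r G) \<partial>gmat N m) \<partial>gauss N)"
  proof (rule nn_integral_lr[symmetric])
    show "(\<lambda>r. \<integral>\<^sup>+G. F (att r G) \<partial>gmat N m) \<in> borel_measurable (gauss N)"
      by (rule sigma_finite_measure.borel_measurable_nn_integral[OF prob_space_imp_sigma_finite[OF prob_gmat]])
        (use measurable_compose[OF measurable_att F] in \<open>simp only: case_prod_beta'\<close>)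
  qed
  also have "\<dots> = (\<integral>\<^sup>+X. lik \<beta> (Suc m) N x X * F X \<partial>gmat N (Suc m))"
    by (rule nn_integral_lik[OF F, symmetric])
  finally show ?thesis .
qed

lemma goodx_att: "goodx s (Suc m) N \<theta> C x (att r G) \<longleftrightarrow> good s m N \<theta> C r G"
proof -
  have "good s (Suc m) N \<theta> C (\<lambda>k. ip (Suc m) x (att r G k)) (\<lambda>k. cproj (Suc m) x (att r G k))
    = good s (Suc m) N \<theta> C (\<lambda>k. \<xi> * r k) (\<lambda>k\<in>{..<N}. T' ((G k)(m := 0)))"
  proof (rule good_cong)
    fix k i assume k: "k < N" and i: "i < Suc m"
    have "cproj (Suc m) x (att r G k) i = T' ((G k)(m := r k)) i + (- r k / \<xi>) * x i"
      using k i \<xi> by (simp add: cproj_def ip_x_att \<xi>2[symmetric] power2_eq_square) (simp add: att_def)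
    also have "x i = T' (T x) i" using isom_inverse[OF isom i] by simp
    also have "T' ((G k)(m := r k)) i + (- r k / \<xi>) * T' (T x) i = T' (\<lambda>j. ((G k)(m := r k)) j + (- r k / \<xi>) * T x j) i"
      by (simp only: isom_add[OF isom_sym[OF isom] i] isom_scale[OF isom_sym[OF isom] i])
    also have "\<dots> = T' ((G k)(m := 0)) i"
      by (rule isom_cong[OF isom_sym[OF isom] _ i]) (use Tx \<xi> in \<open>auto simp: less_Suc_eq \<xi>_def[symmetric]\<close>)
    finally show "cproj (Suc m) x (att r G k) i = (\<lambda>k\<in>{..<N}. T' ((G k)(m := 0))) k i" using k by simp
  qed (simp add: ip_x_att)
  also have "\<dots> = good s (Suc m) N \<theta> C (\<lambda>k. \<xi> * r k) (\<lambda>k. (G k)(m := 0))"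
    by (rule good_map[OF isom_sym[OF isom]])
  also have "\<dots> = good s m N \<theta> C r G" by (rule good_drop_last[OF \<xi>])
  finally show ?thesis by (simp add: goodx_def)
qed

text \<open>Weighting by \<open>lik\<close> changes the law of \<open>r\<close> only, while
  \<open>G\<close> stays standard Gaussian; a bound valid for every fixed \<open>r\<close> therefore
  survives.\<close>

lemma nn_integral_lik_bad:
  assumes bound: "\<And>r. (\<integral>\<^sup>+G. indicator {G. \<not> good s m N \<theta> C r G} G \<partial>gmat N m) \<le> \<epsilon>"
  shows "(\<integral>\<^sup>+X. lik \<beta> (Suc m) N x X * indicator {X. \<not> goodx s (Suc m) N \<theta> C x X} X \<partial>gmat N (Suc m)) \<le> \<epsilon>"
proof -
  have "Measurable.pred (gmat N (Suc m)) (\<lambda>X. goodx s (Suc m) N \<theta> C x X)"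
    by (intro pred_goodx borel_measurable_const measurable_ident_sets refl)
  then have m: "(\<lambda>X. indicator {X. \<not> goodx s (Suc m) N \<theta> C x X} X :: ennreal) \<in> borel_measurable (gmat N (Suc m))"
    unfolding indicator_def by measurable
  have "(\<integral>\<^sup>+X. lik \<beta> (Suc m) N x X * indicator {X. \<not> goodx s (Suc m) N \<theta> C x X} X \<partial>gmat N (Suc m))
    = (\<integral>\<^sup>+r. lr r * (\<integral>\<^sup>+G. indicator {G. \<not> good s m N \<theta> C r G} G \<partial>gmat N m) \<partial>gauss N)"
  proof -
    have "indicator {X. \<not> goodx s (Suc m) N \<theta> C x X} (att r G) = (indicator {G. \<not> good s m N \<theta> C r G} G :: ennreal)" for r G
      by (simp add: indicator_def goodx_att)
    then show ?thesis by (simp only: nn_integral_lik[OF m])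
  qed
  also have "\<dots> \<le> (\<integral>\<^sup>+r. lr r * \<epsilon> \<partial>gauss N)"
    by (intro nn_integral_mono mult_left_mono bound) simp
  also have "\<dots> = (\<integral>\<^sup>+r. lr r \<partial>gauss N) * \<epsilon>" by (rule nn_integral_multc) measurable
  also have "\<dots> = \<epsilon>" by (simp add: nn_integral_lr_1)
  finally show ?thesis .
qed

text \<open>Under the weight \<open>lr\<close> the row \<open>r\<close> is a standard Gaussian
  vector stretched by \<open>sqrt (1 + \<beta> * ip (Suc m) x x)\<close>, so the length of
  \<open>X^T x\<close> is governed by a chi-square variable.\<close>

lemma nn_integral_lik_norm:
  "(\<integral>\<^sup>+X. lik \<beta> (Suc m) N x X * indicator {X. R * ip (Suc m) x x < (\<Sum>k<N. (ip (Suc m) x (X k))\<^sup>2)} X \<partial>gmat N (Suc m))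
    = (\<integral>\<^sup>+r. indicator {r. R < (1 + \<beta> * ip (Suc m) x x) * ip N r r} r \<partial>gauss N)"
proof -
  have pos: "ip (Suc m) x x > 0" using xx by (metis ip_self_nonneg less_le)
  have [measurable]: "(\<lambda>X. \<Sum>k<N. (ip (Suc m) x (X k))\<^sup>2) \<in> borel_measurable (gmat N (Suc m))"
    by (intro borel_measurable_sum borel_measurable_power measurable_ip_const measurable_gmat_col) auto
  have m: "(\<lambda>X. indicator {X. R * ip (Suc m) x x < (\<Sum>k<N. (ip (Suc m) x (X k))\<^sup>2)} X :: ennreal) \<in> borel_measurable (gmat N (Suc m))"
    unfolding indicator_def by measurable
  interpret G: prob_space "gmat N m" by (rule prob_gmat)
  have s: "(\<Sum>k<N. (ip (Suc m) x (att r G k))\<^sup>2) = ip (Suc m) x x * ip N r r" for r G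
  proof -
    have "(\<Sum>k<N. (ip (Suc m) x (att r G k))\<^sup>2) = (\<Sum>k<N. \<xi>\<^sup>2 * (r k * r k))"
      by (intro sum.cong refl) (simp add: ip_x_att power_mult_distrib power2_eq_square)
    then show ?thesis by (simp add: \<xi>2 ip_def[of N] sum_distrib_left)
  qed
  have "(\<integral>\<^sup>+X. lik \<beta> (Suc m) N x X * indicator {X. R * ip (Suc m) x x < (\<Sum>k<N. (ip (Suc m) x (X k))\<^sup>2)} X \<partial>gmat N (Suc m))
    = (\<integral>\<^sup>+r. lr r * indicator {r. R < ip N r r} r \<partial>gauss N)"
    by (subst nn_integral_lik[OF m]) (use pos in \<open>simp add: s indicator_def mult.commute[of R] G.emeasure_space_1\<close>)
  also have "\<dots> = (\<integral>\<^sup>+r. indicator {r. R < ip N r r} (\<lambda>k\<in>{..<N}. sqrt (1 + \<beta> * ip (Suc m) x x) * r k) \<partial>gauss N)"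
    by (rule nn_integral_lr) (rule measurable_indicator_ip, measurable)
  also have "\<dots> = (\<integral>\<^sup>+r. indicator {r. R < (1 + \<beta> * ip (Suc m) x x) * ip N r r} r \<partial>gauss N)"
  proof (rule nn_integral_cong)
    fix r :: "nat \<Rightarrow> real"
    have nn: "0 \<le> 1 + \<beta> * ip (Suc m) x x" using \<beta> by (simp add: add_nonneg_nonneg)
    have "ip N (\<lambda>k\<in>{..<N}. sqrt (1 + \<beta> * ip (Suc m) x x) * r k) (\<lambda>k\<in>{..<N}. sqrt (1 + \<beta> * ip (Suc m) x x) * r k)
      = (sqrt (1 + \<beta> * ip (Suc m) x x))\<^sup>2 * ip N r r"
      by (rule ip_restrict_scale)
    then show "indicator {r. R < ip N r r} (\<lambda>k\<in>{..<N}. sqrt (1 + \<beta> * ip (Suc m) x x) * r k)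
      = (indicator {r. R < (1 + \<beta> * ip (Suc m) x x) * ip N r r} r :: ennreal)"
      using nn by (simp add: indicator_def)
  qed
  finally show ?thesis .
qed

text \<open>For fixed \<open>r\<close> the first ratio is constant in \<open>G\<close>, and the
  second is a \<open>tilt\<close> whose vector is the component of \<open>x'\<close> orthogonal to
  \<open>x\<close>, of squared length \<open>\<rho> - \<alpha>^2 / v\<close>.
  \<open>nn_integral_tilt_bound\<close> applies to each \<open>r\<close> with
  \<open>ip N r r \<le> R\<close>, and \<open>lr\<close> has total mass 1. Keeping the Gaussian
  probability on the left avoids a division in \<open>ennreal\<close>.\<close>

lemma nn_integral_lik_pair:
  fixes x' :: "nat \<Rightarrow> real"
  defines "\<rho> \<equiv> ip (Suc m) x' x'" and "\<alpha> \<equiv> ip (Suc m) x x'" and "v \<equiv> ip (Suc m) x x"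
  assumes \<beta>pos: "\<beta> > 0" and s: "s > 0" and C: "0 \<le> C" and \<theta>: "0 \<le> \<theta>"
  shows "(\<integral>\<^sup>+X. lik \<beta> (Suc m) N x X * (lik \<beta> (Suc m) N x' X
        * indicator {X. goodx s (Suc m) N \<theta> C x X \<and> (\<Sum>k<N. (ip (Suc m) x (X k))\<^sup>2) \<le> R * v} X) \<partial>gmat N (Suc m))
      * (\<integral>\<^sup>+w. indicator {w. (\<rho> - \<alpha>\<^sup>2 / v) * (\<beta> / (1 + \<beta> * \<rho>)) / s \<le> ip m w w} w \<partial>gauss m)
    \<le> ennreal ((1 + \<beta> * \<rho>) powr (- real N / 2) * (C * exp (\<beta> / (1 + \<beta> * \<rho>) / 2 * (\<alpha>\<^sup>2 / v) * \<theta> * R)))"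
proof -
  define b where "b = \<beta> / (1 + \<beta> * \<rho>)"
  define K where "K = (1 + \<beta> * \<rho>) powr (- real N / 2)"
  define c where "c = T x' m"
  \<comment> \<open>The scale at which averaging the tilt over a Gaussian vector produces
    \<open>Lam\<close> with parameter \<open>s\<close>.\<close>
  define \<sigma> where "\<sigma> = sqrt (s / b)"
  have \<rho>0: "\<rho> \<ge> 0" by (simp add: \<rho>_def)
  have v0: "v > 0" using xx unfolding v_def by (metis ip_self_nonneg less_le)
  have b: "b > 0" using \<beta>pos \<rho>0 by (simp add: b_def add_pos_nonneg)
  have K: "K \<ge> 0" by (simp add: K_def)
  have \<sigma>: "\<sigma> > 0" "\<sigma>\<^sup>2 = s / b" "s = b * \<sigma>\<^sup>2" using b s by (simp_all add: \<sigma>_def)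
  have "\<alpha> = ip (Suc m) (T x) (T x')" by (simp add: \<alpha>_def isom_ip[OF isom])
  also have "\<dots> = \<xi> * c" using Tx by (simp add: ip_Suc \<xi>_def c_def) (simp add: ip_def)
  finally have c2: "c\<^sup>2 = \<alpha>\<^sup>2 / v" using \<xi> by (simp add: v_def \<xi>2[symmetric] power_mult_distrib)
  have w0: "ip m (T x') (T x') = \<rho> - \<alpha>\<^sup>2 / v"
  proof -
    have "\<rho> = ip (Suc m) (T x') (T x')" by (simp add: \<rho>_def isom_ip[OF isom])
    also have "\<dots> = ip m (T x') (T x') + c\<^sup>2" by (simp add: ip_Suc c_def power2_eq_square)
    finally show ?thesis by (simp add: c2)
  qed
  let ?F = "\<lambda>X. lik \<beta> (Suc m) N x' X * indicator {X. goodx s (Suc m) N \<theta> C x X \<and> (\<Sum>k<N. (ip (Suc m) x (X k))\<^sup>2) \<le> R * v} X"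
  let ?P = "\<integral>\<^sup>+w. indicator {w. (\<rho> - \<alpha>\<^sup>2 / v) * b / s \<le> ip m w w} w \<partial>gauss m"
  have [measurable]: "(\<lambda>X. \<Sum>k<N. (ip (Suc m) x (X k))\<^sup>2) \<in> borel_measurable (gmat N (Suc m))"
    by (intro borel_measurable_sum borel_measurable_power measurable_ip_const measurable_gmat_col) auto
  have [measurable]: "Measurable.pred (gmat N (Suc m)) (\<lambda>X. goodx s (Suc m) N \<theta> C x X)"
    by (intro pred_goodx borel_measurable_const measurable_ident_sets refl)
  have [measurable]: "(\<lambda>X. lik \<beta> (Suc m) N x' X) \<in> borel_measurable (gmat N (Suc m))"
    by (intro measurable_lik borel_measurable_const measurable_ident_sets refl)
  have m: "?F \<in> borel_measurable (gmat N (Suc m))" unfolding indicator_def by measurable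
  have sq: "(\<Sum>k<N. (ip (Suc m) x (att r G k))\<^sup>2) \<le> R * v \<longleftrightarrow> ip N r r \<le> R" for r G
  proof -
    have "(\<Sum>k<N. (ip (Suc m) x (att r G k))\<^sup>2) = (\<Sum>k<N. \<xi>\<^sup>2 * (r k * r k))"
      by (intro sum.cong refl) (simp add: ip_x_att power_mult_distrib power2_eq_square)
    also have "\<dots> = ip N r r * v" by (simp add: \<xi>2 v_def ip_def[of N] sum_distrib_left mult.commute)
    finally show ?thesis using v0 by simp
  qed
  have Fatt: "?F (att r G) = ennreal K * indicator {r. ip N r r \<le> R} r * tilt b s \<theta> C c 1 m N r (T x') G" for r G
  proof -
    have "(\<Sum>k<N. (ip (Suc m) x' (att r G k))\<^sup>2) = (\<Sum>k<N. (c * r k + 1 * ip m (G k) (T x'))\<^sup>2)"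
      by (intro sum.cong refl) (simp add: ip_att c_def)
    then have "lik \<beta> (Suc m) N x' (att r G) = ennreal K * ennreal (exp (b / 2 * (\<Sum>k<N. (c * r k + 1 * ip m (G k) (T x'))\<^sup>2)))"
      using K by (simp only: lik_def \<rho>_def[symmetric] b_def[symmetric] K_def[symmetric]) (simp add: ennreal_mult)
    then show ?thesis
      by (cases "good s m N \<theta> C r G"; cases "ip N r r \<le> R") (simp_all only: sq goodx_att tilt_def indicator_def mem_Collect_eq, simp_all)
  qed
  have "(\<integral>\<^sup>+X. lik \<beta> (Suc m) N x X * ?F X \<partial>gmat N (Suc m)) * ?P = (\<integral>\<^sup>+r. lr r * (\<integral>\<^sup>+G. ?F (att r G) \<partial>gmat N m) \<partial>gauss N) * ?P"
    by (simp only: nn_integral_lik[OF m])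
  also have "\<dots> = (\<integral>\<^sup>+r. lr r * (\<integral>\<^sup>+G. ?F (att r G) \<partial>gmat N m) * ?P \<partial>gauss N)"
  proof (rule nn_integral_multc[symmetric])
    have "(\<lambda>r. \<integral>\<^sup>+G. ?F (att r G) \<partial>gmat N m) \<in> borel_measurable (gauss N)"
      by (rule sigma_finite_measure.borel_measurable_nn_integral[OF prob_space_imp_sigma_finite[OF prob_gmat]])
        (use measurable_compose[OF measurable_att m] in \<open>simp only: case_prod_beta'\<close>)
    then show "(\<lambda>r. lr r * (\<integral>\<^sup>+G. ?F (att r G) \<partial>gmat N m)) \<in> borel_measurable (gauss N)" by measurable
  qed
  also have "\<dots> \<le> (\<integral>\<^sup>+r. lr r * ennreal (K * (C * exp (b / 2 * (\<alpha>\<^sup>2 / v) * \<theta> * R))) \<partial>gauss N)"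
  proof (rule nn_integral_mono)
    fix r
    have "(\<integral>\<^sup>+G. ?F (att r G) \<partial>gmat N m) * ?P \<le> ennreal (K * (C * exp (b / 2 * (\<alpha>\<^sup>2 / v) * \<theta> * R)))"
    proof (cases "ip N r r \<le> R")
      case True
      have "(\<integral>\<^sup>+G. ?F (att r G) \<partial>gmat N m) * ?P = ennreal K * ((\<integral>\<^sup>+G. tilt b s \<theta> C c 1 m N r (T x') G \<partial>gmat N m) * ?P)"
        using True by (simp only: Fatt) (simp add: nn_integral_cmult measurable_tilt_const mult.assoc)
      also have "\<dots> \<le> ennreal K * ennreal (C * exp (b / 2 * (\<alpha>\<^sup>2 / v) * \<theta> * R))"
      proof (rule mult_left_mono)
        have e: "(\<rho> - \<alpha>\<^sup>2 / v) * b / s = ip m (T x') (T x') / \<sigma>\<^sup>2" using b s by (simp add: w0 \<sigma>(2))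
        have "(\<integral>\<^sup>+G. tilt b s \<theta> C c 1 m N r (T x') G \<partial>gmat N m) * ?P \<le> ennreal (C * exp (b / 2 * c\<^sup>2 * \<theta> * ip N r r))"
          unfolding e by (rule nn_integral_tilt_bound[OF b \<sigma>(1,3) C])
        also have "\<dots> \<le> ennreal (C * exp (b / 2 * (\<alpha>\<^sup>2 / v) * \<theta> * R))"
        proof -
          have "0 \<le> b / 2 * (\<alpha>\<^sup>2 / v) * \<theta>" using b \<theta> v0 by simp
          then have "b / 2 * (\<alpha>\<^sup>2 / v) * \<theta> * ip N r r \<le> b / 2 * (\<alpha>\<^sup>2 / v) * \<theta> * R"
            using True by (rule mult_left_mono[rotated])
          then show ?thesis unfolding c2 using C by (intro ennreal_leI mult_left_mono) simp_all
        qed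
        finally show "(\<integral>\<^sup>+G. tilt b s \<theta> C c 1 m N r (T x') G \<partial>gmat N m) * ?P
          \<le> ennreal (C * exp (b / 2 * (\<alpha>\<^sup>2 / v) * \<theta> * R))" .
      qed simp
      finally show ?thesis using K by (simp only: ennreal_mult')
    next
      case False
      then show ?thesis by (simp add: Fatt)
    qed
    then show "lr r * (\<integral>\<^sup>+G. ?F (att r G) \<partial>gmat N m) * ?P \<le> lr r * ennreal (K * (C * exp (b / 2 * (\<alpha>\<^sup>2 / v) * \<theta> * R)))"
      by (simp add: mult.assoc mult_left_mono)
  qed
  also have "\<dots> = (\<integral>\<^sup>+r. lr r \<partial>gauss N) * ennreal (K * (C * exp (b / 2 * (\<alpha>\<^sup>2 / v) * \<theta> * R)))"
    by (rule nn_integral_multc) measurable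
  finally show ?thesis by (simp add: nn_integral_lr_1 b_def K_def)
qed

end

subsection \<open>Reduction of contiguity to likelihood ratios\<close>

lemma nn_integral_gauss_exp_linear:
  "(\<integral>\<^sup>+g. ennreal (exp (ip n w g)) \<partial>gauss n) = ennreal (exp (ip n w w / 2))"
proof -
  interpret product_sigma_finite "\<lambda>i::nat. std_normal_distribution" by (rule product_sigma_finite_normal)
  have "(\<integral>\<^sup>+g. ennreal (exp (ip n w g)) \<partial>gauss n) = (\<integral>\<^sup>+g. (\<Prod>i<n. ennreal (exp (w i * g i))) \<partial>gauss n)"
    by (intro nn_integral_cong) (simp add: ip_def exp_sum prod_ennreal)
  also have "\<dots> = (\<Prod>i<n. \<integral>\<^sup>+a. ennreal (exp (w i * a)) \<partial>std_normal_distribution)"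
    by (intro product_nn_integral_prod) auto
  also have "\<dots> = (\<Prod>i<n. ennreal (exp ((w i)\<^sup>2 / 2)))"
    using nn_integral_normal_exp[of 0] by simp
  also have "\<dots> = ennreal (exp (ip n w w / 2))"
    by (simp add: ip_def exp_sum[symmetric] prod_ennreal sum_divide_distrib[symmetric] power2_eq_square)
  finally show ?thesis .
qed

definition lik1 :: "real \<Rightarrow> nat \<Rightarrow> (nat \<Rightarrow> real) \<Rightarrow> (nat \<Rightarrow> real) \<Rightarrow> ennreal" where
  "lik1 \<beta> n x g = ennreal (exp (\<beta> * (ip n x g)\<^sup>2 / (2 * (1 + \<beta> * ip n x x))) / sqrt (1 + \<beta> * ip n x x))"

lemma lik_eq_prod:
  assumes "\<beta> \<ge> 0"
  shows "lik \<beta> n N x X = (\<Prod>k<N. lik1 \<beta> n x (X k))"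
proof -
  define a where "a = 1 + \<beta> * ip n x x"
  have a: "a > 0" using assms by (simp add: a_def add_pos_nonneg)
  have "(\<Prod>k<N. lik1 \<beta> n x (X k)) = ennreal (\<Prod>k<N. exp (\<beta> * (ip n x (X k))\<^sup>2 / (2 * a)) / sqrt a)"
    unfolding lik1_def a_def[symmetric] using a by (intro prod_ennreal) simp
  also have "(\<Prod>k<N. exp (\<beta> * (ip n x (X k))\<^sup>2 / (2 * a)) / sqrt a)
    = exp (\<Sum>k<N. \<beta> * (ip n x (X k))\<^sup>2 / (2 * a)) * (1 / sqrt a) ^ N"
    by (simp add: exp_sum prod_dividef power_divide)
  also have "(1 / sqrt a) ^ N = a powr (- real N / 2)"
    using a by (simp add: powr_minus_divide powr_half_sqrt[symmetric] powr_realpow[symmetric] powr_powr power_divide)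
  also have "(\<Sum>k<N. \<beta> * (ip n x (X k))\<^sup>2 / (2 * a)) = \<beta> / a / 2 * (\<Sum>k<N. (ip n x (X k))\<^sup>2)"
    unfolding sum_distrib_left by (intro sum.cong refl) (simp add: ac_simps)
  finally show ?thesis unfolding lik_def a_def[symmetric] by (simp add: mult.commute)
qed

lemma ip_lincomb:
  "ip n (\<lambda>i. p * x i + q * y i) (\<lambda>i. p * x i + q * y i) = p\<^sup>2 * ip n x x + q\<^sup>2 * ip n y y + 2 * (p * q) * ip n x y"
  by (simp add: ip_def power2_eq_square algebra_simps sum.distrib sum_distrib_left)

text \<open>Each factor is a Gaussian average, over an auxiliary variable \<open>u\<close>, of an
  exponential that is linear in \<open>g\<close>. After Fubini the integral over \<open>g\<close> is
  explicit; the terms in \<open>u^2\<close> and \<open>u'^2\<close> cancel, and only the cross term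
  with the overlap remains. The hypothesis \<open>small\<close> makes the last Gaussian integral
  finite.\<close>

lemma nn_integral_lik1_pair:
  assumes b: "\<beta> \<ge> 0" and small: "\<beta>\<^sup>2 * (ip n x x')\<^sup>2 < 1"
  shows "(\<integral>\<^sup>+g. lik1 \<beta> n x g * lik1 \<beta> n x' g \<partial>gauss n) = ennreal (1 / sqrt (1 - \<beta>\<^sup>2 * (ip n x x')\<^sup>2))"
proof -
  interpret U: prob_space std_normal_distribution by (rule prob_std_normal)
  interpret G: prob_space "gauss n" by (rule prob_gauss)
  interpret P: pair_sigma_finite std_normal_distribution "gauss n" ..
  define f where "f x u g = ennreal (exp (- \<beta> * ip n x x / 2 * u\<^sup>2 + sqrt \<beta> * ip n x g * u))" for x u g
  have lik1: "lik1 \<beta> n x g = (\<integral>\<^sup>+u. f x u g \<partial>std_normal_distribution)" for x g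
    using nn_integral_normal_exp[of "- \<beta> * ip n x x" "sqrt \<beta> * ip n x g"] b
    by (simp add: f_def lik1_def power_mult_distrib)
      (metis ip_self_nonneg less_le_trans mult_nonneg_nonneg neg_less_0_iff_less not_less zero_less_one)
  have m1: "(\<lambda>u. f x u g) \<in> borel_measurable std_normal_distribution" for x g
    unfolding f_def by measurable
  have [measurable]: "f x \<in> borel_measurable borel \<Longrightarrow> True" for x by simp
  have m3: "(\<lambda>p. f x (fst p) (snd p)) \<in> borel_measurable (std_normal_distribution \<Otimes>\<^sub>M gauss n)" for x
    unfolding f_def by measurable
  have m2: "(\<lambda>g. f x u g) \<in> borel_measurable (gauss n)" for x u
    unfolding f_def by measurable
  have m4: "(\<lambda>g. \<integral>\<^sup>+u. f x u g \<partial>std_normal_distribution) \<in> borel_measurable (gauss n)" for x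
    by (intro U.borel_measurable_nn_integral, unfold case_prod_beta' f_def) measurable
  have "(\<integral>\<^sup>+g. lik1 \<beta> n x g * lik1 \<beta> n x' g \<partial>gauss n)
    = (\<integral>\<^sup>+g. \<integral>\<^sup>+u. f x u g * (\<integral>\<^sup>+u'. f x' u' g \<partial>std_normal_distribution) \<partial>std_normal_distribution \<partial>gauss n)"
    unfolding lik1 by (intro nn_integral_cong nn_integral_multc[symmetric] m1)
  also have "\<dots> = (\<integral>\<^sup>+u. \<integral>\<^sup>+g. f x u g * (\<integral>\<^sup>+u'. f x' u' g \<partial>std_normal_distribution) \<partial>gauss n \<partial>std_normal_distribution)"
  proof (rule P.Fubini', unfold case_prod_beta')
    show "(\<lambda>p. f x (fst p) (snd p) * (\<integral>\<^sup>+u'. f x' u' (snd p) \<partial>std_normal_distribution)) \<in> borel_measurable (std_normal_distribution \<Otimes>\<^sub>M gauss n)"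
      by (intro borel_measurable_times_ennreal m3 measurable_compose[OF measurable_snd m4])
  qed
  also have "\<dots> = (\<integral>\<^sup>+u. \<integral>\<^sup>+g. \<integral>\<^sup>+u'. f x u g * f x' u' g \<partial>std_normal_distribution \<partial>gauss n \<partial>std_normal_distribution)"
    by (intro nn_integral_cong nn_integral_cmult[symmetric] m1)
  also have "\<dots> = (\<integral>\<^sup>+u. \<integral>\<^sup>+u'. \<integral>\<^sup>+g. f x u g * f x' u' g \<partial>gauss n \<partial>std_normal_distribution \<partial>std_normal_distribution)"
    by (intro nn_integral_cong P.Fubini', unfold case_prod_beta')
      (intro borel_measurable_times_ennreal m3 measurable_compose[OF measurable_snd m2])
  also have "\<dots> = (\<integral>\<^sup>+u. \<integral>\<^sup>+u'. ennreal (exp (\<beta> * u * ip n x x' * u')) \<partial>std_normal_distribution \<partial>std_normal_distribution)"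
  proof (intro nn_integral_cong)
    fix u u' :: real
    define w where "w i = (sqrt \<beta> * u) * x i + (sqrt \<beta> * u') * x' i" for i
    have "ip n w w = (sqrt \<beta>)\<^sup>2 * u\<^sup>2 * ip n x x + (sqrt \<beta>)\<^sup>2 * u'\<^sup>2 * ip n x' x' + 2 * (sqrt \<beta>)\<^sup>2 * u * u' * ip n x x'"
      unfolding w_def ip_lincomb by (simp add: power_mult_distrib power2_eq_square mult_ac)
    then have ww: "ip n w w / 2 = \<beta> * ip n x x / 2 * u\<^sup>2 + \<beta> * ip n x' x' / 2 * u'\<^sup>2 + \<beta> * u * ip n x x' * u'"
      using b by simp
    have "f x u g * f x' u' g = ennreal (exp (- \<beta> * ip n x x / 2 * u\<^sup>2 - \<beta> * ip n x' x' / 2 * u'\<^sup>2)) * ennreal (exp (ip n w g))" for g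
    proof -
      have "ip n w g = sqrt \<beta> * ip n x g * u + sqrt \<beta> * ip n x' g * u'"
        unfolding w_def by (simp only: ip_add_left ip_scale_left) (simp add: mult_ac)
      then show ?thesis unfolding f_def by (simp add: ennreal_mult'[symmetric] exp_add[symmetric])
    qed
    then have "(\<integral>\<^sup>+g. f x u g * f x' u' g \<partial>gauss n)
      = ennreal (exp (- \<beta> * ip n x x / 2 * u\<^sup>2 - \<beta> * ip n x' x' / 2 * u'\<^sup>2)) * ennreal (exp (ip n w w / 2))"
      by (simp only: nn_integral_gauss_exp_linear[symmetric]) (intro nn_integral_cmult, measurable)
    also have "\<dots> = ennreal (exp (\<beta> * u * ip n x x' * u'))"
      unfolding ww by (simp add: ennreal_mult'[symmetric] exp_add[symmetric])
    finally show "(\<integral>\<^sup>+g. f x u g * f x' u' g \<partial>gauss n) = ennreal (exp (\<beta> * u * ip n x x' * u'))" .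
  qed
  also have "\<dots> = (\<integral>\<^sup>+u. ennreal (exp (\<beta>\<^sup>2 * (ip n x x')\<^sup>2 / 2 * u\<^sup>2 + 0 * u)) \<partial>std_normal_distribution)"
  proof (intro nn_integral_cong)
    fix u :: real
    show "(\<integral>\<^sup>+u'. ennreal (exp (\<beta> * u * ip n x x' * u')) \<partial>std_normal_distribution) = ennreal (exp (\<beta>\<^sup>2 * (ip n x x')\<^sup>2 / 2 * u\<^sup>2 + 0 * u))"
      using nn_integral_normal_exp[of 0 "\<beta> * u * ip n x x'"] by (simp add: power_mult_distrib mult_ac)
  qed
  also have "\<dots> = ennreal (1 / sqrt (1 - \<beta>\<^sup>2 * (ip n x x')\<^sup>2))"
    using nn_integral_normal_exp[OF small, of 0] by simp
  finally show ?thesis .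
qed

lemma nn_integral_lik_lik:
  assumes b: "\<beta> \<ge> 0" and small: "\<beta>\<^sup>2 * (ip n x x')\<^sup>2 < 1"
  shows "(\<integral>\<^sup>+X. lik \<beta> n N x X * lik \<beta> n N x' X \<partial>gmat N n) = ennreal ((1 - \<beta>\<^sup>2 * (ip n x x')\<^sup>2) powr (- real N / 2))"
proof -
  interpret product_sigma_finite "\<lambda>i::nat. gauss n" by (rule product_sigma_finite_gauss)
  have "(\<integral>\<^sup>+X. lik \<beta> n N x X * lik \<beta> n N x' X \<partial>gmat N n) = (\<integral>\<^sup>+X. (\<Prod>k<N. lik1 \<beta> n x (X k) * lik1 \<beta> n x' (X k)) \<partial>gmat N n)"
    by (simp only: lik_eq_prod[OF b] prod.distrib)
  also have "\<dots> = (\<Prod>k<N. \<integral>\<^sup>+g. lik1 \<beta> n x g * lik1 \<beta> n x' g \<partial>gauss n)"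
    by (intro product_nn_integral_prod) (auto simp: lik1_def)
  also have "\<dots> = ennreal ((1 / sqrt (1 - \<beta>\<^sup>2 * (ip n x x')\<^sup>2)) ^ N)"
    using small by (simp add: nn_integral_lik1_pair[OF b small] ennreal_power)
  also have "(1 / sqrt (1 - \<beta>\<^sup>2 * (ip n x x')\<^sup>2)) ^ N = (1 - \<beta>\<^sup>2 * (ip n x x')\<^sup>2) powr (- real N / 2)"
    using small by (simp add: powr_minus_divide powr_half_sqrt[symmetric] powr_realpow[symmetric] powr_powr power_divide)
  finally show ?thesis .
qed

lemma rotated_exists:
  assumes "\<beta> \<ge> 0" "ip (Suc m) x x \<noteq> 0"
  obtains T T' where "rotated \<beta> m x T T'"
  using assms isom_to_last[of m x] unfolding rotated_def by metis

lemma spike_zero: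
  assumes "ip n x x = 0" "v \<in> space (gauss n)"
  shows "spike \<beta> n x v = v"
  using assms by (auto simp: spike_def fun_eq_iff space_PiM PiE_def extensional_def)

lemma lik_zero:
  assumes "ip n x x = 0"
  shows "lik \<beta> n N x X = 1"
proof -
  have "ip n x v = 0" for v using ip_self_zero[OF assms] by (simp add: ip_def)
  then show ?thesis by (simp add: lik_def)
qed

lemma nn_integral_spike_lik:
  assumes b: "\<beta> \<ge> 0" and F: "F \<in> borel_measurable (gmat N n)"
  shows "(\<integral>\<^sup>+X. F (\<lambda>k\<in>{..<N}. spike \<beta> n x (X k)) \<partial>gmat N n) = (\<integral>\<^sup>+X. lik \<beta> n N x X * F X \<partial>gmat N n)"
proof (cases "ip n x x = 0")
  case True
  have "(\<lambda>k\<in>{..<N}. spike \<beta> n x (X k)) = X" if "X \<in> space (gmat N n)" for X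
  proof -
    have "X k \<in> space (gauss n)" if "k < N" for k using that \<open>X \<in> _\<close> by (auto simp: space_PiM PiE_def Pi_def extensional_def)
    then show ?thesis using \<open>X \<in> _\<close> by (auto simp: spike_zero[OF True] fun_eq_iff space_PiM PiE_def extensional_def)
  qed
  then show ?thesis by (simp add: lik_zero[OF True] cong: nn_integral_cong)
next
  case False
  then obtain m where n: "n = Suc m" by (cases n) (auto simp: ip_def)
  with False obtain T T' where "rotated \<beta> m x T T'" using rotated_exists[OF b] by blast
  then show ?thesis using rotated.nn_integral_spike[of \<beta> m x T T' F N] F unfolding n by blast
qed

lemma nn_integral_lik_1:
  assumes "\<beta> \<ge> 0"
  shows "(\<integral>\<^sup>+X. lik \<beta> n N x X \<partial>gmat N n) = 1"
proof -
  interpret prob_space "gmat N n" by (rule prob_gmat)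
  show ?thesis using nn_integral_spike_lik[OF assms, of "\<lambda>_. 1" N n x] by (simp add: emeasure_space_1)
qed

lemma lik_le:
  assumes b: "\<beta> > 0" and le: "(\<Sum>k<N. (ip n x (X k))\<^sup>2) \<le> R * ip n x x" and R: "0 \<le> R"
  shows "lik \<beta> n N x X \<le> ennreal (exp (R / 2))"
proof -
  let ?a = "\<beta> * ip n x x"
  have a: "?a \<ge> 0" using b by simp
  have "\<beta> / (1 + ?a) / 2 * (\<Sum>k<N. (ip n x (X k))\<^sup>2) \<le> \<beta> / (1 + ?a) / 2 * (R * ip n x x)"
    using le a b by (intro mult_left_mono) auto
  also have "\<dots> = (?a / (1 + ?a)) * (R / 2)" by simp
  also have "\<dots> \<le> 1 * (R / 2)" using a R by (intro mult_right_mono) auto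
  finally have "exp (\<beta> / (1 + ?a) / 2 * (\<Sum>k<N. (ip n x (X k))\<^sup>2)) \<le> exp (R / 2)" by simp
  moreover have "(1 + ?a) powr (- real N / 2) \<le> 1"
    using powr_mono[of "- real N / 2" 0 "1 + ?a"] a by simp
  ultimately have "(1 + ?a) powr (- real N / 2) * exp (\<beta> / (1 + ?a) / 2 * (\<Sum>k<N. (ip n x (X k))\<^sup>2)) \<le> 1 * exp (R / 2)"
    by (intro mult_mono) auto
  then show ?thesis unfolding lik_def by (intro ennreal_leI) simp
qed

text \<open>On the length event the second ratio is at most \<open>exp (R / 2)\<close> pointwise,
  whatever the overlap, and the first one integrates to 1.\<close>

lemma nn_integral_lik_crude:
  assumes b: "\<beta> > 0" and R: "0 \<le> R"
  shows "(\<integral>\<^sup>+X. lik \<beta> n N x X * (lik \<beta> n N x' X * indicator {X. (\<Sum>k<N. (ip n x' (X k))\<^sup>2) \<le> R * ip n x' x'} X) \<partial>gmat N n)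
    \<le> ennreal (exp (R / 2))"
proof -
  have "(\<integral>\<^sup>+X. lik \<beta> n N x X * (lik \<beta> n N x' X * indicator {X. (\<Sum>k<N. (ip n x' (X k))\<^sup>2) \<le> R * ip n x' x'} X) \<partial>gmat N n)
    \<le> (\<integral>\<^sup>+X. lik \<beta> n N x X * ennreal (exp (R / 2)) \<partial>gmat N n)"
    using lik_le[OF b _ R] by (intro nn_integral_mono mult_left_mono) (auto simp: indicator_def)
  also have "\<dots> = (\<integral>\<^sup>+X. lik \<beta> n N x X \<partial>gmat N n) * ennreal (exp (R / 2))"
    by (intro nn_integral_multc measurable_lik borel_measurable_const measurable_ident_sets refl)
  finally show ?thesis using nn_integral_lik_1[of \<beta> N n x] b by simp
qed

section \<open>The square root of the covariance matrix and the law of the observation\<close>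

definition mv :: "nat \<Rightarrow> (nat \<Rightarrow> nat \<Rightarrow> real) \<Rightarrow> (nat \<Rightarrow> real) \<Rightarrow> nat \<Rightarrow> real" where
  "mv n A v i = (\<Sum>j<n. A i j * v j)"

lemma mv_ip_symmetric:
  assumes "\<And>i j. i < n \<Longrightarrow> j < n \<Longrightarrow> A i j = A j i"
  shows "ip n (mv n A v) w = ip n v (mv n A w)"
proof -
  have "ip n (mv n A v) w = (\<Sum>i<n. \<Sum>j<n. A i j * v j * w i)" by (simp add: ip_def mv_def sum_distrib_right)
  also have "\<dots> = (\<Sum>j<n. \<Sum>i<n. A i j * v j * w i)" by (rule sum.swap)
  also have "\<dots> = (\<Sum>j<n. v j * (\<Sum>i<n. A j i * w i))"
    unfolding sum_distrib_left by (intro sum.cong refl) (use assms in simp)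
  finally show ?thesis by (simp add: ip_def mv_def)
qed

text \<open>\<open>psd_sqrt\<close> is chosen by \<open>SOME\<close>, so the argument must cover any
  positive semidefinite root \<open>A\<close>: such a root fixes vectors orthogonal to
  \<open>x\<close> and multiplies \<open>x\<close> by \<open>a\<close>, which determines its value
  at \<open>g\<close>. The explicit matrix \<open>B\<close> supplies existence.\<close>

lemma psd_sqrt_spiked_cov:
  assumes b: "\<beta> \<ge> 0" and i: "i < n"
  shows "(\<Sum>j<n. psd_sqrt n (spiked_cov \<beta> x) i j * g j) = spike \<beta> n x g i"
proof -
  define S where "S = spiked_cov \<beta> x"
  define v where "v = ip n x x"
  define a where "a = sqrt (1 + \<beta> * v)"
  have v0: "v \<ge> 0" by (simp add: v_def)
  have a2: "a\<^sup>2 = 1 + \<beta> * v" and a1: "a \<ge> 1" using b v0 by (simp_all add: a_def)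
  have x0: "x i = 0" if "v = 0" "i < n" for i using ip_self_zero[of n x i] that by (simp add: v_def)
  define c where "c = (a - 1) / v"
  define B where "B i j = (if i = j then 1 else 0) + c * x i * x j" for i j
  have c0: "c \<ge> 0" using a1 v0 by (simp add: c_def)
  have B: "psd n B \<and> (\<forall>i<n. \<forall>j<n. (\<Sum>k<n. B i k * B k j) = S i j)"
  proof (intro conjI allI impI)
    show "psd n B"
      unfolding psd_def
    proof (intro conjI allI impI)
      fix u :: "nat \<Rightarrow> real"
      have "(\<Sum>i<n. \<Sum>j<n. u i * B i j * u j) = (\<Sum>i<n. u i * u i + c * (u i * x i) * ip n x u)"
      proof (intro sum.cong refl)
        fix i assume "i \<in> {..<n}"
        have "(\<Sum>j<n. u i * B i j * u j) = (\<Sum>j<n. (if j = i then u i * u j else 0) + c * (u i * x i) * (x j * u j))"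
          by (intro sum.cong refl) (auto simp: B_def algebra_simps)
        then show "(\<Sum>j<n. u i * B i j * u j) = u i * u i + c * (u i * x i) * ip n x u"
          using \<open>i \<in> {..<n}\<close> by (simp add: sum.distrib ip_def sum_distrib_left)
      qed
      also have "\<dots> = ip n u u + c * (ip n x u)\<^sup>2"
        by (simp add: sum.distrib ip_def sum_distrib_left sum_distrib_right power2_eq_square mult_ac)
      finally show "0 \<le> (\<Sum>i<n. \<Sum>j<n. u i * B i j * u j)" using c0 by simp
    qed (simp add: B_def)
    fix i j assume ij: "i < n" "j < n"
    have "(\<Sum>k<n. B i k * B k j) = (\<Sum>k<n. (if k = i then B k j else 0) + (if k = j then c * x i * x k else 0) + c\<^sup>2 * x i * x j * (x k * x k))"
      by (intro sum.cong refl) (auto simp: B_def algebra_simps power2_eq_square)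
    also have "\<dots> = B i j + c * x i * x j + c\<^sup>2 * x i * x j * v"
      using ij by (simp add: sum.distrib sum_distrib_left[symmetric] v_def ip_def)
    also have "\<dots> = (if i = j then 1 else 0) + (2 * c + c\<^sup>2 * v) * (x i * x j)" by (simp add: B_def algebra_simps)
    also have "(2 * c + c\<^sup>2 * v) * (x i * x j) = \<beta> * (x i * x j)"
    proof (cases "v = 0")
      case False
      have "v * (2 * c + c\<^sup>2 * v) = (1 + c * v)\<^sup>2 - 1" by (simp add: power2_eq_square algebra_simps)
      also have "1 + c * v = a" using False by (simp add: c_def)
      finally have "v * (2 * c + c\<^sup>2 * v) = v * \<beta>" by (simp add: a2)
      then show ?thesis using False by simp
    qed (use x0 ij in simp)
    finally show "(\<Sum>k<n. B i k * B k j) = S i j" by (simp add: S_def spiked_cov_def)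
  qed
  define A where "A = psd_sqrt n S"
  have "psd n A \<and> (\<forall>i<n. \<forall>j<n. (\<Sum>k<n. A i k * A k j) = S i j)"
    unfolding A_def psd_sqrt_def by (rule someI[where P="\<lambda>A. psd n A \<and> (\<forall>i<n. \<forall>j<n. (\<Sum>k<n. A i k * A k j) = S i j)", OF B])
  then have sym: "\<And>i j. i < n \<Longrightarrow> j < n \<Longrightarrow> A i j = A j i"
    and pos: "\<And>u. 0 \<le> ip n u (mv n A u)"
    and sq: "\<And>i j. i < n \<Longrightarrow> j < n \<Longrightarrow> (\<Sum>k<n. A i k * A k j) = S i j"
    by (auto simp: psd_def ip_def mv_def sum_distrib_left mult.assoc)
  note adj = mv_ip_symmetric[of n A, OF sym]
  have A2: "mv n A (mv n A u) i = u i + \<beta> * ip n x u * x i" if "i < n" for u i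
  proof -
    have "mv n A (mv n A u) i = (\<Sum>k<n. \<Sum>j<n. A i k * A k j * u j)"
      by (simp add: mv_def sum_distrib_left mult.assoc)
    also have "\<dots> = (\<Sum>j<n. (\<Sum>k<n. A i k * A k j) * u j)"
      by (subst sum.swap) (simp add: sum_distrib_right)
    also have "\<dots> = (\<Sum>j<n. S i j * u j)"
      using that by (intro sum.cong refl) (simp add: sq)
    also have "\<dots> = (\<Sum>j<n. (if j = i then u j else 0) + \<beta> * x i * (x j * u j))"
      by (intro sum.cong refl) (auto simp: S_def spiked_cov_def algebra_simps)
    also have "\<dots> = u i + \<beta> * ip n x u * x i"
      using that by (simp add: sum.distrib sum_distrib_left[symmetric] ip_def)
    finally show ?thesis .
  qed
  have mv_cong: "mv n A u i = mv n A u' i" if "\<And>j. j < n \<Longrightarrow> u j = u' j" for u u' i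
    using that by (simp add: mv_def)
  have mv_lin: "mv n A (\<lambda>j. u j + r * w j) i = mv n A u i + r * mv n A w i" for u w r i
    by (simp add: mv_def sum.distrib sum_distrib_left algebra_simps)
  \<comment> \<open>Since the square of \<open>A\<close> fixes \<open>p\<close>, the difference
    \<open>y\<close> of \<open>A p\<close> and \<open>p\<close> satisfies \<open>A y = - y\<close>;
    positivity then leaves only \<open>y = 0\<close>.\<close>
  have fixed: "mv n A p i = p i" if p: "ip n x p = 0" and i: "i < n" for p i
  proof -
    define y where "y i = mv n A p i + (- 1) * p i" for i
    have "mv n A y i = - y i" if "i < n" for i
    proof -
      have "mv n A y i = mv n A (mv n A p) i + (- 1) * mv n A p i"
        unfolding y_def by (rule mv_lin)
      then show ?thesis using A2[OF that, of p] p by (simp add: y_def)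
    qed
    then have "ip n y (mv n A y) = - ip n y y" by (simp add: ip_def sum_negf[symmetric])
    with pos[of y] have "ip n y y = 0" using ip_self_nonneg[of n y] by linarith
    from ip_self_zero[OF this i] show ?thesis by (simp add: y_def)
  qed
  have eig: "mv n A x i = a * x i" if i: "i < n" for i
  proof (cases "\<beta> = 0 \<or> v = 0")
    case True
    then have a: "a = 1 \<or> v = 0" by (auto simp: a_def)
    show ?thesis
    proof (cases "v = 0")
      case True
      then have "ip n x x = 0" by (simp add: v_def)
      then have "mv n A x i = x i" using fixed i by blast
      then show ?thesis using x0[OF True i] by simp
    next
      case False
      with \<open>\<beta> = 0 \<or> v = 0\<close> have "\<beta> = 0" by simp
      define y where "y i = mv n A x i + (- 1) * x i" for i
      have "mv n A y i = - y i" if "i < n" for i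
      proof -
        have "mv n A y i = mv n A (mv n A x) i + (- 1) * mv n A x i"
          unfolding y_def by (rule mv_lin)
        then show ?thesis using A2[OF that, of x] \<open>\<beta> = 0\<close> by (simp add: y_def)
      qed
      then have "ip n y (mv n A y) = - ip n y y" by (simp add: ip_def sum_negf[symmetric])
      with pos[of y] have "ip n y y = 0" using ip_self_nonneg[of n y] by linarith
      from ip_self_zero[OF this i] show ?thesis using False \<open>\<beta> = 0\<close> by (simp add: y_def a_def)
    qed
  next
    case False
    then have bv: "\<beta> > 0" "v > 0" using b v0 by auto
    define y where "y = mv n A x"
    \<comment> \<open>\<open>A\<close> commutes with its square, so \<open>y = A x\<close> is again
      an eigenvector of \<open>I + \<beta> x x^T\<close> for \<open>1 + \<beta> * v\<close>, or
      zero. As \<open>\<beta> * v > 0\<close>, that eigenspace is the line through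
      \<open>x\<close>.\<close>
    have "v * y i = ip n x y * x i" if i: "i < n" for i
    proof -
      have "mv n A (mv n A y) i = mv n A (\<lambda>j. x j + (\<beta> * v) * x j) i"
        unfolding y_def by (rule mv_cong) (simp add: A2 v_def)
      also have "\<dots> = y i + (\<beta> * v) * y i" by (simp only: mv_lin y_def)
      finally show ?thesis using A2[OF i, of y] bv by simp
    qed
    then have y: "y i = ip n x y / v * x i" if "i < n" for i using that bv by (simp add: field_simps)
    define l where "l = ip n x y / v"
    have l0: "l \<ge> 0" using pos[of x] bv by (simp add: l_def y_def)
    have l2: "l\<^sup>2 * x i = a\<^sup>2 * x i" if i: "i < n" for i
    proof -
      have "mv n A y i = mv n A (\<lambda>j. 0 + l * x j) i" by (rule mv_cong) (simp add: y l_def)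
      also have "\<dots> = l * y i" unfolding mv_lin by (simp add: mv_def y_def)
      also have "\<dots> = l\<^sup>2 * x i" using y[OF i] by (simp add: l_def power2_eq_square)
      finally have "l\<^sup>2 * x i = mv n A (mv n A x) i" by (simp only: y_def)
      also have "\<dots> = a\<^sup>2 * x i" unfolding A2[OF i] a2 v_def by (simp only: ring_distribs mult_1_left)
      finally show ?thesis .
    qed
    have "\<exists>j<n. x j \<noteq> 0"
    proof (rule ccontr)
      assume "\<not> ?thesis"
      then have "v = 0" by (simp add: v_def ip_def)
      then show False using bv by simp
    qed
    then obtain j where "j < n" "x j \<noteq> 0" by blast
    with l2[of j] have "l\<^sup>2 = a\<^sup>2" by simp
    then have "l = a" using l0 a1 by (simp add: power2_eq_iff)
    then show ?thesis using y[OF i] by (simp add: y_def l_def)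
  qed
  define r where "r = ip n x g / v"
  define p where "p i = g i + (- r) * x i" for i
  have "ip n x p = 0"
  proof (cases "v = 0")
    case True
    then show ?thesis using x0 by (simp add: ip_def)
  next
    case False
    have "ip n x p = ip n p x" by (rule ip_commute)
    also have "\<dots> = ip n g x + (- r) * ip n x x" unfolding p_def by (simp only: ip_add_left ip_scale_left)
    finally show ?thesis using False by (simp add: r_def ip_commute[of n g] v_def)
  qed
  have "mv n A g i = mv n A (\<lambda>j. p j + r * x j) i" by (rule mv_cong) (simp add: p_def)
  also have "\<dots> = p i + r * (a * x i)" using fixed[OF \<open>ip n x p = 0\<close> i] eig[OF i] by (simp add: mv_lin)
  also have "\<dots> = g i + (a - 1) * r * x i" by (simp add: p_def algebra_simps)
  also have "\<dots> = spike \<beta> n x g i"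
    unfolding spike_def a_def v_def r_def using i by simp
  finally show ?thesis by (simp add: mv_def A_def S_def)
qed

lemma multi_normal_spiked:
  assumes "\<beta> \<ge> 0"
  shows "multi_normal n (spiked_cov \<beta> x) = distr (gauss n) (gauss n) (spike \<beta> n x)"
  unfolding multi_normal_def
proof (rule distr_cong)
  show "sets (vec_borel n) = sets (gauss n)" by (simp only: sets_gauss)
  show "(\<lambda>i\<in>{..<n}. \<Sum>j<n. psd_sqrt n (spiked_cov \<beta> x) i j * g j) = spike \<beta> n x g" for g
  proof
    fix i show "(\<lambda>i\<in>{..<n}. \<Sum>j<n. psd_sqrt n (spiked_cov \<beta> x) i j * g j) i = spike \<beta> n x g i"
      using psd_sqrt_spiked_cov[OF assms, of i n x g] by (cases "i < n") (auto simp: spike_def)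
  qed
qed simp

lemma measurable_Some_option_algebra: "Some \<in> M \<rightarrow>\<^sub>M option_algebra M"
  unfolding option_algebra_def
proof (rule measurable_measure_of)
  show "insert {None} ((`) Some ` sets M) \<subseteq> Pow (insert None (Some ` space M))"
    using sets.sets_into_space[of _ M] by auto
  show "Some \<in> space M \<rightarrow> insert None (Some ` space M)" by auto
  fix B assume "B \<in> insert {None} ((`) Some ` sets M)"
  then consider "B = {None}" | A where "A \<in> sets M" "B = Some ` A" by blast
  then show "Some -` B \<inter> space M \<in> sets M"
  proof cases
    case 1
    then have "Some -` B \<inter> space M = {}" by blast
    then show ?thesis by (simp only: sets.empty_sets)
  next
    case 2
    have "A \<subseteq> space M" by (rule sets.sets_into_space[OF 2(1)])
    then have "Some -` B \<inter> space M = A" unfolding 2(2) by blast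
    then show ?thesis using 2(1) by (simp only:)
  qed
qed

lemma measurable_sample_cov: "(\<lambda>X. Some (sample_cov n N X)) \<in> gmat N n \<rightarrow>\<^sub>M option_algebra (mat_borel n)"
proof (rule measurable_compose[OF _ measurable_Some_option_algebra])
  have "sample_cov n N = (\<lambda>X. \<lambda>ij\<in>{..<n} \<times> {..<n}. (1 / real N) * (\<Sum>k<N. X k (fst ij) * X k (snd ij)))"
    by (simp add: sample_cov_def fun_eq_iff case_prod_beta)
  also have "\<dots> \<in> gmat N n \<rightarrow>\<^sub>M mat_borel n"
    by (intro measurable_restrict borel_measurable_times borel_measurable_const borel_measurable_sum
        measurable_gauss_comp[OF measurable_gmat_col]) auto
  finally show "sample_cov n N \<in> gmat N n \<rightarrow>\<^sub>M mat_borel n" .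
qed

text \<open>For nonnegative \<open>\<beta>\<close> the failure branch is void, and the columns are
  independent images of standard Gaussian vectors under \<open>spike\<close>.\<close>

lemma wishart_given_eq:
  assumes "\<beta> \<ge> 0"
  shows "wishart_given \<beta> n N x = distr (gmat N n) (option_algebra (mat_borel n))
    (\<lambda>X. Some (sample_cov n N (\<lambda>k\<in>{..<N}. spike \<beta> n x (X k))))"
proof -
  have m: "spike \<beta> n x \<in> gauss n \<rightarrow>\<^sub>M gauss n"
    by (rule measurable_spike) (auto intro: measurable_ident_sets)
  have mc: "compose {..<N} (spike \<beta> n x) \<in> gmat N n \<rightarrow>\<^sub>M gmat N n"
    unfolding compose_def by (intro measurable_restrict measurable_compose[OF measurable_gmat_col m]) auto
  have "(\<Pi>\<^sub>M k\<in>{..<N}. multi_normal n (spiked_cov \<beta> x)) = distr (gmat N n) (gmat N n) (compose {..<N} (spike \<beta> n x))"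
    unfolding multi_normal_spiked[OF assms]
    by (rule distr_PiM_finite_prob_space'[symmetric]) (auto intro: prob_gauss m)
  then have "wishart_given \<beta> n N x = distr (distr (gmat N n) (gmat N n) (compose {..<N} (spike \<beta> n x))) (option_algebra (mat_borel n)) (\<lambda>X. Some (sample_cov n N X))"
    using assms by (simp add: wishart_given_def)
  also have "\<dots> = distr (gmat N n) (option_algebra (mat_borel n)) ((\<lambda>X. Some (sample_cov n N X)) \<circ> compose {..<N} (spike \<beta> n x))"
    by (rule distr_distr[OF measurable_sample_cov mc])
  finally show ?thesis by (simp add: comp_def compose_def)
qed

lemma emeasure_spiked_wishart:
  assumes b: "\<beta> \<ge> 0" and x: "sets (\<X> n) = sets (vec_borel n)" "prob_space (\<X> n)"
    and A: "A \<in> sets (option_algebra (mat_borel n))"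
  shows "emeasure (spiked_wishart \<beta> \<X> N n) A
    = (\<integral>\<^sup>+x. \<integral>\<^sup>+X. lik \<beta> n (N n) x X * indicator ((\<lambda>X. Some (sample_cov n (N n) X)) -` A \<inter> space (gmat (N n) n)) X \<partial>gmat (N n) n \<partial>\<X> n)"
    and "sets (spiked_wishart \<beta> \<X> N n) = sets (option_algebra (mat_borel n))"
proof -
  interpret X: prob_space "\<X> n" by fact
  let ?O = "option_algebra (mat_borel n)" and ?S = "\<lambda>X. Some (sample_cov n (N n) X)"
  let ?f = "\<lambda>x X. \<lambda>k\<in>{..<N n}. spike \<beta> n x (X k)"
  have x_comp: "(\<lambda>p. fst p i) \<in> borel_measurable (\<X> n \<Otimes>\<^sub>M M)" if "i < n" for i and M :: "'z measure"
  proof -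
    have "(\<lambda>x. x i) \<in> borel_measurable (vec_borel n)"
      using that by (intro measurable_component_singleton) simp
    then have "(\<lambda>x. x i) \<in> borel_measurable (\<X> n)" by (simp only: measurable_cong_sets[OF x(1) refl])
    then show ?thesis by (rule measurable_compose[OF measurable_fst])
  qed
  have f: "(\<lambda>p. ?f (fst p) (snd p)) \<in> \<X> n \<Otimes>\<^sub>M gmat (N n) n \<rightarrow>\<^sub>M gmat (N n) n"
    by (intro measurable_restrict measurable_spike x_comp measurable_gmat_comp[OF measurable_snd]) auto
  have k: "wishart_given \<beta> n (N n) \<in> \<X> n \<rightarrow>\<^sub>M subprob_algebra ?O"
  proof -
    have "wishart_given \<beta> n (N n) = (\<lambda>x. distr (gmat (N n) n) ?O (\<lambda>X. ?S (?f x X)))"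
      by (rule ext) (rule wishart_given_eq[OF b])
    also have "\<dots> \<in> \<X> n \<rightarrow>\<^sub>M subprob_algebra ?O"
      by (rule measurable_distr2[where M="gmat (N n) n"])
        (use measurable_compose[OF f measurable_sample_cov] prob_space.M_in_subprob[OF prob_gmat] in
          \<open>simp_all only: case_prod_beta' measurable_const\<close>)
    finally show ?thesis .
  qed
  show "sets (spiked_wishart \<beta> \<X> N n) = sets ?O"
    unfolding spiked_wishart_def by (rule sets_bind) (use measurable_space[OF k] X.not_empty in \<open>auto simp: space_subprob_algebra\<close>)
  have "emeasure (spiked_wishart \<beta> \<X> N n) A = (\<integral>\<^sup>+x. emeasure (wishart_given \<beta> n (N n) x) A \<partial>\<X> n)"
    unfolding spiked_wishart_def by (rule emeasure_bind[OF X.not_empty k A])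
  also have "\<dots> = (\<integral>\<^sup>+x. \<integral>\<^sup>+X. lik \<beta> n (N n) x X * indicator (?S -` A \<inter> space (gmat (N n) n)) X \<partial>gmat (N n) n \<partial>\<X> n)"
  proof (rule nn_integral_cong)
    fix x
    have m: "?f x \<in> gmat (N n) n \<rightarrow>\<^sub>M gmat (N n) n"
      by (intro measurable_restrict measurable_spike borel_measurable_const measurable_gmat_col) auto
    have B: "?S -` A \<inter> space (gmat (N n) n) \<in> sets (gmat (N n) n)"
      by (rule measurable_sets[OF measurable_sample_cov A])
    have "emeasure (wishart_given \<beta> n (N n) x) A = emeasure (gmat (N n) n) ((\<lambda>X. ?S (?f x X)) -` A \<inter> space (gmat (N n) n))"
      unfolding wishart_given_eq[OF b] by (rule emeasure_distr[OF measurable_compose[OF m measurable_sample_cov] A])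
    also have "\<dots> = (\<integral>\<^sup>+X. indicator ((\<lambda>X. ?S (?f x X)) -` A \<inter> space (gmat (N n) n)) X \<partial>gmat (N n) n)"
      by (rule nn_integral_indicator[symmetric]) (rule measurable_sets[OF measurable_compose[OF m measurable_sample_cov] A])
    also have "\<dots> = (\<integral>\<^sup>+X. indicator (?S -` A \<inter> space (gmat (N n) n)) (?f x X) \<partial>gmat (N n) n)"
      by (intro nn_integral_cong) (use measurable_space[OF m] in \<open>auto simp: indicator_def\<close>)
    also have "\<dots> = (\<integral>\<^sup>+X. lik \<beta> n (N n) x X * indicator (?S -` A \<inter> space (gmat (N n) n)) X \<partial>gmat (N n) n)"
      by (rule nn_integral_spike_lik[OF b]) (use B in simp)
    finally show "emeasure (wishart_given \<beta> n (N n) x) A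
      = (\<integral>\<^sup>+X. lik \<beta> n (N n) x X * indicator (?S -` A \<inter> space (gmat (N n) n)) X \<partial>gmat (N n) n)" .
  qed
  finally show "emeasure (spiked_wishart \<beta> \<X> N n) A
    = (\<integral>\<^sup>+x. \<integral>\<^sup>+X. lik \<beta> n (N n) x X * indicator (?S -` A \<inter> space (gmat (N n) n)) X \<partial>gmat (N n) n \<partial>\<X> n)" .
qed

text \<open>The observation is a function of the data matrix, so it suffices to treat every sequence
  of events of the data. In the unspiked model the likelihood ratio is 1 for all spikes, so its
  probabilities are those of \<open>gmat\<close>.\<close>

lemma contiguous_spiked_wishartI:
  assumes b: "\<beta> \<ge> 0" and x: "\<And>n. sets (\<X> n) = sets (vec_borel n)" "\<And>n. prob_space (\<X> n)"
    and lim: "\<And>B. (\<And>n. B n \<in> sets (gmat (N n) n)) \<Longrightarrow> (\<lambda>n. emeasure (gmat (N n) n) (B n)) \<longlonglongrightarrow> 0 \<Longrightarrow>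
      (\<lambda>n. \<integral>\<^sup>+x. \<integral>\<^sup>+X. lik \<beta> n (N n) x X * indicator (B n) X \<partial>gmat (N n) n \<partial>\<X> n) \<longlonglongrightarrow> 0"
  shows "contiguous (spiked_wishart \<beta> \<X> N) (unspiked_wishart \<X> N)"
  unfolding contiguous_def
proof (intro allI impI)
  fix A assume "\<forall>n. A n \<in> sets (unspiked_wishart \<X> N n)"
    and l: "(\<lambda>n. measure (unspiked_wishart \<X> N n) (A n)) \<longlonglongrightarrow> 0"
  moreover have "sets (unspiked_wishart \<X> N n) = sets (option_algebra (mat_borel n))" for n
    unfolding unspiked_wishart_def
    by (rule emeasure_spiked_wishart(2)[where \<X>=\<X> and n=n, OF order_refl x(1) x(2) sets.empty_sets])
  ultimately have A: "A n \<in> sets (option_algebra (mat_borel n))" for n by blast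
  define B where "B n = (\<lambda>X. Some (sample_cov n (N n) X)) -` A n \<inter> space (gmat (N n) n)" for n
  have B: "B n \<in> sets (gmat (N n) n)" for n unfolding B_def by (rule measurable_sets[OF measurable_sample_cov A])
  interpret G: prob_space "gmat (N n) n" for n by (rule prob_gmat)
  interpret X: prob_space "\<X> n" for n by (rule x)
  have l0: "lik 0 n N' x X = 1" for n N' x X by (simp add: lik_def)
  have "emeasure (unspiked_wishart \<X> N n) (A n) = emeasure (gmat (N n) n) (B n)" for n
    unfolding unspiked_wishart_def emeasure_spiked_wishart(1)[where \<X>=\<X> and n=n, OF order_refl x(1) x(2) A]
    using B[of n] by (simp add: l0 B_def[symmetric] X.emeasure_space_1)
  then have "measure (unspiked_wishart \<X> N n) (A n) = measure (gmat (N n) n) (B n)" for n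
    by (simp add: measure_def)
  with l have "(\<lambda>n. ennreal (measure (gmat (N n) n) (B n))) \<longlonglongrightarrow> ennreal 0" by (intro tendsto_ennrealI) simp
  then have "(\<lambda>n. emeasure (gmat (N n) n) (B n)) \<longlonglongrightarrow> 0" by (simp add: G.emeasure_eq_measure)
  from lim[OF B this] have "(\<lambda>n. emeasure (spiked_wishart \<beta> \<X> N n) (A n)) \<longlonglongrightarrow> 0"
    unfolding B_def by (simp only: emeasure_spiked_wishart(1)[where \<X>=\<X>, OF b x(1) x(2) A])
  then have "(\<lambda>n. enn2real (emeasure (spiked_wishart \<beta> \<X> N n) (A n))) \<longlonglongrightarrow> enn2real 0"
    by (intro tendsto_enn2real) auto
  then show "(\<lambda>n. measure (spiked_wishart \<beta> \<X> N n) (A n)) \<longlonglongrightarrow> 0" by (simp add: measure_def)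
qed

subsection \<open>Overlap and norm under the prior\<close>

lemma exp_taylor3:
  fixes y :: real
  shows "exp y \<le> 1 + y + y\<^sup>2 / 2 + \<bar>y\<bar> ^ 3 * exp \<bar>y\<bar>"
proof -
  obtain t where t: "\<bar>t\<bar> \<le> \<bar>y\<bar>" "exp y = (\<Sum>m<3. (y ^ m) / fact m) + (exp t / fact 3) * y ^ 3"
    using Maclaurin_exp_le[of y 3] by blast
  have "(exp t / fact 3) * y ^ 3 \<le> \<bar>(exp t / fact 3) * y ^ 3\<bar>" by (rule abs_ge_self)
  also have "\<dots> = exp t * \<bar>y\<bar> ^ 3 / 6" by (simp add: abs_mult power_abs fact_numeral)
  also have "\<dots> \<le> exp \<bar>y\<bar> * \<bar>y\<bar> ^ 3" using t(1) by (intro mult_mono order_trans[OF _ mult_right_mono[of "exp t" "exp \<bar>y\<bar>"]]) auto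
  finally show ?thesis using t(2) by (simp add: numeral_3_eq_3 power2_eq_square algebra_simps)
qed

lemma power3_le_exp:
  fixes x :: real assumes "0 \<le> x" shows "x ^ 3 \<le> 6 * exp x"
proof -
  have "x ^ 3 / fact 3 \<le> (\<Sum>k<4. x ^ k / fact k)"
    using assms by (intro member_le_sum) auto
  also have "\<dots> \<le> exp x"
  proof -
    obtain t where "exp x = (\<Sum>m<4. (x ^ m) / fact m) + (exp t / fact 4) * x ^ 4"
      using Maclaurin_exp_le[of x 4] by blast
    then show ?thesis using assms by simp
  qed
  finally show ?thesis by (simp add: fact_numeral)
qed

context
  fixes \<pi> :: "real measure"
  assumes p: "prob_space \<pi>" and sets_pi: "sets \<pi> = sets borel"
    and m1i: "integrable \<pi> (\<lambda>t. t)" and m1: "(\<integral>t. t \<partial>\<pi>) = 0"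
    and m2i: "integrable \<pi> (\<lambda>t. t\<^sup>2)" and m2: "(\<integral>t. t\<^sup>2 \<partial>\<pi>) = 1"
    and mgf: "\<exists>a b. a < 0 \<and> 0 < b \<and> (\<forall>\<theta>\<in>{a<..<b}. product_mgf \<pi> \<theta> < \<infinity>)"
begin

interpretation P: prob_space \<pi> by (rule p)
interpretation PP: pair_prob_space \<pi> \<pi> ..

lemma measurable_pi: "(\<lambda>t. t) \<in> borel_measurable \<pi>"
  using measurable_ident_sets[OF sets_pi] by simp

lemma measurable_pair_prod [measurable]: "(\<lambda>p. fst p * snd p) \<in> borel_measurable (\<pi> \<Otimes>\<^sub>M \<pi>)"
  by (intro borel_measurable_times measurable_compose[OF measurable_fst measurable_pi] measurable_compose[OF measurable_snd measurable_pi])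

text \<open>A third order Taylor expansion under the integral. By independence the product has mean
  0 and second moment 1, and \<open>C\<close> is its third absolute moment with an exponential
  weight.\<close>

lemma product_mgf_bound:
  "\<exists>C \<theta>1. 0 \<le> C \<and> 0 < \<theta>1 \<and> \<theta>1 \<le> 1 \<and> (\<forall>\<theta>. \<bar>\<theta>\<bar> \<le> \<theta>1 \<longrightarrow> product_mgf \<pi> \<theta> \<le> ennreal (exp (\<theta>\<^sup>2 / 2 + C * \<bar>\<theta>\<bar> ^ 3)))
    \<and> integrable (\<pi> \<Otimes>\<^sub>M \<pi>) (\<lambda>p. \<bar>fst p * snd p\<bar> ^ 3 * exp (\<theta>1 * \<bar>fst p * snd p\<bar>))
    \<and> integrable (\<pi> \<Otimes>\<^sub>M \<pi>) (\<lambda>p. exp (\<theta>1 * \<bar>fst p * snd p\<bar>))"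
proof -
  let ?w = "\<lambda>p :: real \<times> real. fst p * snd p"
  obtain a b where ab: "a < 0" "0 < b" "\<And>\<theta>. a < \<theta> \<Longrightarrow> \<theta> < b \<Longrightarrow> product_mgf \<pi> \<theta> < \<infinity>"
    using mgf by auto
  \<comment> \<open>\<open>2 * \<theta>1\<close> and its negative still lie inside the interval of
    finiteness; the spare exponential factor absorbs the third power.\<close>
  define \<theta>1 where "\<theta>1 = min 1 (min (- a) b / 4)"
  have th: "0 < \<theta>1" "\<theta>1 \<le> 1" "a < - (2 * \<theta>1)" "2 * \<theta>1 < b" using ab(1,2) by (auto simp: \<theta>1_def min_def)
  have mg: "product_mgf \<pi> \<theta> = (\<integral>\<^sup>+p. ennreal (exp (\<theta> * ?w p)) \<partial>(\<pi> \<Otimes>\<^sub>M \<pi>))" for \<theta>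
    by (simp add: product_mgf_def case_prod_beta')
  have int: "integrable (\<pi> \<Otimes>\<^sub>M \<pi>) (\<lambda>p. exp (\<theta> * ?w p))" if "a < \<theta>" "\<theta> < b" for \<theta>
    by (rule integrableI_nonneg) (use ab(3)[OF that] mg in auto)
  have "integrable (\<pi> \<Otimes>\<^sub>M \<pi>) (\<lambda>p. exp ((2 * \<theta>1) * ?w p) + exp ((- (2 * \<theta>1)) * ?w p))"
    using th by (intro Bochner_Integration.integrable_add int) auto
  then have intabs: "integrable (\<pi> \<Otimes>\<^sub>M \<pi>) (\<lambda>p. exp (2 * \<theta>1 * \<bar>?w p\<bar>))"
  proof (rule Bochner_Integration.integrable_bound)
    show "AE p in \<pi> \<Otimes>\<^sub>M \<pi>. norm (exp (2 * \<theta>1 * \<bar>?w p\<bar>)) \<le> norm (exp ((2 * \<theta>1) * ?w p) + exp ((- (2 * \<theta>1)) * ?w p))"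
    proof (rule AE_I2)
      fix p :: "real \<times> real"
      have "exp (2 * \<theta>1 * \<bar>?w p\<bar>) \<le> exp ((2 * \<theta>1) * ?w p) + exp ((- (2 * \<theta>1)) * ?w p)"
        by (cases "?w p \<ge> 0") (simp_all add: add_increasing add_increasing2)
      moreover have "0 < exp ((2 * \<theta>1) * ?w p) + exp ((- (2 * \<theta>1)) * ?w p)" by (simp add: add_pos_pos)
      ultimately show "norm (exp (2 * \<theta>1 * \<bar>?w p\<bar>)) \<le> norm (exp ((2 * \<theta>1) * ?w p) + exp ((- (2 * \<theta>1)) * ?w p))"
        unfolding real_norm_def by (simp only: abs_of_pos exp_gt_zero)
    qed
  qed measurable
  have int1: "integrable (\<pi> \<Otimes>\<^sub>M \<pi>) (\<lambda>p. exp (\<theta>1 * \<bar>?w p\<bar>))"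
    by (rule Bochner_Integration.integrable_bound[OF intabs]) (use th in \<open>auto intro!: AE_I2 mult_right_mono\<close>)
  have int3: "integrable (\<pi> \<Otimes>\<^sub>M \<pi>) (\<lambda>p. \<bar>?w p\<bar> ^ 3 * exp (\<theta>1 * \<bar>?w p\<bar>))"
  proof (rule Bochner_Integration.integrable_bound)
    show "integrable (\<pi> \<Otimes>\<^sub>M \<pi>) (\<lambda>p. (6 / \<theta>1 ^ 3) * exp (2 * \<theta>1 * \<bar>?w p\<bar>))" using intabs by simp
    show "AE p in \<pi> \<Otimes>\<^sub>M \<pi>. norm (\<bar>?w p\<bar> ^ 3 * exp (\<theta>1 * \<bar>?w p\<bar>)) \<le> norm ((6 / \<theta>1 ^ 3) * exp (2 * \<theta>1 * \<bar>?w p\<bar>))"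
    proof (rule AE_I2)
      fix p
      have "(\<theta>1 * \<bar>?w p\<bar>) ^ 3 \<le> 6 * exp (\<theta>1 * \<bar>?w p\<bar>)" using th by (intro power3_le_exp) simp
      then have "\<bar>?w p\<bar> ^ 3 \<le> (6 / \<theta>1 ^ 3) * exp (\<theta>1 * \<bar>?w p\<bar>)" using th by (simp add: power_mult_distrib field_simps)
      then have "\<bar>?w p\<bar> ^ 3 * exp (\<theta>1 * \<bar>?w p\<bar>) \<le> (6 / \<theta>1 ^ 3) * exp (\<theta>1 * \<bar>?w p\<bar>) * exp (\<theta>1 * \<bar>?w p\<bar>)"
        by (intro mult_right_mono) auto
      also have "\<dots> = (6 / \<theta>1 ^ 3) * exp (2 * \<theta>1 * \<bar>?w p\<bar>)" by (simp add: exp_add[symmetric])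
      finally show "norm (\<bar>?w p\<bar> ^ 3 * exp (\<theta>1 * \<bar>?w p\<bar>)) \<le> norm ((6 / \<theta>1 ^ 3) * exp (2 * \<theta>1 * \<bar>?w p\<bar>))"
        using th by simp
    qed
  qed measurable
  have intw: "integrable (\<pi> \<Otimes>\<^sub>M \<pi>) ?w" and intw2: "integrable (\<pi> \<Otimes>\<^sub>M \<pi>) (\<lambda>p. (?w p)\<^sup>2)"
  proof -
    have 1: "\<bar>w\<bar> \<le> (1 + \<bar>w\<bar> ^ 3) * exp (\<theta>1 * \<bar>w\<bar>)" "w\<^sup>2 \<le> (1 + \<bar>w\<bar> ^ 3) * exp (\<theta>1 * \<bar>w\<bar>)" for w :: real
    proof -
      have e: "1 \<le> exp (\<theta>1 * \<bar>w\<bar>)" using th by simp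
      have "\<bar>w\<bar> \<le> 1 + \<bar>w\<bar> ^ 3 \<and> w\<^sup>2 \<le> 1 + \<bar>w\<bar> ^ 3"
      proof (cases "\<bar>w\<bar> \<le> 1")
        case True
        then have "w\<^sup>2 \<le> 1" by (simp add: abs_square_le_1)
        then show ?thesis using True by (smt (verit) zero_le_power abs_ge_zero)
      next
        case False
        then have "\<bar>w\<bar> ^ 1 \<le> \<bar>w\<bar> ^ 3" "\<bar>w\<bar>\<^sup>2 \<le> \<bar>w\<bar> ^ 3" by (intro power_increasing; simp)+
        then show ?thesis by simp
      qed
      moreover have "1 + \<bar>w\<bar> ^ 3 \<le> (1 + \<bar>w\<bar> ^ 3) * exp (\<theta>1 * \<bar>w\<bar>)" using mult_left_mono[OF e, of "1 + \<bar>w\<bar> ^ 3"] by simp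
      ultimately show "\<bar>w\<bar> \<le> (1 + \<bar>w\<bar> ^ 3) * exp (\<theta>1 * \<bar>w\<bar>)" "w\<^sup>2 \<le> (1 + \<bar>w\<bar> ^ 3) * exp (\<theta>1 * \<bar>w\<bar>)" by linarith+
    qed
    have 2: "integrable (\<pi> \<Otimes>\<^sub>M \<pi>) (\<lambda>p. (1 + \<bar>?w p\<bar> ^ 3) * exp (\<theta>1 * \<bar>?w p\<bar>))"
      using Bochner_Integration.integrable_add[OF int1 int3] by (simp add: ring_distribs)
    show "integrable (\<pi> \<Otimes>\<^sub>M \<pi>) ?w"
      by (rule Bochner_Integration.integrable_bound[OF 2]) (use 1 in \<open>auto intro!: AE_I2\<close>)
    show "integrable (\<pi> \<Otimes>\<^sub>M \<pi>) (\<lambda>p. (?w p)\<^sup>2)"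
      by (rule Bochner_Integration.integrable_bound[OF 2]) (use 1 in \<open>auto intro!: AE_I2\<close>)
  qed
  have Ew: "(\<integral>p. ?w p \<partial>(\<pi> \<Otimes>\<^sub>M \<pi>)) = 0"
    using PP.integral_fst'[of ?w] intw m1 by simp
  have Ew2: "(\<integral>p. (?w p)\<^sup>2 \<partial>(\<pi> \<Otimes>\<^sub>M \<pi>)) = 1"
    using PP.integral_fst'[of "\<lambda>p. (?w p)\<^sup>2"] intw2 m2 by (simp add: power_mult_distrib)
  define C where "C = (\<integral>p. \<bar>?w p\<bar> ^ 3 * exp (\<theta>1 * \<bar>?w p\<bar>) \<partial>(\<pi> \<Otimes>\<^sub>M \<pi>))"
  have C: "0 \<le> C" unfolding C_def by (intro integral_nonneg_AE AE_I2) simp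
  have "product_mgf \<pi> \<theta> \<le> ennreal (exp (\<theta>\<^sup>2 / 2 + C * \<bar>\<theta>\<bar> ^ 3))" if \<theta>: "\<bar>\<theta>\<bar> \<le> \<theta>1" for \<theta>
  proof -
    have i: "integrable (\<pi> \<Otimes>\<^sub>M \<pi>) (\<lambda>p. exp (\<theta> * ?w p))" using \<theta> th by (intro int) auto
    have "(\<integral>p. exp (\<theta> * ?w p) \<partial>(\<pi> \<Otimes>\<^sub>M \<pi>))
      \<le> (\<integral>p. 1 + \<theta> * ?w p + \<theta>\<^sup>2 / 2 * (?w p)\<^sup>2 + \<bar>\<theta>\<bar> ^ 3 * (\<bar>?w p\<bar> ^ 3 * exp (\<theta>1 * \<bar>?w p\<bar>)) \<partial>(\<pi> \<Otimes>\<^sub>M \<pi>))"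
    proof (rule integral_mono[OF i])
      show "integrable (\<pi> \<Otimes>\<^sub>M \<pi>) (\<lambda>p. 1 + \<theta> * ?w p + \<theta>\<^sup>2 / 2 * (?w p)\<^sup>2 + \<bar>\<theta>\<bar> ^ 3 * (\<bar>?w p\<bar> ^ 3 * exp (\<theta>1 * \<bar>?w p\<bar>)))"
        using intw intw2 int3 by (intro Bochner_Integration.integrable_add integrable_mult_right) auto
      fix p
      have "exp (\<theta> * ?w p) \<le> 1 + \<theta> * ?w p + (\<theta> * ?w p)\<^sup>2 / 2 + \<bar>\<theta> * ?w p\<bar> ^ 3 * exp \<bar>\<theta> * ?w p\<bar>" by (rule exp_taylor3)
      also have "\<bar>\<theta> * ?w p\<bar> ^ 3 * exp \<bar>\<theta> * ?w p\<bar> \<le> \<bar>\<theta>\<bar> ^ 3 * (\<bar>?w p\<bar> ^ 3 * exp (\<theta>1 * \<bar>?w p\<bar>))"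
        unfolding abs_mult[of \<theta>] power_mult_distrib mult.assoc using \<theta>
        by (intro mult_left_mono) (auto intro!: mult_right_mono)
      finally show "exp (\<theta> * ?w p) \<le> 1 + \<theta> * ?w p + \<theta>\<^sup>2 / 2 * (?w p)\<^sup>2 + \<bar>\<theta>\<bar> ^ 3 * (\<bar>?w p\<bar> ^ 3 * exp (\<theta>1 * \<bar>?w p\<bar>))"
        by (simp add: power_mult_distrib)
    qed
    also have "\<dots> = 1 + \<theta>\<^sup>2 / 2 + C * \<bar>\<theta>\<bar> ^ 3"
      using intw intw2 int3 Ew Ew2 by (simp add: C_def PP.prob_space)
    also have "\<dots> \<le> exp (\<theta>\<^sup>2 / 2 + C * \<bar>\<theta>\<bar> ^ 3)" using exp_ge_add_one_self[of "\<theta>\<^sup>2 / 2 + C * \<bar>\<theta>\<bar> ^ 3"] by linarith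
    finally show ?thesis unfolding mg by (subst nn_integral_eq_integral[OF i]) (auto intro: ennreal_leI)
  qed
  then show ?thesis using C th int1 int3 by blast
qed

definition "pi_n n = distr \<pi> borel (\<lambda>t. t / sqrt (real n))"

lemma prob_pi_n: "prob_space (pi_n n)"
  unfolding pi_n_def by (rule P.prob_space_distr) (intro borel_measurable_divide measurable_pi borel_measurable_const)

lemma sets_pi_n [measurable_cong]: "sets (pi_n n) = sets borel"
  by (simp add: pi_n_def)

lemma nn_integral_pi_n:
  assumes "f \<in> borel_measurable borel"
  shows "(\<integral>\<^sup>+y. f y \<partial>pi_n n) = (\<integral>\<^sup>+t. f (t / sqrt (real n)) \<partial>\<pi>)"
  unfolding pi_n_def
  by (rule nn_integral_distr) (use assms in \<open>auto intro: borel_measurable_divide measurable_pi\<close>)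

lemma iid_prior_eq: "iid_prior \<pi> n = (\<Pi>\<^sub>M i\<in>{..<n}. pi_n n)"
  by (simp add: iid_prior_def pi_n_def)

lemma product_sigma_finite_pi_n: "product_sigma_finite (\<lambda>i. pi_n n)"
  using prob_pi_n by (simp add: product_sigma_finite_def prob_space_imp_sigma_finite)

lemma prob_iid_prior: "prob_space (iid_prior \<pi> n)"
  unfolding iid_prior_eq by (intro prob_space_PiM prob_pi_n)

lemma sets_iid_prior: "sets (iid_prior \<pi> n) = sets (vec_borel n)"
  unfolding iid_prior_eq by (intro sets_PiM_cong) (simp_all add: sets_pi_n)

lemma measurable_prior_coord: "i < n \<Longrightarrow> (\<lambda>x. x i) \<in> borel_measurable (iid_prior \<pi> n)"
proof -
  assume "i < n"
  then have "(\<lambda>x. x i) \<in> borel_measurable (vec_borel n)" by (intro measurable_component_singleton) simp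
  then show ?thesis by (simp only: measurable_cong_sets[OF sets_iid_prior refl])
qed

text \<open>The factor \<open>n\<close> in the exponent cancels the factors
  \<open>1 / sqrt n\<close> of the two spikes, and the coordinates are independent.\<close>

lemma prior_exp_overlap:
  assumes n: "n > 0"
  shows "(\<integral>\<^sup>+x. \<integral>\<^sup>+x'. ennreal (exp (n * \<theta> * ip n x x')) \<partial>iid_prior \<pi> n \<partial>iid_prior \<pi> n) = product_mgf \<pi> \<theta> ^ n"
proof -
  interpret product_sigma_finite "\<lambda>i::nat. pi_n n" by (rule product_sigma_finite_pi_n)
  interpret N: prob_space "pi_n n" by (rule prob_pi_n)
  have m: "(\<lambda>p. ennreal (exp (n * \<theta> * (fst p * snd p)))) \<in> borel_measurable (pi_n n \<Otimes>\<^sub>M pi_n n)" by measurable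
  have m1: "(\<lambda>b. ennreal (exp (n * \<theta> * (a * b)))) \<in> borel_measurable (pi_n n)" for a by measurable
  have m2: "(\<lambda>a. \<integral>\<^sup>+b. ennreal (exp (n * \<theta> * (a * b))) \<partial>pi_n n) \<in> borel_measurable (pi_n n)"
    by (rule sigma_finite_measure.borel_measurable_nn_integral[OF prob_space_imp_sigma_finite[OF prob_pi_n]]) (use m in \<open>simp only: case_prod_beta'\<close>)
  have "(\<integral>\<^sup>+x. \<integral>\<^sup>+x'. ennreal (exp (n * \<theta> * ip n x x')) \<partial>iid_prior \<pi> n \<partial>iid_prior \<pi> n)
    = (\<integral>\<^sup>+x. \<integral>\<^sup>+x'. (\<Prod>i<n. ennreal (exp (n * \<theta> * (x i * x' i)))) \<partial>iid_prior \<pi> n \<partial>iid_prior \<pi> n)"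
    by (intro nn_integral_cong) (simp add: ip_def sum_distrib_left exp_sum prod_ennreal)
  also have "\<dots> = (\<integral>\<^sup>+x. (\<Prod>i<n. \<integral>\<^sup>+b. ennreal (exp (n * \<theta> * (x i * b))) \<partial>pi_n n) \<partial>iid_prior \<pi> n)"
    unfolding iid_prior_eq by (intro nn_integral_cong product_nn_integral_prod m1) simp
  also have "\<dots> = (\<Prod>i<n. \<integral>\<^sup>+a. \<integral>\<^sup>+b. ennreal (exp (n * \<theta> * (a * b))) \<partial>pi_n n \<partial>pi_n n)"
    unfolding iid_prior_eq by (rule product_nn_integral_prod, simp, rule m2)
  also have "(\<integral>\<^sup>+a. \<integral>\<^sup>+b. ennreal (exp (n * \<theta> * (a * b))) \<partial>pi_n n \<partial>pi_n n) = product_mgf \<pi> \<theta>"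
  proof -
    have "(\<integral>\<^sup>+a. \<integral>\<^sup>+b. ennreal (exp (n * \<theta> * (a * b))) \<partial>pi_n n \<partial>pi_n n)
      = (\<integral>\<^sup>+s. \<integral>\<^sup>+t. ennreal (exp (n * \<theta> * (s / sqrt n * (t / sqrt n)))) \<partial>\<pi> \<partial>\<pi>)"
    proof -
      have "(\<integral>\<^sup>+a. \<integral>\<^sup>+b. ennreal (exp (n * \<theta> * (a * b))) \<partial>pi_n n \<partial>pi_n n)
        = (\<integral>\<^sup>+s. \<integral>\<^sup>+b. ennreal (exp (n * \<theta> * (s / sqrt n * b))) \<partial>pi_n n \<partial>\<pi>)"
        by (rule nn_integral_pi_n) (use m2 in \<open>simp only: measurable_cong_sets[OF sets_pi_n refl]\<close>)
      also have "\<dots> = (\<integral>\<^sup>+s. \<integral>\<^sup>+t. ennreal (exp (n * \<theta> * (s / sqrt n * (t / sqrt n)))) \<partial>\<pi> \<partial>\<pi>)"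
        by (intro nn_integral_cong nn_integral_pi_n) measurable
      finally show ?thesis .
    qed
    also have "\<dots> = (\<integral>\<^sup>+s. \<integral>\<^sup>+t. ennreal (exp (\<theta> * (s * t))) \<partial>\<pi> \<partial>\<pi>)"
      using n by (intro nn_integral_cong) (simp add: field_simps)
    also have "\<dots> = product_mgf \<pi> \<theta>"
      unfolding product_mgf_def case_prod_beta'
      by (subst P.nn_integral_fst[symmetric]) auto
    finally show ?thesis .
  qed
  finally show ?thesis by simp
qed

text \<open>Chernoff's bound at the parameters \<open>a\<close> and \<open>- a\<close>, which would
  be optimal for a Gaussian overlap; the cubic error in the moment generating function is the only
  loss in the exponent.\<close>

lemma prior_overlap_tail:
  assumes C: "0 \<le> C" and bd: "\<And>\<theta>. \<bar>\<theta>\<bar> \<le> \<theta>1 \<Longrightarrow> product_mgf \<pi> \<theta> \<le> ennreal (exp (\<theta>\<^sup>2 / 2 + C * \<bar>\<theta>\<bar> ^ 3))"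
    and a: "0 \<le> a" "a \<le> \<theta>1" and n: "n > 0"
  shows "(\<integral>\<^sup>+x. \<integral>\<^sup>+x'. indicator {x'. a \<le> \<bar>ip n x x'\<bar>} x' \<partial>iid_prior \<pi> n \<partial>iid_prior \<pi> n)
    \<le> ennreal (2 * exp (- (n * (a\<^sup>2 / 2 - C * a ^ 3))))"
proof -
  interpret X: prob_space "iid_prior \<pi> n" by (rule prob_iid_prior)
  have ipm: "(\<lambda>p. ip n (fst p) (snd p)) \<in> borel_measurable (iid_prior \<pi> n \<Otimes>\<^sub>M iid_prior \<pi> n)"
    by (intro measurable_ip_both measurable_compose[OF measurable_fst measurable_prior_coord] measurable_compose[OF measurable_snd measurable_prior_coord])
  have ipm1: "(\<lambda>x'. ip n x x') \<in> borel_measurable (iid_prior \<pi> n)" for x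
    by (intro measurable_ip_both borel_measurable_const measurable_prior_coord)
  have em: "(\<lambda>p. ennreal (exp (n * \<theta> * ip n (fst p) (snd p)))) \<in> borel_measurable (iid_prior \<pi> n \<Otimes>\<^sub>M iid_prior \<pi> n)" for \<theta> :: real
    using ipm by measurable
  have em1: "(\<lambda>x'. ennreal (exp (n * \<theta> * ip n x x'))) \<in> borel_measurable (iid_prior \<pi> n)" for \<theta> :: real and x
    using ipm1[of x] by measurable
  have em2: "(\<lambda>x. \<integral>\<^sup>+x'. ennreal (exp (n * \<theta> * ip n x x')) \<partial>iid_prior \<pi> n) \<in> borel_measurable (iid_prior \<pi> n)" for \<theta> :: real
    by (rule X.borel_measurable_nn_integral) (use em in \<open>simp only: case_prod_beta'\<close>)
  let ?K = "ennreal (exp (- (n * a\<^sup>2)))"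
  have "(\<integral>\<^sup>+x. \<integral>\<^sup>+x'. indicator {x'. a \<le> \<bar>ip n x x'\<bar>} x' \<partial>iid_prior \<pi> n \<partial>iid_prior \<pi> n)
    \<le> (\<integral>\<^sup>+x. \<integral>\<^sup>+x'. ?K * ennreal (exp (n * a * ip n x x')) + ?K * ennreal (exp (n * (- a) * ip n x x')) \<partial>iid_prior \<pi> n \<partial>iid_prior \<pi> n)"
  proof (intro nn_integral_mono)
    fix x x'
    show "indicator {x'. a \<le> \<bar>ip n x x'\<bar>} x' \<le> ?K * ennreal (exp (n * a * ip n x x')) + ?K * ennreal (exp (n * (- a) * ip n x x'))"
    proof (cases "a \<le> \<bar>ip n x x'\<bar>")
      case True
      have "1 \<le> exp (n * (a * (\<bar>ip n x x'\<bar> - a)))" using True a by simp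
      also have "n * (a * (\<bar>ip n x x'\<bar> - a)) = - (n * a\<^sup>2) + n * a * \<bar>ip n x x'\<bar>" by (simp add: algebra_simps power2_eq_square)
      also have "exp \<dots> \<le> exp (- (n * a\<^sup>2)) * exp (n * a * ip n x x') + exp (- (n * a\<^sup>2)) * exp (n * (- a) * ip n x x')"
        unfolding exp_add by (cases "ip n x x' \<ge> 0") simp_all
      finally have "ennreal 1 \<le> ennreal (exp (- (n * a\<^sup>2)) * exp (n * a * ip n x x') + exp (- (n * a\<^sup>2)) * exp (n * (- a) * ip n x x'))"
        by (rule ennreal_leI)
      then show ?thesis using True by (simp add: ennreal_mult')
    qed simp
  qed
  also have "\<dots> = ?K * (\<integral>\<^sup>+x. \<integral>\<^sup>+x'. ennreal (exp (n * a * ip n x x')) \<partial>iid_prior \<pi> n \<partial>iid_prior \<pi> n)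
    + ?K * (\<integral>\<^sup>+x. \<integral>\<^sup>+x'. ennreal (exp (n * (- a) * ip n x x')) \<partial>iid_prior \<pi> n \<partial>iid_prior \<pi> n)"
  proof -
    have lin: "(\<integral>\<^sup>+x. ?K * f x + ?K * g x \<partial>iid_prior \<pi> n) = ?K * (\<integral>\<^sup>+x. f x \<partial>iid_prior \<pi> n) + ?K * (\<integral>\<^sup>+x. g x \<partial>iid_prior \<pi> n)"
      if [measurable]: "f \<in> borel_measurable (iid_prior \<pi> n)" "g \<in> borel_measurable (iid_prior \<pi> n)" for f g
      by (simp add: nn_integral_add nn_integral_cmult)
    have inner: "(\<integral>\<^sup>+x'. ?K * ennreal (exp (n * a * ip n x x')) + ?K * ennreal (exp (n * (- a) * ip n x x')) \<partial>iid_prior \<pi> n)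
      = ?K * (\<integral>\<^sup>+x'. ennreal (exp (n * a * ip n x x')) \<partial>iid_prior \<pi> n) + ?K * (\<integral>\<^sup>+x'. ennreal (exp (n * (- a) * ip n x x')) \<partial>iid_prior \<pi> n)" for x
      using lin[of "\<lambda>x'. ennreal (exp (n * a * ip n x x'))" "\<lambda>x'. ennreal (exp (n * (- a) * ip n x x'))", OF em1 em1] .
    show ?thesis unfolding inner using lin[OF em2[of a] em2[of "- a"]] .
  qed
  also have "\<dots> = ?K * product_mgf \<pi> a ^ n + ?K * product_mgf \<pi> (- a) ^ n" by (simp only: prior_exp_overlap[OF n])
  also have "\<dots> \<le> ?K * ennreal (exp (a\<^sup>2 / 2 + C * a ^ 3)) ^ n + ?K * ennreal (exp (a\<^sup>2 / 2 + C * a ^ 3)) ^ n"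
    using bd[of a] bd[of "- a"] a by (intro add_mono mult_left_mono power_mono) auto
  also have "\<dots> = ennreal (2 * exp (- (n * (a\<^sup>2 / 2 - C * a ^ 3))))"
  proof -
    have "exp (- (n * a\<^sup>2)) * exp (n * (a\<^sup>2 / 2 + C * a ^ 3)) = exp (- (n * (a\<^sup>2 / 2 - C * a ^ 3)))"
      unfolding exp_add[symmetric] by (simp add: algebra_simps)
    then have "?K * ennreal (exp (a\<^sup>2 / 2 + C * a ^ 3)) ^ n = ennreal (exp (- (n * (a\<^sup>2 / 2 - C * a ^ 3))))"
      by (simp add: ennreal_power ennreal_mult'[symmetric] exp_of_nat_mult[symmetric])
    then show ?thesis by (simp add: ennreal_plus[symmetric] del: ennreal_plus)
  qed
  finally show ?thesis .
qed

text \<open>Chebyshev's inequality for a sum of independent centred terms. It needs a fourth moment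
  of \<open>\<pi>\<close>, which is extracted from the exponential moment of the product.\<close>

lemma prior_norm:
  "\<exists>V. 0 \<le> V \<and> (\<forall>(n::nat) (e::real). n > 0 \<longrightarrow> e > 0 \<longrightarrow> (\<integral>\<^sup>+x. indicator {x. e < \<bar>ip n x x - 1\<bar>} x \<partial>iid_prior \<pi> n) \<le> ennreal (V / (n * e\<^sup>2)))"
proof -
  note [measurable] = measurable_pi
  obtain C \<theta>1 where th: "0 < \<theta>1" "integrable (\<pi> \<Otimes>\<^sub>M \<pi>) (\<lambda>p. exp (\<theta>1 * \<bar>fst p * snd p\<bar>))"
    using product_mgf_bound by blast
  \<comment> \<open>The fourth moment of the product of two independent copies is the square of the
    fourth moment of \<open>\<pi>\<close>, so its finiteness carries over.\<close>
  have m4i: "integrable \<pi> (\<lambda>t. t ^ 4)"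
  proof (rule integrableI_nonneg)
    have "(\<integral>\<^sup>+p. ennreal ((fst p * snd p) ^ 4) \<partial>(\<pi> \<Otimes>\<^sub>M \<pi>)) \<le> (\<integral>\<^sup>+p. ennreal (24 / \<theta>1 ^ 4) * ennreal (exp (\<theta>1 * \<bar>fst p * snd p\<bar>)) \<partial>(\<pi> \<Otimes>\<^sub>M \<pi>))"
    proof (rule nn_integral_mono)
      fix p :: "real \<times> real"
      let ?y = "\<theta>1 * \<bar>fst p * snd p\<bar>"
      have y: "0 \<le> ?y" using th by simp
      obtain t where "exp ?y = (\<Sum>m<5. (?y ^ m) / fact m) + (exp t / fact 5) * ?y ^ 5"
        using Maclaurin_exp_le[of ?y 5] by blast
      moreover have "?y ^ 4 / fact 4 \<le> (\<Sum>m<5. (?y ^ m) / fact m)" using y by (intro member_le_sum) auto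
      ultimately have "?y ^ 4 / 24 \<le> exp ?y" using y by (simp add: fact_numeral add_increasing2)
      then have "(fst p * snd p) ^ 4 \<le> 24 / \<theta>1 ^ 4 * exp ?y"
        using th(1) by (simp add: power_mult_distrib power_abs field_simps)
      then show "ennreal ((fst p * snd p) ^ 4) \<le> ennreal (24 / \<theta>1 ^ 4) * ennreal (exp ?y)"
        using th(1) by (simp add: ennreal_mult'[symmetric] ennreal_leI)
    qed
    also have "\<dots> < \<infinity>"
      using th(2) by (subst nn_integral_cmult) (auto simp: ennreal_mult_less_top integrable_iff_bounded)
    finally have "(\<integral>\<^sup>+p. ennreal ((fst p * snd p) ^ 4) \<partial>(\<pi> \<Otimes>\<^sub>M \<pi>)) < \<infinity>" .
    also have "(\<integral>\<^sup>+p. ennreal ((fst p * snd p) ^ 4) \<partial>(\<pi> \<Otimes>\<^sub>M \<pi>)) = (\<integral>\<^sup>+s. \<integral>\<^sup>+t. ennreal (s ^ 4) * ennreal (t ^ 4) \<partial>\<pi> \<partial>\<pi>)"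
      by (subst P.nn_integral_fst[symmetric]) (auto simp: power_mult_distrib ennreal_mult')
    also have "\<dots> = (\<integral>\<^sup>+s. ennreal (s ^ 4) \<partial>\<pi>) * (\<integral>\<^sup>+t. ennreal (t ^ 4) \<partial>\<pi>)"
      by (simp add: nn_integral_cmult nn_integral_multc)
    finally show "(\<integral>\<^sup>+t. ennreal (t ^ 4) \<partial>\<pi>) < \<infinity>"
      by (auto simp: ennreal_mult_less_top less_top)
  qed auto
  define V where "V = (\<integral>t. (t\<^sup>2 - 1)\<^sup>2 \<partial>\<pi>)"
  have V0: "0 \<le> V" unfolding V_def by (intro integral_nonneg_AE AE_I2) simp
  have Vi: "integrable \<pi> (\<lambda>t. (t\<^sup>2 - 1)\<^sup>2)"
  proof -
    have "(\<lambda>t. (t\<^sup>2 - 1)\<^sup>2) = (\<lambda>t::real. t ^ 4 - 2 * t\<^sup>2 + 1)" by (simp add: fun_eq_iff power2_eq_square power4_eq_xxxx algebra_simps)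
    then show ?thesis using m4i m2i by simp
  qed
  have "(\<integral>\<^sup>+x. indicator {x. e < \<bar>ip n x x - 1\<bar>} x \<partial>iid_prior \<pi> n) \<le> ennreal (V / (n * e\<^sup>2))" if n: "n > 0" and e: "e > 0" for n :: nat and e :: real
  proof -
    interpret S: product_sigma_finite "\<lambda>i::nat. pi_n n" by (rule product_sigma_finite_pi_n)
    interpret N: prob_space "pi_n n" by (rule prob_pi_n)
    define f where "f y = y\<^sup>2 - 1 / n" for y :: real
    have fpi: "f (t / sqrt n) = (t\<^sup>2 - 1) / n" for t using n by (simp add: f_def power_divide diff_divide_distrib)
    have fi: "integrable (pi_n n) f" and f0: "(\<integral>y. f y \<partial>pi_n n) = 0"
      and ffi: "integrable (pi_n n) (\<lambda>y. f y * f y)" and ff: "(\<integral>y. f y * f y \<partial>pi_n n) = V / n\<^sup>2"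
    proof -
      have [measurable]: "f \<in> borel_measurable borel" by (simp add: f_def[abs_def])
      show "integrable (pi_n n) f" unfolding pi_n_def by (subst integrable_distr_eq) (use m2i in \<open>simp_all add: fpi\<close>)
      show "(\<integral>y. f y \<partial>pi_n n) = 0" unfolding pi_n_def
        by (subst integral_distr) (use m2i m2 in \<open>simp_all add: fpi P.prob_space\<close>)
      have eq: "f (t / sqrt n) * f (t / sqrt n) = (t\<^sup>2 - 1)\<^sup>2 / n\<^sup>2" for t by (simp add: fpi power2_eq_square)
      show "integrable (pi_n n) (\<lambda>y. f y * f y)" unfolding pi_n_def
        by (subst integrable_distr_eq) (use Vi in \<open>simp_all only: eq, simp_all\<close>)
      show "(\<integral>y. f y * f y \<partial>pi_n n) = V / n\<^sup>2" unfolding pi_n_def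
        by (subst integral_distr) (use Vi in \<open>simp_all only: eq, simp_all add: V_def\<close>)
    qed
    have fm: "f \<in> borel_measurable (pi_n n)" using fi by auto
    have pair: "integrable (iid_prior \<pi> n) (\<lambda>x. f (x i) * f (x j)) \<and>
      (\<integral>x. f (x i) * f (x j) \<partial>iid_prior \<pi> n) = (if i = j then V / n\<^sup>2 else 0)" if ij: "i < n" "j < n" for i j
    proof -
      \<comment> \<open>\<open>f (x i) * f (x j)\<close> is written as a product over all
        coordinates so that its integral factorises; on the diagonal one slot carries the
        square.\<close>
      define g where "g k = (if k = i \<and> k = j then (\<lambda>y. f y * f y) else if k = i \<or> k = j then f else (\<lambda>_. 1))" for k
      have gi: "integrable (pi_n n) (g k)" for k using fi ffi by (simp add: g_def)
      have prod: "(\<Prod>k<n. g k (x k)) = f (x i) * f (x j)" for x :: "nat \<Rightarrow> real"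
      proof (cases "i = j")
        case True
        then have "(\<Prod>k<n. g k (x k)) = (\<Prod>k<n. if k = i then f (x i) * f (x j) else 1)" by (intro prod.cong) (auto simp: g_def)
        then show ?thesis using ij by simp
      next
        case False
        then have "(\<Prod>k<n. g k (x k)) = (\<Prod>k<n. (if k = i then f (x i) else 1) * (if k = j then f (x j) else 1))"
          by (intro prod.cong) (auto simp: g_def)
        then show ?thesis using ij by (simp add: prod.distrib)
      qed
      have "integrable (iid_prior \<pi> n) (\<lambda>x. \<Prod>k<n. g k (x k))"
        unfolding iid_prior_eq by (intro S.product_integrable_prod gi) simp
      moreover have "(\<integral>x. (\<Prod>k<n. g k (x k)) \<partial>iid_prior \<pi> n) = (\<Prod>k<n. integral\<^sup>L (pi_n n) (g k))"
        unfolding iid_prior_eq by (intro S.product_integral_prod gi) simp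
      moreover have "(\<Prod>k<n. integral\<^sup>L (pi_n n) (g k)) = (if i = j then V / n\<^sup>2 else 0)"
      proof (cases "i = j")
        case True
        then have "(\<Prod>k<n. integral\<^sup>L (pi_n n) (g k)) = (\<Prod>k<n. if k = i then V / n\<^sup>2 else 1)"
          by (intro prod.cong) (auto simp: g_def ff N.prob_space)
        then show ?thesis using ij True by simp
      next
        case False
        then have "integral\<^sup>L (pi_n n) (g i) = 0" by (simp add: g_def f0)
        then show ?thesis using ij False by (auto intro!: prod_zero)
      qed
      ultimately show ?thesis unfolding prod by simp
    qed
    have ipf: "ip n x x - 1 = (\<Sum>i<n. f (x i))" for x
      using n by (simp add: f_def ip_def power2_eq_square sum_subtractf)
    have sq: "(ip n x x - 1)\<^sup>2 = (\<Sum>i<n. \<Sum>j<n. f (x i) * f (x j))" for x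
      unfolding ipf power2_eq_square by (rule sum_product)
    have int: "integrable (iid_prior \<pi> n) (\<lambda>x. (ip n x x - 1)\<^sup>2)"
      unfolding sq using pair by (intro Bochner_Integration.integrable_sum) auto
    have "(\<integral>x. (ip n x x - 1)\<^sup>2 \<partial>iid_prior \<pi> n) = (\<Sum>i<n. \<Sum>j<n. \<integral>x. f (x i) * f (x j) \<partial>iid_prior \<pi> n)"
      unfolding sq using pair by (subst Bochner_Integration.integral_sum, intro Bochner_Integration.integrable_sum, simp)
        (intro sum.cong refl Bochner_Integration.integral_sum, simp)
    also have "\<dots> = (\<Sum>i<n. \<Sum>j<n. if i = j then V / n\<^sup>2 else 0)" using pair by (intro sum.cong refl) simp
    also have "\<dots> = V / n" using n by (simp add: power2_eq_square)
    finally have EV: "(\<integral>x. (ip n x x - 1)\<^sup>2 \<partial>iid_prior \<pi> n) = V / n" .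
    have "(\<integral>\<^sup>+x. indicator {x. e < \<bar>ip n x x - 1\<bar>} x \<partial>iid_prior \<pi> n)
      \<le> (\<integral>\<^sup>+x. ennreal (1 / e\<^sup>2) * ennreal ((ip n x x - 1)\<^sup>2) \<partial>iid_prior \<pi> n)"
    proof (rule nn_integral_mono)
      fix x
      show "indicator {x. e < \<bar>ip n x x - 1\<bar>} x \<le> ennreal (1 / e\<^sup>2) * ennreal ((ip n x x - 1)\<^sup>2)"
      proof (cases "e < \<bar>ip n x x - 1\<bar>")
        case True
        then have "e\<^sup>2 \<le> (ip n x x - 1)\<^sup>2" using e by (metis abs_le_square_iff abs_of_pos less_imp_le)
        then have "1 \<le> 1 / e\<^sup>2 * (ip n x x - 1)\<^sup>2" using e by simp
        then have "ennreal 1 \<le> ennreal (1 / e\<^sup>2 * (ip n x x - 1)\<^sup>2)" by (rule ennreal_leI)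
        then show ?thesis using True by (subst ennreal_mult[symmetric]) auto
      qed simp
    qed
    also have "\<dots> = ennreal (1 / e\<^sup>2) * ennreal (V / n)"
      using nn_integral_eq_integral[OF int] int EV by (subst nn_integral_cmult) auto
    also have "\<dots> = ennreal (V / (n * e\<^sup>2))" using V0 by (subst ennreal_mult[symmetric]) (auto simp: mult.commute)
    finally show ?thesis .
  qed
  then show ?thesis using V0 by blast
qed

end

subsection \<open>The exponent\<close>

text \<open>Chosen such that \<open>1 + tsel \<beta> a = (1 + \<beta>) * (1 - z)\<close> with
  \<open>z = min (\<beta> * a) 1 / 8\<close>. The slope \<open>\<beta> / 8\<close> in
  \<open>a\<close> is what makes the gain cubic, and the cap keeps \<open>tsel\<close> comparable to
  \<open>\<beta>\<close>.\<close>

definition tsel :: "real \<Rightarrow> real \<Rightarrow> real" where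
  "tsel \<beta> a = \<beta> - (1 + \<beta>) * (min (\<beta> * a) 1 / 8)"

text \<open>The squared scale at which a standard Gaussian vector attains the length demanded in
  \<open>nn_integral_lik_pair\<close>, bounded over all spikes whose squared norm is within
  \<open>e\<close> of 1. The division by \<open>1 - e\<close> provides the slack for
  \<open>gauss_ge_lower_bound\<close>.\<close>

definition Vfun :: "real \<Rightarrow> real \<Rightarrow> real \<Rightarrow> real \<Rightarrow> real" where
  "Vfun \<beta> e a \<zeta> = ((1 + e) - a\<^sup>2 / (1 + e)) * (\<beta> / (1 + \<beta> * (1 - e)))
     * ((1 + tsel \<beta> a) * (1 + e + tsel \<beta> a * \<zeta>) / tsel \<beta> a) / (1 - e)"

text \<open>
  \<open>n * Hfun \<beta> e a (N / n) \<zeta>\<close> bounds the logarithm of the truncated correlation of two likelihood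
  ratios whose spikes have overlap in \<open>[a, a + e]\<close>, up to a constant.
\<close>
definition Hfun :: "real \<Rightarrow> real \<Rightarrow> real \<Rightarrow> real \<Rightarrow> real \<Rightarrow> real" where
  "Hfun \<beta> e a \<nu> \<zeta> = (- \<nu> * ln (1 + \<beta> * (1 - e))
     + (\<zeta> * ln (1 + tsel \<beta> a) + (1 + e) * ln (1 + tsel \<beta> a * \<zeta> / (1 + e)) - tsel \<beta> a * \<zeta>)
     + ((Vfun \<beta> e a \<zeta> - 1) + e * \<bar>Vfun \<beta> e a \<zeta> - 1\<bar> - ln (Vfun \<beta> e a \<zeta>))
     + \<beta> / (1 + \<beta> * (1 - e)) * ((a + e)\<^sup>2 / (1 - e)) * (1 + tsel \<beta> a) * (\<nu> * (1 + \<beta> * (1 + e)) * (1 + e))) / 2"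

lemma tsel_bounds:
  assumes "1 \<le> \<beta>" "0 \<le> a"
  shows "3 / 4 * \<beta> \<le> tsel \<beta> a" "0 < tsel \<beta> a" "tsel \<beta> a \<le> \<beta>"
proof -
  have z: "0 \<le> min (\<beta> * a) 1 / 8" "min (\<beta> * a) 1 / 8 \<le> 1 / 8" using assms by auto
  have "(1 + \<beta>) * (min (\<beta> * a) 1 / 8) \<le> (2 * \<beta>) * (1 / 8)" using assms z by (intro mult_mono) auto
  then show "3 / 4 * \<beta> \<le> tsel \<beta> a" by (simp add: tsel_def)
  then show "0 < tsel \<beta> a" using assms by simp
  show "tsel \<beta> a \<le> \<beta>" using assms z by (simp add: tsel_def)
qed

lemma ln_one_plus_ge:
  fixes u :: real assumes "0 \<le> u" shows "u - u\<^sup>2 / 2 \<le> ln (1 + u)"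
proof -
  have "(\<lambda>u. ln (1 + u) - u + u\<^sup>2 / 2) 0 \<le> (\<lambda>u. ln (1 + u) - u + u\<^sup>2 / 2) u"
  proof (rule DERIV_nonneg_imp_nondecreasing[OF assms])
    fix x :: real assume x: "0 \<le> x" "x \<le> u"
    have "((\<lambda>u. ln (1 + u) - u + u\<^sup>2 / 2) has_real_derivative (1 / (1 + x) - 1 + x)) (at x)"
      using x by (auto intro!: derivative_eq_intros)
    moreover have "0 \<le> 1 / (1 + x) - 1 + x"
    proof -
      have "1 / (1 + x) - 1 + x = x\<^sup>2 / (1 + x)" using x by (simp add: field_simps power2_eq_square)
      then show ?thesis using x by simp
    qed
    ultimately show "\<exists>y. ((\<lambda>u. ln (1 + u) - u + u\<^sup>2 / 2) has_real_derivative y) (at x) \<and> 0 \<le> y" by blast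
  qed
  then show ?thesis by simp
qed

lemma ln_one_minus_le:
  fixes u :: real assumes "0 \<le> u" "u < 1" shows "ln (1 - u) \<le> - u - u\<^sup>2 / 2"
proof -
  have "(\<lambda>u. ln (1 - u) + u + u\<^sup>2 / 2) u \<le> (\<lambda>u. ln (1 - u) + u + u\<^sup>2 / 2) 0"
  proof (rule DERIV_nonpos_imp_nonincreasing[OF assms(1)])
    fix x :: real assume x: "0 \<le> x" "x \<le> u"
    have x1: "x < 1" using x assms by simp
    have "((\<lambda>u. ln (1 - u) + u + u\<^sup>2 / 2) has_real_derivative (- 1 / (1 - x) + 1 + x)) (at x)"
      using x1 by (auto intro!: derivative_eq_intros)
    moreover have "- 1 / (1 - x) + 1 + x \<le> 0"
    proof -
      have "- 1 / (1 - x) + 1 + x = - (x\<^sup>2) / (1 - x)" using x1 by (simp add: field_simps power2_eq_square)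
      then show ?thesis using x1 by simp
    qed
    ultimately show "\<exists>y. ((\<lambda>u. ln (1 - u) + u + u\<^sup>2 / 2) has_real_derivative y) (at x) \<and> y \<le> 0" by blast
  qed
  then show ?thesis by simp
qed

text \<open>At \<open>e = 0\<close> the terms \<open>ln (1 + t * \<nu>)\<close> from the constant of
  \<open>good\<close> and from the large deviation cost cancel. The rest separates into a penalty in
  \<open>z\<close>, the fourth order term \<open>- ln (1 - a^2) - a^2\<close>, and
  \<open>\<mu> * a^2 * (1 - z)\<close>.\<close>

lemma Hfun_limit_le:
  assumes b: "1 \<le> \<beta>" and a: "0 < a" "a \<le> 1 / 2" and l: "0 < \<mu>" "\<mu> < 1"
  defines "z \<equiv> min (\<beta> * a) 1 / 8"
  shows "2 * Hfun \<beta> 0 a (\<mu> / \<beta>\<^sup>2) (\<mu> / \<beta>\<^sup>2) \<le> z\<^sup>2 / (2 * \<beta>\<^sup>2) * (1 - \<mu> + 8 * z) + \<mu> * a\<^sup>2 * (1 - z) + 2 * a ^ 4"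
proof -
  define t where "t = tsel \<beta> a"
  define \<nu> where "\<nu> = \<mu> / \<beta>\<^sup>2"
  have t: "3 / 4 * \<beta> \<le> t" "0 < t" "t \<le> \<beta>" using tsel_bounds[OF b, of a] a by (auto simp: t_def)
  have z: "0 < z" "z \<le> 1 / 8" using a b by (auto simp: z_def)
  have tz: "t = \<beta> - (1 + \<beta>) * z" by (simp add: t_def tsel_def z_def)
  have \<nu>: "0 < \<nu>" "\<nu> * \<beta>\<^sup>2 = \<mu>" using b l by (auto simp: \<nu>_def)
  \<comment> \<open>The factor of \<open>Vfun\<close> that leaves 1 as \<open>z\<close> grows:
    \<open>x - 1 = z / t\<close>, so \<open>x - 1 - ln x\<close> is a cost of second order in
    \<open>z / t\<close>.\<close>
  define x where "x = \<beta> / (1 + \<beta>) * (1 + t) / t"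
  have y2: "1 + t = (1 + \<beta>) * (1 - z)" by (simp add: tz algebra_simps)
  have x: "x = \<beta> * (1 - z) / t" using b by (simp add: x_def y2)
  have x1: "x - 1 = z / t" using t(2) unfolding x by (simp add: field_simps) (simp add: tz algebra_simps)
  have x0: "x \<ge> 1" using x1 z t by (simp add: algebra_simps)
  have a2: "0 < 1 - a\<^sup>2" "a\<^sup>2 \<le> 1 / 2"
  proof -
    have "a\<^sup>2 \<le> (1/2)\<^sup>2" using a by (intro power_mono) auto
    then show "0 < 1 - a\<^sup>2" "a\<^sup>2 \<le> 1 / 2" by (auto simp: power2_eq_square)
  qed
  have V: "Vfun \<beta> 0 a \<nu> = (1 - a\<^sup>2) * x * (1 + t * \<nu>)"
    by (simp add: Vfun_def t_def[symmetric] x_def)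
  have tv: "0 < 1 + t * \<nu>" using t \<nu> by (simp add: add_pos_pos)
  have lnV: "ln (Vfun \<beta> 0 a \<nu>) = ln (1 - a\<^sup>2) + ln x + ln (1 + t * \<nu>)"
    unfolding V using a2 x0 tv by (simp add: ln_mult)
  have xt: "x * t = \<beta> * (1 - z)" using t by (simp add: x)
  have ln1t: "ln (1 + t) = ln (1 + \<beta>) + ln (1 - z)" unfolding y2 using b z by (simp add: ln_mult)
  have "2 * Hfun \<beta> 0 a \<nu> \<nu> = - \<nu> * ln (1 + \<beta>) + (\<nu> * ln (1 + t) + ln (1 + t * \<nu>) - t * \<nu>)
     + (Vfun \<beta> 0 a \<nu> - 1 - ln (Vfun \<beta> 0 a \<nu>)) + \<beta> / (1 + \<beta>) * a\<^sup>2 * (1 + t) * (\<nu> * (1 + \<beta>))"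
    by (simp add: Hfun_def t_def[symmetric])
  also have "\<beta> / (1 + \<beta>) * a\<^sup>2 * (1 + t) * (\<nu> * (1 + \<beta>)) = \<beta> * a\<^sup>2 * (1 + t) * \<nu>"
    using b by (simp add: field_simps)
  also have "Vfun \<beta> 0 a \<nu> = (1 - a\<^sup>2) * (x + \<nu> * (x * t))" by (simp add: V algebra_simps)
  also have "\<dots> = (1 - a\<^sup>2) * (x + \<nu> * (\<beta> * (1 - z)))" by (simp only: xt)
  also have "- \<nu> * ln (1 + \<beta>) + (\<nu> * ln (1 + t) + ln (1 + t * \<nu>) - t * \<nu>)
     + ((1 - a\<^sup>2) * (x + \<nu> * (\<beta> * (1 - z))) - 1 - ln ((1 - a\<^sup>2) * (x + \<nu> * (\<beta> * (1 - z))))) + \<beta> * a\<^sup>2 * (1 + t) * \<nu>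
    = (x - 1 - ln x) + \<nu> * (z + ln (1 - z)) + (- ln (1 - a\<^sup>2) - a\<^sup>2) + a\<^sup>2 * (1 - x) + a\<^sup>2 * (\<nu> * (\<beta> * (1 + t) - \<beta> * (1 - z)))"
  proof -
    have "ln ((1 - a\<^sup>2) * (x + \<nu> * (\<beta> * (1 - z)))) = ln (1 - a\<^sup>2) + ln x + ln (1 + t * \<nu>)"
      using lnV unfolding V xt[symmetric] by (simp add: algebra_simps)
    moreover have "t = \<beta> * (1 - z) - z" by (simp add: tz algebra_simps)
    ultimately show ?thesis unfolding ln1t by (simp only:) (simp add: algebra_simps)
  qed
  also have "\<nu> * (\<beta> * (1 + t) - \<beta> * (1 - z)) = \<mu> * (1 - z)"
    unfolding y2 \<nu>(2)[symmetric] by (simp add: algebra_simps power2_eq_square)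
  also have "(x - 1 - ln x) + \<nu> * (z + ln (1 - z)) + (- ln (1 - a\<^sup>2) - a\<^sup>2) + a\<^sup>2 * (1 - x) + a\<^sup>2 * (\<mu> * (1 - z))
    \<le> (z / t)\<^sup>2 / 2 + \<nu> * (- z\<^sup>2 / 2) + 2 * a ^ 4 + 0 + a\<^sup>2 * (\<mu> * (1 - z))"
  proof (intro add_mono order_refl)
    show "x - 1 - ln x \<le> (z / t)\<^sup>2 / 2" using ln_one_plus_ge[of "x - 1"] x0 unfolding x1[symmetric] by simp
    show "\<nu> * (z + ln (1 - z)) \<le> \<nu> * (- z\<^sup>2 / 2)"
      using ln_one_minus_le[of z] z \<nu> by (intro mult_left_mono) auto
    have "- a\<^sup>2 - 2 * (a\<^sup>2)\<^sup>2 \<le> ln (1 - a\<^sup>2)" using a2 by (intro ln_one_minus_pos_lower_bound) auto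
    then show "- ln (1 - a\<^sup>2) - a\<^sup>2 \<le> 2 * a ^ 4" by (simp add: power4_eq_xxxx power2_eq_square mult.assoc)
    show "a\<^sup>2 * (1 - x) \<le> 0" using x0 by (simp add: mult_nonneg_nonpos)
  qed
  also have "(z / t)\<^sup>2 / 2 \<le> z\<^sup>2 / (2 * \<beta>\<^sup>2) * (1 + 8 * z)"
  proof -
    have "(1 + \<beta>) * z \<le> (2 * \<beta>) * z" using b z by (intro mult_right_mono) auto
    then have t2: "\<beta> * (1 - 2 * z) \<le> t" by (simp add: tz algebra_simps)
    \<comment> \<open>The polynomial form of \<open>(1 + 8 * z) * (1 - 2 * z)^2 \<ge> 1\<close> for
      \<open>z\<close> up to 1/8, which turns \<open>1 / t^2\<close> into
      \<open>(1 + 8 * z) / \<beta>^2\<close>.\<close>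
    have "0 \<le> (4 - 28 * z + 32 * z\<^sup>2) * z" using z by (intro mult_nonneg_nonneg) (auto simp: power2_eq_square)
    also have "\<dots> = (1 + 8 * z) * (1 - 2 * z)\<^sup>2 - 1" by (simp add: power2_eq_square algebra_simps)
    finally have q: "1 \<le> (1 + 8 * z) * (1 - 2 * z)\<^sup>2" by simp
    have "\<beta>\<^sup>2 \<le> \<beta>\<^sup>2 * ((1 + 8 * z) * (1 - 2 * z)\<^sup>2)" using mult_left_mono[OF q, of "\<beta>\<^sup>2"] by simp
    also have "\<dots> = (1 + 8 * z) * (\<beta> * (1 - 2 * z))\<^sup>2" by (simp add: power_mult_distrib)
    also have "\<dots> \<le> (1 + 8 * z) * t\<^sup>2" using t2 z b by (intro mult_left_mono power_mono) auto
    finally have "1 / t\<^sup>2 \<le> (1 + 8 * z) / \<beta>\<^sup>2" using t b by (simp add: field_simps)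
    then have "z\<^sup>2 / 2 * (1 / t\<^sup>2) \<le> z\<^sup>2 / 2 * ((1 + 8 * z) / \<beta>\<^sup>2)" by (intro mult_left_mono) auto
    then show ?thesis by (simp add: power_divide field_simps)
  qed
  also have "z\<^sup>2 / (2 * \<beta>\<^sup>2) * (1 + 8 * z) + \<nu> * (- z\<^sup>2 / 2) + 2 * a ^ 4 + 0 + a\<^sup>2 * (\<mu> * (1 - z))
    = z\<^sup>2 / (2 * \<beta>\<^sup>2) * (1 - \<mu> + 8 * z) + \<mu> * a\<^sup>2 * (1 - z) + 2 * a ^ 4"
    using b by (simp add: \<nu>_def field_simps)
  finally show ?thesis by (simp add: \<nu>_def)
qed

text \<open>
  The gain \<open>\<mu> a\<^sup>2 z\<close> from the choice of \<^const>\<open>tsel\<close> is cubic in \<open>a\<close> with a factor \<open>\<beta>\<close>; for large \<open>\<beta>\<close> it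
  beats the cubic loss \<open>C a\<^sup>3\<close> caused by a nonzero third moment of the prior.
\<close>
lemma Hfun_limit_less:
  assumes b: "1 \<le> \<beta>" "20 * (2 * C + 1) \<le> \<beta>" and C: "0 \<le> C" and a: "0 < a" "a * (10 * (2 * C + 1)) \<le> 1" and l: "0 < \<mu>" "\<mu> < 1"
  shows "Hfun \<beta> 0 a (\<mu> / \<beta>\<^sup>2) (\<mu> / \<beta>\<^sup>2) < a\<^sup>2 / 2 - C * a ^ 3"
proof -
  have "a * 10 \<le> a * (10 * (2 * C + 1))" using a C by (intro mult_left_mono) auto
  then have a10: "a \<le> 1 / 10" using a(2) by linarith
  define z where "z = min (\<beta> * a) 1 / 8"
  have H: "2 * Hfun \<beta> 0 a (\<mu> / \<beta>\<^sup>2) (\<mu> / \<beta>\<^sup>2) \<le> z\<^sup>2 / (2 * \<beta>\<^sup>2) * (1 - \<mu> + 8 * z) + \<mu> * a\<^sup>2 * (1 - z) + 2 * a ^ 4"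
    unfolding z_def using a a10 b l by (intro Hfun_limit_le) auto
  \<comment> \<open>This \<open>a ^ 3\<close> together with twice the loss \<open>C * a ^ 3\<close>
    of the prior tail makes up the combination \<open>(2 * C + 1) * a ^ 3\<close>.\<close>
  have a4: "2 * a ^ 4 \<le> a ^ 3"
  proof -
    have "a ^ 3 * (2 * a) \<le> a ^ 3 * 1" using a a10 by (intro mult_left_mono) auto
    then show ?thesis by (simp add: power4_eq_xxxx power3_eq_cube mult_ac)
  qed
  have a3: "(2 * C + 1) * a ^ 3 \<le> a\<^sup>2 / 10"
  proof -
    have "a\<^sup>2 * (a * (10 * (2 * C + 1))) \<le> a\<^sup>2 * 1" using a by (intro mult_left_mono) auto
    then show ?thesis by (simp add: power2_eq_square power3_eq_cube algebra_simps)
  qed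
  have a2: "0 < a\<^sup>2" and a3': "0 < a ^ 3" using a by auto
  have key: "z\<^sup>2 / (2 * \<beta>\<^sup>2) * (1 - \<mu> + 8 * z) + \<mu> * a\<^sup>2 * (1 - z) < a\<^sup>2 - (2 * C + 1) * a ^ 3"
  proof (cases "\<beta> * a \<le> 1")
    case True
    then have z: "z = \<beta> * a / 8" by (simp add: z_def)
    have e: "z\<^sup>2 / (2 * \<beta>\<^sup>2) * (1 - \<mu> + 8 * z) + \<mu> * a\<^sup>2 * (1 - z)
      = a\<^sup>2 / 128 * (1 - \<mu> + \<beta> * a) + \<mu> * a\<^sup>2 - \<mu> * \<beta> * a ^ 3 / 8"
    proof -
      have "z\<^sup>2 / (2 * \<beta>\<^sup>2) = a\<^sup>2 / 128" using b by (simp add: z power_mult_distrib power_divide)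
      then show ?thesis by (simp only:) (simp add: z power2_eq_square power3_eq_cube algebra_simps)
    qed
    \<comment> \<open>For \<open>\<mu> \<ge> 1 / 2\<close> the gain is at least
      \<open>\<beta> * a ^ 3 / 16\<close> against a cubic cost of
      \<open>\<beta> * a ^ 3 / 128\<close>, so \<open>\<beta> \<ge> 20 * (2 * C + 1)\<close> wins
      even as \<open>\<mu>\<close> tends to 1. For smaller \<open>\<mu>\<close> there is quadratic
      room to spare.\<close>
    show ?thesis
    proof (cases "\<mu> \<ge> 1 / 2")
      case True
      have "(1 / 2) * (\<beta> * a ^ 3) \<le> \<mu> * (\<beta> * a ^ 3)" using True b a3' by (intro mult_right_mono) auto
      moreover have "a\<^sup>2 / 128 * (1 - \<mu> + \<beta> * a) = a\<^sup>2 * (1 - \<mu>) / 128 + (\<beta> * a ^ 3) / 128"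
      proof -
        have "a\<^sup>2 * (1 - \<mu> + \<beta> * a) = a\<^sup>2 * (1 - \<mu>) + \<beta> * a ^ 3"
          by (simp add: power2_eq_square power3_eq_cube algebra_simps)
        then show ?thesis by simp
      qed
      moreover have "\<mu> * \<beta> * a ^ 3 / 8 = \<mu> * (\<beta> * a ^ 3) / 8" by simp
      moreover have "20 * (2 * C + 1) * a ^ 3 \<le> \<beta> * a ^ 3" using b a3' by (intro mult_right_mono) auto
      moreover have "0 < a\<^sup>2 * (1 - \<mu>)" using a2 l by simp
      moreover have "a\<^sup>2 * (1 - \<mu>) = a\<^sup>2 - \<mu> * a\<^sup>2" by (simp add: algebra_simps)
      moreover have "0 \<le> (2 * C + 1) * a ^ 3" using C a3' by simp
      ultimately show ?thesis unfolding e by linarith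
    next
      case False
      have "a\<^sup>2 / 128 * (1 - \<mu> + \<beta> * a) \<le> a\<^sup>2 / 128 * 2" using \<open>\<beta> * a \<le> 1\<close> l a2 by (intro mult_left_mono) auto
      moreover have "\<mu> * a\<^sup>2 \<le> 1 / 2 * a\<^sup>2" using False a2 by (intro mult_right_mono) auto
      moreover have "0 \<le> \<mu> * \<beta> * a ^ 3 / 8" using l b a3' by simp
      ultimately show ?thesis unfolding e using a3 a2 by linarith
    qed
  next
    case False
    \<comment> \<open>Now \<open>1 / \<beta>^2 \<le> a^2\<close>, so the penalty is at most
      \<open>a^2 / 64\<close>. With \<open>7 / 8 * a^2\<close> from the other term this leaves more
      than the \<open>a^2 / 10\<close> that bounds the cubic loss.\<close>
    then have z: "z = 1 / 8" by (simp add: z_def)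
    have "1 \<le> (\<beta> * a)\<^sup>2" using False by (simp add: one_le_power)
    then have "1 / \<beta>\<^sup>2 \<le> a\<^sup>2" using b by (simp add: power_mult_distrib field_simps)
    then have "(1 / \<beta>\<^sup>2) * ((2 - \<mu>) / 128) \<le> a\<^sup>2 * ((2 - \<mu>) / 128)" using l by (intro mult_right_mono) auto
    also have "\<dots> \<le> a\<^sup>2 * (2 / 128)" using l by (intro mult_left_mono) auto
    finally have "z\<^sup>2 / (2 * \<beta>\<^sup>2) * (1 - \<mu> + 8 * z) \<le> a\<^sup>2 / 64" by (simp add: z power2_eq_square field_simps)
    moreover have "\<mu> * a\<^sup>2 * (1 - z) \<le> 7 / 8 * a\<^sup>2"
      using l a2 by (simp add: z)
    ultimately show ?thesis using a3 a2 by linarith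
  qed
  show ?thesis using H key a4 by (simp add: algebra_simps)
qed

section \<open>Uniformity of the exponent over a compact range of parameters\<close>

lemma Vfun_pos:
  assumes "1 \<le> \<beta>" "0 \<le> e" "e \<le> 1 / 2" "0 \<le> a" "a \<le> 1 / 2" "0 \<le> \<zeta>"
  shows "0 < Vfun \<beta> e a \<zeta>" "0 \<le> (1 + e) - a\<^sup>2 / (1 + e)"
proof -
  note t = tsel_bounds[OF assms(1,4)]
  have "a\<^sup>2 \<le> (1 / 2)\<^sup>2" using assms by (intro power_mono) auto
  then have "a\<^sup>2 / (1 + e) \<le> (1 / 4) / 1" using assms by (intro frac_le) (auto simp: power2_eq_square)
  then have 1: "0 < (1 + e) - a\<^sup>2 / (1 + e)" using assms(2) by linarith
  have "0 \<le> \<beta> * (1 - e)" using assms by simp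
  then have "0 < 1 + \<beta> * (1 - e)" by linarith
  then have 2: "0 < \<beta> / (1 + \<beta> * (1 - e))" using assms by (intro divide_pos_pos) linarith+
  have "0 \<le> tsel \<beta> a * \<zeta>" using t assms by simp
  then have "0 < 1 + e + tsel \<beta> a * \<zeta>" using assms(2) by linarith
  then have 3: "0 < (1 + tsel \<beta> a) * (1 + e + tsel \<beta> a * \<zeta>) / tsel \<beta> a"
    using t assms by (intro divide_pos_pos mult_pos_pos) auto
  show "0 < Vfun \<beta> e a \<zeta>" unfolding Vfun_def
    by (rule divide_pos_pos[OF mult_pos_pos[OF mult_pos_pos[OF 1 2] 3]]) (use assms in simp)
  show "0 \<le> (1 + e) - a\<^sup>2 / (1 + e)" using 1 by simp
qed

lemma Vfun_le:
  assumes "1 \<le> \<beta>" "0 \<le> e" "e \<le> 1 / 2" "0 \<le> a" "a \<le> 1 / 2" "0 \<le> \<zeta>" "\<zeta> \<le> 2"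
  shows "Vfun \<beta> e a \<zeta> \<le> 27 + 36 * \<beta>"
proof -
  note t = tsel_bounds[OF assms(1,4)]
  define t where "t = tsel \<beta> a"
  have t: "3 / 4 \<le> t" "0 < t" "t \<le> \<beta>" using t assms unfolding t_def by linarith+
  have 1: "(1 + e) - a\<^sup>2 / (1 + e) \<le> 3 / 2" "0 \<le> (1 + e) - a\<^sup>2 / (1 + e)"
    using Vfun_pos(2)[OF assms(1-6)] divide_nonneg_nonneg[of "a\<^sup>2" "1 + e"] assms(2,3) zero_le_power2[of a] by linarith+
  have "\<beta> * (1 / 2) \<le> \<beta> * (1 - e)" using assms by (intro mult_left_mono) auto
  then have "\<beta> \<le> 2 * (1 + \<beta> * (1 - e))" by argo
  moreover from this have "0 < 2 * (1 + \<beta> * (1 - e))" using assms(1) by (rule less_le_trans[OF less_le_trans[OF zero_less_one], rotated])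
  then have "0 < 1 + \<beta> * (1 - e)" by (simp only: zero_less_mult_iff) simp
  ultimately have 2: "\<beta> / (1 + \<beta> * (1 - e)) \<le> 2" "0 \<le> \<beta> / (1 + \<beta> * (1 - e))"
    using assms(1) by (simp_all only: pos_divide_le_eq) simp_all
  have tz: "0 \<le> t * \<zeta>" "t * \<zeta> \<le> \<beta> * 2" using t assms by (auto intro!: mult_mono)
  have "(1 + t) / t \<le> 3" using t by (simp add: field_simps)
  then have "(1 + t) / t * (1 + e + t * \<zeta>) \<le> 3 * (3 / 2 + \<beta> * 2)"
    using tz assms by (intro mult_mono) auto
  then have 3: "(1 + t) * (1 + e + t * \<zeta>) / t \<le> 9 / 2 + 6 * \<beta>" by simp
  have 4: "0 \<le> (1 + t) * (1 + e + t * \<zeta>) / t" using t tz assms by (intro divide_nonneg_pos mult_nonneg_nonneg) auto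
  have 5: "((1 + e) - a\<^sup>2 / (1 + e)) * (\<beta> / (1 + \<beta> * (1 - e))) * ((1 + t) * (1 + e + t * \<zeta>) / t) \<le> 3 / 2 * 2 * (9 / 2 + 6 * \<beta>)"
    by (intro mult_mono 1 2 3 4) auto
  have "Vfun \<beta> e a \<zeta> \<le> 3 / 2 * 2 * (9 / 2 + 6 * \<beta>) / (1 / 2)"
    unfolding Vfun_def t_def[symmetric] using assms 5 by (intro frac_le) auto
  then show ?thesis by simp
qed

definition box :: "real \<Rightarrow> real \<Rightarrow> (real \<times> real \<times> real \<times> real) set" where
  "box \<nu> \<alpha>0 = {0..1/2} \<times> {0..\<alpha>0} \<times> {0..2 * \<nu>} \<times> {0..2 * \<nu>}"

lemma continuous_on_tsel: "continuous_on A f \<Longrightarrow> continuous_on A (\<lambda>p. tsel \<beta> (f p))"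
  unfolding tsel_def by (intro continuous_intros) auto

lemma continuous_on_Vfun:
  assumes b: "1 \<le> \<beta>" and \<alpha>0: "\<alpha>0 \<le> 1 / 2"
  shows "continuous_on (box \<nu> \<alpha>0) (\<lambda>(e, a, \<nu>', \<zeta>). Vfun \<beta> e a \<zeta>)"
  unfolding Vfun_def case_prod_beta'
proof (intro continuous_intros continuous_on_tsel ballI)
  fix p assume p: "p \<in> box \<nu> \<alpha>0"
  then have e: "0 \<le> fst p" "fst p \<le> 1 / 2" "0 \<le> fst (snd p)" by (auto simp: box_def)
  show "1 + fst p \<noteq> 0" "1 - fst p \<noteq> 0" using e by auto
  have "0 \<le> \<beta> * (1 - fst p)" using b e by simp
  then show "1 + \<beta> * (1 - fst p) \<noteq> 0" by linarith
  show "tsel \<beta> (fst (snd p)) \<noteq> 0" using tsel_bounds(2)[OF b e(3)] by simp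
qed

lemma continuous_on_Hfun:
  assumes b: "1 \<le> \<beta>" and \<alpha>0: "\<alpha>0 \<le> 1 / 2"
  shows "continuous_on (box \<nu> \<alpha>0) (\<lambda>(e, a, \<nu>', \<zeta>). Hfun \<beta> e a \<nu>' \<zeta>)"
  unfolding Hfun_def case_prod_beta'
proof -
  have *: "0 < 1 + \<beta> * (1 - fst p) \<and> 0 < 1 + fst p \<and> 0 < 1 - fst p \<and> 0 < 1 + tsel \<beta> (fst (snd p))
    \<and> 0 < 1 + tsel \<beta> (fst (snd p)) * snd (snd (snd p)) / (1 + fst p) \<and> 0 < Vfun \<beta> (fst p) (fst (snd p)) (snd (snd (snd p)))"
    if p: "p \<in> box \<nu> \<alpha>0" for p
  proof -
    have e: "0 \<le> fst p" "fst p \<le> 1 / 2" "0 \<le> fst (snd p)" "fst (snd p) \<le> 1 / 2" "0 \<le> snd (snd (snd p))"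
      using p \<alpha>0 by (auto simp: box_def)
    note t = tsel_bounds[OF b e(3)]
    have "0 \<le> \<beta> * (1 - fst p)" using b e by simp
    moreover have "0 \<le> tsel \<beta> (fst (snd p)) * snd (snd (snd p)) / (1 + fst p)" using e t by (intro divide_nonneg_nonneg mult_nonneg_nonneg) auto
    moreover have "0 < Vfun \<beta> (fst p) (fst (snd p)) (snd (snd (snd p)))" using e b by (intro Vfun_pos) auto
    ultimately show ?thesis using e t by (auto intro: add_pos_nonneg)
  qed
  have **: "1 + \<beta> * (1 - fst p) \<noteq> 0" "1 + fst p \<noteq> 0" "1 - fst p \<noteq> 0" "1 + tsel \<beta> (fst (snd p)) \<noteq> 0"
    "1 + tsel \<beta> (fst (snd p)) * snd (snd (snd p)) / (1 + fst p) \<noteq> 0" "Vfun \<beta> (fst p) (fst (snd p)) (snd (snd (snd p))) \<noteq> 0"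
    if "p \<in> box \<nu> \<alpha>0" for p
    using *[OF that] by linarith+
  have pos: "0 < 1 + \<beta> * (1 - fst p)" "0 < 1 + tsel \<beta> (fst (snd p))"
    "0 < 1 + tsel \<beta> (fst (snd p)) * snd (snd (snd p)) / (1 + fst p)" "0 < Vfun \<beta> (fst p) (fst (snd p)) (snd (snd (snd p)))"
    if "p \<in> box \<nu> \<alpha>0" for p
    using *[OF that] by linarith+
  show "continuous_on (box \<nu> \<alpha>0) (\<lambda>x. (- fst (snd (snd x)) * ln (1 + \<beta> * (1 - fst x))
     + (snd (snd (snd x)) * ln (1 + tsel \<beta> (fst (snd x))) + (1 + fst x) * ln (1 + tsel \<beta> (fst (snd x)) * snd (snd (snd x)) / (1 + fst x)) - tsel \<beta> (fst (snd x)) * snd (snd (snd x)))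
     + ((Vfun \<beta> (fst x) (fst (snd x)) (snd (snd (snd x))) - 1) + fst x * \<bar>Vfun \<beta> (fst x) (fst (snd x)) (snd (snd (snd x))) - 1\<bar> - ln (Vfun \<beta> (fst x) (fst (snd x)) (snd (snd (snd x)))))
     + \<beta> / (1 + \<beta> * (1 - fst x)) * ((fst (snd x) + fst x)\<^sup>2 / (1 - fst x)) * (1 + tsel \<beta> (fst (snd x))) * (fst (snd (snd x)) * (1 + \<beta> * (1 + fst x)) * (1 + fst x))) / 2)"
    by (intro continuous_intros continuous_on_tsel continuous_on_Vfun[OF assms, unfolded case_prod_beta'] ballI ** pos) simp_all
qed

text \<open>The strict inequality in the limit has a positive minimum over the compact interval
  \<open>{\<epsilon>1..\<alpha>0}\<close>, and uniform continuity on \<open>box\<close> carries it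
  over to nearby \<open>e\<close>, \<open>\<nu>'\<close> and \<open>\<zeta>\<close>. The lower end
  must be positive, as both sides vanish at \<open>a = 0\<close>.\<close>

lemma Hfun_uniform:
  assumes b: "1 \<le> \<beta>" "20 * (2 * C + 1) \<le> \<beta>" and C: "0 \<le> C" and a: "0 < \<epsilon>1" "\<epsilon>1 \<le> \<alpha>0" "\<alpha>0 * (10 * (2 * C + 1)) \<le> 1" and l: "0 < \<mu>" "\<mu> < 1"
  defines "\<nu> \<equiv> \<mu> / \<beta>\<^sup>2"
  shows "\<exists>d>0. d \<le> 1 / 2 \<and> (\<forall>e a \<nu>' \<zeta>. 0 \<le> e \<longrightarrow> e \<le> d \<longrightarrow> \<epsilon>1 \<le> a \<longrightarrow> a \<le> \<alpha>0 \<longrightarrow> \<bar>\<nu>' - \<nu>\<bar> \<le> d \<longrightarrow> \<bar>\<zeta> - \<nu>\<bar> \<le> d \<longrightarrow>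
     Hfun \<beta> e a \<nu>' \<zeta> \<le> a\<^sup>2 / 2 - C * a ^ 3)"
proof -
  have \<nu>: "0 < \<nu>" using b l by (simp add: \<nu>_def)
  have "\<alpha>0 * 10 \<le> \<alpha>0 * (10 * (2 * C + 1))" using a C by (intro mult_left_mono) auto
  then have \<alpha>0: "\<alpha>0 \<le> 1 / 2" using a by linarith
  define f where "f a = a\<^sup>2 / 2 - C * a ^ 3 - Hfun \<beta> 0 a \<nu> \<nu>" for a
  have comp: "continuous_on {\<epsilon>1..\<alpha>0} ((\<lambda>(e, a, \<nu>', \<zeta>). Hfun \<beta> e a \<nu>' \<zeta>) \<circ> (\<lambda>a. (0, a, \<nu>, \<nu>)))"
  proof (rule continuous_on_compose)
    show "continuous_on ((\<lambda>a. (0, a, \<nu>, \<nu>)) ` {\<epsilon>1..\<alpha>0}) (\<lambda>(e, a, \<nu>', \<zeta>). Hfun \<beta> e a \<nu>' \<zeta>)"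
      by (rule continuous_on_subset[OF continuous_on_Hfun[OF b(1) \<alpha>0, of \<nu>]]) (use a \<nu> in \<open>auto simp: box_def\<close>)
  qed (intro continuous_intros)
  then have "continuous_on {\<epsilon>1..\<alpha>0} (\<lambda>a. Hfun \<beta> 0 a \<nu> \<nu>)" by (simp add: comp_def)
  then have "continuous_on {\<epsilon>1..\<alpha>0} f" unfolding f_def by (intro continuous_intros) simp_all
  from continuous_attains_inf[OF compact_Icc _ this] a
  obtain a0 where a0: "a0 \<in> {\<epsilon>1..\<alpha>0}" "\<And>a. a \<in> {\<epsilon>1..\<alpha>0} \<Longrightarrow> f a0 \<le> f a" by auto
  have "a0 * (10 * (2 * C + 1)) \<le> \<alpha>0 * (10 * (2 * C + 1))" using a0 C by (intro mult_right_mono) auto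
  then have "Hfun \<beta> 0 a0 \<nu> \<nu> < a0\<^sup>2 / 2 - C * a0 ^ 3"
    unfolding \<nu>_def using a0(1) a by (intro Hfun_limit_less b l C) auto
  then have "0 < f a0" by (simp add: f_def)
  define c where "c = f a0 / 2"
  have c: "c > 0" using \<open>0 < f a0\<close> by (simp add: c_def)
  have "compact (box \<nu> \<alpha>0)" unfolding box_def by (intro compact_Times compact_Icc)
  then have "uniformly_continuous_on (box \<nu> \<alpha>0) (\<lambda>(e, a, \<nu>', \<zeta>). Hfun \<beta> e a \<nu>' \<zeta>)"
    by (intro compact_uniformly_continuous continuous_on_Hfun b \<alpha>0)
  then obtain d0 where d0: "d0 > 0" "\<And>p q. p \<in> box \<nu> \<alpha>0 \<Longrightarrow> q \<in> box \<nu> \<alpha>0 \<Longrightarrow> dist q p < d0 \<Longrightarrow>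
      dist ((\<lambda>(e, a, \<nu>', \<zeta>). Hfun \<beta> e a \<nu>' \<zeta>) q) ((\<lambda>(e, a, \<nu>', \<zeta>). Hfun \<beta> e a \<nu>' \<zeta>) p) < c"
    using c unfolding uniformly_continuous_on_def by meson
  \<comment> \<open>Three parameters move by at most \<open>d\<close> each, so the distance stays
    below \<open>d0\<close>; the bound by \<open>\<nu>\<close> keeps \<open>\<nu>'\<close> and
    \<open>\<zeta>\<close> inside \<open>box\<close>.\<close>
  define d where "d = min (1 / 2) (min \<nu> (d0 / 4))"
  have d: "d > 0" "d \<le> 1 / 2" "d \<le> \<nu>" "3 * d < d0" using d0(1) \<nu> by (auto simp: d_def min_def)
  have "Hfun \<beta> e a \<nu>' \<zeta> \<le> a\<^sup>2 / 2 - C * a ^ 3"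
    if h: "0 \<le> e" "e \<le> d" "\<epsilon>1 \<le> a" "a \<le> \<alpha>0" "\<bar>\<nu>' - \<nu>\<bar> \<le> d" "\<bar>\<zeta> - \<nu>\<bar> \<le> d" for e a \<nu>' \<zeta>
  proof -
    have pq: "(0, a, \<nu>, \<nu>) \<in> box \<nu> \<alpha>0" "(e, a, \<nu>', \<zeta>) \<in> box \<nu> \<alpha>0"
      using h d \<nu> \<open>0 < \<epsilon>1\<close> by (auto simp: box_def abs_le_iff)
    have "dist (e, a, \<nu>', \<zeta>) (0, a, \<nu>, \<nu>) \<le> dist e 0 + dist (a, \<nu>', \<zeta>) (a, \<nu>, \<nu>)"
      unfolding dist_Pair_Pair[of e] by (rule sqrt_sum_squares_le_sum) auto
    also have "dist (a, \<nu>', \<zeta>) (a, \<nu>, \<nu>) \<le> dist a a + dist (\<nu>', \<zeta>) (\<nu>, \<nu>)"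
      unfolding dist_Pair_Pair[of a] by (rule sqrt_sum_squares_le_sum) auto
    also have "dist (\<nu>', \<zeta>) (\<nu>, \<nu>) \<le> dist \<nu>' \<nu> + dist \<zeta> \<nu>"
      unfolding dist_Pair_Pair[of \<nu>'] by (rule sqrt_sum_squares_le_sum) auto
    finally have "dist (e, a, \<nu>', \<zeta>) (0, a, \<nu>, \<nu>) < d0" using h d by (simp add: dist_real_def)
    from d0(2)[OF pq this] have "\<bar>Hfun \<beta> e a \<nu>' \<zeta> - Hfun \<beta> 0 a \<nu> \<nu>\<bar> < c" by (simp add: dist_real_def)
    moreover have "f a0 \<le> f a" using a0(2)[of a] h by simp
    moreover have "f a0 = 2 * c" by (simp add: c_def)
    moreover have "f a = a\<^sup>2 / 2 - C * a ^ 3 - Hfun \<beta> 0 a \<nu> \<nu>" by (simp add: f_def)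
    ultimately show ?thesis using c by linarith
  qed
  then show ?thesis using d by blast
qed

text \<open>With \<open>n = Suc m\<close> this is \<open>(N + 1 + e * n) / n\<close>: the endpoint
  \<open>X\<close> of the recursion in \<open>good_gauss\<close> per dimension, when the chi-square
  variables may deviate by \<open>e * n\<close>.\<close>

definition cell_zeta :: "real \<Rightarrow> nat \<Rightarrow> nat \<Rightarrow> real" where
  "cell_zeta e m N = real (N + 1) / real (Suc m) + e"

text \<open>
  With this \<open>s\<close> the fixed point in \<open>good_gauss\<close> is \<open>\<theta> = 1 + tsel \<beta> a\<close>.
\<close>
definition cell_s :: "real \<Rightarrow> real \<Rightarrow> real \<Rightarrow> nat \<Rightarrow> nat \<Rightarrow> real" where
  "cell_s \<beta> a e m N = tsel \<beta> a / ((1 + tsel \<beta> a) * (real (Suc m) * (1 + e + tsel \<beta> a * cell_zeta e m N)))"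

text \<open>The constant \<open>exp (logdet (s * L) q / (2 * s))\<close> of
  \<open>good_gauss\<close> at \<open>q = 1 / (1 + tsel \<beta> a)\<close>, in closed form.\<close>

definition cell_const :: "real \<Rightarrow> real \<Rightarrow> real \<Rightarrow> nat \<Rightarrow> nat \<Rightarrow> real" where
  "cell_const \<beta> a e m N = exp (real (Suc m) / 2 * (cell_zeta e m N * ln (1 + tsel \<beta> a)
    + (1 + e) * ln (1 + tsel \<beta> a * cell_zeta e m N / (1 + e)) - tsel \<beta> a * cell_zeta e m N))"

text \<open>Under the spiked law the squared length of \<open>X^T x\<close> divided by
  \<open>ip n x x\<close> is \<open>1 + \<beta> * ip n x x\<close> times a chi-square variable with
  \<open>N\<close> degrees of freedom. One factor with \<open>1 + e\<close> allows for the norm of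
  the spike, the other for that variable.\<close>

definition norm_bound :: "real \<Rightarrow> real \<Rightarrow> nat \<Rightarrow> real" where
  "norm_bound \<beta> e N = real N * (1 + \<beta> * (1 + e)) * (1 + e)"

context
  fixes \<beta> a e :: real and m N :: nat
  assumes \<beta>: "1 \<le> \<beta>" and a: "0 \<le> a" "a \<le> 1 / 2" and e: "0 < e" "e \<le> 1 / 2" and N: "N \<le> m"
begin

lemma cell_zeta_pos: "0 < cell_zeta e m N"
  using e by (simp add: cell_zeta_def add_nonneg_pos)

lemma cell_s_pos: "0 < cell_s \<beta> a e m N"
  using tsel_bounds(2)[OF \<beta> a(1)] cell_zeta_pos e unfolding cell_s_def
  by (intro divide_pos_pos mult_pos_pos add_pos_pos) auto

text \<open>\<open>cell_s\<close> is solved for such that the prescribed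
  \<open>q = 1 / (1 + t)\<close> is a root, and the expressions simplify because
  \<open>X + L = n * (1 + e)\<close>. The hypothesis \<open>root\<close> is equivalent to
  \<open>q\<close> being the larger of the two roots.\<close>

lemma good_cell:
  assumes root: "(tsel \<beta> a)\<^sup>2 * cell_zeta e m N \<le> 1 + e"
  shows "(\<integral>\<^sup>+G. indicator {G. \<not> good (cell_s \<beta> a e m N) m N (1 + tsel \<beta> a) (cell_const \<beta> a e m N) y G} G \<partial>gmat N m)
    \<le> ennreal (2 * real N * exp (- (e\<^sup>2 * real (Suc m) / 16)))"
proof -
  define n where "n = real (Suc m)"
  define t where "t = tsel \<beta> a"
  define \<zeta> where "\<zeta> = cell_zeta e m N"
  define L where "L = m - N"
  define X where "X = \<zeta> * n"
  define D where "D = n * (1 + e + t * \<zeta>)"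
  define q where "q = 1 / (1 + t)"
  have n: "0 < n" by (simp add: n_def)
  have t: "0 < t" using tsel_bounds(2)[OF \<beta> a(1)] by (simp add: t_def)
  have \<zeta>: "0 < \<zeta>" using cell_zeta_pos by (simp add: \<zeta>_def)
  have "\<zeta> = (real N + 1) / n + e" by (simp add: \<zeta>_def cell_zeta_def n_def)
  then have X: "X = real N + 1 + e * n" using n by (simp add: X_def field_simps)
  have X0: "0 < X" using \<zeta> n by (simp add: X_def)
  have XL: "X + real L = n * (1 + e)" using N by (simp add: X n_def L_def of_nat_diff algebra_simps)
  have D: "D = X + real L + t * X" unfolding XL by (simp add: D_def X_def algebra_simps)
  have D0: "0 < D" using n t \<zeta> e by (simp add: D_def add_pos_pos)
  have s: "cell_s \<beta> a e m N = t / ((1 + t) * D)" by (simp add: cell_s_def t_def \<zeta>_def D_def n_def)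
  have NL: "N + L = m" using N by (simp add: L_def)
  have f1: "1 - cell_s \<beta> a e m N * real L - q = t * X / D"
  proof -
    have "1 - cell_s \<beta> a e m N * real L - q = t / (1 + t) * ((D - real L) / D)"
    proof -
      have "(D - real L) / D = 1 - real L / D" using D0 by (simp add: diff_divide_distrib)
      moreover have "1 - q = t / (1 + t)" using t by (simp add: q_def field_simps)
      ultimately show ?thesis by (simp add: s right_diff_distrib)
    qed
    also have "D - real L = (1 + t) * X" by (simp add: D algebra_simps)
    finally show ?thesis using t by simp
  qed
  have f2: "q + cell_s \<beta> a e m N * real L = (X + real L) / D"
  proof -
    have "q + cell_s \<beta> a e m N * real L = (D + t * real L) / ((1 + t) * D)"
      using D0 by (simp add: s q_def add_divide_distrib)
    also have "D + t * real L = (1 + t) * (X + real L)" by (simp add: D algebra_simps)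
    finally show ?thesis using t by simp
  qed
  have f3: "1 - q = t / (1 + t)" using t by (simp add: q_def field_simps)
  have logdet: "logdet (cell_s \<beta> a e m N * real L) q / (2 * cell_s \<beta> a e m N) = n / 2 * (\<zeta> * ln (1 + t) + (1 + e) * ln (1 + t * \<zeta> / (1 + e)) - t * \<zeta>)"
  proof -
    have "(X + real L) / D = inverse (1 + t * \<zeta> / (1 + e))"
    proof -
      have "1 + t * \<zeta> / (1 + e) = (1 + e + t * \<zeta>) / (1 + e)" using e by (simp add: add_divide_distrib)
      then show ?thesis using n unfolding XL D_def by simp
    qed
    moreover have "0 < 1 + t * \<zeta> / (1 + e)" using t \<zeta> e by (simp add: add_pos_pos)
    ultimately have l1: "ln ((X + real L) / D) = - ln (1 + t * \<zeta> / (1 + e))" by (simp add: ln_inverse)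
    have l2: "ln q = - ln (1 + t)" using t by (simp add: q_def ln_div)
    have "logdet (cell_s \<beta> a e m N * real L) q = - q * (1 - cell_s \<beta> a e m N * real L - q) * ln q - (1 - q) * (q + cell_s \<beta> a e m N * real L) * ln (q + cell_s \<beta> a e m N * real L)
      - (1 - cell_s \<beta> a e m N * real L - q) * (1 - q)" by (simp add: logdet_def)
    also have "\<dots> = q * (t * X / D) * ln (1 + t) + t / (1 + t) * ((X + real L) / D) * ln (1 + t * \<zeta> / (1 + e)) - t * X / D * (t / (1 + t))"
      unfolding f1 f2 f3 l1 l2 by simp
    also have "\<dots> = cell_s \<beta> a e m N * (X * ln (1 + t) + (X + real L) * ln (1 + t * \<zeta> / (1 + e)) - t * X)"
      by (simp add: s q_def diff_divide_distrib add_divide_distrib algebra_simps)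
    also have "X * ln (1 + t) + (X + real L) * ln (1 + t * \<zeta> / (1 + e)) - t * X
      = n * (\<zeta> * ln (1 + t) + (1 + e) * ln (1 + t * \<zeta> / (1 + e)) - t * \<zeta>)"
      unfolding XL by (simp add: X_def algebra_simps)
    finally show ?thesis using cell_s_pos by simp
  qed
  have "(\<integral>\<^sup>+G. indicator {G. \<not> good (cell_s \<beta> a e m N) (N + L) N (1 / q) (exp (logdet (cell_s \<beta> a e m N * real L) q / (2 * cell_s \<beta> a e m N))) y G} G \<partial>gmat N (N + L))
    \<le> ennreal (2 * real N * exp (- (e * n)\<^sup>2 / (16 * real (Suc m))))"
  proof (rule good_gauss)
    show "0 < q" using t by (simp add: q_def)
    show "cell_s \<beta> a e m N * (real N + 1 + e * n) = q * (1 - cell_s \<beta> a e m N * real L - q)"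
      unfolding f1 X[symmetric] by (simp add: s q_def)
    have "t\<^sup>2 * X \<le> X + real L" using mult_right_mono[OF root, of n] n unfolding XL by (simp add: X_def t_def \<zeta>_def mult_ac)
    then have "t * X * (1 + t) \<le> D" unfolding D by (simp add: power2_eq_square algebra_simps)
    then have "t * X / D \<le> q" using t D0 by (simp add: q_def field_simps)
    then show "1 - cell_s \<beta> a e m N * real L \<le> 2 * q" using f1 by linarith
    show "e * n \<le> real (Suc m)" using e by (simp add: n_def)
  qed (use cell_s_pos NL e n in auto)
  also have "- (e * n)\<^sup>2 / (16 * real (Suc m)) = - (e\<^sup>2 * real (Suc m) / 16)"
  proof -
    have "- (e * n)\<^sup>2 / (16 * n) = - (e\<^sup>2 * n / 16)" using n by (simp add: power2_eq_square)
    then show ?thesis by (simp only: n_def)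
  qed
  also have "exp (logdet (cell_s \<beta> a e m N * real L) q / (2 * cell_s \<beta> a e m N)) = cell_const \<beta> a e m N"
    unfolding logdet by (simp only: cell_const_def n_def t_def \<zeta>_def)
  also have "1 / q = 1 + tsel \<beta> a" by (simp add: q_def t_def)
  finally show ?thesis by (simp only: NL)
qed

lemma nn_integral_lik_bad_cell:
  assumes root: "(tsel \<beta> a)\<^sup>2 * cell_zeta e m N \<le> 1 + e" and x: "ip (Suc m) x x \<noteq> 0"
  shows "(\<integral>\<^sup>+X. lik \<beta> (Suc m) N x X * indicator {X. \<not> goodx (cell_s \<beta> a e m N) (Suc m) N (1 + tsel \<beta> a) (cell_const \<beta> a e m N) x X} X \<partial>gmat N (Suc m))
    \<le> ennreal (2 * real N * exp (- (e\<^sup>2 * real (Suc m) / 16)))"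
proof -
  obtain T T' where "rotated \<beta> m x T T'" using rotated_exists[of \<beta> m x] x \<beta> by auto
  from rotated.nn_integral_lik_bad[OF this good_cell[OF root]] show ?thesis .
qed

lemma nn_integral_lik_pair_cell:
  assumes n: "2 \<le> e * Suc m" "4 * exp (- e\<^sup>2 * Suc m / 64) \<le> 1"
    and x: "\<bar>ip (Suc m) x x - 1\<bar> \<le> e" "\<bar>ip (Suc m) x' x' - 1\<bar> \<le> e"
    and al: "a \<le> \<bar>ip (Suc m) x x'\<bar>" "\<bar>ip (Suc m) x x'\<bar> \<le> a + e"
  shows "(\<integral>\<^sup>+X. lik \<beta> (Suc m) N x X * (lik \<beta> (Suc m) N x' X
      * indicator {X. goodx (cell_s \<beta> a e m N) (Suc m) N (1 + tsel \<beta> a) (cell_const \<beta> a e m N) x X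
          \<and> (\<Sum>k<N. (ip (Suc m) x (X k))\<^sup>2) \<le> norm_bound \<beta> e N * ip (Suc m) x x} X) \<partial>gmat N (Suc m))
    \<le> ennreal (2 * sqrt (Vfun \<beta> e a (cell_zeta e m N)) * exp (Suc m * Hfun \<beta> e a (real N / Suc m) (cell_zeta e m N)))"
    (is "?I \<le> _")
proof -
  define n where "n = real (Suc m)"
  define t where "t = tsel \<beta> a"
  define \<zeta> where "\<zeta> = cell_zeta e m N"
  define V where "V = Vfun \<beta> e a \<zeta>"
  define \<rho> where "\<rho> = ip (Suc m) x' x'"
  define \<alpha> where "\<alpha> = ip (Suc m) x x'"
  define v where "v = ip (Suc m) x x"
  define B where "B = \<beta> / (1 + \<beta> * (1 - e))"
  define y where "y = ((1 + e) - a\<^sup>2 / (1 + e)) * B / (cell_s \<beta> a e m N * n)"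
  have n0: "0 < n" by (simp add: n_def)
  have t: "0 < t" using tsel_bounds(2)[OF \<beta> a(1)] by (simp add: t_def)
  have \<zeta>: "0 < \<zeta>" using cell_zeta_pos by (simp add: \<zeta>_def)
  have v: "1 - e \<le> v" "v \<le> 1 + e" "0 < v" "\<rho> \<le> 1 + e" "1 - e \<le> \<rho>" using x e by (auto simp: v_def \<rho>_def)
  have \<alpha>: "a\<^sup>2 \<le> \<alpha>\<^sup>2" "\<alpha>\<^sup>2 \<le> (a + e)\<^sup>2"
    using power_mono[OF al(1), of 2] power_mono[OF al(2), of 2] a by (auto simp: \<alpha>_def)
  have e1: "0 < 1 - e" "0 < 1 + e" using e by auto
  have den: "0 < 1 + \<beta> * (1 - e)" "1 + \<beta> * (1 - e) \<le> 1 + \<beta> * \<rho>"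
    using \<beta> e1 v by (auto intro!: add_pos_pos mult_left_mono)
  note den' = less_le_trans[OF den]
  have B: "0 < B" "\<beta> / (1 + \<beta> * \<rho>) \<le> B" unfolding B_def using \<beta> den den'
    by (auto intro!: divide_left_mono mult_pos_pos)
  have B0: "0 \<le> \<beta> / (1 + \<beta> * \<rho>)" using \<beta> den' by (intro divide_nonneg_pos) auto
  have V0: "0 < V" "0 \<le> (1 + e) - a\<^sup>2 / (1 + e)" 
    unfolding V_def using Vfun_pos[of \<beta> e a \<zeta>] \<beta> a e \<zeta> by auto
  have cs: "cell_s \<beta> a e m N = t / ((1 + t) * (n * (1 + e + t * \<zeta>)))" by (simp only: cell_s_def t_def \<zeta>_def n_def)
  \<comment> \<open>The squared length to be attained is \<open>n * y\<close>, and
    \<open>Vfun\<close> leaves exactly the slack that \<open>gauss_ge_lower_bound\<close> asks for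
    when its scale is \<open>sqrt V\<close>.\<close>
  have yV: "y = V * (1 - e)"
    using e1 t n0 by (simp add: y_def V_def Vfun_def B_def cs t_def[symmetric])
  have le: "(\<rho> - \<alpha>\<^sup>2 / v) * (\<beta> / (1 + \<beta> * \<rho>)) / cell_s \<beta> a e m N \<le> n * y"
  proof -
    have "a\<^sup>2 / (1 + e) \<le> \<alpha>\<^sup>2 / v" using \<alpha> v by (intro frac_le) auto
    then have "(\<rho> - \<alpha>\<^sup>2 / v) * (\<beta> / (1 + \<beta> * \<rho>)) \<le> ((1 + e) - a\<^sup>2 / (1 + e)) * B"
      using v V0 B B0 by (intro mult_mono) auto
    then have "(\<rho> - \<alpha>\<^sup>2 / v) * (\<beta> / (1 + \<beta> * \<rho>)) / cell_s \<beta> a e m N \<le> ((1 + e) - a\<^sup>2 / (1 + e)) * B / cell_s \<beta> a e m N"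
      using cell_s_pos by (intro divide_right_mono) auto
    then show ?thesis using n0 by (simp add: y_def)
  qed
  \<comment> \<open>The lower bound for the Gaussian probability. The dimension is
    \<open>m = n - 1\<close>, so one factor \<open>sqrt V\<close> is missing; together with the 1/2
    this is the prefactor \<open>2 * sqrt V\<close> of the claim.\<close>
  define P where "P = sqrt V ^ m * exp (- n / 2 * ((V - 1) + e * \<bar>V - 1\<bar>)) / 2"
  have P: "0 < P" using V0 by (simp add: P_def)
  have "ennreal P \<le> (\<integral>\<^sup>+w. indicator {w. n * y \<le> ip m w w} w \<partial>gauss m)"
    using gauss_ge_lower_bound[of e "Suc m" m "sqrt V" y] n e V0 yV by (simp add: P_def n_def)
  also have "\<dots> \<le> (\<integral>\<^sup>+w. indicator {w. (\<rho> - \<alpha>\<^sup>2 / v) * (\<beta> / (1 + \<beta> * \<rho>)) / cell_s \<beta> a e m N \<le> ip m w w} w \<partial>gauss m)"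
    using le by (intro nn_integral_mono) (auto simp: indicator_def)
  finally have "?I * ennreal P \<le> ?I * (\<integral>\<^sup>+w. indicator {w. (\<rho> - \<alpha>\<^sup>2 / v) * (\<beta> / (1 + \<beta> * \<rho>)) / cell_s \<beta> a e m N \<le> ip m w w} w \<partial>gauss m)"
    by (rule mult_left_mono) simp
  also have "\<dots> \<le> ennreal ((1 + \<beta> * \<rho>) powr (- real N / 2) * (cell_const \<beta> a e m N * exp (\<beta> / (1 + \<beta> * \<rho>) / 2 * (\<alpha>\<^sup>2 / v) * (1 + t) * norm_bound \<beta> e N)))"
  proof -
    have "ip (Suc m) x x \<noteq> 0" using v by (simp add: v_def)
    then obtain T T' where "rotated \<beta> m x T T'" using rotated_exists[of \<beta> m x] \<beta> by auto
    from rotated.nn_integral_lik_pair[OF this _ cell_s_pos, of "cell_const \<beta> a e m N" "1 + tsel \<beta> a" N x' "norm_bound \<beta> e N"]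
    show ?thesis using \<beta> t by (simp add: \<rho>_def \<alpha>_def v_def t_def cell_const_def)
  qed
  also have "\<dots> \<le> ennreal ((1 + \<beta> * (1 - e)) powr (- real N / 2) * (cell_const \<beta> a e m N * exp (B / 2 * ((a + e)\<^sup>2 / (1 - e)) * (1 + t) * norm_bound \<beta> e N)))"
  proof (intro ennreal_leI mult_mono mult_left_mono)
    show "(1 + \<beta> * \<rho>) powr (- real N / 2) \<le> (1 + \<beta> * (1 - e)) powr (- real N / 2)"
      using den by (intro powr_mono2') auto
    have "\<alpha>\<^sup>2 / v \<le> (a + e)\<^sup>2 / (1 - e)" using \<alpha> v e1 by (intro frac_le) auto
    then have "\<beta> / (1 + \<beta> * \<rho>) / 2 * (\<alpha>\<^sup>2 / v) \<le> B / 2 * ((a + e)\<^sup>2 / (1 - e))"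
      using B B0 v by (intro mult_mono divide_right_mono B(2)) auto
    moreover have "0 \<le> norm_bound \<beta> e N" using \<beta> e1 by (auto simp: norm_bound_def intro!: mult_nonneg_nonneg add_nonneg_nonneg)
    ultimately show "exp (\<beta> / (1 + \<beta> * \<rho>) / 2 * (\<alpha>\<^sup>2 / v) * (1 + t) * norm_bound \<beta> e N)
      \<le> exp (B / 2 * ((a + e)\<^sup>2 / (1 - e)) * (1 + t) * norm_bound \<beta> e N)"
      using t unfolding exp_le_cancel_iff by (intro mult_right_mono) auto
  qed (auto simp: cell_const_def)
  also have "\<dots> = ennreal (2 * sqrt V * exp (n * Hfun \<beta> e a (real N / n) \<zeta>)) * ennreal P"
  proof -
    define G where "G = \<zeta> * ln (1 + t) + (1 + e) * ln (1 + t * \<zeta> / (1 + e)) - t * \<zeta>"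
    define W where "W = (V - 1) + e * \<bar>V - 1\<bar>"
    define J where "J = B * ((a + e)\<^sup>2 / (1 - e)) * (1 + t)"
    have "sqrt V = exp (ln V / 2)" using V0 by (simp add: ln_sqrt[symmetric])
    then have sm: "sqrt V * sqrt V ^ m = exp (n * (ln V / 2))"
      unfolding power_Suc[symmetric] n_def by (simp only: exp_of_nat_mult)
    have nb: "norm_bound \<beta> e N = n * (real N / n * (1 + \<beta> * (1 + e)) * (1 + e))" using n0 by (simp add: norm_bound_def)
    have H: "Hfun \<beta> e a (real N / n) \<zeta> = (- (real N / n) * ln (1 + \<beta> * (1 - e)) + G + (W - ln V)
        + J * (real N / n * (1 + \<beta> * (1 + e)) * (1 + e))) / 2"
      by (simp add: Hfun_def G_def W_def J_def B_def t_def V_def)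
    have "2 * sqrt V * exp (n * Hfun \<beta> e a (real N / n) \<zeta>) * P
      = (sqrt V * sqrt V ^ m) * exp (n * Hfun \<beta> e a (real N / n) \<zeta>) * exp (- n / 2 * W)"
      by (simp add: P_def W_def)
    also have "\<dots> = exp (n * (ln V / 2) + n * Hfun \<beta> e a (real N / n) \<zeta> + - n / 2 * W)"
      unfolding sm exp_add by simp
    also have "n * (ln V / 2) + n * Hfun \<beta> e a (real N / n) \<zeta> + - n / 2 * W
      = - real N / 2 * ln (1 + \<beta> * (1 - e)) + (n / 2 * G + J / 2 * norm_bound \<beta> e N)"
      unfolding H nb using n0 by (simp add: field_simps)
    also have "exp \<dots> = (1 + \<beta> * (1 - e)) powr (- real N / 2) * (cell_const \<beta> a e m N * exp (J / 2 * norm_bound \<beta> e N))"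
    proof -
      have "(1 + \<beta> * (1 - e)) powr (- real N / 2) = exp (- real N / 2 * ln (1 + \<beta> * (1 - e)))"
        using den by (simp add: powr_def)
      moreover have "cell_const \<beta> a e m N = exp (n / 2 * G)" unfolding cell_const_def G_def n_def t_def \<zeta>_def ..
      ultimately show ?thesis by (simp only: exp_add)
    qed
    also have "J / 2 = B / 2 * ((a + e)\<^sup>2 / (1 - e)) * (1 + t)" by (simp add: J_def)
    finally show ?thesis using P V0 by (simp add: ennreal_mult'[symmetric])
  qed
  finally have "?I * ennreal P * inverse (ennreal P) \<le> ennreal (2 * sqrt V * exp (n * Hfun \<beta> e a (real N / n) \<zeta>)) * ennreal P * inverse (ennreal P)"
    by (rule mult_right_mono) simp
  moreover have "ennreal P * inverse (ennreal P) = 1" using P by (simp add: inverse_ennreal ennreal_mult'[symmetric])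
  ultimately show ?thesis by (simp add: mult.assoc V_def \<zeta>_def n_def)
qed

end

subsection \<open>The truncated second moment\<close>

text \<open>The part outside \<open>A\<close> is split off. For the prior average \<open>Lt\<close>
  of the truncated ratio, either \<open>Lt \<le> K\<close> or \<open>Lt \<le> Lt^2 / K\<close>; its
  second moment is a double average over two independent spikes.\<close>

lemma truncated_second_moment:
  fixes f :: "'a \<Rightarrow> 'b \<Rightarrow> ennreal" and K :: real
  assumes M: "prob_space M" and G: "prob_space G"
    and f: "(\<lambda>p. f (fst p) (snd p)) \<in> borel_measurable (M \<Otimes>\<^sub>M G)"
    and A: "Measurable.pred (M \<Otimes>\<^sub>M G) (\<lambda>p. A (fst p) (snd p))"
    and B: "B \<in> sets G" and K: "K > 0"
  shows "(\<integral>\<^sup>+x. \<integral>\<^sup>+X. f x X * indicator B X \<partial>G \<partial>M)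
    \<le> (\<integral>\<^sup>+x. \<integral>\<^sup>+X. f x X * indicator {X. \<not> A x X} X \<partial>G \<partial>M) + ennreal K * emeasure G B
      + ennreal (1 / K) * (\<integral>\<^sup>+x. \<integral>\<^sup>+x'. \<integral>\<^sup>+X. (f x X * indicator {X. A x X} X) * (f x' X * indicator {X. A x' X} X) \<partial>G \<partial>M \<partial>M)"
proof -
  interpret M: sigma_finite_measure M by (rule prob_space_imp_sigma_finite[OF M])
  interpret G: sigma_finite_measure G by (rule prob_space_imp_sigma_finite[OF G])
  interpret GM: pair_sigma_finite G M ..
  interpret MG: pair_sigma_finite M G ..
  define h where "h x X = f x X * (if A x X then 1 else 0)" for x X
  have hm: "(\<lambda>p. h (fst p) (snd p)) \<in> borel_measurable (M \<Otimes>\<^sub>M G)"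
    unfolding h_def using f A by measurable
  have hc: "(\<lambda>q. h (x q) (X q)) \<in> borel_measurable L" if "x \<in> L \<rightarrow>\<^sub>M M" "X \<in> L \<rightarrow>\<^sub>M G" for x X L
    using measurable_compose[OF measurable_Pair[OF that] hm] by simp
  have fc: "(\<lambda>q. f (x q) (X q)) \<in> borel_measurable L" if "x \<in> L \<rightarrow>\<^sub>M M" "X \<in> L \<rightarrow>\<^sub>M G" for x X L
    using measurable_compose[OF measurable_Pair[OF that] f] by simp
  have Ac: "Measurable.pred L (\<lambda>q. A (x q) (X q))" if "x \<in> L \<rightarrow>\<^sub>M M" "X \<in> L \<rightarrow>\<^sub>M G" for x X L
    using measurable_compose[OF measurable_Pair[OF that] A] by simp
  define Lt where "Lt X = (\<integral>\<^sup>+x. h x X \<partial>M)" for X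
  have Ltm [measurable]: "Lt \<in> borel_measurable G"
    unfolding Lt_def by (intro M.borel_measurable_nn_integral) (simp add: case_prod_beta' hc)
  have B' [measurable]: "(indicator B :: 'b \<Rightarrow> ennreal) \<in> borel_measurable G" using B by simp
  have "(\<integral>\<^sup>+x. \<integral>\<^sup>+X. f x X * indicator B X \<partial>G \<partial>M)
    \<le> (\<integral>\<^sup>+x. \<integral>\<^sup>+X. f x X * indicator {X. \<not> A x X} X + h x X * indicator B X \<partial>G \<partial>M)"
    by (intro nn_integral_mono) (auto simp: indicator_def h_def)
  also have "\<dots> = (\<integral>\<^sup>+x. (\<integral>\<^sup>+X. f x X * indicator {X. \<not> A x X} X \<partial>G) + (\<integral>\<^sup>+X. h x X * indicator B X \<partial>G) \<partial>M)"
  proof (intro nn_integral_cong nn_integral_add)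
    fix x assume x: "x \<in> space M"
    have [measurable]: "(\<lambda>X. f x X) \<in> borel_measurable G" "Measurable.pred G (\<lambda>X. A x X)" "(\<lambda>X. h x X) \<in> borel_measurable G"
      using x by (auto intro: fc Ac hc)
    show "(\<lambda>X. f x X * indicator {X. \<not> A x X} X) \<in> borel_measurable G" unfolding indicator_def by measurable
    show "(\<lambda>X. h x X * indicator B X) \<in> borel_measurable G" by measurable
  qed
  also have "\<dots> = (\<integral>\<^sup>+x. \<integral>\<^sup>+X. f x X * indicator {X. \<not> A x X} X \<partial>G \<partial>M) + (\<integral>\<^sup>+x. \<integral>\<^sup>+X. h x X * indicator B X \<partial>G \<partial>M)"
  proof (intro nn_integral_add G.borel_measurable_nn_integral)
    have [measurable]: "(\<lambda>p. f (fst p) (snd p)) \<in> borel_measurable (M \<Otimes>\<^sub>M G)" "Measurable.pred (M \<Otimes>\<^sub>M G) (\<lambda>p. A (fst p) (snd p))"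
      "(\<lambda>p. h (fst p) (snd p)) \<in> borel_measurable (M \<Otimes>\<^sub>M G)" by (rule f A hm)+
    show "(\<lambda>(x, X). f x X * indicator {X. \<not> A x X} X) \<in> borel_measurable (M \<Otimes>\<^sub>M G)"
      unfolding indicator_def case_prod_beta' mem_Collect_eq by measurable
    show "(\<lambda>(x, X). h x X * indicator B X) \<in> borel_measurable (M \<Otimes>\<^sub>M G)"
      unfolding case_prod_beta' by measurable
  qed
  also have "(\<integral>\<^sup>+x. \<integral>\<^sup>+X. h x X * indicator B X \<partial>G \<partial>M) = (\<integral>\<^sup>+X. \<integral>\<^sup>+x. h x X * indicator B X \<partial>M \<partial>G)"
  proof (rule MG.Fubini'[symmetric])
    have [measurable]: "(\<lambda>p. h (fst p) (snd p)) \<in> borel_measurable (M \<Otimes>\<^sub>M G)" by (rule hm)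
    show "(\<lambda>(x, X). h x X * indicator B X) \<in> borel_measurable (M \<Otimes>\<^sub>M G)"
      unfolding case_prod_beta' by measurable
  qed
  also have "\<dots> = (\<integral>\<^sup>+X. Lt X * indicator B X \<partial>G)"
    unfolding Lt_def by (intro nn_integral_cong nn_integral_multc hc) auto
  also have "\<dots> \<le> (\<integral>\<^sup>+X. ennreal K * indicator B X + ennreal (1 / K) * (Lt X * Lt X) \<partial>G)"
  proof (rule nn_integral_mono)
    fix X
    show "Lt X * indicator B X \<le> ennreal K * indicator B X + ennreal (1 / K) * (Lt X * Lt X)"
    proof (cases "Lt X \<le> ennreal K")
      case True
      then have "Lt X * indicator B X \<le> ennreal K * indicator B X" by (rule mult_right_mono) simp
      then show ?thesis by (rule add_increasing2[rotated]) simp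
    next
      case False
      have "Lt X * indicator B X \<le> Lt X * 1" by (intro mult_left_mono) (auto simp: indicator_def)
      also have "\<dots> = ennreal (1 / K) * (ennreal K * Lt X)"
        using K by (simp add: mult.assoc[symmetric] ennreal_mult'[symmetric])
      also have "\<dots> \<le> ennreal (1 / K) * (Lt X * Lt X)" using False by (intro mult_left_mono mult_right_mono) auto
      finally show ?thesis by (rule add_increasing[rotated]) simp
    qed
  qed
  also have "\<dots> = ennreal K * emeasure G B + ennreal (1 / K) * (\<integral>\<^sup>+X. Lt X * Lt X \<partial>G)"
    using B by (simp add: nn_integral_add nn_integral_cmult)
  also have "(\<integral>\<^sup>+X. Lt X * Lt X \<partial>G) = (\<integral>\<^sup>+X. \<integral>\<^sup>+x. h x X * Lt X \<partial>M \<partial>G)"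
    unfolding Lt_def[of X for X] by (intro nn_integral_cong nn_integral_multc[symmetric] hc) auto
  also have "\<dots> = (\<integral>\<^sup>+x. \<integral>\<^sup>+X. h x X * Lt X \<partial>G \<partial>M)"
  proof (rule MG.Fubini')
    have [measurable]: "(\<lambda>p. h (fst p) (snd p)) \<in> borel_measurable (M \<Otimes>\<^sub>M G)" by (rule hm)
    show "(\<lambda>(x, X). h x X * Lt X) \<in> borel_measurable (M \<Otimes>\<^sub>M G)" unfolding case_prod_beta' by measurable
  qed
  also have "\<dots> = (\<integral>\<^sup>+x. \<integral>\<^sup>+X. \<integral>\<^sup>+x'. h x X * h x' X \<partial>M \<partial>G \<partial>M)"
    unfolding Lt_def by (intro nn_integral_cong nn_integral_cmult[symmetric] hc) auto
  also have "\<dots> = (\<integral>\<^sup>+x. \<integral>\<^sup>+x'. \<integral>\<^sup>+X. h x X * h x' X \<partial>G \<partial>M \<partial>M)"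
  proof (intro nn_integral_cong MG.Fubini')
    fix x assume x: "x \<in> space M"
    have [measurable]: "(\<lambda>p. h (fst p) (snd p)) \<in> borel_measurable (M \<Otimes>\<^sub>M G)" "(\<lambda>p. h x (snd p)) \<in> borel_measurable (M \<Otimes>\<^sub>M G)"
      using x by (auto intro!: hc)
    show "(\<lambda>(x', X). h x X * h x' X) \<in> borel_measurable (M \<Otimes>\<^sub>M G)" unfolding case_prod_beta' by measurable
  qed
  also have "\<dots> = (\<integral>\<^sup>+x. \<integral>\<^sup>+x'. \<integral>\<^sup>+X. (f x X * indicator {X. A x X} X) * (f x' X * indicator {X. A x' X} X) \<partial>G \<partial>M \<partial>M)"
    by (intro nn_integral_cong) (simp add: h_def indicator_def)
  finally show ?thesis by (simp add: add.assoc add_left_mono)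
qed

text \<open>The integral is cut into layers of width \<open>1 / sqrt n\<close>, the natural size of
  an overlap. Layer \<open>k\<close> contributes about
  \<open>exp (l1 * (k + 1)^2 / 2 - \<kappa> * k^2 / 2)\<close>, which is summable because
  \<open>l1\<close> is smaller than \<open>\<kappa>\<close>; the resulting bound is free of
  \<open>n\<close>.\<close>

lemma small_overlap_moment:
  fixes \<alpha> :: "'a \<Rightarrow> real" and n :: nat and \<kappa> l1 \<delta> \<epsilon>1 :: real
  assumes \<alpha>: "\<alpha> \<in> borel_measurable P" and n: "n > 0" and \<epsilon>: "0 \<le> \<epsilon>1"
    and tail: "\<And>a. 0 \<le> a \<Longrightarrow> a \<le> \<epsilon>1 \<Longrightarrow> (\<integral>\<^sup>+p. indicator {p. a \<le> \<bar>\<alpha> p\<bar>} p \<partial>P) \<le> ennreal (2 * exp (- (n * (\<kappa> * a\<^sup>2 / 2))))"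
    and l: "0 \<le> l1" "l1 \<le> 1" "0 < \<delta>" "l1 + \<delta> \<le> \<kappa>"
  shows "(\<integral>\<^sup>+p. indicator {p. \<bar>\<alpha> p\<bar> \<le> \<epsilon>1} p * ennreal (exp (n * l1 * (\<alpha> p)\<^sup>2 / 2)) \<partial>P)
    \<le> ennreal (2 * exp (2 / \<delta> + 1 / 2) / (1 - exp (- 1)))"
proof -
  note [measurable] = \<alpha>
  define r where "r = sqrt (real n)"
  have r: "0 < r" "r\<^sup>2 = n" using n by (auto simp: r_def)
  define K where "K = nat \<lfloor>r * \<epsilon>1\<rfloor>"
  have kb: "k \<le> K \<Longrightarrow> real k / r \<le> \<epsilon>1" for k
  proof -
    assume "k \<le> K"
    then have "real k \<le> r * \<epsilon>1" using r \<epsilon> unfolding K_def by (simp add: le_nat_floor le_floor_iff nat_le_iff of_nat_le_iff le_nat_iff)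
    then show ?thesis using r by (simp add: field_simps)
  qed
  let ?c = "\<lambda>k::nat. exp (l1 * (real k + 1)\<^sup>2 / 2)"
  have "(\<integral>\<^sup>+p. indicator {p. \<bar>\<alpha> p\<bar> \<le> \<epsilon>1} p * ennreal (exp (n * l1 * (\<alpha> p)\<^sup>2 / 2)) \<partial>P)
    \<le> (\<integral>\<^sup>+p. (\<Sum>k\<le>K. ennreal (?c k) * indicator {p. real k / r \<le> \<bar>\<alpha> p\<bar>} p) \<partial>P)"
  proof (rule nn_integral_mono)
    fix p
    show "indicator {p. \<bar>\<alpha> p\<bar> \<le> \<epsilon>1} p * ennreal (exp (n * l1 * (\<alpha> p)\<^sup>2 / 2))
      \<le> (\<Sum>k\<le>K. ennreal (?c k) * indicator {p. real k / r \<le> \<bar>\<alpha> p\<bar>} p)"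
    proof (cases "\<bar>\<alpha> p\<bar> \<le> \<epsilon>1")
      case True
      define k where "k = nat \<lfloor>r * \<bar>\<alpha> p\<bar>\<rfloor>"
      have nn: "0 \<le> r * \<bar>\<alpha> p\<bar>" using r by simp
      have "r * \<bar>\<alpha> p\<bar> \<le> r * \<epsilon>1" using True r by (intro mult_left_mono) auto
      then have kK: "k \<le> K" unfolding k_def K_def by (intro nat_mono floor_mono)
      have k1: "real k \<le> r * \<bar>\<alpha> p\<bar>" "r * \<bar>\<alpha> p\<bar> \<le> real k + 1"
        using nn unfolding k_def by simp_all
      have "(r * \<bar>\<alpha> p\<bar>)\<^sup>2 \<le> (real k + 1)\<^sup>2" using k1 nn by (intro power_mono) auto
      then have "l1 * (r * \<bar>\<alpha> p\<bar>)\<^sup>2 \<le> l1 * (real k + 1)\<^sup>2" using l by (intro mult_left_mono)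
      then have "exp (n * l1 * (\<alpha> p)\<^sup>2 / 2) \<le> ?c k" using r by (simp add: power_mult_distrib mult_ac)
      then have "indicator {p. \<bar>\<alpha> p\<bar> \<le> \<epsilon>1} p * ennreal (exp (n * l1 * (\<alpha> p)\<^sup>2 / 2)) \<le> ennreal (?c k)"
        using True by (simp add: ennreal_leI)
      also have "\<dots> = ennreal (?c k) * indicator {p. real k / r \<le> \<bar>\<alpha> p\<bar>} p"
        using k1(1) r by (simp add: indicator_def field_simps)
      also have "\<dots> \<le> (\<Sum>k\<le>K. ennreal (?c k) * indicator {p. real k / r \<le> \<bar>\<alpha> p\<bar>} p)"
        using kK by (intro member_le_sum) auto
      finally show ?thesis .
    qed simp
  qed
  also have "\<dots> = (\<Sum>k\<le>K. ennreal (?c k) * (\<integral>\<^sup>+p. indicator {p. real k / r \<le> \<bar>\<alpha> p\<bar>} p \<partial>P))"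
  proof -
    have [measurable]: "(\<lambda>p. indicator {p. real k / r \<le> \<bar>\<alpha> p\<bar>} p :: ennreal) \<in> borel_measurable P" for k
      unfolding indicator_def by measurable
    show ?thesis by (subst nn_integral_sum) (auto intro!: sum.cong nn_integral_cmult)
  qed
  also have "\<dots> \<le> (\<Sum>k\<le>K. ennreal (2 * exp (2 / \<delta> + 1 / 2) * exp (- 1) ^ k))"
  proof (rule sum_mono)
    fix k assume "k \<in> {..K}"
    then have "ennreal (?c k) * (\<integral>\<^sup>+p. indicator {p. real k / r \<le> \<bar>\<alpha> p\<bar>} p \<partial>P)
      \<le> ennreal (?c k) * ennreal (2 * exp (- (n * (\<kappa> * (real k / r)\<^sup>2 / 2))))"
      using kb[of k] r by (intro mult_left_mono tail) auto
    also have "\<dots> = ennreal (2 * exp (l1 * (real k + 1)\<^sup>2 / 2 - \<kappa> * (real k)\<^sup>2 / 2))"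
    proof -
      have 1: "- (n * (\<kappa> * (real k / r)\<^sup>2 / 2)) = - (\<kappa> * (real k)\<^sup>2 / 2)" using n r by (simp add: power_divide)
      have "?c k * (2 * exp (- (\<kappa> * (real k)\<^sup>2 / 2))) = 2 * exp (l1 * (real k + 1)\<^sup>2 / 2 - \<kappa> * (real k)\<^sup>2 / 2)"
        by (simp only: mult.left_commute[of _ 2] mult_exp_exp diff_conv_add_uminus)
      then show ?thesis unfolding 1 by (simp add: ennreal_mult'[symmetric])
    qed
    also have "\<dots> \<le> ennreal (2 * exp (2 / \<delta> + 1 / 2 - real k))"
    proof -
      have "l1 * (2 * real k + 1) \<le> 1 * (2 * real k + 1)" using l by (intro mult_right_mono) auto
      then have 1: "l1 * (real k + 1)\<^sup>2 \<le> l1 * (real k)\<^sup>2 + (2 * real k + 1)"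
        by (simp add: power2_eq_square algebra_simps)
      have "(l1 + \<delta>) * (real k)\<^sup>2 \<le> \<kappa> * (real k)\<^sup>2" using l by (intro mult_right_mono) auto
      then have 2: "l1 * (real k)\<^sup>2 + \<delta> * (real k)\<^sup>2 \<le> \<kappa> * (real k)\<^sup>2" by (simp only: distrib_right)
      define u where "u = 2 / \<delta>"
      \<comment> \<open>This square bounds \<open>2 * k - \<delta> * k^2 / 2\<close> by
        \<open>2 / \<delta>\<close>; one of the two multiples of \<open>k\<close> is kept as
        geometric decay.\<close>
      have "0 \<le> (\<delta> * real k - 2)\<^sup>2 / \<delta>" using l by simp
      also have "\<dots> = \<delta> * (real k)\<^sup>2 - 4 * real k + 2 * u" using l by (simp add: u_def power2_eq_square field_simps)
      finally have "l1 * (real k + 1)\<^sup>2 / 2 - \<kappa> * (real k)\<^sup>2 / 2 \<le> u + 1 / 2 - real k" using 1 2 by argo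
      then have "l1 * (real k + 1)\<^sup>2 / 2 - \<kappa> * (real k)\<^sup>2 / 2 \<le> 2 / \<delta> + 1 / 2 - real k" by (simp add: u_def)
      then show ?thesis by (intro ennreal_leI) simp
    qed
    also have "exp (2 / \<delta> + 1 / 2 - real k) = exp (2 / \<delta> + 1 / 2) * exp (- 1) ^ k"
      using exp_of_nat_mult[of k "- 1 :: real"] by (simp only: diff_conv_add_uminus exp_add) simp
    finally show "ennreal (?c k) * (\<integral>\<^sup>+p. indicator {p. real k / r \<le> \<bar>\<alpha> p\<bar>} p \<partial>P)
      \<le> ennreal (2 * exp (2 / \<delta> + 1 / 2) * exp (- 1) ^ k)" by (simp add: mult.assoc)
  qed
  also have "\<dots> = ennreal (\<Sum>k\<le>K. 2 * exp (2 / \<delta> + 1 / 2) * exp (- 1) ^ k)" by (intro sum_ennreal) auto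
  also have "\<dots> \<le> ennreal (2 * exp (2 / \<delta> + 1 / 2) / (1 - exp (- 1)))"
  proof (rule ennreal_leI)
    have s: "norm (exp (- 1 :: real)) < 1" by simp
    have "(\<Sum>k\<le>K. exp (- 1 :: real) ^ k) \<le> (\<Sum>k. exp (- 1) ^ k)"
      by (intro sum_le_suminf summable_geometric s) auto
    also have "\<dots> = 1 / (1 - exp (- 1))" by (rule suminf_geometric[OF s])
    finally have "2 * exp (2 / \<delta> + 1 / 2) * (\<Sum>k\<le>K. exp (- 1 :: real) ^ k) \<le> 2 * exp (2 / \<delta> + 1 / 2) * (1 / (1 - exp (- 1)))"
      by (intro mult_left_mono) auto
    then show "(\<Sum>k\<le>K. 2 * exp (2 / \<delta> + 1 / 2) * exp (- 1) ^ k) \<le> 2 * exp (2 / \<delta> + 1 / 2) / (1 - exp (- 1))"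
      by (simp add: sum_distrib_left)
  qed
  finally show ?thesis .
qed

text \<open>
  \<open>As\<close> is a finite grid of overlaps: the optimal parameters of \<^const>\<open>goodx\<close> depend on the overlap with the
  second spike, so one condition is imposed for each grid point.
\<close>
definition trunc :: "real \<Rightarrow> real \<Rightarrow> nat \<Rightarrow> nat \<Rightarrow> real set \<Rightarrow> (nat \<Rightarrow> real) \<Rightarrow> (nat \<Rightarrow> nat \<Rightarrow> real) \<Rightarrow> bool" where
  "trunc \<beta> e m N As x X \<longleftrightarrow> \<bar>ip (Suc m) x x - 1\<bar> \<le> e
     \<and> (\<Sum>k<N. (ip (Suc m) x (X k))\<^sup>2) \<le> norm_bound \<beta> e N * ip (Suc m) x x
     \<and> (\<forall>a\<in>As. goodx (cell_s \<beta> a e m N) (Suc m) N (1 + tsel \<beta> a) (cell_const \<beta> a e m N) x X)"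

lemma pred_trunc:
  assumes x: "\<And>i. i < Suc m \<Longrightarrow> (\<lambda>p. x p i) \<in> borel_measurable M" and X: "X \<in> M \<rightarrow>\<^sub>M gmat N (Suc m)" and As: "finite As"
  shows "Measurable.pred M (\<lambda>p. trunc \<beta> e m N As (x p) (X p))"
proof -
  have [measurable]: "(\<lambda>p. ip (Suc m) (x p) (x p)) \<in> borel_measurable M" by (intro measurable_ip_both x)
  have [measurable]: "(\<lambda>p. \<Sum>k<N. (ip (Suc m) (x p) (X p k))\<^sup>2) \<in> borel_measurable M"
    by (intro borel_measurable_sum borel_measurable_power measurable_ip_left x measurable_gmat_comp[OF X]) auto
  have [measurable]: "Measurable.pred M (\<lambda>p. \<forall>a\<in>As. goodx (cell_s \<beta> a e m N) (Suc m) N (1 + tsel \<beta> a) (cell_const \<beta> a e m N) (x p) (X p))"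
    by (intro pred_intros_finite As pred_goodx x X)
  show ?thesis unfolding trunc_def by measurable
qed

text \<open>A union bound: either the length condition fails, which is a chi-square tail under the
  spiked law, or \<open>goodx\<close> fails at one of the grid points.\<close>

lemma nn_integral_lik_not_trunc:
  fixes \<beta> e :: real
  assumes \<beta>: "1 \<le> \<beta>" and e: "0 < e" "e \<le> 1 / 2" and N: "0 < N" "N \<le> m" and As: "finite As"
    and a: "\<And>a. a \<in> As \<Longrightarrow> 0 \<le> a \<and> a \<le> 1 / 2 \<and> (tsel \<beta> a)\<^sup>2 * cell_zeta e m N \<le> 1 + e"
    and x: "\<bar>ip (Suc m) x x - 1\<bar> \<le> e"
  shows "(\<integral>\<^sup>+X. lik \<beta> (Suc m) N x X * indicator {X. \<not> trunc \<beta> e m N As x X} X \<partial>gmat N (Suc m))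
    \<le> ennreal (exp (- (e\<^sup>2 * real N / 16)) + real (card As) * (2 * real N * exp (- (e\<^sup>2 * real (Suc m) / 16))))"
proof -
  define I :: "real \<Rightarrow> (nat \<Rightarrow> nat \<Rightarrow> real) \<Rightarrow> ennreal" where
    "I a X = lik \<beta> (Suc m) N x X * indicator {X. \<not> goodx (cell_s \<beta> a e m N) (Suc m) N (1 + tsel \<beta> a) (cell_const \<beta> a e m N) x X} X" for a X
  define J :: "(nat \<Rightarrow> nat \<Rightarrow> real) \<Rightarrow> ennreal" where
    "J X = lik \<beta> (Suc m) N x X * indicator {X. norm_bound \<beta> e N * ip (Suc m) x x < (\<Sum>k<N. (ip (Suc m) x (X k))\<^sup>2)} X" for X
  have [measurable]: "(\<lambda>X. lik \<beta> (Suc m) N x X) \<in> borel_measurable (gmat N (Suc m))"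
    "Measurable.pred (gmat N (Suc m)) (\<lambda>X. goodx s (Suc m) N \<theta> C x X)" for s \<theta> C
    by (intro measurable_lik pred_goodx borel_measurable_const measurable_ident_sets refl)+
  have [measurable]: "(\<lambda>X. \<Sum>k<N. (ip (Suc m) x (X k))\<^sup>2) \<in> borel_measurable (gmat N (Suc m))"
    by (intro borel_measurable_sum borel_measurable_power measurable_ip_left borel_measurable_const
        measurable_gmat_comp[OF measurable_ident_sets[OF refl]]) auto
  have I: "I a \<in> borel_measurable (gmat N (Suc m))" for a unfolding I_def indicator_def by measurable
  have J: "J \<in> borel_measurable (gmat N (Suc m))" unfolding J_def indicator_def by measurable
  have v: "ip (Suc m) x x \<noteq> 0" "ip (Suc m) x x \<le> 1 + e" using x e by auto
  have "(\<integral>\<^sup>+X. lik \<beta> (Suc m) N x X * indicator {X. \<not> trunc \<beta> e m N As x X} X \<partial>gmat N (Suc m))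
    \<le> (\<integral>\<^sup>+X. J X + (\<Sum>a\<in>As. I a X) \<partial>gmat N (Suc m))"
  proof (rule nn_integral_mono)
    fix X
    show "lik \<beta> (Suc m) N x X * indicator {X. \<not> trunc \<beta> e m N As x X} X \<le> J X + (\<Sum>a\<in>As. I a X)"
    proof (cases "trunc \<beta> e m N As x X")
      case False
      show ?thesis
      proof (cases "norm_bound \<beta> e N * ip (Suc m) x x < (\<Sum>k<N. (ip (Suc m) x (X k))\<^sup>2)")
        case True
        then have "J X = lik \<beta> (Suc m) N x X" by (simp add: J_def)
        then show ?thesis by (simp add: indicator_def add_increasing2)
      next
        case f: False
        with False x obtain a where "a \<in> As" "\<not> goodx (cell_s \<beta> a e m N) (Suc m) N (1 + tsel \<beta> a) (cell_const \<beta> a e m N) x X"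
          by (auto simp: trunc_def)
        then have "lik \<beta> (Suc m) N x X = I a X" by (simp add: I_def)
        also have "\<dots> \<le> (\<Sum>a\<in>As. I a X)" by (rule member_le_sum) (use \<open>a \<in> As\<close> As in auto)
        finally show ?thesis by (simp add: indicator_def add_increasing)
      qed
    qed simp
  qed
  also have "\<dots> = (\<integral>\<^sup>+X. J X \<partial>gmat N (Suc m)) + (\<Sum>a\<in>As. \<integral>\<^sup>+X. I a X \<partial>gmat N (Suc m))"
    using I J by (simp add: nn_integral_add nn_integral_sum borel_measurable_sum)
  also have "\<dots> \<le> ennreal (exp (- (e\<^sup>2 * real N / 16))) + (\<Sum>a\<in>As. ennreal (2 * real N * exp (- (e\<^sup>2 * real (Suc m) / 16))))"
  proof (intro add_mono sum_mono)
    fix a assume "a \<in> As"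
    with a have "0 \<le> a" "a \<le> 1 / 2" "(tsel \<beta> a)\<^sup>2 * cell_zeta e m N \<le> 1 + e" by auto
    then show "(\<integral>\<^sup>+X. I a X \<partial>gmat N (Suc m)) \<le> ennreal (2 * real N * exp (- (e\<^sup>2 * real (Suc m) / 16)))"
      unfolding I_def by (intro nn_integral_lik_bad_cell \<beta> e N v)
  next
    obtain T T' where "rotated \<beta> m x T T'" using rotated_exists[of \<beta> m x] v \<beta> by auto
    from rotated.nn_integral_lik_norm[OF this]
    have "(\<integral>\<^sup>+X. J X \<partial>gmat N (Suc m)) = (\<integral>\<^sup>+r. indicator {r. norm_bound \<beta> e N < (1 + \<beta> * ip (Suc m) x x) * ip N r r} r \<partial>gauss N)"
      unfolding J_def .
    also have "\<dots> \<le> (\<integral>\<^sup>+r. indicator {r. real N + e * real N < ip N r r} r \<partial>gauss N)"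
    proof (rule nn_integral_mono)
      fix r :: "nat \<Rightarrow> real"
      define q where "q = 1 + \<beta> * (1 + e)"
      have q: "0 < q" using \<beta> e by (auto simp: q_def intro!: add_pos_pos)
      have "real N + e * real N < ip N r r" if "norm_bound \<beta> e N < (1 + \<beta> * ip (Suc m) x x) * ip N r r"
      proof -
        have "norm_bound \<beta> e N = q * (real N + e * real N)" by (simp add: norm_bound_def q_def algebra_simps)
        moreover have "(1 + \<beta> * ip (Suc m) x x) * ip N r r \<le> q * ip N r r"
          unfolding q_def using v \<beta> by (intro mult_right_mono add_left_mono mult_left_mono ip_self_nonneg) auto
        ultimately have "q * (real N + e * real N) < q * ip N r r" using that by linarith
        then show ?thesis using q by simp
      qed
      then show "indicator {r. norm_bound \<beta> e N < (1 + \<beta> * ip (Suc m) x x) * ip N r r} r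
        \<le> (indicator {r. real N + e * real N < ip N r r} r :: ennreal)"
        by (auto simp: indicator_def)
    qed
    also have "\<dots> \<le> ennreal (exp (- (e * real N)\<^sup>2 / (16 * real N)))" using e N gauss_upper_tail[of "e * real N" N N] by simp
    also have "- (e * real N)\<^sup>2 / (16 * real N) = - (e\<^sup>2 * real N / 16)" using N by (simp add: power2_eq_square)
    finally show "(\<integral>\<^sup>+X. J X \<partial>gmat N (Suc m)) \<le> ennreal (exp (- (e\<^sup>2 * real N / 16)))" .
  qed
  also have "\<dots> = ennreal (exp (- (e\<^sup>2 * real N / 16)) + real (card As) * (2 * real N * exp (- (e\<^sup>2 * real (Suc m) / 16))))"
    by (simp add: ennreal_of_nat_eq_real_of_nat ennreal_mult'[symmetric] ennreal_plus[symmetric] del: ennreal_plus)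
  finally show ?thesis .
qed

lemma powr_le_exp_of_overlap:
  fixes u U :: real
  assumes "0 \<le> u" "u \<le> U" "U < 1"
  shows "(1 - u) powr (- real N / 2) \<le> exp (real N / 2 * (u / (1 - U)))"
proof -
  have "ln (1 / (1 - u)) \<le> 1 / (1 - u) - 1" using assms by (intro ln_le_minus_one) auto
  also have "1 / (1 - u) - 1 = u / (1 - u)" using assms by (simp add: field_simps)
  also have "\<dots> \<le> u / (1 - U)" using assms by (intro divide_left_mono) auto
  finally have "- ln (1 - u) \<le> u / (1 - U)" using assms by (simp add: ln_div)
  then have "real N / 2 * (- ln (1 - u)) \<le> real N / 2 * (u / (1 - U))" by (intro mult_left_mono) auto
  then show ?thesis using assms by (simp add: powr_def)
qed

text \<open>One summand for each range of the overlap; spikes with atypical norm contribute 0. In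
  the middle range only the conditions on the first spike are used, at the grid point below the
  overlap, and for large overlaps only the length condition on the second. The indicators are kept
  so that the prior tail can pay for the exponentials.\<close>

lemma nn_integral_trunc_pair:
  fixes \<beta> e \<epsilon>1 \<alpha>0 l1 :: real and x x' :: "nat \<Rightarrow> real"
  assumes \<beta>: "1 \<le> \<beta>" and e: "0 < e" "e \<le> 1 / 2" and N: "N \<le> m" and As: "finite As"
    and n: "2 \<le> e * Suc m" "4 * exp (- e\<^sup>2 * Suc m / 64) \<le> 1"
    and a: "\<And>a. a \<in> As \<Longrightarrow> 0 \<le> a \<and> a \<le> 1 / 2"
    and cover: "\<And>b. \<epsilon>1 \<le> b \<Longrightarrow> b \<le> \<alpha>0 \<Longrightarrow> \<exists>a\<in>As. a \<le> b \<and> b \<le> a + e"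
    and \<epsilon>1: "\<beta>\<^sup>2 * \<epsilon>1\<^sup>2 < 1" "real N * \<beta>\<^sup>2 \<le> Suc m * (l1 * (1 - \<beta>\<^sup>2 * \<epsilon>1\<^sup>2))"
  defines "\<alpha> \<equiv> ip (Suc m) x x'"
  shows "(\<integral>\<^sup>+X. (lik \<beta> (Suc m) N x X * indicator {X. trunc \<beta> e m N As x X} X)
        * (lik \<beta> (Suc m) N x' X * indicator {X. trunc \<beta> e m N As x' X} X) \<partial>gmat N (Suc m))
    \<le> indicator {\<alpha>. \<bar>\<alpha>\<bar> \<le> \<epsilon>1} \<alpha> * ennreal (exp (Suc m * l1 * \<alpha>\<^sup>2 / 2))
      + (\<Sum>a\<in>As. ennreal (2 * sqrt (Vfun \<beta> e a (cell_zeta e m N)) * exp (Suc m * Hfun \<beta> e a (real N / Suc m) (cell_zeta e m N))) * indicator {\<alpha>. a \<le> \<bar>\<alpha>\<bar>} \<alpha>)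
      + ennreal (exp (norm_bound \<beta> e N / 2)) * indicator {\<alpha>. \<alpha>0 \<le> \<bar>\<alpha>\<bar>} \<alpha>"
    (is "?I \<le> ?A + ?B + ?C")
proof -
  let ?L = "lik \<beta> (Suc m) N"
  have nb: "0 \<le> norm_bound \<beta> e N" using \<beta> e by (auto simp: norm_bound_def intro!: mult_nonneg_nonneg add_nonneg_nonneg)
  consider "\<not> (\<bar>ip (Suc m) x x - 1\<bar> \<le> e \<and> \<bar>ip (Suc m) x' x' - 1\<bar> \<le> e)"
    | "\<bar>\<alpha>\<bar> \<le> \<epsilon>1" | "\<alpha>0 \<le> \<bar>\<alpha>\<bar>"
    | "\<bar>ip (Suc m) x x - 1\<bar> \<le> e" "\<bar>ip (Suc m) x' x' - 1\<bar> \<le> e" "\<epsilon>1 \<le> \<bar>\<alpha>\<bar>" "\<bar>\<alpha>\<bar> \<le> \<alpha>0"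
    by linarith
  then show ?thesis
  proof cases
    case 1
    then have "?I = (\<integral>\<^sup>+X. 0 \<partial>gmat N (Suc m))"
      by (intro nn_integral_cong) (auto simp: trunc_def indicator_def)
    then show ?thesis by simp
  next
    case 2
    have "\<alpha>\<^sup>2 \<le> \<epsilon>1\<^sup>2" using power_mono[OF 2, of 2] by simp
    then have u: "\<beta>\<^sup>2 * \<alpha>\<^sup>2 \<le> \<beta>\<^sup>2 * \<epsilon>1\<^sup>2" by (intro mult_left_mono) auto
    have "?I \<le> (\<integral>\<^sup>+X. ?L x X * ?L x' X \<partial>gmat N (Suc m))"
      by (intro nn_integral_mono) (auto simp: indicator_def)
    also have "\<dots> = ennreal ((1 - \<beta>\<^sup>2 * \<alpha>\<^sup>2) powr (- real N / 2))"
      using le_less_trans[OF u \<epsilon>1(1)] \<beta> unfolding \<alpha>_def by (intro nn_integral_lik_lik) auto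
    also have "\<dots> \<le> ennreal (exp (real N / 2 * (\<beta>\<^sup>2 * \<alpha>\<^sup>2 / (1 - \<beta>\<^sup>2 * \<epsilon>1\<^sup>2))))"
      using u \<epsilon>1 by (intro ennreal_leI powr_le_exp_of_overlap) auto
    also have "\<dots> \<le> ennreal (exp (Suc m * l1 * \<alpha>\<^sup>2 / 2))"
    proof -
      have "real N * \<beta>\<^sup>2 / (1 - \<beta>\<^sup>2 * \<epsilon>1\<^sup>2) \<le> Suc m * l1" using \<epsilon>1 by (simp add: pos_divide_le_eq mult.assoc)
      then have "real N * \<beta>\<^sup>2 / (1 - \<beta>\<^sup>2 * \<epsilon>1\<^sup>2) * (\<alpha>\<^sup>2 / 2) \<le> Suc m * l1 * (\<alpha>\<^sup>2 / 2)" by (intro mult_right_mono) auto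
      then show ?thesis by (intro ennreal_leI) (simp add: mult_ac)
    qed
    also have "\<dots> = ?A" using 2 by simp
    finally show ?thesis by (simp add: add_increasing2)
  next
    case 3
    have "?I \<le> (\<integral>\<^sup>+X. ?L x X * (?L x' X * indicator {X. (\<Sum>k<N. (ip (Suc m) x' (X k))\<^sup>2) \<le> norm_bound \<beta> e N * ip (Suc m) x' x'} X) \<partial>gmat N (Suc m))"
      by (intro nn_integral_mono) (auto simp: indicator_def trunc_def)
    also have "\<dots> \<le> ennreal (exp (norm_bound \<beta> e N / 2))" using \<beta> nb by (intro nn_integral_lik_crude) auto
    also have "\<dots> = ?C" using 3 by simp
    finally show ?thesis by (simp add: add_increasing)
  next
    case 4
    obtain b where b: "b \<in> As" "b \<le> \<bar>\<alpha>\<bar>" "\<bar>\<alpha>\<bar> \<le> b + e" using cover[OF 4(3,4)] by blast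
    have b2: "0 \<le> b" "b \<le> 1 / 2" using a[OF b(1)] by auto
    have "?I \<le> (\<integral>\<^sup>+X. ?L x X * (?L x' X * indicator {X. goodx (cell_s \<beta> b e m N) (Suc m) N (1 + tsel \<beta> b) (cell_const \<beta> b e m N) x X
          \<and> (\<Sum>k<N. (ip (Suc m) x (X k))\<^sup>2) \<le> norm_bound \<beta> e N * ip (Suc m) x x} X) \<partial>gmat N (Suc m))"
      using b(1) by (intro nn_integral_mono) (auto simp: indicator_def trunc_def)
    also have "\<dots> \<le> ennreal (2 * sqrt (Vfun \<beta> e b (cell_zeta e m N)) * exp (Suc m * Hfun \<beta> e b (real N / Suc m) (cell_zeta e m N)))"
      by (rule nn_integral_lik_pair_cell[OF \<beta> b2 e N n 4(1,2) b(2,3)[unfolded \<alpha>_def]])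
    also have "\<dots> = ennreal (2 * sqrt (Vfun \<beta> e b (cell_zeta e m N)) * exp (Suc m * Hfun \<beta> e b (real N / Suc m) (cell_zeta e m N))) * indicator {\<alpha>. b \<le> \<bar>\<alpha>\<bar>} \<alpha>"
      using b by simp
    also have "\<dots> \<le> ?B" by (rule member_le_sum) (use b As in auto)
    finally show ?thesis by (simp add: add_increasing add_increasing2)
  qed
qed

text \<open>Each summand of \<open>nn_integral_trunc_pair\<close> meets the prior tail at its own
  overlap. \<open>H\<close> and \<open>R\<close> say that its exponent does not exceed the decay
  rate there, so every term is bounded by a constant free of the dimension.\<close>

lemma nn_integral_trunc_second_moment:
  fixes \<beta> e l1 \<delta> \<epsilon>1 \<alpha>0 C Vm :: real
  assumes M: "prob_space M" "sets M = sets (vec_borel (Suc m))"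
    and tail: "\<And>a. 0 \<le> a \<Longrightarrow> a \<le> \<alpha>0 \<Longrightarrow> (\<integral>\<^sup>+x. \<integral>\<^sup>+x'. indicator {x'. a \<le> \<bar>ip (Suc m) x x'\<bar>} x' \<partial>M \<partial>M)
      \<le> ennreal (2 * exp (- (Suc m * (a\<^sup>2 / 2 - C * a ^ 3))))"
    and \<beta>: "1 \<le> \<beta>" and e: "0 < e" "e \<le> 1 / 2" and N: "N \<le> m" and As: "finite As"
    and n: "2 \<le> e * Suc m" "4 * exp (- e\<^sup>2 * Suc m / 64) \<le> 1"
    and a: "\<And>a. a \<in> As \<Longrightarrow> 0 \<le> a \<and> a \<le> 1 / 2 \<and> a \<le> \<alpha>0"
    and H: "\<And>a. a \<in> As \<Longrightarrow> Hfun \<beta> e a (real N / Suc m) (cell_zeta e m N) \<le> a\<^sup>2 / 2 - C * a ^ 3"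
    and V: "\<And>a. a \<in> As \<Longrightarrow> Vfun \<beta> e a (cell_zeta e m N) \<le> Vm" "0 \<le> Vm"
    and cover: "\<And>b. \<epsilon>1 \<le> b \<Longrightarrow> b \<le> \<alpha>0 \<Longrightarrow> \<exists>a\<in>As. a \<le> b \<and> b \<le> a + e"
    and \<epsilon>1: "0 \<le> \<epsilon>1" "\<epsilon>1 \<le> \<alpha>0" "\<beta>\<^sup>2 * \<epsilon>1\<^sup>2 < 1" "real N * \<beta>\<^sup>2 \<le> Suc m * (l1 * (1 - \<beta>\<^sup>2 * \<epsilon>1\<^sup>2))"
    and C: "0 \<le> C" "l1 + \<delta> \<le> 1 - 2 * C * \<epsilon>1" "0 < \<delta>" "0 \<le> l1" "l1 \<le> 1"
    and R: "norm_bound \<beta> e N / 2 \<le> Suc m * (\<alpha>0\<^sup>2 / 2 - C * \<alpha>0 ^ 3)"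
  shows "(\<integral>\<^sup>+x. \<integral>\<^sup>+x'. \<integral>\<^sup>+X. (lik \<beta> (Suc m) N x X * indicator {X. trunc \<beta> e m N As x X} X)
        * (lik \<beta> (Suc m) N x' X * indicator {X. trunc \<beta> e m N As x' X} X) \<partial>gmat N (Suc m) \<partial>M \<partial>M)
    \<le> ennreal (2 * exp (2 / \<delta> + 1 / 2) / (1 - exp (- 1)) + real (card As) * (4 * sqrt Vm) + 2)"
proof -
  interpret M: sigma_finite_measure M by (rule prob_space_imp_sigma_finite[OF M(1)])
  define P where "P = M \<Otimes>\<^sub>M M"
  define \<alpha> where "\<alpha> p = ip (Suc m) (fst p) (snd p)" for p :: "(nat \<Rightarrow> real) \<times> (nat \<Rightarrow> real)"
  have coord: "(\<lambda>x. x i) \<in> borel_measurable M" if "i < Suc m" for i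
    unfolding measurable_cong_sets[OF M(2) refl] using that by (intro measurable_component_singleton) simp
  have \<alpha> [measurable]: "\<alpha> \<in> borel_measurable P"
    unfolding \<alpha>_def P_def ip_def
    by (intro borel_measurable_sum borel_measurable_times measurable_compose[OF measurable_fst coord] measurable_compose[OF measurable_snd coord]) auto
  have fst: "(\<integral>\<^sup>+x. \<integral>\<^sup>+x'. h (ip (Suc m) x x') \<partial>M \<partial>M) = (\<integral>\<^sup>+p. h (\<alpha> p) \<partial>P)" if "h \<in> borel_measurable borel" for h :: "real \<Rightarrow> ennreal"
  proof -
    have "(\<lambda>p. h (\<alpha> p)) \<in> borel_measurable (M \<Otimes>\<^sub>M M)" using measurable_compose[OF \<alpha> that] by (simp add: P_def)
    from M.nn_integral_fst[OF this] show ?thesis by (simp add: P_def \<alpha>_def)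
  qed
  have tailP: "(\<integral>\<^sup>+p. indicator {p. b \<le> \<bar>\<alpha> p\<bar>} p \<partial>P) \<le> ennreal (2 * exp (- (Suc m * (b\<^sup>2 / 2 - C * b ^ 3))))"
    if "0 \<le> b" "b \<le> \<alpha>0" for b
  proof -
    have "(\<integral>\<^sup>+p. indicator {p. b \<le> \<bar>\<alpha> p\<bar>} p \<partial>P) = (\<integral>\<^sup>+p. indicator {r. b \<le> \<bar>r\<bar>} (\<alpha> p) \<partial>P)"
      by (intro nn_integral_cong) (simp add: indicator_def)
    also have "\<dots> = (\<integral>\<^sup>+x. \<integral>\<^sup>+x'. indicator {r. b \<le> \<bar>r\<bar>} (ip (Suc m) x x') \<partial>M \<partial>M)"
      by (rule fst[symmetric]) (unfold indicator_def, measurable)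
    also have "\<dots> = (\<integral>\<^sup>+x. \<integral>\<^sup>+x'. indicator {x'. b \<le> \<bar>ip (Suc m) x x'\<bar>} x' \<partial>M \<partial>M)"
      by (intro nn_integral_cong) (simp add: indicator_def)
    finally show ?thesis using tail[OF that] by simp
  qed
  let ?c = "\<lambda>a. ennreal (2 * sqrt (Vfun \<beta> e a (cell_zeta e m N)) * exp (Suc m * Hfun \<beta> e a (real N / Suc m) (cell_zeta e m N)))"
  let ?h = "\<lambda>r. indicator {r. \<bar>r\<bar> \<le> \<epsilon>1} r * ennreal (exp (Suc m * l1 * r\<^sup>2 / 2)) + (\<Sum>a\<in>As. ?c a * indicator {r. a \<le> \<bar>r\<bar>} r)
      + ennreal (exp (norm_bound \<beta> e N / 2)) * indicator {r. \<alpha>0 \<le> \<bar>r\<bar>} r :: ennreal"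
  have "(\<integral>\<^sup>+x. \<integral>\<^sup>+x'. \<integral>\<^sup>+X. (lik \<beta> (Suc m) N x X * indicator {X. trunc \<beta> e m N As x X} X)
        * (lik \<beta> (Suc m) N x' X * indicator {X. trunc \<beta> e m N As x' X} X) \<partial>gmat N (Suc m) \<partial>M \<partial>M)
    \<le> (\<integral>\<^sup>+x. \<integral>\<^sup>+x'. ?h (ip (Suc m) x x') \<partial>M \<partial>M)"
    using a by (intro nn_integral_mono nn_integral_trunc_pair \<beta> e N As n cover \<epsilon>1(3,4)) auto
  also have "\<dots> = (\<integral>\<^sup>+p. ?h (\<alpha> p) \<partial>P)"
    by (rule fst) (unfold indicator_def, measurable)
  also have "\<dots> = (\<integral>\<^sup>+p. indicator {p. \<bar>\<alpha> p\<bar> \<le> \<epsilon>1} p * ennreal (exp (Suc m * l1 * (\<alpha> p)\<^sup>2 / 2)) \<partial>P)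
      + (\<Sum>a\<in>As. ?c a * (\<integral>\<^sup>+p. indicator {p. a \<le> \<bar>\<alpha> p\<bar>} p \<partial>P))
      + ennreal (exp (norm_bound \<beta> e N / 2)) * (\<integral>\<^sup>+p. indicator {p. \<alpha>0 \<le> \<bar>\<alpha> p\<bar>} p \<partial>P)"
  proof -
    have [measurable]: "(\<lambda>p. indicator {p. b \<le> \<bar>\<alpha> p\<bar>} p :: ennreal) \<in> borel_measurable P"
      "(\<lambda>p. indicator {p. \<bar>\<alpha> p\<bar> \<le> b} p :: ennreal) \<in> borel_measurable P" for b
      unfolding indicator_def by measurable
    have "(\<integral>\<^sup>+p. ?h (\<alpha> p) \<partial>P) = (\<integral>\<^sup>+p. indicator {p. \<bar>\<alpha> p\<bar> \<le> \<epsilon>1} p * ennreal (exp (Suc m * l1 * (\<alpha> p)\<^sup>2 / 2))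
      + (\<Sum>a\<in>As. ?c a * indicator {p. a \<le> \<bar>\<alpha> p\<bar>} p)
      + ennreal (exp (norm_bound \<beta> e N / 2)) * indicator {p. \<alpha>0 \<le> \<bar>\<alpha> p\<bar>} p \<partial>P)"
      by (intro nn_integral_cong) (simp add: indicator_def)
    also have "\<dots> = (\<integral>\<^sup>+p. indicator {p. \<bar>\<alpha> p\<bar> \<le> \<epsilon>1} p * ennreal (exp (Suc m * l1 * (\<alpha> p)\<^sup>2 / 2)) + (\<Sum>a\<in>As. ?c a * indicator {p. a \<le> \<bar>\<alpha> p\<bar>} p) \<partial>P)
      + (\<integral>\<^sup>+p. ennreal (exp (norm_bound \<beta> e N / 2)) * indicator {p. \<alpha>0 \<le> \<bar>\<alpha> p\<bar>} p \<partial>P)"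
      by (rule nn_integral_add) measurable
    also have "(\<integral>\<^sup>+p. indicator {p. \<bar>\<alpha> p\<bar> \<le> \<epsilon>1} p * ennreal (exp (Suc m * l1 * (\<alpha> p)\<^sup>2 / 2)) + (\<Sum>a\<in>As. ?c a * indicator {p. a \<le> \<bar>\<alpha> p\<bar>} p) \<partial>P)
      = (\<integral>\<^sup>+p. indicator {p. \<bar>\<alpha> p\<bar> \<le> \<epsilon>1} p * ennreal (exp (Suc m * l1 * (\<alpha> p)\<^sup>2 / 2)) \<partial>P) + (\<integral>\<^sup>+p. (\<Sum>a\<in>As. ?c a * indicator {p. a \<le> \<bar>\<alpha> p\<bar>} p) \<partial>P)"
      by (rule nn_integral_add) measurable
    also have "(\<integral>\<^sup>+p. (\<Sum>a\<in>As. ?c a * indicator {p. a \<le> \<bar>\<alpha> p\<bar>} p) \<partial>P) = (\<Sum>a\<in>As. \<integral>\<^sup>+p. ?c a * indicator {p. a \<le> \<bar>\<alpha> p\<bar>} p \<partial>P)"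
      by (rule nn_integral_sum) measurable
    also have "\<dots> = (\<Sum>a\<in>As. ?c a * (\<integral>\<^sup>+p. indicator {p. a \<le> \<bar>\<alpha> p\<bar>} p \<partial>P))"
      by (intro sum.cong refl nn_integral_cmult) measurable
    also have "(\<integral>\<^sup>+p. ennreal (exp (norm_bound \<beta> e N / 2)) * indicator {p. \<alpha>0 \<le> \<bar>\<alpha> p\<bar>} p \<partial>P)
      = ennreal (exp (norm_bound \<beta> e N / 2)) * (\<integral>\<^sup>+p. indicator {p. \<alpha>0 \<le> \<bar>\<alpha> p\<bar>} p \<partial>P)"
      by (rule nn_integral_cmult) measurable
    finally show ?thesis .
  qed
  also have "\<dots> \<le> ennreal (2 * exp (2 / \<delta> + 1 / 2) / (1 - exp (- 1))) + (\<Sum>a\<in>As. ennreal (4 * sqrt Vm)) + ennreal 2"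
  proof (intro add_mono sum_mono)
    show "(\<integral>\<^sup>+p. indicator {p. \<bar>\<alpha> p\<bar> \<le> \<epsilon>1} p * ennreal (exp (Suc m * l1 * (\<alpha> p)\<^sup>2 / 2)) \<partial>P) \<le> ennreal (2 * exp (2 / \<delta> + 1 / 2) / (1 - exp (- 1)))"
    proof (rule small_overlap_moment[OF \<alpha> _ \<epsilon>1(1) _ C(4,5,3,2)])
      fix b :: real assume b: "0 \<le> b" "b \<le> \<epsilon>1"
      \<comment> \<open>Below \<open>\<epsilon>1\<close> the cubic loss in the tail is traded for
        the smaller quadratic rate \<open>1 - 2 * C * \<epsilon>1\<close>.\<close>
      have "C * b * b\<^sup>2 \<le> C * \<epsilon>1 * b\<^sup>2" using b C by (intro mult_right_mono mult_left_mono) auto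
      moreover have "C * b * b\<^sup>2 = C * b ^ 3" by (simp add: power2_eq_square power3_eq_cube)
      moreover have "(1 - 2 * C * \<epsilon>1) * b\<^sup>2 / 2 = b\<^sup>2 / 2 - C * \<epsilon>1 * b\<^sup>2" by (simp add: left_diff_distrib diff_divide_distrib)
      ultimately have "(1 - 2 * C * \<epsilon>1) * b\<^sup>2 / 2 \<le> b\<^sup>2 / 2 - C * b ^ 3" by linarith
      then have "Suc m * ((1 - 2 * C * \<epsilon>1) * b\<^sup>2 / 2) \<le> Suc m * (b\<^sup>2 / 2 - C * b ^ 3)" by (rule mult_left_mono) simp
      then have "ennreal (2 * exp (- (Suc m * (b\<^sup>2 / 2 - C * b ^ 3)))) \<le> ennreal (2 * exp (- (Suc m * ((1 - 2 * C * \<epsilon>1) * b\<^sup>2 / 2))))"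
        by (intro ennreal_leI) simp
      with tailP[of b] b \<epsilon>1 show "(\<integral>\<^sup>+p. indicator {p. b \<le> \<bar>\<alpha> p\<bar>} p \<partial>P) \<le> ennreal (2 * exp (- (Suc m * ((1 - 2 * C * \<epsilon>1) * b\<^sup>2 / 2))))"
        by (meson order_trans)
    qed simp
  next
    fix b assume b: "b \<in> As"
    have "?c b * (\<integral>\<^sup>+p. indicator {p. b \<le> \<bar>\<alpha> p\<bar>} p \<partial>P) \<le> ennreal (2 * sqrt Vm * exp (Suc m * (b\<^sup>2 / 2 - C * b ^ 3))) * ennreal (2 * exp (- (Suc m * (b\<^sup>2 / 2 - C * b ^ 3))))"
    proof (intro mult_mono tailP)
      have "Suc m * Hfun \<beta> e b (real N / Suc m) (cell_zeta e m N) \<le> Suc m * (b\<^sup>2 / 2 - C * b ^ 3)"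
        using H[OF b] by (rule mult_left_mono) simp
      then have h1: "exp (Suc m * Hfun \<beta> e b (real N / Suc m) (cell_zeta e m N)) \<le> exp (Suc m * (b\<^sup>2 / 2 - C * b ^ 3))" by simp
      have h2: "2 * sqrt (Vfun \<beta> e b (cell_zeta e m N)) \<le> 2 * sqrt Vm" using V(1)[OF b] by simp
      show "?c b \<le> ennreal (2 * sqrt Vm * exp (Suc m * (b\<^sup>2 / 2 - C * b ^ 3)))"
        by (rule ennreal_leI[OF mult_mono[OF h2 h1]]) (use V(2) in simp_all)
    qed (use a[OF b] in auto)
    also have "\<dots> = ennreal (4 * sqrt Vm * (exp (Suc m * (b\<^sup>2 / 2 - C * b ^ 3)) * exp (- (Suc m * (b\<^sup>2 / 2 - C * b ^ 3)))))"
      using V(2) by (simp only: ennreal_mult'[symmetric] exp_ge_zero mult_nonneg_nonneg zero_le_numeral real_sqrt_ge_zero) (simp add: mult_ac)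
    also have "\<dots> = ennreal (4 * sqrt Vm)" by (simp only: exp_minus_inverse mult_1_right)
    finally show "?c b * (\<integral>\<^sup>+p. indicator {p. b \<le> \<bar>\<alpha> p\<bar>} p \<partial>P) \<le> ennreal (4 * sqrt Vm)" .
  next
    define w where "w = Suc m * (\<alpha>0\<^sup>2 / 2 - C * \<alpha>0 ^ 3)"
    have "ennreal (exp (norm_bound \<beta> e N / 2)) * (\<integral>\<^sup>+p. indicator {p. \<alpha>0 \<le> \<bar>\<alpha> p\<bar>} p \<partial>P) \<le> ennreal (exp w) * ennreal (2 * exp (- w))"
      using R tailP[of \<alpha>0] \<epsilon>1 by (intro mult_mono) (auto simp: w_def)
    also have "\<dots> = ennreal (2 * (exp w * exp (- w)))" by (simp add: ennreal_mult'[symmetric] mult_ac)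
    also have "\<dots> = ennreal 2" by (simp only: exp_minus_inverse mult_1_right)
    finally show "ennreal (exp (norm_bound \<beta> e N / 2)) * (\<integral>\<^sup>+p. indicator {p. \<alpha>0 \<le> \<bar>\<alpha> p\<bar>} p \<partial>P) \<le> ennreal 2" .
  qed
  also have "\<dots> = ennreal (2 * exp (2 / \<delta> + 1 / 2) / (1 - exp (- 1)) + real (card As) * (4 * sqrt Vm) + 2)"
  proof -
    have 1: "(0 :: real) \<le> 2 * exp (2 / \<delta> + 1 / 2) / (1 - exp (- 1))" by simp
    have 2: "0 \<le> real (card As) * (4 * sqrt Vm)" using V(2) by simp
    have "(\<Sum>a\<in>As. ennreal (4 * sqrt Vm)) = ennreal (real (card As) * (4 * sqrt Vm))"
      using V(2) by (simp add: ennreal_of_nat_eq_real_of_nat ennreal_mult'[symmetric])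
    then show ?thesis
      by (simp only: ennreal_plus[OF 1 2] ennreal_plus[OF add_nonneg_nonneg[OF 1 2] zero_le_numeral])
  qed
  finally show ?thesis .
qed

section \<open>Passage to the limit and choice of the constants\<close>

lemma tendsto_zero_of_truncation:
  fixes L u b :: "nat \<Rightarrow> ennreal" and D :: real
  assumes le: "\<And>K :: real. K > 0 \<Longrightarrow> \<forall>\<^sub>F n in sequentially. L n \<le> u n + ennreal K * b n + ennreal (1 / K) * ennreal D"
    and u: "u \<longlonglongrightarrow> 0" and b: "b \<longlonglongrightarrow> 0" and D: "0 \<le> D"
  shows "L \<longlonglongrightarrow> 0"
proof (rule order_tendstoI)
  fix a :: ennreal assume "0 < a"
  then obtain y0 where "0 < y0" "y0 < a" using dense by blast
  then obtain y where y: "0 < y" "ennreal y < a"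
    by (cases y0) (auto simp: ennreal_less_zero_iff)
  \<comment> \<open>Makes \<open>D / K\<close> at most \<open>y / 2\<close>, half of the target; the
    summand 1 keeps \<open>K\<close> positive when \<open>D = 0\<close>.\<close>
  define K where "K = 2 * (D + 1) / y"
  have K: "K > 0" using y D by (simp add: K_def)
  have "(\<lambda>n. u n + ennreal K * b n) \<longlonglongrightarrow> 0 + ennreal K * 0"
    by (intro tendsto_add u ennreal_tendsto_cmult b) simp
  then have "\<forall>\<^sub>F n in sequentially. u n + ennreal K * b n < ennreal (y / 2)"
    using y by (intro order_tendstoD(2)) (auto simp: ennreal_zero_less_divide)
  with le[OF K] show "\<forall>\<^sub>F n in sequentially. L n < a"
  proof eventually_elim
    case (elim n)
    have "1 / K * D \<le> y / 2" using y D by (simp add: K_def field_simps)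
    then have "ennreal (1 / K) * ennreal D \<le> ennreal (y / 2)" using K D by (simp add: ennreal_mult'[symmetric] ennreal_leI)
    with elim have "L n \<le> ennreal (y / 2) + ennreal (y / 2)" by (meson add_mono less_imp_le order_trans)
    also have "\<dots> = ennreal y" using y by (simp add: ennreal_plus[symmetric] del: ennreal_plus)
    finally show ?case using y by simp
  qed
qed simp

text \<open>For spikes of atypical norm \<open>trunc\<close> fails outright, but the likelihood
  ratio integrates to 1, so the prior probability of such spikes is enough.\<close>

lemma integral_lik_not_trunc:
  fixes \<beta> e V :: real
  assumes M: "prob_space M" "sets M = sets (vec_borel (Suc m))"
    and nrm: "(\<integral>\<^sup>+x. indicator {x. e < \<bar>ip (Suc m) x x - 1\<bar>} x \<partial>M) \<le> ennreal w1"
    and w: "0 \<le> w1" "0 \<le> w2"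
    and bad: "\<And>x. \<bar>ip (Suc m) x x - 1\<bar> \<le> e \<Longrightarrow>
      (\<integral>\<^sup>+X. lik \<beta> (Suc m) N x X * indicator {X. \<not> trunc \<beta> e m N As x X} X \<partial>gmat N (Suc m)) \<le> ennreal w2"
    and \<beta>: "0 \<le> \<beta>"
  shows "(\<integral>\<^sup>+x. \<integral>\<^sup>+X. lik \<beta> (Suc m) N x X * indicator {X. \<not> trunc \<beta> e m N As x X} X \<partial>gmat N (Suc m) \<partial>M) \<le> ennreal (w1 + w2)"
proof -
  interpret M: prob_space M by (rule M)
  have coord: "(\<lambda>x. x i) \<in> borel_measurable M" if "i < Suc m" for i
    unfolding measurable_cong_sets[OF M(2) refl] using that by (intro measurable_component_singleton) simp
  have [measurable]: "(\<lambda>x. ip (Suc m) x x) \<in> borel_measurable M" by (intro measurable_ip_both coord)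
  have "(\<integral>\<^sup>+x. \<integral>\<^sup>+X. lik \<beta> (Suc m) N x X * indicator {X. \<not> trunc \<beta> e m N As x X} X \<partial>gmat N (Suc m) \<partial>M)
    \<le> (\<integral>\<^sup>+x. indicator {x. e < \<bar>ip (Suc m) x x - 1\<bar>} x + ennreal w2 \<partial>M)"
  proof (rule nn_integral_mono)
    fix x
    show "(\<integral>\<^sup>+X. lik \<beta> (Suc m) N x X * indicator {X. \<not> trunc \<beta> e m N As x X} X \<partial>gmat N (Suc m))
      \<le> indicator {x. e < \<bar>ip (Suc m) x x - 1\<bar>} x + ennreal w2"
    proof (cases "\<bar>ip (Suc m) x x - 1\<bar> \<le> e")
      case True
      then show ?thesis using bad by simp
    next
      case False
      have "(\<integral>\<^sup>+X. lik \<beta> (Suc m) N x X * indicator {X. \<not> trunc \<beta> e m N As x X} X \<partial>gmat N (Suc m)) \<le> (\<integral>\<^sup>+X. lik \<beta> (Suc m) N x X \<partial>gmat N (Suc m))"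
        by (intro nn_integral_mono) (auto simp: indicator_def)
      also have "\<dots> = 1" by (rule nn_integral_lik_1[OF \<beta>])
      finally show ?thesis using False by (simp add: add_increasing2)
    qed
  qed
  also have "\<dots> = (\<integral>\<^sup>+x. indicator {x. e < \<bar>ip (Suc m) x x - 1\<bar>} x \<partial>M) + ennreal w2"
  proof -
    have "(\<lambda>x. indicator {x. e < \<bar>ip (Suc m) x x - 1\<bar>} x :: ennreal) \<in> borel_measurable M"
      unfolding indicator_def by measurable
    then show ?thesis by (simp add: nn_integral_add M.emeasure_space_1)
  qed
  also have "\<dots> \<le> ennreal w1 + ennreal w2" by (intro add_right_mono nrm)
  also have "\<dots> = ennreal (w1 + w2)" using w by simp
  finally show ?thesis .
qed

text \<open>Points spaced by \<open>e\<close> starting at \<open>\<epsilon>1\<close>. Each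
  \<open>b\<close> is assigned the grid point just below it, so that the event of overlap
  \<open>b\<close> is contained in the tail event at that point.\<close>

lemma grid_cover:
  fixes \<epsilon>1 \<alpha>0 e :: real
  assumes "0 < e"
  shows "\<exists>As. finite As \<and> As \<subseteq> {\<epsilon>1..\<alpha>0} \<and> (\<forall>b. \<epsilon>1 \<le> b \<longrightarrow> b \<le> \<alpha>0 \<longrightarrow> (\<exists>a\<in>As. a \<le> b \<and> b \<le> a + e))"
proof (intro exI conjI allI impI)
  let ?As = "{a. a \<le> \<alpha>0} \<inter> (\<lambda>i::nat. \<epsilon>1 + i * e) ` {..nat \<lfloor>(\<alpha>0 - \<epsilon>1) / e\<rfloor>}"
  show "finite ?As" by simp
  show "?As \<subseteq> {\<epsilon>1..\<alpha>0}" using assms by auto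
  fix b assume b: "\<epsilon>1 \<le> b" "b \<le> \<alpha>0"
  define u where "u = (b - \<epsilon>1) / e"
  define i where "i = nat \<lfloor>u\<rfloor>"
  have u: "0 \<le> u" "b = \<epsilon>1 + u * e" using b assms by (auto simp: u_def)
  have "u \<le> (\<alpha>0 - \<epsilon>1) / e" using b assms by (simp add: u_def divide_right_mono)
  then have i: "i \<le> nat \<lfloor>(\<alpha>0 - \<epsilon>1) / e\<rfloor>" unfolding i_def by (intro nat_mono floor_mono)
  have iu: "real i \<le> u" "u \<le> real i + 1" using u unfolding i_def by simp_all
  have "real i * e \<le> u * e" "u * e \<le> (real i + 1) * e" using iu assms by (auto intro!: mult_right_mono)
  then have "\<epsilon>1 + real i * e \<le> b" "b \<le> \<epsilon>1 + real i * e + e" using u(2) by (simp_all add: distrib_right)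
  then show "\<exists>a\<in>?As. a \<le> b \<and> b \<le> a + e" using i b by (intro bexI[of _ "\<epsilon>1 + real i * e"]) auto
qed

theorem proposition5p10:
  fixes \<pi> :: "real measure"
  assumes "prob_space \<pi>" and "sets \<pi> = sets borel"
    and "integrable \<pi> (\<lambda>t. t)" and "(\<integral>t. t \<partial>\<pi>) = 0"
    and "integrable \<pi> (\<lambda>t. t\<^sup>2)" and "(\<integral>t. t\<^sup>2 \<partial>\<pi>) = 1"
    and "\<exists>a b. a < 0 \<and> 0 < b \<and> (\<forall>\<theta>\<in>{a<..<b}. product_mgf \<pi> \<theta> < \<infinity>)"
  shows "\<exists>\<beta>bar :: real. \<forall>\<beta> \<gamma> :: real. \<forall>N :: nat \<Rightarrow> nat.
           \<beta> \<ge> -1 \<longrightarrow> \<beta> \<ge> \<beta>bar \<longrightarrow> \<gamma> > \<beta>\<^sup>2 \<longrightarrow> (\<lambda>n. real n / real (N n)) \<longlonglongrightarrow> \<gamma> \<longrightarrow>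
           contiguous (spiked_wishart \<beta> (iid_prior \<pi>) N) (unspiked_wishart (iid_prior \<pi>) N)"
proof -
  obtain C \<theta>1 where C: "0 \<le> C" and \<theta>1: "0 < \<theta>1"
    and mgf: "\<And>\<theta>. \<bar>\<theta>\<bar> \<le> \<theta>1 \<Longrightarrow> product_mgf \<pi> \<theta> \<le> ennreal (exp (\<theta>\<^sup>2 / 2 + C * \<bar>\<theta>\<bar> ^ 3))"
    using product_mgf_bound[OF assms] by blast
  obtain V where V: "0 \<le> V" and norm: "\<And>(n::nat) e :: real. n > 0 \<Longrightarrow> e > 0 \<Longrightarrow>
      (\<integral>\<^sup>+x. indicator {x. e < \<bar>ip n x x - 1\<bar>} x \<partial>iid_prior \<pi> n) \<le> ennreal (V / (n * e\<^sup>2))"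
    using prior_norm[OF assms] by blast
  \<comment> \<open>The range of the tail bound, cut down so that \<open>(2 * C + 1) * a ^ 3\<close>
    stays below \<open>a^2 / 10\<close> for all \<open>a\<close> up to
    \<open>\<alpha>0\<close>.\<close>
  define \<alpha>0 where "\<alpha>0 = min \<theta>1 (1 / (10 * (2 * C + 1)))"
  have \<alpha>0: "0 < \<alpha>0" "\<alpha>0 \<le> \<theta>1" using \<theta>1 C by (auto simp: \<alpha>0_def)
  have "\<alpha>0 \<le> 1 / (10 * (2 * C + 1))" by (simp add: \<alpha>0_def)
  then have \<alpha>0C: "\<alpha>0 * (10 * (2 * C + 1)) \<le> 1" using C by (simp add: field_simps)
  have C\<alpha>: "0 \<le> C * \<alpha>0" using C \<alpha>0 by simp
  have small: "\<alpha>0 \<le> 1 / 10" "4 * (C * \<alpha>0) \<le> 1" using \<alpha>0C C\<alpha> \<alpha>0 by (simp_all add: algebra_simps)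
  \<comment> \<open>The three entries serve the estimates that assume
    \<open>\<beta> \<ge> 1\<close>, the cubic gain in the exponent, and the crude bound beyond
    \<open>\<alpha>0\<close>. They depend on \<open>\<pi>\<close> only; \<open>\<gamma>\<close>
    enters through the margin \<open>\<tau>\<close> in the constants chosen later.\<close>
  define \<beta>bar where "\<beta>bar = max 1 (max (20 * (2 * C + 1)) (20 / \<alpha>0\<^sup>2))"
  have "contiguous (spiked_wishart \<beta> (iid_prior \<pi>) N) (unspiked_wishart (iid_prior \<pi>) N)"
    if "\<beta>bar \<le> \<beta>" and \<gamma>: "\<beta>\<^sup>2 < \<gamma>" and lim: "(\<lambda>n. real n / real (N n)) \<longlonglongrightarrow> \<gamma>" for \<beta> \<gamma> :: real and N :: "nat \<Rightarrow> nat"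
  proof -
    have \<beta>: "1 \<le> \<beta>" "20 * (2 * C + 1) \<le> \<beta>" "20 / \<alpha>0\<^sup>2 \<le> \<beta>" using that(1) by (auto simp: \<beta>bar_def)
    have \<beta>2: "1 \<le> \<beta>\<^sup>2" using \<beta> by (simp add: one_le_power)
    have \<gamma>0: "0 < \<gamma>" using \<beta>2 \<gamma> by linarith
    define \<mu> where "\<mu> = \<beta>\<^sup>2 / \<gamma>"
    define \<nu> where "\<nu> = \<mu> / \<beta>\<^sup>2"
    define \<tau> where "\<tau> = 1 - \<mu>"
    have \<mu>: "0 < \<mu>" "\<mu> < 1" using \<beta>2 \<gamma> \<gamma>0 less_le_trans[OF zero_less_one \<beta>2] by (simp_all add: \<mu>_def del: zero_less_power2)
    have \<nu>: "\<nu> = 1 / \<gamma>" "0 < \<nu>" "\<nu> * \<beta>\<^sup>2 = \<mu>" using \<beta> \<gamma>0 by (auto simp: \<nu>_def \<mu>_def)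
    have \<tau>: "0 < \<tau>" "\<tau> < 1" using \<mu> by (auto simp: \<tau>_def)
    \<comment> \<open>Small enough that the factor
      \<open>1 / (1 - \<beta>^2 * \<epsilon>1^2)\<close> in the plain correlation and the cubic loss
      \<open>2 * C * \<epsilon>1\<close> both fit into the margin \<open>\<tau>\<close>.\<close>
    define \<epsilon>1 where "\<epsilon>1 = min \<alpha>0 (min (\<tau> / (4 * \<beta>)) (\<tau> / (16 * (C + 1))))"
    have \<epsilon>1: "0 < \<epsilon>1" "\<epsilon>1 \<le> \<alpha>0" using \<alpha>0 \<tau> \<beta> C by (auto simp: \<epsilon>1_def)
    have "\<epsilon>1 \<le> \<tau> / (4 * \<beta>)" by (simp add: \<epsilon>1_def)
    then have "\<beta> * \<epsilon>1 \<le> \<tau> / 4" using \<beta> by (simp add: field_simps)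
    then have "(\<beta> * \<epsilon>1)\<^sup>2 \<le> (\<tau> / 4)\<^sup>2" using \<beta> \<epsilon>1 by (intro power_mono) auto
    also have "\<dots> \<le> \<tau> / 4" using \<tau> by (simp add: power2_eq_square)
    finally have \<beta>\<epsilon>: "\<beta>\<^sup>2 * \<epsilon>1\<^sup>2 \<le> \<tau> / 4" by (simp add: power_mult_distrib)
    have "\<epsilon>1 \<le> \<tau> / (16 * (C + 1))" by (simp add: \<epsilon>1_def)
    then have C\<epsilon>: "2 * C * \<epsilon>1 \<le> \<tau> / 8" using C \<epsilon>1 by (simp add: field_simps)
    obtain d where d: "0 < d" "d \<le> 1 / 2"
      and H: "\<And>e a \<nu>' \<zeta>. 0 \<le> e \<Longrightarrow> e \<le> d \<Longrightarrow> \<epsilon>1 \<le> a \<Longrightarrow> a \<le> \<alpha>0 \<Longrightarrow> \<bar>\<nu>' - \<nu>\<bar> \<le> d \<Longrightarrow> \<bar>\<zeta> - \<nu>\<bar> \<le> d \<Longrightarrow>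
        Hfun \<beta> e a \<nu>' \<zeta> \<le> a\<^sup>2 / 2 - C * a ^ 3"
      using Hfun_uniform[OF \<beta>(1,2) C \<epsilon>1 \<alpha>0C \<mu>] unfolding \<nu>_def[symmetric] by blast
    \<comment> \<open>The half of \<open>d\<close> is taken because \<open>\<zeta>\<close> may
      deviate from \<open>\<nu>\<close> by \<open>2 * e\<close>. The second entry gives
      \<open>\<beta>^2 * (\<nu> + 2 * e) \<le> 1\<close>, from which \<open>good_cell\<close> gets
      the larger root.\<close>
    define e where "e = min (d / 2) (\<tau> / (2 * \<beta>\<^sup>2))"
    have e: "0 < e" "e \<le> 1 / 2" "2 * e \<le> d" using d \<tau> \<beta> by (auto simp: e_def)
    have "e \<le> \<tau> / (2 * \<beta>\<^sup>2)" by (simp add: e_def)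
    moreover have "0 < 2 * \<beta>\<^sup>2" using \<beta>2 by linarith
    ultimately have e\<beta>: "e * \<beta>\<^sup>2 \<le> \<tau> / 2" using pos_le_divide_eq[of "2 * \<beta>\<^sup>2" e \<tau>] by simp
    obtain As where As: "finite As" "As \<subseteq> {\<epsilon>1..\<alpha>0}" and cover: "\<And>b. \<epsilon>1 \<le> b \<Longrightarrow> b \<le> \<alpha>0 \<Longrightarrow> \<exists>a\<in>As. a \<le> b \<and> b \<le> a + e"
      using grid_cover[OF e(1), of \<epsilon>1 \<alpha>0] by blast
    have a: "0 \<le> a" "a \<le> 1 / 2" "a \<le> \<alpha>0" "\<epsilon>1 \<le> a" if "a \<in> As" for a
      using that As \<epsilon>1 small by force+
    define D where "D = 2 * exp (2 / (\<tau> / 8) + 1 / 2) / (1 - exp (- 1)) + real (card As) * (4 * sqrt (27 + 36 * \<beta>)) + 2"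
    \<comment> \<open>The discarded mass: Chebyshev for the norm of the spike, the chi-square tail
      for the length of \<open>X^T x\<close>, and the bad events of the grid. \<open>N n\<close> is
      replaced by its eventual bounds \<open>\<nu> / 2 * n\<close> from below and \<open>n\<close>
      from above.\<close>
    define w where "w n = V / (real n * e\<^sup>2) + (exp (- (e\<^sup>2 * (\<nu> / 2 * real n) / 16)) + real (card As) * (2 * real n * exp (- (e\<^sup>2 * real n / 16))))" for n :: nat
    have w: "(\<lambda>n. ennreal (w n)) \<longlonglongrightarrow> 0"
    proof -
      have l1: "(\<lambda>n. 1 / real n) \<longlonglongrightarrow> 0" by (rule lim_1_over_n)
      have l2: "(\<lambda>n. exp (- (c * real n))) \<longlonglongrightarrow> 0" "(\<lambda>n. real n * exp (- (c * real n))) \<longlonglongrightarrow> 0" if "c > 0" for c :: real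
        using that by real_asymp+
      have c: "0 < e\<^sup>2 * \<nu> / 32" "0 < e\<^sup>2 / 16" using e \<nu>(2) by simp_all
      have "(\<lambda>n. V / e\<^sup>2 * (1 / real n) + (exp (- (e\<^sup>2 * \<nu> / 32 * real n)) + 2 * real (card As) * (real n * exp (- (e\<^sup>2 / 16 * real n))))) \<longlonglongrightarrow> V / e\<^sup>2 * 0 + (0 + 2 * real (card As) * 0)"
        by (intro tendsto_add tendsto_mult_left l1 l2 c)
      then have "w \<longlonglongrightarrow> 0" unfolding w_def by (simp add: mult_ac)
      then show ?thesis using tendsto_ennrealI by fastforce
    qed
    have ratio: "(\<lambda>n. real (N n) / real n) \<longlonglongrightarrow> \<nu>"
      using tendsto_inverse[OF lim] \<gamma>0 by (simp add: \<nu>(1) inverse_eq_divide)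
    have ratio1: "(\<lambda>n. (real (N n) + 1) / real n) \<longlonglongrightarrow> \<nu>"
    proof -
      have "(\<lambda>n. real (N n) / real n + 1 / real n) \<longlonglongrightarrow> \<nu> + 0" by (intro tendsto_add ratio lim_1_over_n)
      then show ?thesis by (simp add: add_divide_distrib)
    qed
    have ev: "\<forall>\<^sub>F n in sequentially. 0 < n \<and> \<bar>real (N n) / real n - \<nu>\<bar> \<le> d \<and> \<nu> / 2 \<le> real (N n) / real n
      \<and> (real (N n) + 1) / real n \<le> \<nu> + e \<and> 2 \<le> e * real n \<and> 4 * exp (- e\<^sup>2 * real n / 64) \<le> 1"
    proof (intro eventually_conj)
      show "\<forall>\<^sub>F n in sequentially. 0 < n" by (rule eventually_gt_at_top)
      show "\<forall>\<^sub>F n in sequentially. \<bar>real (N n) / real n - \<nu>\<bar> \<le> d"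
        using tendstoD[OF ratio d(1)] by eventually_elim (simp add: dist_real_def)
      show "\<forall>\<^sub>F n in sequentially. \<nu> / 2 \<le> real (N n) / real n"
        using order_tendstoD(1)[OF ratio, of "\<nu> / 2"] \<nu>(2) by (auto elim: eventually_mono)
      show "\<forall>\<^sub>F n in sequentially. (real (N n) + 1) / real n \<le> \<nu> + e"
        using order_tendstoD(2)[OF ratio1, of "\<nu> + e"] e by (auto elim: eventually_mono)
      show "\<forall>\<^sub>F n in sequentially. 2 \<le> e * real n" using e(1) by real_asymp
      have "0 < e\<^sup>2" using e by simp
      then show "\<forall>\<^sub>F n in sequentially. 4 * exp (- e\<^sup>2 * real n / 64) \<le> 1" by real_asymp
    qed
    show ?thesis
    proof (rule contiguous_spiked_wishartI)
      show "0 \<le> \<beta>" using \<beta> by simp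
      show "sets (iid_prior \<pi> n) = sets (vec_borel n)" "prob_space (iid_prior \<pi> n)" for n
        by (rule sets_iid_prior[OF assms] prob_iid_prior[OF assms])+
    next
      fix B assume B: "\<And>n. B n \<in> sets (gmat (N n) n)" "(\<lambda>n. emeasure (gmat (N n) n) (B n)) \<longlonglongrightarrow> 0"
      let ?L = "\<lambda>n. \<integral>\<^sup>+x. \<integral>\<^sup>+X. lik \<beta> n (N n) x X * indicator (B n) X \<partial>gmat (N n) n \<partial>iid_prior \<pi> n"
      show "?L \<longlonglongrightarrow> 0"
      proof (rule tendsto_zero_of_truncation[OF _ w B(2)])
        show "0 \<le> D" using \<beta> by (auto simp: D_def intro!: add_nonneg_nonneg divide_nonneg_nonneg)
        fix K :: real assume K: "0 < K"
        show "\<forall>\<^sub>F n in sequentially. ?L n \<le> ennreal (w n) + ennreal K * emeasure (gmat (N n) n) (B n) + ennreal (1 / K) * ennreal D"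
          using ev
        proof eventually_elim
          case (elim n)
          then obtain m where n: "n = Suc m" by (cases n) auto
          define k where "k = N n"
          have rn: "0 < real n" by (simp add: n)
          have r: "real k = real k / real n * real n" using rn by simp
          define \<zeta> where "\<zeta> = cell_zeta e m k"
          have \<zeta>: "\<zeta> = (real k + 1) / real n + e" by (simp add: \<zeta>_def cell_zeta_def n)
          have kn: "real k / real n \<le> (real k + 1) / real n" by (intro divide_right_mono) auto
          have k1: "(real k + 1) / real n \<le> \<nu> + e" and k2: "\<nu> / 2 \<le> real k / real n" and k3: "\<bar>real k / real n - \<nu>\<bar> \<le> d"
            using elim by (auto simp: k_def)
          have "(\<nu> + e) * \<beta>\<^sup>2 = \<mu> + e * \<beta>\<^sup>2" "(\<nu> + e + e) * \<beta>\<^sup>2 = \<mu> + e * \<beta>\<^sup>2 + e * \<beta>\<^sup>2"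
            by (simp_all add: distrib_right \<nu>(3))
          moreover have "\<mu> = 1 - \<tau>" by (simp add: \<tau>_def)
          ultimately have \<nu>e: "(\<nu> + e) * \<beta>\<^sup>2 \<le> 1 - \<tau> / 2" "(\<nu> + e + e) * \<beta>\<^sup>2 \<le> 1"
            using e\<beta> by argo+
          have \<nu>1: "\<nu> + e \<le> 1"
          proof -
            have "(\<nu> + e) * 1 \<le> (\<nu> + e) * \<beta>\<^sup>2" using \<nu>(2) e \<beta>2 by (intro mult_left_mono) auto
            also have "\<dots> \<le> 1 - \<tau> / 2" by (rule \<nu>e)
            also have "\<dots> \<le> 1" using \<tau> by simp
            finally show ?thesis by simp
          qed
          have "(real k + 1) / real n \<le> 1" using k1 \<nu>1 by linarith
          then have "real k + 1 \<le> real n" using rn by (simp only: pos_divide_le_eq mult_1)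
          then have km: "k \<le> m" by (simp add: n)
          have k\<beta>: "real k / real n * \<beta>\<^sup>2 \<le> 1 - \<tau> / 2"
          proof -
            have "real k / real n * \<beta>\<^sup>2 \<le> (\<nu> + e) * \<beta>\<^sup>2" using kn k1 by (intro mult_right_mono) auto
            then show ?thesis using \<nu>e by linarith
          qed
          have k0: "0 < k" using k2 \<nu>(2) by (cases k) auto
          have kle: "real k \<le> real n" using \<open>real k + 1 \<le> real n\<close> by simp
          have \<zeta>2: "0 \<le> \<zeta>" "\<zeta> \<le> 2" "\<bar>\<zeta> - \<nu>\<bar> \<le> d"
          proof -
            have "\<zeta> \<le> \<nu> + e + e" using k1 by (simp add: \<zeta>)
            then show "\<zeta> \<le> 2" using \<nu>1 e by linarith
            have "real k / real n \<le> \<zeta>" using kn e by (simp add: \<zeta>)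
            then show "\<bar>\<zeta> - \<nu>\<bar> \<le> d" using k3 \<open>\<zeta> \<le> \<nu> + e + e\<close> e by linarith
            show "0 \<le> \<zeta>" using e by (simp add: \<zeta>)
          qed
          \<comment> \<open>Here \<open>\<gamma> > \<beta>^2\<close> enters the recursion:
            \<open>tsel\<close> is at most \<open>\<beta>\<close>, and
            \<open>\<beta>^2 * \<zeta>\<close> stays below 1.\<close>
          have root: "(tsel \<beta> a)\<^sup>2 * \<zeta> \<le> 1 + e" if "a \<in> As" for a
          proof -
            have "(tsel \<beta> a)\<^sup>2 \<le> \<beta>\<^sup>2" using tsel_bounds[OF \<beta>(1) a(1)[OF that]] by (intro power_mono) auto
            then have "(tsel \<beta> a)\<^sup>2 * \<zeta> \<le> \<beta>\<^sup>2 * \<zeta>" using \<zeta>2 by (intro mult_right_mono)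
            also have "\<dots> \<le> \<beta>\<^sup>2 * (\<nu> + e + e)" using k1 by (intro mult_left_mono) (auto simp: \<zeta>)
            also have "\<dots> \<le> 1" using \<nu>e(2) by (simp add: mult.commute)
            finally show ?thesis using e by linarith
          qed
          have M: "prob_space (iid_prior \<pi> n)" "sets (iid_prior \<pi> n) = sets (vec_borel (Suc m))"
            using prob_iid_prior[OF assms] sets_iid_prior[OF assms, of n] by (auto simp: n)
          have coord: "(\<lambda>x. x i) \<in> borel_measurable (iid_prior \<pi> n)" if "i < n" for i
            by (rule measurable_prior_coord[OF assms that])
          have ml: "(\<lambda>p. lik \<beta> n k (fst p) (snd p)) \<in> borel_measurable (iid_prior \<pi> n \<Otimes>\<^sub>M gmat k n)"
            by (intro measurable_lik measurable_compose[OF measurable_fst coord] measurable_snd)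
          have mt: "Measurable.pred (iid_prior \<pi> n \<Otimes>\<^sub>M gmat k n) (\<lambda>p. trunc \<beta> e m k As (fst p) (snd p))"
            unfolding n
            by (intro pred_trunc As measurable_compose[OF measurable_fst coord[unfolded n]] measurable_snd)
          have bad: "(\<integral>\<^sup>+x. \<integral>\<^sup>+X. lik \<beta> n k x X * indicator {X. \<not> trunc \<beta> e m k As x X} X \<partial>gmat k n \<partial>iid_prior \<pi> n) \<le> ennreal (w n)"
          proof -
            have "(\<integral>\<^sup>+x. \<integral>\<^sup>+X. lik \<beta> n k x X * indicator {X. \<not> trunc \<beta> e m k As x X} X \<partial>gmat k n \<partial>iid_prior \<pi> n)
              \<le> ennreal (V / (real n * e\<^sup>2) + (exp (- (e\<^sup>2 * real k / 16)) + real (card As) * (2 * real k * exp (- (e\<^sup>2 * real n / 16)))))"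
              unfolding n
            proof (rule integral_lik_not_trunc)
              show "prob_space (iid_prior \<pi> (Suc m))" "sets (iid_prior \<pi> (Suc m)) = sets (vec_borel (Suc m))"
                using M by (simp_all only: n)
              show "(\<integral>\<^sup>+x. indicator {x. e < \<bar>ip (Suc m) x x - 1\<bar>} x \<partial>iid_prior \<pi> (Suc m)) \<le> ennreal (V / (real (Suc m) * e\<^sup>2))"
                by (intro norm e) simp
              show "0 \<le> V / (real (Suc m) * e\<^sup>2)" using V by simp
              show "0 \<le> exp (- (e\<^sup>2 * real k / 16)) + real (card As) * (2 * real k * exp (- (e\<^sup>2 * real (Suc m) / 16)))"
                by (intro add_nonneg_nonneg mult_nonneg_nonneg) auto
              show "0 \<le> \<beta>" using \<beta> by simp
              fix x assume "\<bar>ip (Suc m) x x - 1\<bar> \<le> e"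
              then show "(\<integral>\<^sup>+X. lik \<beta> (Suc m) k x X * indicator {X. \<not> trunc \<beta> e m k As x X} X \<partial>gmat k (Suc m))
                \<le> ennreal (exp (- (e\<^sup>2 * real k / 16)) + real (card As) * (2 * real k * exp (- (e\<^sup>2 * real (Suc m) / 16))))"
                using a root unfolding \<zeta>_def by (intro nn_integral_lik_not_trunc \<beta> e k0 km As) auto
            qed
            also have "\<dots> \<le> ennreal (w n)"
            proof -
              have "\<nu> / 2 * real n \<le> real k" using mult_right_mono[OF k2, of "real n"] r by simp
              then have "e\<^sup>2 * (\<nu> / 2 * real n) \<le> e\<^sup>2 * real k" by (intro mult_left_mono) auto
              then have "exp (- (e\<^sup>2 * real k / 16)) \<le> exp (- (e\<^sup>2 * (\<nu> / 2 * real n) / 16))"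
                by (simp only: exp_le_cancel_iff neg_le_iff_le)
              moreover have "2 * real k * exp (- (e\<^sup>2 * real n / 16)) \<le> 2 * real n * exp (- (e\<^sup>2 * real n / 16))"
                using kle by (intro mult_right_mono) auto
              ultimately show ?thesis unfolding w_def by (intro ennreal_leI add_mono mult_left_mono) auto
            qed
            finally show ?thesis .
          qed
          have second: "(\<integral>\<^sup>+x. \<integral>\<^sup>+x'. \<integral>\<^sup>+X. (lik \<beta> n k x X * indicator {X. trunc \<beta> e m k As x X} X)
              * (lik \<beta> n k x' X * indicator {X. trunc \<beta> e m k As x' X} X) \<partial>gmat k n \<partial>iid_prior \<pi> n \<partial>iid_prior \<pi> n) \<le> ennreal D"
            unfolding n D_def
          proof (rule nn_integral_trunc_second_moment[where ?\<alpha>0.0=\<alpha>0 and ?\<epsilon>1.0=\<epsilon>1 and C=C and ?l1.0="1 - \<tau> / 4"])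
            show "prob_space (iid_prior \<pi> (Suc m))" "sets (iid_prior \<pi> (Suc m)) = sets (vec_borel (Suc m))"
              using M by (simp_all only: n)
            show "(\<integral>\<^sup>+x. \<integral>\<^sup>+x'. indicator {x'. b \<le> \<bar>ip (Suc m) x x'\<bar>} x' \<partial>iid_prior \<pi> (Suc m) \<partial>iid_prior \<pi> (Suc m))
              \<le> ennreal (2 * exp (- (Suc m * (b\<^sup>2 / 2 - C * b ^ 3))))" if "0 \<le> b" "b \<le> \<alpha>0" for b
              by (rule prior_overlap_tail[OF assms C mgf that(1) order_trans[OF that(2) \<alpha>0(2)] zero_less_Suc])
            show "2 \<le> e * real (Suc m)" "4 * exp (- e\<^sup>2 * real (Suc m) / 64) \<le> 1" using elim unfolding n by blast+
            show "Hfun \<beta> e b (real k / real (Suc m)) (cell_zeta e m k) \<le> b\<^sup>2 / 2 - C * b ^ 3" if "b \<in> As" for b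
              using k3 \<zeta>2(3) a[OF that] e unfolding n \<zeta>_def by (intro H) auto
            show "Vfun \<beta> e b (cell_zeta e m k) \<le> 27 + 36 * \<beta>" if "b \<in> As" for b
              using \<zeta>2(1,2) a[OF that] e \<beta> unfolding \<zeta>_def by (intro Vfun_le) auto
            \<comment> \<open>\<open>1 - \<tau> / 2\<close> is at most the square of
              \<open>1 - \<tau> / 4\<close>: one factor is the rate \<open>l1\<close>, the other
              pays for \<open>1 - \<beta>^2 * \<epsilon>1^2\<close>.\<close>
            show "real k * \<beta>\<^sup>2 \<le> real (Suc m) * ((1 - \<tau> / 4) * (1 - \<beta>\<^sup>2 * \<epsilon>1\<^sup>2))"
            proof -
              have "real k / real n * \<beta>\<^sup>2 \<le> (1 - \<tau> / 4) * (1 - \<tau> / 4)"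
              proof -
                have "(1 - \<tau> / 4) * (1 - \<tau> / 4) = 1 - \<tau> / 2 + (\<tau> / 4)\<^sup>2" by (simp add: power2_eq_square algebra_simps)
                then show ?thesis using k\<beta> zero_le_power2[of "\<tau> / 4"] by linarith
              qed
              also have "\<dots> \<le> (1 - \<tau> / 4) * (1 - \<beta>\<^sup>2 * \<epsilon>1\<^sup>2)" using \<beta>\<epsilon> \<tau> by (intro mult_left_mono) auto
              finally have "real k / real n * \<beta>\<^sup>2 * real n \<le> (1 - \<tau> / 4) * (1 - \<beta>\<^sup>2 * \<epsilon>1\<^sup>2) * real n" by (intro mult_right_mono) auto
              then show ?thesis using rn unfolding n by (simp add: mult_ac)
            qed
            \<comment> \<open>As \<open>k\<close> is at most \<open>n / \<beta>^2\<close>, the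
              length bound is of order \<open>n / \<beta>\<close>; the entry
              \<open>20 / \<alpha>0^2\<close> of \<open>\<beta>bar\<close> puts half of it below
              \<open>n * \<alpha>0^2 / 4\<close>, and the tail rate at \<open>\<alpha>0\<close> is
              at least that.\<close>
            show "norm_bound \<beta> e k / 2 \<le> real (Suc m) * (\<alpha>0\<^sup>2 / 2 - C * \<alpha>0 ^ 3)"
            proof -
              have b1: "1 / \<beta> \<le> \<alpha>0\<^sup>2 / 20"
              proof -
                have "20 \<le> \<beta> * \<alpha>0\<^sup>2" using \<beta>(3) \<alpha>0 by (simp add: field_simps)
                then show ?thesis using \<beta>(1) by (simp add: field_simps)
              qed
              have "0 < \<beta>\<^sup>2" using \<beta>2 by linarith
              then have "real k / real n \<le> 1 / \<beta>\<^sup>2" by (rule iffD2[OF pos_le_divide_eq]) (use k\<beta> \<tau> in linarith)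
              then have k\<beta>n: "real k \<le> real n / \<beta>\<^sup>2" using rn by (simp add: field_simps)
              have "\<beta> * (1 + e) \<le> \<beta> * (3 / 2)" using \<beta> e by (intro mult_left_mono) auto
              then have q: "1 + \<beta> * (1 + e) \<le> 5 / 2 * \<beta>" using \<beta> by linarith
              have "norm_bound \<beta> e k \<le> real n / \<beta>\<^sup>2 * (5 / 2 * \<beta>) * (3 / 2)"
                unfolding norm_bound_def using k\<beta>n q e \<beta> by (intro mult_mono) auto
              also have "\<dots> = real n * (15 / 4) * (1 / \<beta>)" using \<beta> by (simp add: power2_eq_square)
              also have "\<dots> \<le> real n * (15 / 4) * (\<alpha>0\<^sup>2 / 20)" using b1 by (intro mult_left_mono) auto
              also have "\<dots> \<le> real n * (\<alpha>0\<^sup>2 / 2)" by simp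
              finally have 1: "norm_bound \<beta> e k / 2 \<le> real n * (\<alpha>0\<^sup>2 / 4)" by simp
              have "4 * (C * \<alpha>0) * \<alpha>0\<^sup>2 \<le> 1 * \<alpha>0\<^sup>2" using small by (intro mult_right_mono) auto
              then have "\<alpha>0\<^sup>2 / 4 \<le> \<alpha>0\<^sup>2 / 2 - C * \<alpha>0 ^ 3" by (simp add: power2_eq_square power3_eq_cube mult_ac)
              then have "real n * (\<alpha>0\<^sup>2 / 4) \<le> real n * (\<alpha>0\<^sup>2 / 2 - C * \<alpha>0 ^ 3)" by (intro mult_left_mono) auto
              with 1 show ?thesis unfolding n by linarith
            qed
            show "1 - \<tau> / 4 + \<tau> / 8 \<le> 1 - 2 * C * \<epsilon>1" using C\<epsilon> by linarith
            show "\<beta>\<^sup>2 * \<epsilon>1\<^sup>2 < 1" using \<beta>\<epsilon> \<tau> by linarith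
          qed (use \<beta> e km As a cover \<epsilon>1 C \<tau> in auto)
          have "?L n \<le> (\<integral>\<^sup>+x. \<integral>\<^sup>+X. lik \<beta> n k x X * indicator {X. \<not> trunc \<beta> e m k As x X} X \<partial>gmat k n \<partial>iid_prior \<pi> n)
             + ennreal K * emeasure (gmat k n) (B n) + ennreal (1 / K) * (\<integral>\<^sup>+x. \<integral>\<^sup>+x'. \<integral>\<^sup>+X. (lik \<beta> n k x X * indicator {X. trunc \<beta> e m k As x X} X)
              * (lik \<beta> n k x' X * indicator {X. trunc \<beta> e m k As x' X} X) \<partial>gmat k n \<partial>iid_prior \<pi> n \<partial>iid_prior \<pi> n)"
            unfolding k_def[symmetric]
            by (rule truncated_second_moment[OF M(1) prob_gmat ml mt _ K]) (use B(1)[of n] in \<open>simp only: k_def\<close>)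
          also have "\<dots> \<le> ennreal (w n) + ennreal K * emeasure (gmat k n) (B n) + ennreal (1 / K) * ennreal D"
            by (intro add_mono bad second mult_left_mono order_refl) auto
          finally show ?case by (simp only: k_def)
        qed
      qed
    qed
  qed
  then show ?thesis by blast
qed

end
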